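(* Let $K$ be a field, and let $A\to B\to\mathbf k$ be surjections of (skew) commutative monoids in $(\mathrm{Mod}_{\mathrm{VB}_K},\otimes)$. Assume that the kernels $A_+$ and $B_+$ of the surjections $A\to\mathbf k$ and $B\to\mathbf k$ are supported in degrees $>0$. If $A$ and $B$ are Koszul, then $$\deg \mathrm{Tor}_i^A(\mathbf k,B)\le 2i\qquad\text{for all } i\ge0 .$$
   Context: Fix a field $K$ and a commutative coefficient ring $\mathbf k$. $\mathrm{VB}_K$ is the groupoid of finite-dimensional $K$-vector spaces and $K$-linear isomorphisms; a $\mathrm{VB}_K$-module is a functor $M:\mathrm{VB}_K\to\mathrm{Mod}_{\mathbf k}$, equivalently a sequence of $\mathbf k[\mathrm{GL}_n(K)]$-modules $M(n)=M(K^n)$. The category $\mathrm{Mod}_{\mathrm{VB}_K}$ of $\mathrm{VB}_K$-modules is symmetric monoidal with $(M\otimes N)(X)=\bigoplus_{X_1\oplus X_2=X}M(X_1)\otimes_{\mathbf k}N(X_2)$, the sum being over ordered pairs of subspaces $X_1,X_2$ of $X$ with $X_1+X_2=X$ and $X_1\cap X_2=0$; the unit is $\mathbf k$ concentrated in degree $0$. The support of $M$ is $\{n:M(n)\ne0\}$, and $\deg M$ is the supremum of the support ($-1$ if the support is empty). A monoid $A$ is skew commutative if $ab=(-1)^{nm}ba$ for $a\in A(X_1)$, $b\in A(X_2)$ with $X_1,X_2$ of dimensions $n,m$, and commutative if $ab=ba$; "(skew) commutative" means that the monoids are all commutative or all skew commutative. For a monoid $A$, a right $A$-module $M$ and a left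 $A$-module $N$, $M\otimes_AN$ is the coequalizer of the two natural maps $M\otimes A\otimes N\rightrightarrows M\otimes N$, and $\mathrm{Tor}^A_*(M,N)$ denotes the associated left derived functors. An augmented monoid $A$ (one with a surjection of monoids $A\to\mathbf k$ whose kernel is supported in degrees $>0$) is Koszul if $\mathrm{Tor}_i^A(\mathbf k,\mathbf k)$ is supported only in degree $i$ for every $i\ge0$. $B$ is an $A$-module via $A\to B$, and $\mathbf k$ is an $A$-module via $A\to\mathbf k$. *)

theory Defs
  imports
    "HOL-Algebra.Module"
    "HOL-Algebra.AbelCoset"
    "HOL-Library.Function_Algebras"
    "HOL-Library.Poly_Mapping"
    "HOL-Library.Extended_Real"
begin

section \<open>Finite-dimensional vector spaces and their isomorphisms\<close>

text \<open>
  The groupoid of finite-dimensional vector spaces over a field is replaced by the equivalent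
  small groupoid of finite-dimensional subspaces of the infinite-dimensional space of sequences.
  It contains spaces of every finite dimension, and it is closed under passing to subspaces, so
  that the decompositions of a space into two summands are the same as in the large groupoid.
\<close>

type_synonym 'f obj = "(nat \<Rightarrow> 'f) set"
type_synonym 'f mor = "(nat \<Rightarrow> 'f) \<Rightarrow> (nat \<Rightarrow> 'f)"

definition seq_scale :: "'f::field \<Rightarrow> (nat \<Rightarrow> 'f) \<Rightarrow> (nat \<Rightarrow> 'f)" where
  "seq_scale c v = (\<lambda>i. c * v i)"

interpretation Seq: vector_space "seq_scale :: 'f::field \<Rightarrow> _"
  by unfold_locales (auto simp: seq_scale_def plus_fun_def fun_eq_iff algebra_simps)

definition vb_obj :: "'f::field obj \<Rightarrow> bool" where
  "vb_obj X \<longleftrightarrow> (\<exists>S. finite S \<and> X = Seq.span S)"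

text \<open>Morphisms are extensional (\<open>undefined\<close> outside the source), so that they are determined by
  their values on the source.\<close>

definition vb_iso :: "'f::field obj \<Rightarrow> 'f obj \<Rightarrow> 'f mor set" where
  "vb_iso X Y = {f \<in> extensional X. bij_betw f X Y \<and>
     (\<forall>u\<in>X. \<forall>v\<in>X. f (u + v) = f u + f v) \<and>
     (\<forall>c. \<forall>v\<in>X. f (seq_scale c v) = seq_scale c (f v))}"

definition vsum :: "'f::field obj \<Rightarrow> 'f obj \<Rightarrow> 'f obj" where
  "vsum X1 X2 = {u + v |u v. u \<in> X1 \<and> v \<in> X2}"

definition decomp :: "'f::field obj \<Rightarrow> 'f obj \<Rightarrow> 'f obj \<Rightarrow> bool" where
  "decomp X X1 X2 \<longleftrightarrow> vb_obj X1 \<and> vb_obj X2 \<and> vsum X1 X2 = X \<and> X1 \<inter> X2 = {0}"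

definition decomp3 :: "'f::field obj \<Rightarrow> 'f obj \<Rightarrow> 'f obj \<Rightarrow> 'f obj \<Rightarrow> bool" where
  "decomp3 X X1 X2 X3 \<longleftrightarrow> decomp (vsum X1 X2) X1 X2 \<and> decomp X (vsum X1 X2) X3"


section \<open>Modules over the coefficient ring\<close>

text \<open>
  The coefficient ring is a type of sort \<open>{comm_ring, monoid_mult}\<close>: a commutative ring with unit,
  which, unlike in the class \<open>comm_ring_1\<close>, may be the zero ring.  As in the Algebra library,
  modules are records with an explicit carrier; their ring fields \<open>mult\<close> and \<open>one\<close> are unused.
\<close>

definition kring :: "'k::{comm_ring,monoid_mult} ring" where
  "kring = \<lparr>carrier = UNIV, mult = (*), one = 1, zero = 0, add = (+)\<rparr>"

definition klinear ::
    "('k, 'm) module \<Rightarrow> ('k, 'n) module \<Rightarrow> ('m \<Rightarrow> 'n) \<Rightarrow> bool" where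
  "klinear M N h \<longleftrightarrow> h \<in> carrier M \<rightarrow> carrier N \<and>
     (\<forall>x\<in>carrier M. \<forall>y\<in>carrier M. h (x \<oplus>\<^bsub>M\<^esub> y) = h x \<oplus>\<^bsub>N\<^esub> h y) \<and>
     (\<forall>c. \<forall>x\<in>carrier M. h (c \<odot>\<^bsub>M\<^esub> x) = c \<odot>\<^bsub>N\<^esub> h x)"

definition kbilinear ::
    "('k, 'm) module \<Rightarrow> ('k, 'n) module \<Rightarrow> ('k, 'l) module \<Rightarrow> ('m \<Rightarrow> 'n \<Rightarrow> 'l) \<Rightarrow> bool" where
  "kbilinear M N L h \<longleftrightarrow>
     (\<forall>x\<in>carrier M. klinear N L (h x)) \<and> (\<forall>y\<in>carrier N. klinear M L (\<lambda>x. h x y))"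

definition kzero :: "('k, 'm) module \<Rightarrow> bool" where
  "kzero M \<longleftrightarrow> carrier M = {\<zero>\<^bsub>M\<^esub>}"

text \<open>The quotient by a submodule \<open>H\<close>; its elements are the cosets of \<open>H\<close>.\<close>

definition kquot :: "('k, 'm) module \<Rightarrow> 'm set \<Rightarrow> ('k, 'm set) module" where
  "kquot M H = \<lparr>carrier = a_rcosets\<^bsub>M\<^esub> H, mult = undefined, one = undefined,
     zero = H, add = (\<lambda>S T. S <+>\<^bsub>M\<^esub> T),
     smult = (\<lambda>c S. H <+>\<^bsub>M\<^esub> ((\<lambda>x. c \<odot>\<^bsub>M\<^esub> x) ` S))\<rparr>"

definition kspan :: "('k::{comm_ring,monoid_mult}, 'm) module \<Rightarrow> 'm set \<Rightarrow> 'm set" where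
  "kspan M G = \<Inter>{H. submodule H kring M \<and> G \<subseteq> H}"

definition kfree :: "'s set \<Rightarrow> ('k::{comm_ring,monoid_mult}, 's \<Rightarrow>\<^sub>0 'k) module" where
  "kfree S = \<lparr>carrier = {p. Poly_Mapping.keys p \<subseteq> S}, mult = undefined, one = undefined,
     zero = 0, add = (+), smult = (\<lambda>c. Poly_Mapping.map ((*) c))\<rparr>"

definition kfree_map :: "('s \<Rightarrow> 't) \<Rightarrow> ('s \<Rightarrow>\<^sub>0 'k) \<Rightarrow> ('t \<Rightarrow>\<^sub>0 'k::{comm_ring,monoid_mult})" where
  "kfree_map \<sigma> p =
     (\<Sum>s\<in>Poly_Mapping.keys p. Poly_Mapping.single (\<sigma> s) (Poly_Mapping.lookup p s))"


section \<open>VB-modules\<close>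

text \<open>\<open>act M X Y f\<close> is the map \<open>M(f) : M(X) \<rightarrow> M(Y)\<close> for an isomorphism \<open>f : X \<rightarrow> Y\<close>.\<close>

record ('f, 'k, 'm) vbmod =
  val :: "'f obj \<Rightarrow> ('k, 'm) module"
  act :: "'f obj \<Rightarrow> 'f obj \<Rightarrow> 'f mor \<Rightarrow> 'm \<Rightarrow> 'm"

abbreviation car :: "('f, 'k, 'm, 'z) vbmod_scheme \<Rightarrow> 'f obj \<Rightarrow> 'm set" where
  "car M X \<equiv> carrier (val M X)"

definition vb_module ::
    "('f::field, 'k::{comm_ring,monoid_mult}, 'm, 'z) vbmod_scheme \<Rightarrow> bool" where
  "vb_module M \<longleftrightarrow>
     (\<forall>X. vb_obj X \<longrightarrow> Module.module kring (val M X)) \<and>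
     (\<forall>X Y f. vb_obj X \<and> vb_obj Y \<and> f \<in> vb_iso X Y \<longrightarrow>
        klinear (val M X) (val M Y) (act M X Y f)) \<and>
     (\<forall>X. vb_obj X \<longrightarrow> (\<forall>x\<in>car M X. act M X X (\<lambda>v\<in>X. v) x = x)) \<and>
     (\<forall>X Y Z f g. vb_obj X \<and> vb_obj Y \<and> vb_obj Z \<and> f \<in> vb_iso X Y \<and> g \<in> vb_iso Y Z \<longrightarrow>
        (\<forall>x\<in>car M X. act M X Z (compose X g f) x = act M Y Z g (act M X Y f x)))"

definition vb_hom ::
    "('f::field, 'k, 'm, 'z) vbmod_scheme \<Rightarrow> ('f, 'k, 'n, 'w) vbmod_scheme \<Rightarrow>
     ('f obj \<Rightarrow> 'm \<Rightarrow> 'n) \<Rightarrow> bool" where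
  "vb_hom M N \<phi> \<longleftrightarrow>
     (\<forall>X. vb_obj X \<longrightarrow> klinear (val M X) (val N X) (\<phi> X)) \<and>
     (\<forall>X Y f. vb_obj X \<and> vb_obj Y \<and> f \<in> vb_iso X Y \<longrightarrow>
        (\<forall>x\<in>car M X. \<phi> Y (act M X Y f x) = act N X Y f (\<phi> X x)))"

definition vb_surj ::
    "('f::field, 'k, 'm, 'z) vbmod_scheme \<Rightarrow> ('f, 'k, 'n, 'w) vbmod_scheme \<Rightarrow>
     ('f obj \<Rightarrow> 'm \<Rightarrow> 'n) \<Rightarrow> bool" where
  "vb_surj M N \<phi> \<longleftrightarrow> (\<forall>X. vb_obj X \<longrightarrow> \<phi> X ` car M X = car N X)"

definition vb_kernel ::
    "('f, 'k, 'm, 'z) vbmod_scheme \<Rightarrow> ('f, 'k, 'n, 'w) vbmod_scheme \<Rightarrow>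
     ('f obj \<Rightarrow> 'm \<Rightarrow> 'n) \<Rightarrow> ('f, 'k, 'm) vbmod" where
  "vb_kernel M N \<phi> =
     \<lparr>val = (\<lambda>X. (val M X)\<lparr>carrier := {x \<in> car M X. \<phi> X x = \<zero>\<^bsub>val N X\<^esub>}\<rparr>), act = act M\<rparr>"

definition vb_supp :: "('f::field, 'k, 'm, 'z) vbmod_scheme \<Rightarrow> nat set" where
  "vb_supp M = {Seq.dim X |X. vb_obj X \<and> \<not> kzero (val M X)}"

definition vb_deg :: "('f::field, 'k, 'm, 'z) vbmod_scheme \<Rightarrow> ereal" where
  "vb_deg M = (if vb_supp M = {} then - 1 else (SUP n\<in>vb_supp M. ereal (real n)))"

text \<open>
  A morphism \<open>M \<otimes> N \<rightarrow> L\<close> out of the tensor product, where \<open>(M \<otimes> N)(X)\<close> is the direct sum of the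
  \<open>M(X1) \<otimes> N(X2)\<close> over all decompositions \<open>X = X1 \<oplus> X2\<close>, is a natural family of bilinear maps
  \<open>h X1 X2 : M(X1) \<times> N(X2) \<rightarrow> L(X1 \<oplus> X2)\<close>.
\<close>

definition vb_pairing ::
    "('f::field, 'k, 'm, 'z) vbmod_scheme \<Rightarrow> ('f, 'k, 'n, 'w) vbmod_scheme \<Rightarrow>
     ('f, 'k, 'l, 'y) vbmod_scheme \<Rightarrow> ('f obj \<Rightarrow> 'f obj \<Rightarrow> 'm \<Rightarrow> 'n \<Rightarrow> 'l) \<Rightarrow> bool" where
  "vb_pairing M N L h \<longleftrightarrow>
     (\<forall>X X1 X2. decomp X X1 X2 \<longrightarrow> kbilinear (val M X1) (val N X2) (val L X) (h X1 X2)) \<and>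
     (\<forall>X X1 X2 Y f. decomp X X1 X2 \<and> vb_obj Y \<and> f \<in> vb_iso X Y \<longrightarrow>
        (\<forall>x\<in>car M X1. \<forall>y\<in>car N X2.
           act L X Y f (h X1 X2 x y) =
           h (f ` X1) (f ` X2) (act M X1 (f ` X1) (restrict f X1) x)
                               (act N X2 (f ` X2) (restrict f X2) y)))"


section \<open>Monoids and their modules\<close>

record ('f, 'k, 'a) vbmonoid = "('f, 'k, 'a) vbmod" +
  mmul :: "'f obj \<Rightarrow> 'f obj \<Rightarrow> 'a \<Rightarrow> 'a \<Rightarrow> 'a"
  mone :: 'a

text \<open>A morphism from the unit object to \<open>A\<close> amounts to an element of \<open>A\<close> at the zero space.\<close>

definition vb_monoid :: "('f::field, 'k::{comm_ring,monoid_mult}, 'a) vbmonoid \<Rightarrow> bool" where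
  "vb_monoid A \<longleftrightarrow> vb_module A \<and> vb_pairing A A A (mmul A) \<and>
     mone A \<in> car A {0} \<and>
     (\<forall>X. vb_obj X \<longrightarrow>
        (\<forall>a\<in>car A X. mmul A {0} X (mone A) a = a \<and> mmul A X {0} a (mone A) = a)) \<and>
     (\<forall>X X1 X2 X3. decomp3 X X1 X2 X3 \<longrightarrow>
        (\<forall>a\<in>car A X1. \<forall>b\<in>car A X2. \<forall>c\<in>car A X3.
           mmul A (vsum X1 X2) X3 (mmul A X1 X2 a b) c =
           mmul A X1 (vsum X2 X3) a (mmul A X2 X3 b c)))"

definition vb_commutative :: "('f::field, 'k, 'a) vbmonoid \<Rightarrow> bool" where
  "vb_commutative A \<longleftrightarrow> (\<forall>X X1 X2. decomp X X1 X2 \<longrightarrow>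
     (\<forall>a\<in>car A X1. \<forall>b\<in>car A X2. mmul A X1 X2 a b = mmul A X2 X1 b a))"

definition vb_skew_commutative ::
    "('f::field, 'k::{comm_ring,monoid_mult}, 'a) vbmonoid \<Rightarrow> bool" where
  "vb_skew_commutative A \<longleftrightarrow> (\<forall>X X1 X2. decomp X X1 X2 \<longrightarrow>
     (\<forall>a\<in>car A X1. \<forall>b\<in>car A X2.
        mmul A X1 X2 a b = ((- 1) ^ (Seq.dim X1 * Seq.dim X2)) \<odot>\<^bsub>val A X\<^esub> mmul A X2 X1 b a))"

definition monoid_hom ::
    "('f::field, 'k, 'a) vbmonoid \<Rightarrow> ('f, 'k, 'b) vbmonoid \<Rightarrow> ('f obj \<Rightarrow> 'a \<Rightarrow> 'b) \<Rightarrow> bool" where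
  "monoid_hom A B \<phi> \<longleftrightarrow> vb_hom A B \<phi> \<and> \<phi> {0} (mone A) = mone B \<and>
     (\<forall>X X1 X2. decomp X X1 X2 \<longrightarrow>
        (\<forall>a\<in>car A X1. \<forall>b\<in>car A X2.
           \<phi> X (mmul A X1 X2 a b) = mmul B X1 X2 (\<phi> X1 a) (\<phi> X2 b)))"

text \<open>The unit object of the tensor product, the coefficient ring concentrated in degree 0,
  with its monoid structure.\<close>

definition vb_unit :: "('f::field, 'k::{comm_ring,monoid_mult}, 'k) vbmonoid" where
  "vb_unit =
     \<lparr>val = (\<lambda>X. \<lparr>carrier = (if X = {0} then UNIV else {0}), mult = undefined, one = undefined,
                  zero = 0, add = (+), smult = (*)\<rparr>),
      act = (\<lambda>X Y f c. c), mmul = (\<lambda>X1 X2. (*)), mone = 1\<rparr>"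

record ('f, 'k, 'a, 'n) vblmod = "('f, 'k, 'n) vbmod" +
  lact :: "'f obj \<Rightarrow> 'f obj \<Rightarrow> 'a \<Rightarrow> 'n \<Rightarrow> 'n"

record ('f, 'k, 'a, 'm) vbrmod = "('f, 'k, 'm) vbmod" +
  ract :: "'f obj \<Rightarrow> 'f obj \<Rightarrow> 'm \<Rightarrow> 'a \<Rightarrow> 'm"

definition left_module ::
    "('f::field, 'k::{comm_ring,monoid_mult}, 'a) vbmonoid \<Rightarrow> ('f, 'k, 'a, 'n) vblmod \<Rightarrow> bool" where
  "left_module A N \<longleftrightarrow> vb_module N \<and> vb_pairing A N N (lact N) \<and>
     (\<forall>X. vb_obj X \<longrightarrow> (\<forall>x\<in>car N X. lact N {0} X (mone A) x = x)) \<and>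
     (\<forall>X X1 X2 X3. decomp3 X X1 X2 X3 \<longrightarrow>
        (\<forall>a\<in>car A X1. \<forall>b\<in>car A X2. \<forall>x\<in>car N X3.
           lact N (vsum X1 X2) X3 (mmul A X1 X2 a b) x =
           lact N X1 (vsum X2 X3) a (lact N X2 X3 b x)))"

definition left_hom ::
    "('f::field, 'k, 'a) vbmonoid \<Rightarrow> ('f, 'k, 'a, 'n) vblmod \<Rightarrow> ('f, 'k, 'a, 'p) vblmod \<Rightarrow>
     ('f obj \<Rightarrow> 'n \<Rightarrow> 'p) \<Rightarrow> bool" where
  "left_hom A N P \<phi> \<longleftrightarrow> vb_hom N P \<phi> \<and>
     (\<forall>X X1 X2. decomp X X1 X2 \<longrightarrow>
        (\<forall>a\<in>car A X1. \<forall>x\<in>car N X2. \<phi> X (lact N X1 X2 a x) = lact P X1 X2 a (\<phi> X2 x)))"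

text \<open>A monoid \<open>B\<close> as a left and as a right module over a monoid mapping to it by \<open>\<phi>\<close>.\<close>

definition left_via ::
    "('f obj \<Rightarrow> 'a \<Rightarrow> 'b) \<Rightarrow> ('f, 'k, 'b) vbmonoid \<Rightarrow> ('f, 'k, 'a, 'b) vblmod" where
  "left_via \<phi> B =
     \<lparr>val = val B, act = act B, lact = (\<lambda>X1 X2 a x. mmul B X1 X2 (\<phi> X1 a) x)\<rparr>"

definition right_via ::
    "('f obj \<Rightarrow> 'a \<Rightarrow> 'b) \<Rightarrow> ('f, 'k, 'b) vbmonoid \<Rightarrow> ('f, 'k, 'a, 'b) vbrmod" where
  "right_via \<phi> B =
     \<lparr>val = val B, act = act B, ract = (\<lambda>X1 X2 x a. mmul B X1 X2 x (\<phi> X2 a))\<rparr>"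


section \<open>The tensor product over a monoid\<close>

text \<open>
  \<open>M \<otimes>\<^sub>A N\<close> is presented by generators and relations.  The symbol \<open>(X1, X2, m, n)\<close> stands for the
  element \<open>m \<otimes> n\<close> of the summand \<open>M(X1) \<otimes> N(X2)\<close>.  The relations \<open>bilin_rels\<close> present
  \<open>(M \<otimes> N)(X)\<close>; the relations \<open>balanced_rels\<close> are the differences of the images of the elements
  \<open>m \<otimes> a \<otimes> n\<close> under the two maps \<open>M \<otimes> A \<otimes> N \<rightarrow> M \<otimes> N\<close>, whose coequalizer is \<open>M \<otimes>\<^sub>A N\<close>.
\<close>

type_synonym ('f, 'm, 'n) symb = "'f obj \<times> 'f obj \<times> 'm \<times> 'n"

abbreviation symb1 ::
    "'f obj \<Rightarrow> 'f obj \<Rightarrow> 'm \<Rightarrow> 'n \<Rightarrow> ('f, 'm, 'n) symb \<Rightarrow>\<^sub>0 'k::{comm_ring,monoid_mult}" where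
  "symb1 X1 X2 m n \<equiv> Poly_Mapping.single (X1, X2, m, n) 1"

definition symbs ::
    "('f::field, 'k, 'm, 'z) vbmod_scheme \<Rightarrow> ('f, 'k, 'n, 'w) vbmod_scheme \<Rightarrow>
     'f obj \<Rightarrow> ('f, 'm, 'n) symb set" where
  "symbs M N X = {(X1, X2, m, n). decomp X X1 X2 \<and> m \<in> car M X1 \<and> n \<in> car N X2}"

definition bilin_rels ::
    "('f::field, 'k::{comm_ring,monoid_mult}, 'm, 'z) vbmod_scheme \<Rightarrow>
     ('f, 'k, 'n, 'w) vbmod_scheme \<Rightarrow> 'f obj \<Rightarrow> (('f, 'm, 'n) symb \<Rightarrow>\<^sub>0 'k) set" where
  "bilin_rels M N X =
     {symb1 X1 X2 (m \<oplus>\<^bsub>val M X1\<^esub> m') n - symb1 X1 X2 m n - symb1 X1 X2 m' n |X1 X2 m m' n.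
        decomp X X1 X2 \<and> m \<in> car M X1 \<and> m' \<in> car M X1 \<and> n \<in> car N X2} \<union>
     {symb1 X1 X2 m (n \<oplus>\<^bsub>val N X2\<^esub> n') - symb1 X1 X2 m n - symb1 X1 X2 m n' |X1 X2 m n n'.
        decomp X X1 X2 \<and> m \<in> car M X1 \<and> n \<in> car N X2 \<and> n' \<in> car N X2} \<union>
     {symb1 X1 X2 (c \<odot>\<^bsub>val M X1\<^esub> m) n - Poly_Mapping.single (X1, X2, m, n) c |X1 X2 c m n.
        decomp X X1 X2 \<and> m \<in> car M X1 \<and> n \<in> car N X2} \<union>
     {symb1 X1 X2 m (c \<odot>\<^bsub>val N X2\<^esub> n) - Poly_Mapping.single (X1, X2, m, n) c |X1 X2 c m n.
        decomp X X1 X2 \<and> m \<in> car M X1 \<and> n \<in> car N X2}"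

definition balanced_rels ::
    "('f::field, 'k::{comm_ring,monoid_mult}, 'a) vbmonoid \<Rightarrow> ('f, 'k, 'a, 'm) vbrmod \<Rightarrow>
     ('f, 'k, 'a, 'n) vblmod \<Rightarrow> 'f obj \<Rightarrow> (('f, 'm, 'n) symb \<Rightarrow>\<^sub>0 'k) set" where
  "balanced_rels A M N X =
     {symb1 (vsum X1 X2) X3 (ract M X1 X2 m a) n - symb1 X1 (vsum X2 X3) m (lact N X2 X3 a n)
        |X1 X2 X3 m a n.
        decomp3 X X1 X2 X3 \<and> m \<in> car M X1 \<and> a \<in> car A X2 \<and> n \<in> car N X3}"

definition tensor_rels ::
    "('f::field, 'k::{comm_ring,monoid_mult}, 'a) vbmonoid \<Rightarrow> ('f, 'k, 'a, 'm) vbrmod \<Rightarrow>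
     ('f, 'k, 'a, 'n) vblmod \<Rightarrow> 'f obj \<Rightarrow> (('f, 'm, 'n) symb \<Rightarrow>\<^sub>0 'k) set" where
  "tensor_rels A M N X = kspan (kfree (symbs M N X)) (bilin_rels M N X \<union> balanced_rels A M N X)"

text \<open>The map of quotients induced by a map \<open>\<sigma>\<close> of symbols sends a coset \<open>S\<close> to the coset
  containing the image of \<open>S\<close>.\<close>

definition tensor_over ::
    "('f::field, 'k::{comm_ring,monoid_mult}, 'a) vbmonoid \<Rightarrow> ('f, 'k, 'a, 'm) vbrmod \<Rightarrow>
     ('f, 'k, 'a, 'n) vblmod \<Rightarrow> ('f, 'k, (('f, 'm, 'n) symb \<Rightarrow>\<^sub>0 'k) set) vbmod" where
  "tensor_over A M N =
     \<lparr>val = (\<lambda>X. kquot (kfree (symbs M N X)) (tensor_rels A M N X)),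
      act = (\<lambda>X Y f S. tensor_rels A M N Y <+>\<^bsub>kfree (symbs M N Y)\<^esub>
        kfree_map (\<lambda>(X1, X2, m, n). (f ` X1, f ` X2,
          act M X1 (f ` X1) (restrict f X1) m, act N X2 (f ` X2) (restrict f X2) n)) ` S)\<rparr>"

text \<open>The map \<open>M \<otimes>\<^sub>A N \<rightarrow> M \<otimes>\<^sub>A P\<close> induced by a map \<open>\<phi> : N \<rightarrow> P\<close> of left modules.\<close>

definition tensor_map ::
    "('f::field, 'k::{comm_ring,monoid_mult}, 'a) vbmonoid \<Rightarrow> ('f, 'k, 'a, 'm) vbrmod \<Rightarrow>
     ('f, 'k, 'a, 'p) vblmod \<Rightarrow> ('f obj \<Rightarrow> 'n \<Rightarrow> 'p) \<Rightarrow> 'f obj \<Rightarrow>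
     (('f, 'm, 'n) symb \<Rightarrow>\<^sub>0 'k) set \<Rightarrow> (('f, 'm, 'p) symb \<Rightarrow>\<^sub>0 'k) set" where
  "tensor_map A M P \<phi> X S = tensor_rels A M P X <+>\<^bsub>kfree (symbs M P X)\<^esub>
     kfree_map (\<lambda>(X1, X2, m, n). (X1, X2, m, \<phi> X2 n)) ` S"


section \<open>Free resolutions and Tor\<close>

text \<open>
  A free left \<open>A\<close>-module is a direct sum of modules \<open>A \<otimes> k[Iso(Y, -)]\<close>, each generated by one
  element over \<open>Y\<close>.  Explicitly, \<open>P\<close> is free with a set \<open>E\<close> of pairs \<open>(Y, e)\<close>, \<open>e \<in> P(Y)\<close>, as
  basis if every element of \<open>P(X)\<close> is uniquely a finite sum of terms \<open>a f(e)\<close>, where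
  \<open>X = X1 \<oplus> X2\<close>, \<open>a \<in> A(X1)\<close>, and \<open>f : Y \<rightarrow> X2\<close> is an isomorphism.
  These modules are projective, and every left \<open>A\<close>-module is a quotient of one of them.
\<close>

definition basis_terms ::
    "('f::field obj \<times> 'p) set \<Rightarrow> 'f obj \<Rightarrow> ('f obj \<times> 'p \<times> 'f obj \<times> 'f mor) set" where
  "basis_terms E X = {(Y, e, X1, f).
     (Y, e) \<in> E \<and> f \<in> vb_iso Y (f ` Y) \<and> decomp X X1 (f ` Y)}"

definition coeff_families ::
    "('f::field, 'k, 'a) vbmonoid \<Rightarrow> ('f obj \<times> 'p) set \<Rightarrow> 'f obj \<Rightarrow>
     ('f obj \<times> 'p \<times> 'f obj \<times> 'f mor \<Rightarrow> 'a) set" where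
  "coeff_families A E X =
     {c \<in> (\<Pi>\<^sub>E (Y, e, X1, f)\<in>basis_terms E X. car A X1).
        finite {(Y, e, X1, f) \<in> basis_terms E X. c (Y, e, X1, f) \<noteq> \<zero>\<^bsub>val A X1\<^esub>}}"

definition basis_comb ::
    "('f::field, 'k, 'a) vbmonoid \<Rightarrow> ('f, 'k, 'a, 'p) vblmod \<Rightarrow> ('f obj \<times> 'p) set \<Rightarrow> 'f obj \<Rightarrow>
     ('f obj \<times> 'p \<times> 'f obj \<times> 'f mor \<Rightarrow> 'a) \<Rightarrow> 'p" where
  "basis_comb A P E X c =
     finsum (val P X)
       (\<lambda>(Y, e, X1, f). lact P X1 (f ` Y) (c (Y, e, X1, f)) (act P Y (f ` Y) f e))
       {(Y, e, X1, f) \<in> basis_terms E X. c (Y, e, X1, f) \<noteq> \<zero>\<^bsub>val A X1\<^esub>}"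

definition free_left_module ::
    "('f::field, 'k::{comm_ring,monoid_mult}, 'a) vbmonoid \<Rightarrow> ('f, 'k, 'a, 'p) vblmod \<Rightarrow> bool" where
  "free_left_module A P \<longleftrightarrow> left_module A P \<and>
     (\<exists>E. (\<forall>(Y, e)\<in>E. vb_obj Y \<and> e \<in> car P Y) \<and>
        (\<forall>X. vb_obj X \<longrightarrow> bij_betw (basis_comb A P E X) (coeff_families A E X) (car P X)))"

text \<open>\<open>\<dots> \<rightarrow> P 2 \<rightarrow> P 1 \<rightarrow> P 0 \<rightarrow> N \<rightarrow> 0\<close> with differentials \<open>d n : P (n + 1) \<rightarrow> P n\<close> and
  augmentation \<open>\<eta>\<close>.\<close>

definition free_resolution ::
    "('f::field, 'k::{comm_ring,monoid_mult}, 'a) vbmonoid \<Rightarrow> ('f, 'k, 'a, 'n) vblmod \<Rightarrow>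
     (nat \<Rightarrow> ('f, 'k, 'a, 'p) vblmod) \<Rightarrow> (nat \<Rightarrow> 'f obj \<Rightarrow> 'p \<Rightarrow> 'p) \<Rightarrow>
     ('f obj \<Rightarrow> 'p \<Rightarrow> 'n) \<Rightarrow> bool" where
  "free_resolution A N P d \<eta> \<longleftrightarrow>
     (\<forall>n. free_left_module A (P n)) \<and>
     (\<forall>n. left_hom A (P (Suc n)) (P n) (d n)) \<and>
     left_hom A (P 0) N \<eta> \<and> vb_surj (P 0) N \<eta> \<and>
     (\<forall>X. vb_obj X \<longrightarrow>
        d 0 X ` car (P 1) X = {x \<in> car (P 0) X. \<eta> X x = \<zero>\<^bsub>val N X\<^esub>} \<and>
        (\<forall>n. d (Suc n) X ` car (P (Suc (Suc n))) X =
             {x \<in> car (P (Suc n)) X. d n X x = \<zero>\<^bsub>val (P n) X\<^esub>}))"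

text \<open>The homology at the \<open>i\<close>-th place of a complex \<open>\<dots> \<rightarrow> C 2 \<rightarrow> C 1 \<rightarrow> C 0 \<rightarrow> 0\<close> of VB-modules.\<close>

definition cycles ::
    "(nat \<Rightarrow> ('f, 'k, 'm) vbmod) \<Rightarrow> (nat \<Rightarrow> 'f obj \<Rightarrow> 'm \<Rightarrow> 'm) \<Rightarrow> nat \<Rightarrow> 'f obj \<Rightarrow> 'm set" where
  "cycles C d i X = (case i of 0 \<Rightarrow> car (C 0) X
     | Suc j \<Rightarrow> {x \<in> car (C (Suc j)) X. d j X x = \<zero>\<^bsub>val (C j) X\<^esub>})"

definition homology ::
    "(nat \<Rightarrow> ('f, 'k, 'm) vbmod) \<Rightarrow> (nat \<Rightarrow> 'f obj \<Rightarrow> 'm \<Rightarrow> 'm) \<Rightarrow> nat \<Rightarrow>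
     ('f, 'k, 'm set) vbmod" where
  "homology C d i =
     \<lparr>val = (\<lambda>X. kquot ((val (C i) X)\<lparr>carrier := cycles C d i X\<rparr>) (d i X ` car (C (Suc i)) X)),
      act = (\<lambda>X Y f S. act (C i) X Y f ` S)\<rparr>"

text \<open>
  Tor is the homology of \<open>M \<otimes>\<^sub>A P\<close> for some free resolution \<open>P\<close> of \<open>N\<close>.  The choice of
  resolution needs a fixed type that contains the carriers of a free resolution of every module
  \<open>N\<close> with elements in \<open>'n\<close>.  The type \<open>syz\<close> provides names for generators:
  \<open>Elt Y y\<close> for a generator of \<open>P 0\<close> that is mapped to \<open>y \<in> N(Y)\<close>, and \<open>Syz Y l\<close> for a generator
  over \<open>Y\<close> of \<open>P (n + 1)\<close> that is mapped to the formal sum \<open>l\<close> of terms \<open>a f(e)\<close>, with each \<open>e\<close> a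
  generator of \<open>P n\<close>.  Elements of \<open>P n\<close> are families of coefficients, indexed by terms \<open>f(e)\<close>.
\<close>

datatype ('f, 'a, 'n) syz =
  Elt "'f obj" 'n
| Syz "'f obj" "(('f, 'a, 'n) syz \<times> 'f obj \<times> 'f mor \<times> 'a) list"

type_synonym ('f, 'a, 'n) res = "('f, 'a, 'n) syz \<times> 'f obj \<times> 'f mor \<Rightarrow> 'a"

definition chosen_resolution ::
    "('f::field, 'k::{comm_ring,monoid_mult}, 'a) vbmonoid \<Rightarrow> ('f, 'k, 'a, 'n) vblmod \<Rightarrow>
     (nat \<Rightarrow> ('f, 'k, 'a, ('f, 'a, 'n) res) vblmod) \<times>
     (nat \<Rightarrow> 'f obj \<Rightarrow> ('f, 'a, 'n) res \<Rightarrow> ('f, 'a, 'n) res)" where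
  "chosen_resolution A N = (SOME (P, d). \<exists>\<eta>. free_resolution A N P d \<eta>)"

definition Tor ::
    "('f::field, 'k::{comm_ring,monoid_mult}, 'a) vbmonoid \<Rightarrow> ('f, 'k, 'a, 'm) vbrmod \<Rightarrow>
     ('f, 'k, 'a, 'n) vblmod \<Rightarrow> nat \<Rightarrow>
     ('f, 'k, (('f, 'm, ('f, 'a, 'n) res) symb \<Rightarrow>\<^sub>0 'k) set set) vbmod" where
  "Tor A M N i = (case chosen_resolution A N of (P, d) \<Rightarrow>
     homology (\<lambda>n. tensor_over A M (P n)) (\<lambda>n. tensor_map A M (P n) (d n)) i)"


section \<open>Koszul monoids\<close>

text \<open>\<open>\<epsilon> : A \<rightarrow> k\<close> is the augmentation.\<close>

definition augmented ::
    "('f::field, 'k::{comm_ring,monoid_mult}, 'a) vbmonoid \<Rightarrow> ('f obj \<Rightarrow> 'a \<Rightarrow> 'k) \<Rightarrow> bool" where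
  "augmented A \<epsilon> \<longleftrightarrow> vb_monoid A \<and> monoid_hom A vb_unit \<epsilon> \<and> vb_surj A vb_unit \<epsilon> \<and>
     vb_supp (vb_kernel A vb_unit \<epsilon>) \<subseteq> {0<..}"

definition koszul ::
    "('f::field, 'k::{comm_ring,monoid_mult}, 'a) vbmonoid \<Rightarrow> ('f obj \<Rightarrow> 'a \<Rightarrow> 'k) \<Rightarrow> bool" where
  "koszul A \<epsilon> \<longleftrightarrow> augmented A \<epsilon> \<and>
     (\<forall>i. vb_supp (Tor A (right_via \<epsilon> vb_unit) (left_via \<epsilon> vb_unit) i) \<subseteq> {i})"

end

theory Submission
  imports Defs "HOL-Library.Product_Plus"
begin

text \<open>
  Write \<open>T_i(N)\<close> for \<open>Tor_i^A(k, N)\<close>. Let \<open>I\<close> be the kernel of \<open>B \<rightarrow> k\<close>. As \<open>B\<close> is Koszul, \<open>I\<close> has a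
  resolution by modules \<open>V_j \<otimes> B\<close> with \<open>V_j\<close> in degrees at most \<open>j + 1\<close>, and over \<open>A\<close> one has
  \<open>T_i(V_j \<otimes> B) = V_j \<otimes> T_i(B)\<close>. The map \<open>T_i(I) \<rightarrow> T_i(B)\<close> vanishes on the image of
  \<open>T_i(V_0 \<otimes> B)\<close>, because by (skew) commutativity \<open>B\<^sub>+\<close> annihilates \<open>T_i(B)\<close>. So, by the long exact
  sequences, \<open>T_i(B)\<close> is controlled by \<open>T_i(k)\<close>, which lives in degree \<open>i\<close>, and by the modules
  \<open>V_j \<otimes> T_{i-j}(B)\<close> with \<open>j \<ge> 1\<close>, which live in degrees at most \<open>j + 1 + 2 (i - j) \<le> 2 i\<close> by
  induction on \<open>i\<close>.
\<close>

text \<open>The summand \<open>V_0 \<otimes> T_i(B)\<close> cannot be bounded by the induction: it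
  involves \<open>T_i(B)\<close> itself and would reach degree 2i + 1. Its contribution is removed
  on the level of chains. Let P resolve B over A. The map from \<open>V_0 \<otimes> B\<close> to B
  multiplies by elements of the ideal of B; lift these to the ideal of A and move them to the other
  side of the product by (skew) commutativity. This gives a chain map from
  \<open>V_0 \<otimes> P\<close> to P over the same map, hence homotopic to the composite through I,
  and it vanishes after reduction modulo the ideal of A. The bound j + 1 on V_j comes from the shift
  of Tor of I against Tor of k, followed by a graded Nakayama argument. Nothing is assumed flat over
  the coefficients, so the resolutions are not minimal, merely generated in bounded degrees.
  Vanishing of Tor is phrased with elements: a cycle modulo the ideal is a boundary modulo the
  ideal. Functoriality and multiplication are merged into one operation indexed by injections with a
  chosen complement. A theorem cannot quantify over the types of modules, which is why projectivity
  is a splitting condition and generators of all degrees share one type.\<close>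

section \<open>Subgroups, additive maps and direct sums\<close>

definition sgrp :: "'n::ab_group_add set \<Rightarrow> bool" where
  "sgrp S \<longleftrightarrow> 0 \<in> S \<and> (\<forall>x\<in>S. \<forall>y\<in>S. x - y \<in> S)"

lemma sgrpD:
  assumes "sgrp S"
  shows "0 \<in> S" "x \<in> S \<Longrightarrow> y \<in> S \<Longrightarrow> x - y \<in> S" "x \<in> S \<Longrightarrow> - x \<in> S"
    "x \<in> S \<Longrightarrow> y \<in> S \<Longrightarrow> x + y \<in> S"
proof -
  show z: "0 \<in> S" using assms by (simp add: sgrp_def)
  show d: "x \<in> S \<Longrightarrow> y \<in> S \<Longrightarrow> x - y \<in> S" for x y using assms by (simp add: sgrp_def)
  show m: "x \<in> S \<Longrightarrow> - x \<in> S" for x using d[OF z, of x] by simp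
  show "x \<in> S \<Longrightarrow> y \<in> S \<Longrightarrow> x + y \<in> S" using d[OF _ m, of x y] by simp
qed

lemma sgrp_sum: "sgrp S \<Longrightarrow> (\<And>i. i \<in> I \<Longrightarrow> f i \<in> S) \<Longrightarrow> sum f I \<in> S"
  by (induction I rule: infinite_finite_induct) (auto intro: sgrpD)

definition additive_on :: "'m::ab_group_add set \<Rightarrow> ('m \<Rightarrow> 'n::ab_group_add) \<Rightarrow> bool" where
  "additive_on S g \<longleftrightarrow> (\<forall>x\<in>S. \<forall>y\<in>S. g (x + y) = g x + g y)"

lemma additive_onD:
  assumes "additive_on S g" "sgrp S"
  shows "g 0 = 0" "x \<in> S \<Longrightarrow> y \<in> S \<Longrightarrow> g (x + y) = g x + g y" "x \<in> S \<Longrightarrow> g (- x) = - g x"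
    "x \<in> S \<Longrightarrow> y \<in> S \<Longrightarrow> g (x - y) = g x - g y"
proof -
  note S = sgrpD[OF assms(2)]
  show p: "x \<in> S \<Longrightarrow> y \<in> S \<Longrightarrow> g (x + y) = g x + g y" for x y
    using assms(1) by (simp add: additive_on_def)
  show z: "g 0 = 0" using p[OF S(1) S(1)] by simp
  show m: "x \<in> S \<Longrightarrow> g (- x) = - g x" for x
    using p[of x "- x"] S(3)[of x] z by (metis add.right_inverse minus_unique)
  show "x \<in> S \<Longrightarrow> y \<in> S \<Longrightarrow> g (x - y) = g x - g y"
    using p[of x "- y"] S(3)[of y] m[of y] by simp
qed

text \<open>The direct sum of the subgroups \<open>S k\<close>, modelled by finitely supported
  functions with values in one ambient group.\<close>

definition dsum :: "'i set \<Rightarrow> ('i \<Rightarrow> 'n::ab_group_add set) \<Rightarrow> ('i \<Rightarrow>\<^sub>0 'n) set" where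
  "dsum K S = {p. Poly_Mapping.keys p \<subseteq> K \<and> (\<forall>k\<in>K. Poly_Mapping.lookup p k \<in> S k)}"

text \<open>The map out of a direct sum with components \<open>g k\<close>. It sums over the
  support, so additivity relies on \<open>g k 0 = 0\<close>, which holds once every component is
  additive on a subgroup.\<close>

definition lin :: "('i \<Rightarrow> 'n::zero \<Rightarrow> 'm::ab_group_add) \<Rightarrow> ('i \<Rightarrow>\<^sub>0 'n) \<Rightarrow> 'm" where
  "lin g p = (\<Sum>k\<in>Poly_Mapping.keys p. g k (Poly_Mapping.lookup p k))"

lemma lin_superset:
  assumes "finite F" "Poly_Mapping.keys p \<subseteq> F" "\<And>k. k \<in> F \<Longrightarrow> g k 0 = 0"
  shows "lin g p = (\<Sum>k\<in>F. g k (Poly_Mapping.lookup p k))"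
  unfolding lin_def using assms
  by (intro sum.mono_neutral_left) (auto simp: in_keys_iff)

lemma lin_0 [simp]: "lin g 0 = 0"
  by (simp add: lin_def)

lemma lin_single: "g k 0 = 0 \<Longrightarrow> lin g (Poly_Mapping.single k x) = g k x"
  by (cases "x = 0") (auto simp: lin_def)

lemma sgrp_dsum:
  assumes "\<And>k. k \<in> K \<Longrightarrow> sgrp (S k)"
  shows "sgrp (dsum K S)"
  unfolding sgrp_def
proof (intro conjI ballI)
  show "0 \<in> dsum K S" using sgrpD(1)[OF assms] by (simp add: dsum_def)
  fix p q assume pq: "p \<in> dsum K S" "q \<in> dsum K S"
  have "Poly_Mapping.keys (p - q) \<subseteq> Poly_Mapping.keys p \<union> Poly_Mapping.keys q"
    by (auto simp: in_keys_iff lookup_minus)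
  then show "p - q \<in> dsum K S"
    using pq sgrpD(2)[OF assms] by (auto simp: dsum_def lookup_minus)
qed

lemma single_dsum: "k \<in> K \<Longrightarrow> x \<in> S k \<Longrightarrow> (\<And>k. k \<in> K \<Longrightarrow> sgrp (S k)) \<Longrightarrow>
    Poly_Mapping.single k x \<in> dsum K S"
  by (auto simp: dsum_def lookup_single when_def sgrp_def)

lemma lin_additive:
  assumes S: "\<And>k. k \<in> K \<Longrightarrow> sgrp (S k)" and g: "\<And>k. k \<in> K \<Longrightarrow> additive_on (S k) (g k)"
  shows "additive_on (dsum K S) (lin g)"
  unfolding additive_on_def
proof (intro ballI)
  fix p q assume pq: "p \<in> dsum K S" "q \<in> dsum K S"
  let ?F = "Poly_Mapping.keys p \<union> Poly_Mapping.keys q"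
  have F: "?F \<subseteq> K" using pq by (auto simp: dsum_def)
  have g0: "g k 0 = 0" if "k \<in> ?F" for k using that F additive_onD(1)[OF g S] by blast
  have "lin g (p + q) = (\<Sum>k\<in>?F. g k (Poly_Mapping.lookup (p + q) k))"
    using keys_add[of p q] by (intro lin_superset g0) auto
  also have "\<dots> = (\<Sum>k\<in>?F. g k (Poly_Mapping.lookup p k) + g k (Poly_Mapping.lookup q k))"
    using F pq by (intro sum.cong refl) (auto simp: lookup_add dsum_def intro!: additive_onD(2)[OF g S])
  also have "\<dots> = lin g p + lin g q"
    using lin_superset[of ?F p g] lin_superset[of ?F q g] g0 by (simp add: sum.distrib)
  finally show "lin g (p + q) = lin g p + lin g q" .
qed

lemma dsum_induct [consumes 1, case_names zero add]:
  assumes "p \<in> dsum K S" "P 0"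
    and step: "\<And>k x p. k \<in> K \<Longrightarrow> x \<in> S k \<Longrightarrow> p \<in> dsum K S \<Longrightarrow> P p \<Longrightarrow>
       Poly_Mapping.lookup p k = 0 \<Longrightarrow> P (Poly_Mapping.single k x + p)"
    and S: "\<And>k. k \<in> K \<Longrightarrow> sgrp (S k)"
  shows "P p"
  using assms(1)
proof (induction "card (Poly_Mapping.keys p)" arbitrary: p)
  case 0
  then show ?case using assms(2) by simp
next
  case (Suc n)
  then obtain k where k: "k \<in> Poly_Mapping.keys p" by fastforce
  define q where "q = p - Poly_Mapping.single k (Poly_Mapping.lookup p k)"
  have lq: "Poly_Mapping.lookup q i = (if i = k then 0 else Poly_Mapping.lookup p i)" for i
    by (auto simp: q_def lookup_minus lookup_single when_def)
  have kq: "Poly_Mapping.keys q = Poly_Mapping.keys p - {k}"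
    by (auto simp: in_keys_iff lq split: if_splits)
  have kK: "k \<in> K" using k Suc.prems by (auto simp: dsum_def)
  have q: "q \<in> dsum K S" using Suc.prems S[THEN sgrpD(1)] by (auto simp: dsum_def kq lq)
  have "card (Poly_Mapping.keys q) = n" using Suc.hyps(2) k by (simp add: kq)
  then have "P q" using Suc.hyps(1) q by blast
  then have "P (Poly_Mapping.single k (Poly_Mapping.lookup p k) + q)"
    using kK Suc.prems q by (intro step) (auto simp: dsum_def lq)
  then show ?case by (simp add: q_def)
qed

lemma additive_dsum_eq:
  assumes "p \<in> dsum K S" "additive_on (dsum K S) f" "additive_on (dsum K S) g"
    and "\<And>k. k \<in> K \<Longrightarrow> sgrp (S k)"
    and "\<And>k x. k \<in> K \<Longrightarrow> x \<in> S k \<Longrightarrow> f (Poly_Mapping.single k x) = g (Poly_Mapping.single k x)"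
  shows "f p = g p"
proof -
  note D = sgrp_dsum[of K S, OF assms(4)]
  show ?thesis using assms(1)
    by (induction p rule: dsum_induct)
      (use assms(4) additive_onD[OF assms(2) D] additive_onD[OF assms(3) D] assms(5) single_dsum[of _ K _ S] in auto)
qed

lemma lin_in_sgrp:
  assumes "p \<in> dsum K S" "\<And>k x. k \<in> K \<Longrightarrow> x \<in> S k \<Longrightarrow> g k x \<in> T" "sgrp T"
  shows "lin g p \<in> T"
  unfolding lin_def using assms by (intro sgrp_sum) (auto simp: dsum_def)

lemma additive_on_comp:
  "additive_on S g \<Longrightarrow> additive_on T h \<Longrightarrow> (\<And>x. x \<in> S \<Longrightarrow> g x \<in> T) \<Longrightarrow> additive_on S (\<lambda>x. h (g x))"
  by (simp add: additive_on_def)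

lemma additive_on_single: "additive_on S (Poly_Mapping.single k)"
  by (simp add: additive_on_def single_add)


section \<open>Modules over an abstract category of injections with complements\<close>

text \<open>A module consists of carriers M(X) and a single operation. For an injection t from Y to
  X with complement \<open>cok t\<close>, a coefficient a over \<open>cok t\<close> and x over Y,
  the element \<open>ac M t a x\<close> over X is the product of a with the image of x under t. Both
  the functor structure and the multiplication are special cases.\<close>

type_synonym ('x, 't, 'a, 'n) md = "('x \<Rightarrow> 'n set) \<times> ('t \<Rightarrow> 'a \<Rightarrow> 'n \<Rightarrow> 'n)"

abbreviation cr :: "('x, 't, 'a, 'n) md \<Rightarrow> 'x \<Rightarrow> 'n set" where "cr \<equiv> fst"
abbreviation ac :: "('x, 't, 'a, 'n) md \<Rightarrow> 't \<Rightarrow> 'a \<Rightarrow> 'n \<Rightarrow> 'n" where "ac \<equiv> snd"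

text \<open>The model is the category of injections with a chosen complement \<open>cok t\<close>.
  If t goes from Y to X and u from X to Z, then \<open>push u t\<close> is the map induced by u from
  the complement of t to the complement of \<open>cmp u t\<close>; what is left over is the
  complement of u. \<open>zm X\<close> is the map from the zero object, whose complement is all of
  X. The assumption \<open>pair\<close> says that giving t together with an injection s into its
  complement is the same as giving one injection from an object X0, the direct sum of Y and W. It is
  what makes induced free modules free again.\<close>

locale vic =
  fixes Ob :: "'x \<Rightarrow> bool" and Hom :: "'x \<Rightarrow> 'x \<Rightarrow> 't set" and cmp :: "'t \<Rightarrow> 't \<Rightarrow> 't"
    and idm :: "'x \<Rightarrow> 't" and cok :: "'t \<Rightarrow> 'x" and push :: "'t \<Rightarrow> 't \<Rightarrow> 't"
    and zr :: 'x and zm :: "'x \<Rightarrow> 't" and dm :: "'x \<Rightarrow> nat"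
  assumes hom_ob: "t \<in> Hom Y X \<Longrightarrow> Ob Y" "t \<in> Hom Y X \<Longrightarrow> Ob X" "t \<in> Hom Y X \<Longrightarrow> Ob (cok t)"
    and hom_cod: "t \<in> Hom Y X \<Longrightarrow> t \<in> Hom Y X' \<Longrightarrow> X' = X"
    and idm: "Ob X \<Longrightarrow> idm X \<in> Hom X X"
    and cok_idm: "Ob X \<Longrightarrow> cok (idm X) = zr"
    and cmp: "t \<in> Hom Y X \<Longrightarrow> u \<in> Hom X Z \<Longrightarrow> cmp u t \<in> Hom Y Z"
    and id_l: "t \<in> Hom Y X \<Longrightarrow> cmp (idm X) t = t"
    and id_r: "t \<in> Hom Y X \<Longrightarrow> cmp t (idm Y) = t"
    and cmp_assoc: "t \<in> Hom W Y \<Longrightarrow> u \<in> Hom Y X \<Longrightarrow> v \<in> Hom X Z \<Longrightarrow>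
      cmp (cmp v u) t = cmp v (cmp u t)"
    and push: "t \<in> Hom Y X \<Longrightarrow> u \<in> Hom X Z \<Longrightarrow> push u t \<in> Hom (cok t) (cok (cmp u t))"
    and cok_push: "t \<in> Hom Y X \<Longrightarrow> u \<in> Hom X Z \<Longrightarrow> cok (push u t) = cok u"
    and push_id: "t \<in> Hom Y X \<Longrightarrow> push (idm X) t = idm (cok t)"
    and push_cmp: "t \<in> Hom W Y \<Longrightarrow> u \<in> Hom Y X \<Longrightarrow> v \<in> Hom X Z \<Longrightarrow>
      push (cmp v u) t = cmp (push v (cmp u t)) (push u t)"
    and push_push: "t \<in> Hom W Y \<Longrightarrow> u \<in> Hom Y X \<Longrightarrow> v \<in> Hom X Z \<Longrightarrow>
      push (push v (cmp u t)) (push u t) = push v u"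
    and zm: "Ob X \<Longrightarrow> zm X \<in> Hom zr X" "Ob X \<Longrightarrow> cok (zm X) = X"
    and cmp_zm: "t \<in> Hom Y X \<Longrightarrow> cmp t (zm Y) = zm X" and push_zm: "t \<in> Hom Y X \<Longrightarrow> push t (zm Y) = t"
    and dm: "t \<in> Hom Y X \<Longrightarrow> dm X = dm Y + dm (cok t)"
    and pair: "t \<in> Hom Y X \<Longrightarrow> s \<in> Hom W (cok t) \<Longrightarrow>
      \<exists>X0 t0 s0. t0 \<in> Hom Y X0 \<and> s0 \<in> Hom W (cok t0) \<and> cok s0 = zr \<and>
        (\<forall>X t s. t \<in> Hom Y X \<and> s \<in> Hom W (cok t) \<longrightarrow>
           (\<exists>!u. u \<in> Hom X0 X \<and> cmp u t0 = t \<and> cmp (push u t0) s0 = s)) \<and>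
        (\<forall>X u. u \<in> Hom X0 X \<longrightarrow> cok (cmp (push u t0) s0) = cok u)"
begin

text \<open>The last clause is naturality and associativity in one:
  \<open>ac A (push u t) b a\<close> is the product of b with the image of a under u, computed over
  the complement of \<open>cmp u t\<close>. Taking \<open>M\<close> to be \<open>A\<close> gives the
  ring axioms themselves, apart from the right unit.\<close>

definition pmd :: "('x, 't, 'a::ab_group_add, 'a) md \<Rightarrow> 'a \<Rightarrow> ('x, 't, 'a, 'n::ab_group_add) md \<Rightarrow> bool" where
  "pmd A un M \<longleftrightarrow> (\<forall>X. Ob X \<longrightarrow> sgrp (cr M X)) \<and>
     (\<forall>Y X. \<forall>t\<in>Hom Y X. \<forall>a\<in>cr A (cok t). \<forall>x\<in>cr M Y. ac M t a x \<in> cr M X) \<and>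
     (\<forall>Y X. \<forall>t\<in>Hom Y X. \<forall>a\<in>cr A (cok t). additive_on (cr M Y) (ac M t a)) \<and>
     (\<forall>Y X. \<forall>t\<in>Hom Y X. \<forall>x\<in>cr M Y. additive_on (cr A (cok t)) (\<lambda>a. ac M t a x)) \<and>
     (\<forall>X. Ob X \<longrightarrow> (\<forall>x\<in>cr M X. ac M (idm X) un x = x)) \<and>
     (\<forall>Y X Z. \<forall>t\<in>Hom Y X. \<forall>u\<in>Hom X Z. \<forall>a\<in>cr A (cok t). \<forall>b\<in>cr A (cok u). \<forall>x\<in>cr M Y.
        ac M u b (ac M t a x) = ac M (cmp u t) (ac A (push u t) b a) x)"

lemma pmdI:
  assumes "\<And>X. Ob X \<Longrightarrow> sgrp (cr M X)"
    "\<And>Y X t a x. t \<in> Hom Y X \<Longrightarrow> a \<in> cr A (cok t) \<Longrightarrow> x \<in> cr M Y \<Longrightarrow> ac M t a x \<in> cr M X"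
    "\<And>Y X t a. t \<in> Hom Y X \<Longrightarrow> a \<in> cr A (cok t) \<Longrightarrow> additive_on (cr M Y) (ac M t a)"
    "\<And>Y X t x. t \<in> Hom Y X \<Longrightarrow> x \<in> cr M Y \<Longrightarrow> additive_on (cr A (cok t)) (\<lambda>a. ac M t a x)"
    "\<And>X x. Ob X \<Longrightarrow> x \<in> cr M X \<Longrightarrow> ac M (idm X) un x = x"
    "\<And>Y X Z t u a b x. t \<in> Hom Y X \<Longrightarrow> u \<in> Hom X Z \<Longrightarrow> a \<in> cr A (cok t) \<Longrightarrow> b \<in> cr A (cok u) \<Longrightarrow>
       x \<in> cr M Y \<Longrightarrow> ac M u b (ac M t a x) = ac M (cmp u t) (ac A (push u t) b a) x"
  shows "pmd A un M"
  unfolding pmd_def by (intro conjI allI impI ballI; rule assms; assumption)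

definition phom :: "('x, 't, 'a::ab_group_add, 'a) md \<Rightarrow> ('x, 't, 'a, 'm::ab_group_add) md \<Rightarrow>
    ('x, 't, 'a, 'n::ab_group_add) md \<Rightarrow> ('x \<Rightarrow> 'm \<Rightarrow> 'n) \<Rightarrow> bool" where
  "phom A M N f \<longleftrightarrow> (\<forall>X. Ob X \<longrightarrow> (\<forall>x\<in>cr M X. f X x \<in> cr N X) \<and> additive_on (cr M X) (f X)) \<and>
     (\<forall>Y X. \<forall>t\<in>Hom Y X. \<forall>a\<in>cr A (cok t). \<forall>x\<in>cr M Y. f X (ac M t a x) = ac N t a (f Y x))"

text \<open>The pair (e, t) stands for the image of the generator e under t; its coefficients live
  over \<open>cok t\<close>.\<close>

definition terms :: "'e set \<Rightarrow> ('e \<Rightarrow> 'x) \<Rightarrow> 'x \<Rightarrow> ('e \<times> 't) set" where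
  "terms E ob X = {(e, t). e \<in> E \<and> t \<in> Hom (ob e) X}"

definition push_single :: "('x, 't, 'a, 'n::ab_group_add) md \<Rightarrow> 't \<Rightarrow> 'a \<Rightarrow> 'e \<times> 't \<Rightarrow> 'n \<Rightarrow> ('e \<times> 't) \<Rightarrow>\<^sub>0 'n" where
  "push_single M u b = (\<lambda>(e, t) x. Poly_Mapping.single (e, cmp u t) (ac M (push u t) b x))"

text \<open>\<open>ind E ob M\<close> is the tensor product of \<open>M\<close> with the free VB-module on the set \<open>E\<close>,
  where \<open>e \<in> E\<close> sits over \<open>ob e\<close>; for \<open>M = A\<close> it is the free \<open>A\<close>-module on \<open>E\<close>.\<close>

definition ind :: "'e set \<Rightarrow> ('e \<Rightarrow> 'x) \<Rightarrow> ('x, 't, 'a, 'n::ab_group_add) md \<Rightarrow>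
    ('x, 't, 'a, ('e \<times> 't) \<Rightarrow>\<^sub>0 'n) md" where
  "ind E ob M = (\<lambda>X. dsum (terms E ob X) (\<lambda>k. cr M (cok (snd k))), \<lambda>u b. lin (push_single M u b))"

lemma cr_ind: "cr (ind E ob M) X = dsum (terms E ob X) (\<lambda>k. cr M (cok (snd k)))"
  by (simp add: ind_def)

lemma ac_ind: "ac (ind E ob M) u b = lin (push_single M u b)"
  by (simp add: ind_def)

end

section \<open>Rings over such a category, module maps and induced modules\<close>

text \<open>\<open>Ap\<close> is the augmentation ideal: everything in positive degree and nothing
  but possibly 0 in degree 0. The right unit law appears in two forms because the unit sits over the
  zero object, which can be reached as the complement of an isomorphism or as the source of
  \<open>zm X\<close>.\<close>

locale gring = vic Ob Hom cmp idm cok push zr zm dm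
  for Ob :: "'x \<Rightarrow> bool" and Hom :: "'x \<Rightarrow> 'x \<Rightarrow> 't set" and cmp idm cok push zr zm dm +
  fixes A :: "('x, 't, 'a::ab_group_add, 'a) md" and un :: 'a and Ap :: "'x \<Rightarrow> 'a set"
  assumes A_md: "pmd A un A"
    and un: "un \<in> cr A zr"
    and unit_r: "w \<in> Hom V Y \<Longrightarrow> cok w = zr \<Longrightarrow> u \<in> Hom Y X \<Longrightarrow> a \<in> cr A (cok u) \<Longrightarrow>
      ac A (push u w) a un = a"
    and unit_z: "Ob X \<Longrightarrow> a \<in> cr A X \<Longrightarrow> ac A (zm X) a un = a"
    and Ap: "Ob X \<Longrightarrow> a \<in> Ap X \<Longrightarrow> a \<in> cr A X"
    and Ap_0: "Ob X \<Longrightarrow> dm X = 0 \<Longrightarrow> a \<in> Ap X \<Longrightarrow> a = 0"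
    and Ap_pos: "Ob X \<Longrightarrow> dm X \<noteq> 0 \<Longrightarrow> a \<in> cr A X \<Longrightarrow> a \<in> Ap X"
begin

abbreviation md :: "('x, 't, 'a, 'n::ab_group_add) md \<Rightarrow> bool" where "md \<equiv> pmd A un"
abbreviation mhom :: "('x, 't, 'a, 'm::ab_group_add) md \<Rightarrow> ('x, 't, 'a, 'n::ab_group_add) md \<Rightarrow>
  ('x \<Rightarrow> 'm \<Rightarrow> 'n) \<Rightarrow> bool" where "mhom \<equiv> phom A"

lemma mdD:
  assumes "md M"
  shows "Ob X \<Longrightarrow> sgrp (cr M X)"
    "t \<in> Hom Y X \<Longrightarrow> a \<in> cr A (cok t) \<Longrightarrow> x \<in> cr M Y \<Longrightarrow> ac M t a x \<in> cr M X"
    "t \<in> Hom Y X \<Longrightarrow> a \<in> cr A (cok t) \<Longrightarrow> additive_on (cr M Y) (ac M t a)"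
    "t \<in> Hom Y X \<Longrightarrow> x \<in> cr M Y \<Longrightarrow> additive_on (cr A (cok t)) (\<lambda>a. ac M t a x)"
    "Ob X \<Longrightarrow> x \<in> cr M X \<Longrightarrow> ac M (idm X) un x = x"
    "t \<in> Hom Y X \<Longrightarrow> u \<in> Hom X Z \<Longrightarrow> a \<in> cr A (cok t) \<Longrightarrow> b \<in> cr A (cok u) \<Longrightarrow> x \<in> cr M Y \<Longrightarrow>
        ac M u b (ac M t a x) = ac M (cmp u t) (ac A (push u t) b a) x"
  using assms unfolding pmd_def by (elim conjE; meson)+

lemma md_sgrp:
  assumes "md M" "Ob X"
  shows "0 \<in> cr M X" "x \<in> cr M X \<Longrightarrow> y \<in> cr M X \<Longrightarrow> x - y \<in> cr M X" "x \<in> cr M X \<Longrightarrow> - x \<in> cr M X"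
    "x \<in> cr M X \<Longrightarrow> y \<in> cr M X \<Longrightarrow> x + y \<in> cr M X"
  using sgrpD[OF mdD(1)[OF assms]] by blast+

lemma md_ac_simps:
  assumes "md M" "t \<in> Hom Y X" "a \<in> cr A (cok t)"
  shows "ac M t a 0 = 0" "x \<in> cr M Y \<Longrightarrow> y \<in> cr M Y \<Longrightarrow> ac M t a (x + y) = ac M t a x + ac M t a y"
    "x \<in> cr M Y \<Longrightarrow> ac M t a (- x) = - ac M t a x"
    "x \<in> cr M Y \<Longrightarrow> y \<in> cr M Y \<Longrightarrow> ac M t a (x - y) = ac M t a x - ac M t a y"
  using additive_onD[OF mdD(3)[OF assms] mdD(1)[OF assms(1) hom_ob(1)[OF assms(2)]]] by blast+

lemma mhomD:
  assumes "mhom M N f"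
  shows "Ob X \<Longrightarrow> x \<in> cr M X \<Longrightarrow> f X x \<in> cr N X"
    "Ob X \<Longrightarrow> additive_on (cr M X) (f X)"
    "t \<in> Hom Y X \<Longrightarrow> a \<in> cr A (cok t) \<Longrightarrow> x \<in> cr M Y \<Longrightarrow> f X (ac M t a x) = ac N t a (f Y x)"
  using assms unfolding phom_def by (elim conjE; meson)+

lemma mhom_simps:
  assumes "mhom M N f" "md M" "Ob X"
  shows "f X 0 = 0" "x \<in> cr M X \<Longrightarrow> y \<in> cr M X \<Longrightarrow> f X (x + y) = f X x + f X y"
    "x \<in> cr M X \<Longrightarrow> f X (- x) = - f X x"
    "x \<in> cr M X \<Longrightarrow> y \<in> cr M X \<Longrightarrow> f X (x - y) = f X x - f X y"
  using additive_onD[OF mhomD(2)[OF assms(1,3)] mdD(1)[OF assms(2,3)]] by blast+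

lemma mhom_comp: "mhom M N f \<Longrightarrow> mhom N L g \<Longrightarrow> mhom M L (\<lambda>X x. g X (f X x))"
  unfolding phom_def additive_on_def by (metis hom_ob(1))

lemma mhom_id: "mhom M M (\<lambda>X x. x)"
  by (simp add: phom_def additive_on_def)

lemma mhom_zero: "md N \<Longrightarrow> mhom M N (\<lambda>X x. 0)"
  by (auto simp: phom_def additive_on_def md_sgrp md_ac_simps)

lemma mhom_add:
  assumes "mhom M N f" "mhom M N g" "md N"
  shows "mhom M N (\<lambda>X x. f X x + g X x)"
  using assms unfolding phom_def additive_on_def
  by (auto simp: md_sgrp md_ac_simps hom_ob)

lemma mhom_uminus:
  assumes "mhom M N f" "md N"
  shows "mhom M N (\<lambda>X x. - f X x)"
  using assms unfolding phom_def additive_on_def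
  by (auto simp: md_sgrp md_ac_simps hom_ob)

lemma mhom_diff:
  assumes "mhom M N f" "mhom M N g" "md N"
  shows "mhom M N (\<lambda>X x. f X x - g X x)"
  using mhom_add[OF assms(1) mhom_uminus[OF assms(2,3)] assms(3)] by simp

lemma termsD: "(e, t) \<in> terms E ob X \<Longrightarrow> e \<in> E" "(e, t) \<in> terms E ob X \<Longrightarrow> t \<in> Hom (ob e) X"
  by (simp_all add: terms_def)

lemma terms_cmp: "(e, t) \<in> terms E ob X \<Longrightarrow> u \<in> Hom X Z \<Longrightarrow> (e, cmp u t) \<in> terms E ob Z"
  by (auto simp: terms_def intro: cmp)

lemma terms_sgrp: "md M \<Longrightarrow> k \<in> terms E ob X \<Longrightarrow> sgrp (cr M (cok (snd k)))"
  by (auto simp: terms_def intro!: mdD(1) hom_ob(3))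

lemma single_ind: "md M \<Longrightarrow> (e, t) \<in> terms E ob X \<Longrightarrow> x \<in> cr M (cok t) \<Longrightarrow>
    Poly_Mapping.single (e, t) x \<in> cr (ind E ob M) X"
  unfolding cr_ind by (rule single_dsum) (auto simp: terms_sgrp)

lemma lin_mhom_aux:
  assumes "md M" "\<And>e t. (e, t) \<in> terms E ob X \<Longrightarrow> additive_on (cr M (cok t)) (m (e, t))"
  shows "additive_on (cr (ind E ob M) X) (lin m)"
  unfolding cr_ind
  by (rule lin_additive) (use assms in \<open>auto simp: terms_sgrp\<close>)

lemma lin_ind_single:
  assumes "md M" "t \<in> Hom Y X" "additive_on (cr M (cok t)) (m (e, t))"
  shows "lin m (Poly_Mapping.single (e, t) x) = m (e, t) x"
  by (rule lin_single, rule additive_onD(1)[OF assms(3) mdD(1)[OF assms(1) hom_ob(3)[OF assms(2)]]])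

lemma additive_push_single:
  assumes "md M" "t \<in> Hom Y X" "u \<in> Hom X Z" "b \<in> cr A (cok u)"
  shows "additive_on (cr M (cok t)) (push_single M u b (e, t))"
  using md_ac_simps(2)[OF assms(1) push[OF assms(2,3)], of b] assms(4) cok_push[OF assms(2,3)]
  by (simp add: push_single_def additive_on_def single_add)

lemma ac_ind_single:
  assumes "md M" "t \<in> Hom Y X" "u \<in> Hom X Z" "b \<in> cr A (cok u)"
  shows "ac (ind E ob M) u b (Poly_Mapping.single (e, t) x) =
    Poly_Mapping.single (e, cmp u t) (ac M (push u t) b x)"
  unfolding ac_ind
  using lin_ind_single[where m = "push_single M u b", OF assms(1,2) additive_push_single[OF assms]]
  by (simp add: push_single_def)

lemma sgrp_ind: "md M \<Longrightarrow> sgrp (cr (ind E ob M) X)"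
  unfolding cr_ind by (rule sgrp_dsum) (auto simp: terms_sgrp)

lemma ac_ind_closed:
  assumes "md M" "u \<in> Hom X Z" "b \<in> cr A (cok u)" "p \<in> cr (ind E ob M) X"
  shows "ac (ind E ob M) u b p \<in> cr (ind E ob M) Z"
  unfolding ac_ind
proof (rule lin_in_sgrp[OF assms(4)[unfolded cr_ind]])
  fix k x assume k: "k \<in> terms E ob X" "x \<in> cr M (cok (snd k))"
  obtain e t where et: "k = (e, t)" "(e, t) \<in> terms E ob X" using k by (cases k) auto
  note t = termsD(2)[OF et(2)]
  have "ac M (push u t) b x \<in> cr M (cok (cmp u t))"
    using k et assms(3) cok_push[OF t assms(2)] by (intro mdD(2)[OF assms(1) push[OF t assms(2)]]) auto
  then show "push_single M u b k x \<in> cr (ind E ob M) Z"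
    using single_ind[OF assms(1) terms_cmp[OF et(2) assms(2)]] by (simp add: et(1) push_single_def)
qed (use assms sgrp_ind in blast)

lemma additive_ac_ind:
  assumes "md M" "u \<in> Hom X Z" "b \<in> cr A (cok u)"
  shows "additive_on (cr (ind E ob M) X) (ac (ind E ob M) u b)"
  unfolding ac_ind
  by (rule lin_mhom_aux[OF assms(1)]) (rule additive_push_single[OF assms(1) termsD(2) assms(2,3)])

lemma ind_eqI:
  assumes "md M" "p \<in> cr (ind E ob M) X" "additive_on (cr (ind E ob M) X) f"
    "additive_on (cr (ind E ob M) X) g"
    "\<And>e t x. (e, t) \<in> terms E ob X \<Longrightarrow> x \<in> cr M (cok t) \<Longrightarrow>
       f (Poly_Mapping.single (e, t) x) = g (Poly_Mapping.single (e, t) x)"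
  shows "f p = g p"
  using assms(2-4) unfolding cr_ind
  by (rule additive_dsum_eq) (use assms in \<open>auto simp: terms_sgrp\<close>)

lemma ind_md:
  assumes M: "md M"
  shows "md (ind E ob M)"
proof -
  let ?I = "ind E ob M"
  have 1: "additive_on (cr A (cok u)) (\<lambda>b. ac ?I u b p)"
    if u: "u \<in> Hom X Z" and p: "p \<in> cr ?I X" for X Z u p
    unfolding additive_on_def
  proof (intro ballI)
    fix a b assume ab: "a \<in> cr A (cok u)" "b \<in> cr A (cok u)"
    note S = mdD(1)[OF A_md hom_ob(3)[OF u]]
    note ab' = sgrpD(4)[OF S ab]
    show "ac ?I u (a + b) p = ac ?I u a p + ac ?I u b p"
    proof (rule ind_eqI[OF M p, where g = "\<lambda>p. ac ?I u a p + ac ?I u b p"])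
      show "additive_on (cr ?I X) (ac ?I u (a + b))" by (rule additive_ac_ind[OF M u ab'])
      show "additive_on (cr ?I X) (\<lambda>p. ac ?I u a p + ac ?I u b p)"
        using additive_ac_ind[OF M u ab(1), of E ob] additive_ac_ind[OF M u ab(2), of E ob]
        by (simp add: additive_on_def algebra_simps)
      fix e t x assume et: "(e, t) \<in> terms E ob X" and x: "x \<in> cr M (cok t)"
      note t = termsD(2)[OF et]
      have "ac M (push u t) (a + b) x = ac M (push u t) a x + ac M (push u t) b x"
        using mdD(4)[OF M push[OF t u] x] ab by (simp add: cok_push[OF t u] additive_on_def)
      then show "ac ?I u (a + b) (Poly_Mapping.single (e, t) x) =
          ac ?I u a (Poly_Mapping.single (e, t) x) + ac ?I u b (Poly_Mapping.single (e, t) x)"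
        by (simp add: ac_ind_single[OF M t u] ab ab' single_add)
    qed
  qed
  have 2: "ac ?I (idm X) un p = p" if X: "Ob X" and p: "p \<in> cr ?I X" for X p
  proof (rule ind_eqI[OF M p, where g = "\<lambda>p. p"])
    have u: "un \<in> cr A (cok (idm X))" using X un by (simp add: cok_idm)
    show "additive_on (cr ?I X) (ac ?I (idm X) un)" by (rule additive_ac_ind[OF M idm[OF X] u])
    show "additive_on (cr ?I X) (\<lambda>p. p)" by (simp add: additive_on_def)
    fix e t x assume et: "(e, t) \<in> terms E ob X" and x: "x \<in> cr M (cok t)"
    note t = termsD(2)[OF et]
    show "ac ?I (idm X) un (Poly_Mapping.single (e, t) x) = Poly_Mapping.single (e, t) x"
      using mdD(5)[OF M hom_ob(3)[OF t] x]
      by (simp add: ac_ind_single[OF M t idm[OF X] u] id_l[OF t] push_id[OF t])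
  qed
  have 3: "ac ?I u b (ac ?I t a p) = ac ?I (cmp u t) (ac A (push u t) b a) p"
    if t: "t \<in> Hom Y X" and u: "u \<in> Hom X Z" and a: "a \<in> cr A (cok t)" and b: "b \<in> cr A (cok u)"
      and p: "p \<in> cr ?I Y" for Y X Z t u a b p
  proof (rule ind_eqI[OF M p])
    have c: "ac A (push u t) b a \<in> cr A (cok (cmp u t))"
      using mdD(2)[OF A_md push[OF t u]] cok_push[OF t u] a b by simp
    show "additive_on (cr ?I Y) (\<lambda>p. ac ?I u b (ac ?I t a p))"
      by (rule additive_on_comp[OF additive_ac_ind[OF M t a] additive_ac_ind[OF M u b]])
        (rule ac_ind_closed[OF M t a])
    show "additive_on (cr ?I Y) (ac ?I (cmp u t) (ac A (push u t) b a))"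
      by (rule additive_ac_ind[OF M cmp[OF t u] c])
    fix e s x assume es: "(e, s) \<in> terms E ob Y" and x: "x \<in> cr M (cok s)"
    note s = termsD(2)[OF es]
    \<comment> \<open>Associativity of \<open>M\<close> is applied over the complement of
      \<open>s\<close>; \<open>push_cmp\<close> and \<open>push_push\<close> turn the pushes that
      arise there into those belonging to \<open>cmp u t\<close>.\<close>
    show "ac ?I u b (ac ?I t a (Poly_Mapping.single (e, s) x)) =
       ac ?I (cmp u t) (ac A (push u t) b a) (Poly_Mapping.single (e, s) x)"
      using mdD(6)[OF M push[OF s t] push[OF cmp[OF s t] u] _ _ x, of a b] cok_push[OF s t]
        cok_push[OF cmp[OF s t] u] a b
      by (simp add: ac_ind_single[OF M s t] ac_ind_single[OF M cmp[OF s t] u]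
         ac_ind_single[OF M s cmp[OF t u]] c cmp_assoc[OF s t u] push_cmp[OF s t u]
         push_push[OF s t u])
  qed
  show ?thesis
    by (rule pmdI) (rule sgrp_ind[OF M] ac_ind_closed[OF M] additive_ac_ind[OF M] 1 2 3; assumption)+
qed

lemma lin_mhom:
  assumes M: "md M" and N: "md N"
    and cl: "\<And>e t X y. (e, t) \<in> terms E ob X \<Longrightarrow> y \<in> cr M (cok t) \<Longrightarrow> m (e, t) y \<in> cr N X"
    and ad: "\<And>e t X. (e, t) \<in> terms E ob X \<Longrightarrow> additive_on (cr M (cok t)) (m (e, t))"
    and nat: "\<And>e t X Z u b y. (e, t) \<in> terms E ob X \<Longrightarrow> u \<in> Hom X Z \<Longrightarrow> b \<in> cr A (cok u) \<Longrightarrow>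
       y \<in> cr M (cok t) \<Longrightarrow> m (e, cmp u t) (ac M (push u t) b y) = ac N u b (m (e, t) y)"
  shows "mhom (ind E ob M) N (\<lambda>X. lin m)"
proof -
  let ?I = "ind E ob M"
  have cl': "lin m p \<in> cr N X" if "Ob X" "p \<in> cr ?I X" for X p
    by (rule lin_in_sgrp[OF that(2)[unfolded cr_ind]]) (use cl mdD(1)[OF N that(1)] in auto)
  have ad': "additive_on (cr ?I X) (lin m)" for X
    by (rule lin_mhom_aux[OF M ad])
  have "lin m (ac ?I u b p) = ac N u b (lin m p)"
    if u: "u \<in> Hom X Z" and b: "b \<in> cr A (cok u)" and p: "p \<in> cr ?I X" for X Z u b p
  proof (rule ind_eqI[OF M p])
    show "additive_on (cr ?I X) (\<lambda>p. lin m (ac ?I u b p))"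
      by (rule additive_on_comp[OF additive_ac_ind[OF M u b] ad'[of Z]])
        (rule ac_ind_closed[OF M u b])
    show "additive_on (cr ?I X) (\<lambda>p. ac N u b (lin m p))"
      by (rule additive_on_comp[OF ad' mdD(3)[OF N u b]]) (rule cl'[OF hom_ob(1)[OF u]])
    fix e s x assume es: "(e, s) \<in> terms E ob X" and x: "x \<in> cr M (cok s)"
    note s = termsD(2)[OF es] and es' = terms_cmp[OF es u]
    show "lin m (ac ?I u b (Poly_Mapping.single (e, s) x)) = ac N u b (lin m (Poly_Mapping.single (e, s) x))"
      by (simp add: ac_ind_single[OF M s u b] lin_ind_single[where m = m, OF M s ad[OF es]]
        lin_ind_single[where m = m, OF M termsD(2)[OF es'] ad[OF es']] nat[OF es u b x])
  qed
  then show ?thesis unfolding phom_def using cl' ad' by blast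
qed

end

section \<open>Free modules and projectivity\<close>

context gring
begin

lemma terms_idm: "e \<in> E \<Longrightarrow> Ob (ob e) \<Longrightarrow> (e, idm (ob e)) \<in> terms E ob (ob e)"
  by (simp add: terms_def idm)

definition gen :: "('e \<Rightarrow> 'x) \<Rightarrow> 'e \<Rightarrow> ('e \<times> 't) \<Rightarrow>\<^sub>0 'a" where
  "gen ob e = Poly_Mapping.single (e, idm (ob e)) un"

lemma gen_in: "e \<in> E \<Longrightarrow> Ob (ob e) \<Longrightarrow> gen ob e \<in> cr (ind E ob A) (ob e)"
  unfolding gen_def by (rule single_ind[OF A_md terms_idm]) (auto simp: cok_idm un)

lemma ac_gen:
  assumes "t \<in> Hom (ob e) X" "a \<in> cr A (cok t)"
  shows "ac (ind E ob A) t a (gen ob e) = Poly_Mapping.single (e, t) a"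
proof -
  note i = idm[OF hom_ob(1)[OF assms(1)]]
  show ?thesis
    unfolding gen_def
    using unit_r[OF i cok_idm[OF hom_ob(1)[OF assms(1)]] assms] id_r[OF assms(1)]
    by (simp add: ac_ind_single[OF A_md i assms])
qed

text \<open>The universal property of a free module: this is the map that takes
  \<open>gen ob e\<close> to \<open>n e\<close>, as \<open>ev_gen\<close> confirms.\<close>

definition ev :: "('x, 't, 'a, 'n::ab_group_add) md \<Rightarrow> ('e \<Rightarrow> 'n) \<Rightarrow> (('e \<times> 't) \<Rightarrow>\<^sub>0 'a) \<Rightarrow> 'n" where
  "ev M n = lin (\<lambda>(e, t) a. ac M t a (n e))"

lemma ev_mhom:
  assumes M: "md M" and n: "\<And>e. e \<in> E \<Longrightarrow> Ob (ob e) \<Longrightarrow> n e \<in> cr M (ob e)"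
  shows "mhom (ind E ob A) M (\<lambda>X. ev M n)"
  unfolding ev_def
proof (rule lin_mhom[OF A_md M]; unfold prod.case)
  fix e t X assume et: "(e, t) \<in> terms E ob X"
  note t = termsD(2)[OF et] and ne = n[OF termsD(1)[OF et] hom_ob(1)[OF termsD(2)[OF et]]]
  show "ac M t y (n e) \<in> cr M X" if "y \<in> cr A (cok t)" for y by (rule mdD(2)[OF M t that ne])
  show "additive_on (cr A (cok t)) (\<lambda>a. ac M t a (n e))" by (rule mdD(4)[OF M t ne])
  show "ac M (cmp u t) (ac A (push u t) b y) (n e) = ac M u b (ac M t y (n e))"
    if "u \<in> Hom X Z" "b \<in> cr A (cok u)" "y \<in> cr A (cok t)" for u Z b y
    by (rule mdD(6)[OF M t that(1,3,2) ne, symmetric])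
qed

lemma ev_single:
  assumes "md M" "t \<in> Hom Y X" "n e \<in> cr M Y"
  shows "ev M n (Poly_Mapping.single (e, t) a) = ac M t a (n e)"
  unfolding ev_def
  using lin_ind_single[OF A_md assms(2), where m = "\<lambda>(e, t) a. ac M t a (n e)" and e = e]
    mdD(4)[OF assms] by simp

lemma ev_gen: "md M \<Longrightarrow> Ob (ob e) \<Longrightarrow> n e \<in> cr M (ob e) \<Longrightarrow> ev M n (gen ob e) = n e"
  unfolding gen_def by (simp add: ev_single[OF _ idm] mdD(5))

lemma mhom_ind_eqI:
  assumes M: "md M" "mhom (ind E ob M) N f" "mhom (ind E ob M) N g" and X: "Ob X" and p: "p \<in> cr (ind E ob M) X"
    and "\<And>e t x. (e, t) \<in> terms E ob X \<Longrightarrow> x \<in> cr M (cok t) \<Longrightarrow>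
       f X (Poly_Mapping.single (e, t) x) = g X (Poly_Mapping.single (e, t) x)"
  shows "f X p = g X p"
  by (rule ind_eqI[OF M(1) p mhomD(2)[OF M(2) X] mhomD(2)[OF M(3) X] assms(6)])

definition elts :: "('x, 't, 'a, 'n) md \<Rightarrow> ('x \<times> 'n) set" where
  "elts M = {(Y, y). Ob Y \<and> y \<in> cr M Y}"

text \<open>The free module with one generator for every element of M; \<open>ev M snd\<close> maps
  it onto M.\<close>

definition cov :: "('x, 't, 'a, 'n::ab_group_add) md \<Rightarrow> ('x, 't, 'a, (('x \<times> 'n) \<times> 't) \<Rightarrow>\<^sub>0 'a) md" where
  "cov M = ind (elts M) fst A"

lemma md_cov: "md (cov M)" unfolding cov_def by (rule ind_md[OF A_md])

lemma ev_cov: "md M \<Longrightarrow> mhom (cov M) M (\<lambda>X. ev M snd)"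
  unfolding cov_def by (rule ev_mhom) (auto simp: elts_def)

text \<open>Projectivity is stated as a splitting of the canonical free cover. The lifting property
  would quantify over modules of all types; this form mentions one module and implies lifting
  against every type.\<close>

definition proj :: "('x, 't, 'a, 'n::ab_group_add) md \<Rightarrow> bool" where
  "proj P \<longleftrightarrow> md P \<and> (\<exists>s. mhom P (cov P) s \<and> (\<forall>X x. Ob X \<longrightarrow> x \<in> cr P X \<longrightarrow> ev P snd (s X x) = x))"

lemma proj_md: "proj P \<Longrightarrow> md P" by (simp add: proj_def)

text \<open>Choose for every element of P a preimage under \<open>h\<close> of its image under
  \<open>f\<close>. The cover of P is free on these elements, so the choices extend to a map, and
  the splitting pulls it back to P.\<close>

lemma proj_lift:
  assumes P: "proj P" and M: "md M" and L: "md L" and f: "mhom P L f" and h: "mhom M L h"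
    and im: "\<And>X x. Ob X \<Longrightarrow> x \<in> cr P X \<Longrightarrow> \<exists>y\<in>cr M X. h X y = f X x"
  shows "\<exists>g. mhom P M g \<and> (\<forall>X x. Ob X \<longrightarrow> x \<in> cr P X \<longrightarrow> h X (g X x) = f X x)"
proof -
  note P' = proj_md[OF P]
  obtain s where s: "mhom P (cov P) s" "\<And>X x. Ob X \<Longrightarrow> x \<in> cr P X \<Longrightarrow> ev P snd (s X x) = x"
    using P unfolding proj_def by blast
  define n where "n = (\<lambda>(Y, y). SOME m. m \<in> cr M Y \<and> h Y m = f Y y)"
  have n: "n e \<in> cr M (fst e) \<and> h (fst e) (n e) = f (fst e) (snd e)" if "e \<in> elts P" for e
    using that someI_ex[of "\<lambda>m. m \<in> cr M (fst e) \<and> h (fst e) m = f (fst e) (snd e)"] im[of "fst e" "snd e"]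
    by (auto simp: elts_def n_def split: prod.splits)
  have E: "mhom (cov P) M (\<lambda>X. ev M n)"
    unfolding cov_def by (rule ev_mhom[OF M]) (use n in auto)
  have eq: "h X (ev M n p) = f X (ev P snd p)" if X: "Ob X" and p: "p \<in> cr (cov P) X" for X p
    using p unfolding cov_def
  proof (rule mhom_ind_eqI[OF A_md mhom_comp[OF E h, unfolded cov_def] mhom_comp[OF ev_cov[OF P'] f, unfolded cov_def] X])
    fix e t a assume et: "(e, t) \<in> terms (elts P) fst X" and a: "a \<in> cr A (cok t)"
    note t = termsD(2)[OF et] and e = termsD(1)[OF et]
    have e': "snd e \<in> cr P (fst e)" using e by (auto simp: elts_def)
    show "h X (ev M n (Poly_Mapping.single (e, t) a)) = f X (ev P snd (Poly_Mapping.single (e, t) a))"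
      using n[OF e] by (simp add: ev_single[where Y = "fst e" and X = X] M P' t e' mhomD(3)[OF h t a] mhomD(3)[OF f t a])
  qed
  show ?thesis
    by (rule exI[of _ "\<lambda>X x. ev M n (s X x)"])
      (use mhom_comp[OF s(1) E] eq s mhomD(1)[OF s(1)] in auto)
qed

lemma cov_surj: "md M \<Longrightarrow> Ob X \<Longrightarrow> x \<in> cr M X \<Longrightarrow> \<exists>y\<in>cr (cov M) X. ev M snd y = x"
  using gen_in[of "(X, x)" "elts M" fst] ev_gen[of M fst "(X, x)" snd]
  unfolding cov_def by (auto simp: elts_def)

text \<open>Lifting the retraction through the cover of M and restricting along \<open>i\<close>
  splits that cover.\<close>

lemma proj_retract:
  assumes P: "proj P" and M: "md M" and i: "mhom M P i" and r: "mhom P M r"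
    and ri: "\<And>X x. Ob X \<Longrightarrow> x \<in> cr M X \<Longrightarrow> r X (i X x) = x"
  shows "proj M"
proof -
  obtain g where g: "mhom P (cov M) g" "\<And>X x. Ob X \<Longrightarrow> x \<in> cr P X \<Longrightarrow> ev M snd (g X x) = r X x"
    using proj_lift[OF P md_cov M r ev_cov[OF M] cov_surj[OF M _ mhomD(1)[OF r]]] by blast
  show ?thesis unfolding proj_def
    using M mhom_comp[OF i g(1)] g(2) mhomD(1)[OF i] ri by auto
qed

text \<open>A free module splits its own cover by sending each generator to the generator that the
  cover has for it.\<close>

lemma proj_ind_A: "proj (ind E ob A)"
proof -
  let ?I = "ind E ob A"
  let ?n = "\<lambda>e. gen fst (ob e, gen ob e)"
  note I = ind_md[OF A_md, of E ob]
  have n: "?n e \<in> cr (cov ?I) (ob e)" if "e \<in> E" "Ob (ob e)" for e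
    unfolding cov_def using gen_in[of "(ob e, gen ob e)" "elts ?I" fst] gen_in[of e E ob, OF that] that
    by (auto simp: elts_def)
  have s: "mhom ?I (cov ?I) (\<lambda>X. ev (cov ?I) ?n)"
    by (rule ev_mhom[OF md_cov n])
  have "ev ?I snd (ev (cov ?I) ?n x) = x" if X: "Ob X" and x: "x \<in> cr ?I X" for X x
  proof (rule mhom_ind_eqI[OF A_md mhom_comp[OF s ev_cov[OF I]] mhom_id X x])
    fix e t a assume et: "(e, t) \<in> terms E ob X" and a: "a \<in> cr A (cok t)"
    note t = termsD(2)[OF et] and e = termsD(1)[OF et]
    note obe = hom_ob(1)[OF t]
    have "ev ?I snd (ev (cov ?I) ?n (Poly_Mapping.single (e, t) a)) = ev ?I snd (ac (cov ?I) t a (?n e))"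
      by (simp add: ev_single[where n = ?n, OF md_cov t n[OF e obe]])
    also have "\<dots> = ac ?I t a (ev ?I snd (?n e))"
      by (rule mhomD(3)[OF ev_cov[OF I] t a n[OF e obe]])
    also have "ev ?I snd (?n e) = gen ob e"
      using ev_gen[of ?I fst "(ob e, gen ob e)" snd] I obe gen_in[of e E ob, OF e obe] by simp
    also have "ac ?I t a (gen ob e) = Poly_Mapping.single (e, t) a" by (rule ac_gen[of t ob e X a, OF t a])
    finally show "ev ?I snd (ev (cov ?I) ?n (Poly_Mapping.single (e, t) a)) = Poly_Mapping.single (e, t) a" .
  qed
  then show ?thesis unfolding proj_def using I s by blast
qed

lemma proj_free:
  assumes P: "md P" and n: "\<And>e. e \<in> E \<Longrightarrow> n e \<in> cr P (ob e)"
    and b: "\<And>X. Ob X \<Longrightarrow> bij_betw (ev P n) (cr (ind E ob A) X) (cr P X)"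
  shows "proj P"
proof -
  let ?I = "ind E ob A"
  have r: "mhom ?I P (\<lambda>X. ev P n)" by (rule ev_mhom[OF P n])
  define i where "i = (\<lambda>X. the_inv_into (cr ?I X) (ev P n))"
  have inj: "inj_on (ev P n) (cr ?I X)" if "Ob X" for X using b[OF that] by (simp add: bij_betw_def)
  have i1: "i X x \<in> cr ?I X" "ev P n (i X x) = x" if "Ob X" "x \<in> cr P X" for X x
    using b[OF that(1)] that(2) the_inv_into_into[OF inj[OF that(1)], of x "cr ?I X"]
      f_the_inv_into_f[OF inj[OF that(1)], of x] by (auto simp: i_def bij_betw_def)
  have i2: "i X y = z" if "Ob X" "z \<in> cr ?I X" "ev P n z = y" for X y z
    using the_inv_into_f_f[OF inj[OF that(1)] that(2)] that by (simp add: i_def)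
  have "mhom P ?I i"
    unfolding phom_def additive_on_def
  proof (intro conjI allI impI ballI)
    fix X x y assume X: "Ob X" and xy: "x \<in> cr P X" "y \<in> cr P X"
    show "i X x \<in> cr ?I X" using i1 X xy by blast
    show "i X (x + y) = i X x + i X y"
      by (rule i2[OF X])
        (use i1[OF X] xy md_sgrp(4)[OF ind_md[OF A_md, of E ob] X] mhom_simps(2)[OF r ind_md[OF A_md] X] in auto)
  next
    fix Y X t a x assume t: "t \<in> Hom Y X" and a: "a \<in> cr A (cok t)" and x: "x \<in> cr P Y"
    show "i X (ac P t a x) = ac ?I t a (i Y x)"
      by (rule i2[OF hom_ob(2)[OF t]])
        (use i1[OF hom_ob(1)[OF t] x] mdD(2)[OF ind_md[OF A_md] t a] mhomD(3)[OF r t a] in auto)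
  qed
  then show ?thesis using proj_retract[OF proj_ind_A P _ r] i1 by blast
qed

definition prd :: "('x, 't, 'a, 'm) md \<Rightarrow> ('x, 't, 'a, 'n) md \<Rightarrow> ('x, 't, 'a, 'm \<times> 'n) md" where
  "prd M N = (\<lambda>X. cr M X \<times> cr N X, \<lambda>t a. map_prod (ac M t a) (ac N t a))"

lemma cr_prd: "cr (prd M N) X = cr M X \<times> cr N X" and ac_prd: "ac (prd M N) t a (x, y) = (ac M t a x, ac N t a y)"
  by (simp_all add: prd_def)

lemma md_prd: "md M \<Longrightarrow> md N \<Longrightarrow> md (prd M N)"
proof (rule pmdI, goal_cases)
  case (1 X) then show ?case by (auto simp: sgrp_def cr_prd md_sgrp zero_prod_def)
next
  case (2 Y X t a x) then show ?case by (auto simp: cr_prd ac_prd intro: mdD(2))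
next
  case (3 Y X t a) then show ?case
    using md_ac_simps(2)[OF 3(1) 3(3,4)] md_ac_simps(2)[OF 3(2) 3(3,4)]
    by (simp add: additive_on_def cr_prd ac_prd)
next
  case (4 Y X t x) then show ?case
    using mdD(4)[OF 4(1) 4(3), of "fst x"] mdD(4)[OF 4(2) 4(3), of "snd x"]
    by (cases x) (simp add: additive_on_def cr_prd ac_prd)
next
  case (5 X x) then show ?case by (auto simp: cr_prd ac_prd mdD(5))
next
  case (6 Y X Z t u a b x) then show ?case
    using mdD(6)[OF 6(1) 6(3-6), of "fst x"] mdD(6)[OF 6(2) 6(3-6), of "snd x"]
    by (cases x) (simp add: cr_prd ac_prd)
qed

lemma mhom_fst: "mhom (prd M N) M (\<lambda>X. fst)" and mhom_snd: "mhom (prd M N) N (\<lambda>X. snd)"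
  by (auto simp: phom_def cr_prd ac_prd additive_on_def)

lemma mhom_pair: "mhom L M f \<Longrightarrow> mhom L N g \<Longrightarrow> mhom L (prd M N) (\<lambda>X x. (f X x, g X x))"
  by (auto simp: phom_def cr_prd ac_prd additive_on_def)

text \<open>The two inclusions lift separately to the cover of the product, and the sum of the lifts
  is a splitting.\<close>

lemma proj_prd:
  assumes "proj M" "proj N"
  shows "proj (prd M N)"
proof -
  let ?P = "prd M N"
  note M = proj_md[OF assms(1)] and N = proj_md[OF assms(2)]
  note P = md_prd[OF M N]
  have f: "mhom M ?P (\<lambda>X x. (x, 0))" by (rule mhom_pair[OF mhom_id mhom_zero[OF N]])
  have g: "mhom N ?P (\<lambda>X x. (0, x))" by (rule mhom_pair[OF mhom_zero[OF M] mhom_id])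
  obtain f' where f': "mhom M (cov ?P) f'" "\<And>X x. Ob X \<Longrightarrow> x \<in> cr M X \<Longrightarrow> ev ?P snd (f' X x) = (x, 0)"
    using proj_lift[OF assms(1) md_cov P f ev_cov[OF P] cov_surj[OF P]] mhomD(1)[OF f] by blast
  obtain g' where g': "mhom N (cov ?P) g'" "\<And>X x. Ob X \<Longrightarrow> x \<in> cr N X \<Longrightarrow> ev ?P snd (g' X x) = (0, x)"
    using proj_lift[OF assms(2) md_cov P g ev_cov[OF P] cov_surj[OF P]] mhomD(1)[OF g] by blast
  have s: "mhom ?P (cov ?P) (\<lambda>X z. f' X (fst z) + g' X (snd z))"
    by (rule mhom_add[OF mhom_comp[OF mhom_fst f'(1)] mhom_comp[OF mhom_snd g'(1)] md_cov])
  have "ev ?P snd (f' X (fst z) + g' X (snd z)) = z" if "Ob X" "z \<in> cr ?P X" for X z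
    using that f' g' mhomD(1)[OF f'(1)] mhomD(1)[OF g'(1)] mhom_simps(2)[OF ev_cov[OF P] md_cov that(1)]
    by (cases z) (auto simp: cr_prd)
  then show ?thesis unfolding proj_def using P s by blast
qed

definition indmap :: "('x \<Rightarrow> 'm \<Rightarrow> 'n) \<Rightarrow> (('e \<times> 't) \<Rightarrow>\<^sub>0 'm::ab_group_add) \<Rightarrow> ('e \<times> 't) \<Rightarrow>\<^sub>0 'n::ab_group_add" where
  "indmap f = lin (\<lambda>(e, t) x. Poly_Mapping.single (e, t) (f (cok t) x))"

lemma indmap_mhom:
  assumes M: "md M" and N: "md N" and f: "mhom M N f"
  shows "mhom (ind E ob M) (ind E ob N) (\<lambda>X. indmap f)"
  unfolding indmap_def
proof (rule lin_mhom[OF M ind_md[OF N]]; unfold prod.case)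
  fix e t X assume et: "(e, t) \<in> terms E ob X"
  note t = termsD(2)[OF et]
  show "Poly_Mapping.single (e, t) (f (cok t) y) \<in> cr (ind E ob N) X" if "y \<in> cr M (cok t)" for y
    by (rule single_ind[OF N et mhomD(1)[OF f hom_ob(3)[OF t] that]])
  show "additive_on (cr M (cok t)) (\<lambda>x. Poly_Mapping.single (e, t) (f (cok t) x))"
    using mhomD(2)[OF f hom_ob(3)[OF t]] by (simp add: additive_on_def single_add)
  show "Poly_Mapping.single (e, cmp u t) (f (cok (cmp u t)) (ac M (push u t) b y)) =
      ac (ind E ob N) u b (Poly_Mapping.single (e, t) (f (cok t) y))"
    if "u \<in> Hom X Z" "b \<in> cr A (cok u)" "y \<in> cr M (cok t)" for u Z b y
    by (simp add: ac_ind_single[OF N t that(1,2)] mhomD(3)[OF f push[OF t that(1)] _ that(3)]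
        cok_push[OF t that(1)] that(2))
qed

lemma indmap_single:
  assumes "md M" "mhom M N f" "t \<in> Hom Y X"
  shows "indmap f (Poly_Mapping.single (e, t) x) = Poly_Mapping.single (e, t) (f (cok t) x)"
  unfolding indmap_def
  by (subst lin_single) (simp_all add: mhom_simps(1)[OF assms(2,1) hom_ob(3)[OF assms(3)]])

lemma lookup_ind: "md M \<Longrightarrow> p \<in> cr (ind E ob M) X \<Longrightarrow> k \<in> terms E ob X \<Longrightarrow>
    Poly_Mapping.lookup p k \<in> cr M (cok (snd k))"
  by (simp add: cr_ind dsum_def)

lemma lookup_ind_0: "p \<in> cr (ind E ob M) X \<Longrightarrow> k \<notin> terms E ob X \<Longrightarrow> Poly_Mapping.lookup p k = 0"
  by (auto simp: cr_ind dsum_def in_keys_iff)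

lemma lookup_indmap:
  assumes M: "md M" and f: "mhom M N f" and p: "p \<in> cr (ind E ob M) X" and k: "k \<in> terms E ob X"
  shows "Poly_Mapping.lookup (indmap f p) k = f (cok (snd k)) (Poly_Mapping.lookup p k)"
proof -
  let ?g = "\<lambda>(e, t) x. Poly_Mapping.single (e, t) (f (cok t) x)"
  have 0: "?g i 0 = 0" if "i \<in> terms E ob X" for i
    using that mhom_simps(1)[OF f M hom_ob(3)] by (auto simp: terms_def)
  have sub: "Poly_Mapping.keys p \<subseteq> terms E ob X" using p by (auto simp: cr_ind dsum_def)
  have "indmap f p = (\<Sum>i\<in>insert k (Poly_Mapping.keys p). ?g i (Poly_Mapping.lookup p i))"
    unfolding indmap_def by (rule lin_superset) (use 0 k sub in auto)
  moreover have "Poly_Mapping.lookup (?g i (Poly_Mapping.lookup p i)) k =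
      (if i = k then f (cok (snd k)) (Poly_Mapping.lookup p k) else 0)" for i
    by (cases i) (auto simp: lookup_single when_def)
  ultimately show ?thesis by (simp add: lookup_sum)
qed

text \<open>By \<open>pair\<close>, a term t of the outer module together with a term s over its
  complement is one injection out of the direct sum of the two source objects. The module is
  therefore free on pairs of generators, and the splitting sends each such pair to the element that
  has coefficient 1 at the universal pair.\<close>

lemma proj_ind_ind_A: "proj (ind E ob (ind E' ob' A))"
proof -
  let ?I = "ind E' ob' A" let ?J = "ind E ob ?I"
  note I = ind_md[OF A_md, of E' ob']
  note J = ind_md[OF I, of E ob]
  \<comment> \<open>\<open>good\<close> says that (t0, s0) is a universal pair; one is fixed for
    every Y and W, so that the generators depend on the objects and not on the term at hand.\<close>
  define good where "good Y W X0 t0 s0 \<longleftrightarrow> t0 \<in> Hom Y X0 \<and> s0 \<in> Hom W (cok t0) \<and> cok s0 = zr \<and>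
        (\<forall>X t s. t \<in> Hom Y X \<and> s \<in> Hom W (cok t) \<longrightarrow>
           (\<exists>!u. u \<in> Hom X0 X \<and> cmp u t0 = t \<and> cmp (push u t0) s0 = s)) \<and>
        (\<forall>X u. u \<in> Hom X0 X \<longrightarrow> cok (cmp (push u t0) s0) = cok u)" for Y W X0 t0 s0
  define z where "z Y W = (SOME z. good Y W (fst z) (fst (snd z)) (snd (snd z)))" for Y W
  define X0 t0 s0 where "X0 = (\<lambda>Y W. fst (z Y W))" and "t0 = (\<lambda>Y W. fst (snd (z Y W)))"
    and "s0 = (\<lambda>Y W. snd (snd (z Y W)))"
  have good: "good Y W (X0 Y W) (t0 Y W) (s0 Y W)" if ts: "t \<in> Hom Y X" "s \<in> Hom W (cok t)" for Y W X t s
  proof -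
    obtain x y w where "good Y W x y w" using pair[OF ts] unfolding good_def[symmetric] by (elim exE)
    then have "good Y W (fst (x, y, w)) (fst (snd (x, y, w))) (snd (snd (x, y, w)))" by simp
    then show ?thesis unfolding X0_def t0_def s0_def z_def by (rule someI)
  qed
  \<comment> \<open>The injection classifying the pair (t, s). The target X is not an argument: it
    is recovered from t, since a morphism determines its codomain by \<open>hom_cod\<close>.\<close>
  define u where "u Y W t s = (THE v. (\<exists>X. v \<in> Hom (X0 Y W) X \<and> t \<in> Hom Y X) \<and> cmp v (t0 Y W) = t \<and>
     cmp (push v (t0 Y W)) (s0 Y W) = s)" for Y W t s
  define X' t' s' u' where "X' = (\<lambda>e e'. X0 (ob e) (ob' e'))" and "t' = (\<lambda>e e'. t0 (ob e) (ob' e'))"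
    and "s' = (\<lambda>e e'. s0 (ob e) (ob' e'))" and "u' = (\<lambda>e e'. u (ob e) (ob' e'))"
  have main: "t' e e' \<in> Hom (ob e) (X' e e') \<and> s' e e' \<in> Hom (ob' e') (cok (t' e e')) \<and> cok (s' e e') = zr \<and>
      u' e e' t s \<in> Hom (X' e e') X \<and> cmp (u' e e' t s) (t' e e') = t \<and>
      cmp (push (u' e e' t s) (t' e e')) (s' e e') = s \<and> cok (u' e e' t s) = cok s \<and>
      (\<forall>v. v \<in> Hom (X' e e') X \<longrightarrow> cmp v (t' e e') = t \<longrightarrow> cmp (push v (t' e e')) (s' e e') = s \<longrightarrow> v = u' e e' t s)"
    if t: "t \<in> Hom (ob e) X" and s: "s \<in> Hom (ob' e') (cok t)" for e e' t s X
  proof -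
    let ?Y = "ob e" and ?W = "ob' e'"
    have g: "good ?Y ?W (X' e e') (t' e e') (s' e e')" unfolding X'_def t'_def s'_def by (rule good[OF t s])
    note g' = g[unfolded good_def]
    have "\<exists>!v. v \<in> Hom (X' e e') X \<and> cmp v (t' e e') = t \<and> cmp (push v (t' e e')) (s' e e') = s"
      using g'[THEN conjunct2, THEN conjunct2, THEN conjunct2, THEN conjunct1] t s by (elim allE impE) (rule conjI)
    then obtain v where v: "v \<in> Hom (X' e e') X" "cmp v (t' e e') = t" "cmp (push v (t' e e')) (s' e e') = s"
      and uni: "\<And>w. w \<in> Hom (X' e e') X \<Longrightarrow> cmp w (t' e e') = t \<Longrightarrow> cmp (push w (t' e e')) (s' e e') = s \<Longrightarrow> w = v"
      by blast
    have uv: "u' e e' t s = v" unfolding u'_def u_def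
    proof (rule the_equality)
      show "(\<exists>X. v \<in> Hom (X0 ?Y ?W) X \<and> t \<in> Hom ?Y X) \<and> cmp v (t0 ?Y ?W) = t \<and>
          cmp (push v (t0 ?Y ?W)) (s0 ?Y ?W) = s"
        using v[unfolded X'_def t'_def s'_def] t by blast
      fix w assume w: "(\<exists>X. w \<in> Hom (X0 ?Y ?W) X \<and> t \<in> Hom ?Y X) \<and> cmp w (t0 ?Y ?W) = t \<and>
          cmp (push w (t0 ?Y ?W)) (s0 ?Y ?W) = s"
      then have "w \<in> Hom (X0 ?Y ?W) X" using hom_cod[OF t] by blast
      then show "w = v" using w uni[unfolded X'_def t'_def s'_def] by blast
    qed
    have "cok (cmp (push v (t' e e')) (s' e e')) = cok v"
      using g'[THEN conjunct2, THEN conjunct2, THEN conjunct2, THEN conjunct2] v(1) by (elim allE impE)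
    then have c: "cok v = cok s" unfolding v(3) by (rule sym)
    show ?thesis unfolding uv
      by (intro conjI allI impI v c g'[THEN conjunct1] g'[THEN conjunct2, THEN conjunct1]
          g'[THEN conjunct2, THEN conjunct2, THEN conjunct1] uni) assumption+
  qed
  define G where "G e e' = Poly_Mapping.single (e, t' e e') (Poly_Mapping.single (e', s' e e') un)" for e e'
  define g where "g e e' = (X' e e', G e e')" for e e'
  \<comment> \<open>The candidate splitting on the outer component (e, t): the inner term (e', s)
    with coefficient a becomes the generator of the pair, moved by its classifying injection, with
    the same coefficient.\<close>
  define k where "k e t = (\<lambda>(e', s) a. Poly_Mapping.single (g e e', u' e e' t s) (a::'a))" for e t
  define m where "m = (\<lambda>(e, t). lin (k e t))"
  have G: "G e e' \<in> cr ?J (X' e e')"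
    if "(e, t) \<in> terms E ob X" "(e', s) \<in> terms E' ob' (cok t)" for e t X e' s
    using main[OF termsD(2)[OF that(1)] termsD(2)[OF that(2)]] that unfolding G_def
    by (intro single_ind[OF I] single_ind[OF A_md]) (auto simp: terms_def un)
  have gu: "(g e e', u' e e' t s) \<in> terms (elts ?J) fst X"
    if "(e, t) \<in> terms E ob X" "(e', s) \<in> terms E' ob' (cok t)" for e t X e' s
    using main[OF termsD(2)[OF that(1)] termsD(2)[OF that(2)]] G[OF that]
    by (auto simp: g_def terms_def elts_def dest: hom_ob)
  have k_single: "lin (k e t) (Poly_Mapping.single (e', s) a) = Poly_Mapping.single (g e e', u' e e' t s) a"
    for e t e' s a
    using lin_single[of "k e t" "(e', s)" a] by (simp add: k_def)
  have k_additive: "additive_on (cr ?I X) (lin (k e t))" for e t X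
    by (rule lin_mhom_aux[OF A_md]) (simp add: k_def additive_on_def single_add)
  have s_hom: "mhom ?J (cov ?J) (\<lambda>X. lin m)"
  proof (rule lin_mhom[OF I md_cov])
    fix e t X y assume et: "(e, t) \<in> terms E ob X" and y: "y \<in> cr ?I (cok t)"
    note t = termsD(2)[OF et]
    show "m (e, t) y \<in> cr (cov ?J) X" unfolding m_def prod.case
    proof (rule lin_in_sgrp[OF y[unfolded cr_ind] _ mdD(1)[OF md_cov hom_ob(2)[OF t]]])
      fix i a assume i: "i \<in> terms E' ob' (cok t)" "a \<in> cr A (cok (snd i))"
      obtain e' s where ies: "i = (e', s)" by fastforce
      show "k e t i a \<in> cr (cov ?J) X"
        unfolding cov_def ies k_def prod.case
        by (rule single_ind[OF A_md gu[OF et i(1)[unfolded ies]]])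
          (use main[OF t termsD(2)[OF i(1)[unfolded ies]]] i ies in auto)
    qed
  next
    fix e t X assume et: "(e, t) \<in> terms E ob X"
    show "additive_on (cr ?I (cok t)) (m (e, t))" by (simp add: m_def k_additive)
  next
    fix e t X Z v b y assume et: "(e, t) \<in> terms E ob X" and v: "v \<in> Hom X Z" and b: "b \<in> cr A (cok v)"
      and y: "y \<in> cr ?I (cok t)"
    note t = termsD(2)[OF et]
    note p = push[OF t v] and cp = cok_push[OF t v]
    have b': "b \<in> cr A (cok (push v t))" using b cp by simp
    have "lin (k e (cmp v t)) (ac ?I (push v t) b y) = ac (cov ?J) v b (lin (k e t) y)"
    proof (rule ind_eqI[OF A_md y])
      show "additive_on (cr ?I (cok t)) (\<lambda>y. lin (k e (cmp v t)) (ac ?I (push v t) b y))"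
        by (rule additive_on_comp[OF additive_ac_ind[OF A_md p b'] k_additive[of "cok (cmp v t)"]])
          (rule ac_ind_closed[OF A_md p b'])
      have kin: "lin (k e t) y \<in> cr (cov ?J) X" if "y \<in> cr ?I (cok t)" for y
      proof (rule lin_in_sgrp[OF that[unfolded cr_ind] _ mdD(1)[OF md_cov hom_ob(2)[OF t]]])
        fix i a assume i: "i \<in> terms E' ob' (cok t)" "a \<in> cr A (cok (snd i))"
        obtain e' s where ies: "i = (e', s)" by fastforce
        show "k e t i a \<in> cr (cov ?J) X"
          unfolding cov_def ies k_def prod.case
          by (rule single_ind[OF A_md gu[OF et i(1)[unfolded ies]]])
            (use main[OF t termsD(2)[OF i(1)[unfolded ies]]] i ies in auto)
      qed
      show "additive_on (cr ?I (cok t)) (\<lambda>y. ac (cov ?J) v b (lin (k e t) y))"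
        by (rule additive_on_comp[OF k_additive mdD(3)[OF md_cov v b]]) (rule kin)
      fix e' s a assume es: "(e', s) \<in> terms E' ob' (cok t)" and a: "a \<in> cr A (cok s)"
      note s = termsD(2)[OF es]
      note M = main[OF t s]
      let ?t0 = "t' e e'" and ?s0 = "s' e e'" and ?u = "u' e e' t s"
      have t0: "?t0 \<in> Hom (ob e) (X' e e')" and s0: "?s0 \<in> Hom (ob' e') (cok ?t0)" and cs0: "cok ?s0 = zr"
        and u: "?u \<in> Hom (X' e e') X" and ut: "cmp ?u ?t0 = t" and us: "cmp (push ?u ?t0) ?s0 = s"
        and cu: "cok ?u = cok s" using M by blast+
      have pu: "push ?u ?t0 \<in> Hom (cok ?t0) (cok t)" using push[OF t0 u] ut by simp
      have vt: "cmp v t \<in> Hom (ob e) Z" and ps: "cmp (push v t) s \<in> Hom (ob' e') (cok (cmp v t))"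
        using cmp[OF t v] cmp[OF s p] by auto
      have vu: "cmp v ?u \<in> Hom (X' e e') Z" by (rule cmp[OF u v])
      have pp: "push (push v t) (push ?u ?t0) = push v ?u" using push_push[OF t0 u v] ut by simp
      \<comment> \<open>Uniqueness in the universal property: the composite classifies the pair
        moved along v.\<close>
      have "cmp v ?u = u' e e' (cmp v t) (cmp (push v t) s)"
      proof -
        have "cmp (cmp v ?u) ?t0 = cmp v t" using cmp_assoc[OF t0 u v] ut by simp
        moreover have "cmp (push (cmp v ?u) ?t0) ?s0 = cmp (push v t) s"
          using push_cmp[OF t0 u v] cmp_assoc[OF s0 pu p] us ut by simp
        ultimately show ?thesis using main[OF vt ps] vu by blast
      qed
      \<comment> \<open>The products of b and a along two different pushes have to agree, while
        associativity only compares actions on an element. Writing a as a product with the unit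
        supplies that element; the unit law removes it at the end.\<close>
      moreover have "ac A (push (push v t) s) b a = ac A (push v ?u) b a"
      proof -
        let ?r = "push (push ?u ?t0) ?s0" and ?q = "push (push v t) s"
        have a': "a = ac A ?r a un"
          using unit_r[OF s0 cs0 pu] cok_push[OF t0 u] cu a by simp
        have r: "?r \<in> Hom zr (cok s)" using push[OF s0 pu] us cs0 by simp
        have cr: "cok ?r = cok s" using cok_push[OF s0 pu] cok_push[OF t0 u] cu by simp
        have q: "?q \<in> Hom (cok s) (cok (cmp (push v t) s))" by (rule push[OF s p])
        have cq: "cok ?q = cok v" using cok_push[OF s p] cp by simp
        have "ac A ?q b (ac A ?r a un) = ac A (cmp ?q ?r) (ac A (push ?q ?r) b a) un"
          using mdD(6)[OF A_md r q _ _ un] cr cq a b by simp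
        also have "push ?q ?r = push v ?u"
          using push_push[OF s0 pu p] us pp by simp
        also have "cmp ?q ?r = push (cmp (push v t) (push ?u ?t0)) ?s0"
          using push_cmp[OF s0 pu p] us by simp
        also have "ac A (push (cmp (push v t) (push ?u ?t0)) ?s0) (ac A (push v ?u) b a) un = ac A (push v ?u) b a"
        proof (rule unit_r[OF s0 cs0 cmp[OF pu p]])
          have "push (cmp v ?u) ?t0 = cmp (push v t) (push ?u ?t0)" using push_cmp[OF t0 u v] ut by simp
          then have c: "cok (cmp (push v t) (push ?u ?t0)) = cok (cmp v ?u)" using cok_push[OF t0 vu] by simp
          show "ac A (push v ?u) b a \<in> cr A (cok (cmp (push v t) (push ?u ?t0)))"
            unfolding c by (rule mdD(2)[OF A_md push[OF u v]]) (use a b cu cok_push[OF u v] in auto)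
        qed
        finally show ?thesis using a' by simp
      qed
      ultimately show "lin (k e (cmp v t)) (ac ?I (push v t) b (Poly_Mapping.single (e', s) a)) =
          ac (cov ?J) v b (lin (k e t) (Poly_Mapping.single (e', s) a))"
        by (simp add: ac_ind_single[OF A_md s p b'] k_single cov_def ac_ind_single[OF A_md u v b])
    qed
    then show "m (e, cmp v t) (ac ?I (push v t) b y) = ac (cov ?J) v b (m (e, t) y)"
      by (simp add: m_def)
  qed
  have "ev ?J snd (lin m p) = p" if X: "Ob X" and p: "p \<in> cr ?J X" for X p
  proof (rule mhom_ind_eqI[OF I mhom_comp[OF s_hom ev_cov[OF J]] mhom_id X p])
    fix e t x assume et: "(e, t) \<in> terms E ob X" and x: "x \<in> cr ?I (cok t)"
    note t = termsD(2)[OF et]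
    have mx: "lin m (Poly_Mapping.single (e, t) y) = lin (k e t) y" for y
      using lin_ind_single[where m = m and e = e, OF I t] by (simp add: m_def k_additive)
    have "ev ?J snd (lin m (Poly_Mapping.single (e, t) x)) = Poly_Mapping.single (e, t) x"
    proof (rule ind_eqI[OF A_md x])
      show "additive_on (cr ?I (cok t)) (\<lambda>x. ev ?J snd (lin m (Poly_Mapping.single (e, t) x)))"
        by (rule additive_on_comp[OF additive_on_single mhomD(2)[OF mhom_comp[OF s_hom ev_cov[OF J]] X]])
          (rule single_ind[OF I et])
      show "additive_on (cr ?I (cok t)) (Poly_Mapping.single (e, t))" by (rule additive_on_single)
      fix e' s a assume es: "(e', s) \<in> terms E' ob' (cok t)" and a: "a \<in> cr A (cok s)"
      note s = termsD(2)[OF es]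
      note M = main[OF t s]
      let ?t0 = "t' e e'" and ?s0 = "s' e e'" and ?u = "u' e e' t s"
      have t0: "?t0 \<in> Hom (ob e) (X' e e')" and s0: "?s0 \<in> Hom (ob' e') (cok ?t0)" and cs0: "cok ?s0 = zr"
        and u: "?u \<in> Hom (X' e e') X" and ut: "cmp ?u ?t0 = t" and us: "cmp (push ?u ?t0) ?s0 = s"
        and cu: "cok ?u = cok s" using M by blast+
      have pu: "push ?u ?t0 \<in> Hom (cok ?t0) (cok t)" using push[OF t0 u] ut by simp
      have a': "a \<in> cr A (cok ?u)" "a \<in> cr A (cok (push ?u ?t0))" using a cu cok_push[OF t0 u] by auto
      have "ev ?J snd (lin m (Poly_Mapping.single (e, t) (Poly_Mapping.single (e', s) a))) =
          ac ?J ?u a (G e e')"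
        using ev_single[OF J u, of snd "g e e'" a] G[OF et es] by (simp add: mx k_single g_def)
      also have "\<dots> = Poly_Mapping.single (e, t) (Poly_Mapping.single (e', s) a)"
        using unit_r[OF s0 cs0 pu a'(2)]
        by (simp add: G_def ac_ind_single[OF I t0 u a'(1)] ac_ind_single[OF A_md s0 pu a'(2)] ut us)
      finally show "ev ?J snd (lin m (Poly_Mapping.single (e, t) (Poly_Mapping.single (e', s) a))) =
          Poly_Mapping.single (e, t) (Poly_Mapping.single (e', s) a)" .
    qed
    then show "ev ?J snd (lin m (Poly_Mapping.single (e, t) x)) = Poly_Mapping.single (e, t) x" .
  qed
  then show ?thesis unfolding proj_def using J s_hom by blast
qed

text \<open>P is a retract of its free cover, and induction preserves retracts, so the case of a
  free module suffices.\<close>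

lemma proj_ind:
  assumes "proj P"
  shows "proj (ind E ob P)"
proof -
  note P = proj_md[OF assms]
  obtain s where s: "mhom P (cov P) s" "\<And>X x. Ob X \<Longrightarrow> x \<in> cr P X \<Longrightarrow> ev P snd (s X x) = x"
    using assms unfolding proj_def by blast
  have c: "proj (ind E ob (cov P))" unfolding cov_def by (rule proj_ind_ind_A)
  show ?thesis
  proof (rule proj_retract[OF c ind_md[OF P] indmap_mhom[OF P md_cov s(1)]
        indmap_mhom[OF md_cov P ev_cov[OF P]]])
    fix X x assume X: "Ob X" and x: "x \<in> cr (ind E ob P) X"
    note h1 = indmap_mhom[OF P md_cov s(1), of E ob] and h2 = indmap_mhom[OF md_cov P ev_cov[OF P], of E ob]
    show "indmap (\<lambda>X. ev P snd) (indmap s x) = x"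
    proof (rule mhom_ind_eqI[OF P mhom_comp[OF h1 h2] mhom_id X x])
      fix e t y assume et: "(e, t) \<in> terms E ob X" and y: "y \<in> cr P (cok t)"
      note t = termsD(2)[OF et]
      show "indmap (\<lambda>X. ev P snd) (indmap s (Poly_Mapping.single (e, t) y)) = Poly_Mapping.single (e, t) y"
        by (simp add: indmap_single[OF P s(1) t] indmap_single[OF md_cov ev_cov[OF P] t]
            s(2)[OF hom_ob(3)[OF t] y])
    qed
  qed
qed

section \<open>The submodule generated by the augmentation ideal\<close>

text \<open>The quotient of M by \<open>Pos M\<close> is \<open>k \<otimes>_A M\<close>. Working
  with membership in \<open>Pos M\<close> replaces that quotient throughout the abstract
  part.\<close>

inductive_set Pos :: "('x, 't, 'a, 'n::ab_group_add) md \<Rightarrow> 'x \<Rightarrow> 'n set"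
  for M :: "('x, 't, 'a, 'n::ab_group_add) md" and X where
  zero: "0 \<in> Pos M X"
| step: "t \<in> Hom Y X \<Longrightarrow> a \<in> Ap (cok t) \<Longrightarrow> x \<in> cr M Y \<Longrightarrow> y \<in> Pos M X \<Longrightarrow> ac M t a x + y \<in> Pos M X"

lemma Pos_in: "y \<in> Pos M X \<Longrightarrow> md M \<Longrightarrow> Ob X \<Longrightarrow> y \<in> cr M X"
proof (induction rule: Pos.induct)
  case zero
  then show ?case by (simp add: md_sgrp)
next
  case (step t Y a x y)
  show ?case
    by (rule md_sgrp(4)[OF step.prems mdD(2)[OF step.prems(1) step(1) Ap[OF hom_ob(3)[OF step(1)] step(2)] step(3)]
          step.IH[OF step.prems]])
qed

lemma Pos_add: "y \<in> Pos M X \<Longrightarrow> z \<in> Pos M X \<Longrightarrow> y + z \<in> Pos M X"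
  by (induction rule: Pos.induct) (simp_all add: add.assoc Pos.step)

lemma Pos_ac: "t \<in> Hom Y X \<Longrightarrow> a \<in> Ap (cok t) \<Longrightarrow> x \<in> cr M Y \<Longrightarrow> ac M t a x \<in> Pos M X"
  by (drule (2) Pos.step[OF _ _ _ Pos.zero]) simp

lemma Pos_uminus: "y \<in> Pos M X \<Longrightarrow> md M \<Longrightarrow> - y \<in> Pos M X"
proof (induction rule: Pos.induct)
  case (step t Y a x y)
  have "ac M t a (- x) + - y \<in> Pos M X"
    using step md_sgrp(3)[OF step.prems hom_ob(1)[OF step(1)]] by (intro Pos.step) auto
  then show ?case
    using md_ac_simps(3)[OF step.prems step(1) Ap[OF hom_ob(3)[OF step(1)] step(2)] step(3)] by simp
qed (simp add: Pos.zero)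

lemma Pos_diff: "y \<in> Pos M X \<Longrightarrow> z \<in> Pos M X \<Longrightarrow> md M \<Longrightarrow> y - z \<in> Pos M X"
  using Pos_add[OF _ Pos_uminus, of y M X z] by simp

lemma Pos_hom:
  assumes "y \<in> Pos M X" "mhom M N f" "md M" "Ob X"
  shows "f X y \<in> Pos N X"
  using assms(1)
proof (induction rule: Pos.induct)
  case zero
  then show ?case using mhom_simps(1)[OF assms(2-4)] by (simp add: Pos.zero)
next
  case (step t Y a x y)
  note a = Ap[OF hom_ob(3)[OF step(1)] step(2)]
  have "f X (ac M t a x + y) = ac N t a (f Y x) + f X y"
    using mhom_simps(2)[OF assms(2-4) mdD(2)[OF assms(3) step(1) a step(3)] Pos_in[OF step(4) assms(3,4)]]
      mhomD(3)[OF assms(2) step(1) a step(3)] by simp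
  then show ?case
    using Pos.step[OF step(1,2) mhomD(1)[OF assms(2) hom_ob(1)[OF step(1)] step(3)] step.IH] by simp
qed

lemma Pos_sum: "(\<And>i. i \<in> I \<Longrightarrow> f i \<in> Pos M X) \<Longrightarrow> sum f I \<in> Pos M X"
  by (induction I rule: infinite_finite_induct) (auto intro: Pos_add Pos.zero)

text \<open>A product a v(x) inside the component (e, t) is also a product in the induced module: by
  \<open>pair\<close> the term t factors through the direct sum of its source with the source of v,
  and a acts along the factoring map, whose complement is that of v.\<close>

lemma single_Pos:
  assumes M: "md M" and et: "(e, t) \<in> terms E ob X" and x: "x \<in> Pos M (cok t)"
  shows "Poly_Mapping.single (e, t) x \<in> Pos (ind E ob M) X"
  using x
proof (induction rule: Pos.induct)
  case zero
  then show ?case by (simp add: Pos.zero)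
next
  case (step v V a x y)
  note t = termsD(2)[OF et]
  obtain X0 t0 s0 u where t0: "t0 \<in> Hom (ob e) X0" and s0: "s0 \<in> Hom V (cok t0)" and cs0: "cok s0 = zr"
    and u: "u \<in> Hom X0 X" and ut: "cmp u t0 = t" and us: "cmp (push u t0) s0 = v" and cu: "cok v = cok u"
    using pair[OF t step(1)] t step(1) by metis
  have pu: "push u t0 \<in> Hom (cok t0) (cok t)" using push[OF t0 u] ut by simp
  have a: "a \<in> Ap (cok u)" "a \<in> cr A (cok u)" "a \<in> cr A (cok (push u t0))"
    using step(2) cu Ap[OF hom_ob(3)[OF u]] cok_push[OF t0 u] by auto
  have e: "e \<in> E" using et by (simp add: terms_def)
  have un0: "un \<in> cr A (cok s0)" using un cs0 by simp
  define z where "z = Poly_Mapping.single (e, t0) (ac M s0 un x)"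
  have z: "z \<in> cr (ind E ob M) X0"
    unfolding z_def using mdD(2)[OF M s0 un0 step(3)] t0 e by (intro single_ind[OF M]) (simp_all add: terms_def)
  have "ac M (push u t0) a (ac M s0 un x) = ac M v a x"
    using mdD(6)[OF M s0 pu un0 a(3) step(3)] unit_r[OF s0 cs0 pu a(3)] us by simp
  then have "ac (ind E ob M) u a z = Poly_Mapping.single (e, t) (ac M v a x)"
    unfolding z_def by (simp add: ac_ind_single[OF M t0 u a(2)] ut)
  then show ?case using Pos.step[OF u a(1) z step.IH] by (simp add: single_add)
qed

text \<open>Reduction modulo the ideal is computed in each component. One inclusion is
  \<open>single_Pos\<close>; the other holds because pushing a term along v leaves the coefficient a
  over the same complement.\<close>

lemma Pos_ind:
  assumes M: "md M" and p: "p \<in> cr (ind E ob M) X"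
  shows "p \<in> Pos (ind E ob M) X \<longleftrightarrow> (\<forall>k\<in>terms E ob X. Poly_Mapping.lookup p k \<in> Pos M (cok (snd k)))"
proof
  assume "\<forall>k\<in>terms E ob X. Poly_Mapping.lookup p k \<in> Pos M (cok (snd k))"
  then have "Poly_Mapping.single k (Poly_Mapping.lookup p k) \<in> Pos (ind E ob M) X"
    if "k \<in> Poly_Mapping.keys p" for k
    using p that single_Pos[OF M, of "fst k" "snd k" E ob X] by (auto simp: cr_ind dsum_def)
  then have "(\<Sum>k\<in>Poly_Mapping.keys p. Poly_Mapping.single k (Poly_Mapping.lookup p k)) \<in> Pos (ind E ob M) X"
    by (rule Pos_sum)
  moreover have "(\<Sum>k\<in>Poly_Mapping.keys p. Poly_Mapping.single k (Poly_Mapping.lookup p k)) = p"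
    by (rule poly_mapping_eqI)
      (auto simp: lookup_sum lookup_single when_def in_keys_iff if_distrib cong: if_cong)
  ultimately show "p \<in> Pos (ind E ob M) X" by simp
next
  assume "p \<in> Pos (ind E ob M) X"
  then show "\<forall>k\<in>terms E ob X. Poly_Mapping.lookup p k \<in> Pos M (cok (snd k))"
  proof (induction rule: Pos.induct)
    case zero
    then show ?case by (simp add: Pos.zero)
  next
    case (step v V a q y)
    note b = Ap[OF hom_ob(3)[OF step(1)] step(2)]
    have "Poly_Mapping.lookup (ac (ind E ob M) v a q) k \<in> Pos M (cok (snd k))" if k: "k \<in> terms E ob X" for k
      unfolding ac_ind lin_def lookup_sum
    proof (rule Pos_sum)
      fix i assume i: "i \<in> Poly_Mapping.keys q"
      obtain e t where ies: "i = (e, t)" by fastforce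
      have et: "(e, t) \<in> terms E ob V" using i step(3) by (auto simp: ies cr_ind dsum_def)
      note t = termsD(2)[OF et]
      have "ac M (push v t) a (Poly_Mapping.lookup q (e, t)) \<in> Pos M (cok (cmp v t))"
        by (rule Pos_ac[OF push[OF t step(1)]])
          (use step(2) cok_push[OF t step(1)] lookup_ind[OF M step(3) et] in auto)
      then show "Poly_Mapping.lookup (push_single M v a i (Poly_Mapping.lookup q i)) k \<in> Pos M (cok (snd k))"
        by (auto simp: push_single_def ies lookup_single when_def Pos.zero)
    qed
    then show ?case using step.IH by (auto simp: lookup_add intro: Pos_add)
  qed
qed

end

section \<open>Complexes, comparison of resolutions and vanishing of Tor\<close>

context gring
begin

text \<open>The differential \<open>D n\<close> starts at \<open>P n\<close>, and \<open>D 0\<close>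
  is the zero endomorphism of \<open>P 0\<close>. With this convention cycles in degree 0 need no
  separate definition.\<close>

definition cpx :: "(nat \<Rightarrow> ('x, 't, 'a, 'p::ab_group_add) md) \<Rightarrow> (nat \<Rightarrow> 'x \<Rightarrow> 'p \<Rightarrow> 'p) \<Rightarrow> bool" where
  "cpx P D \<longleftrightarrow> (\<forall>n. md (P n)) \<and> (\<forall>n. mhom (P n) (P (n - 1)) (D n)) \<and> D 0 = (\<lambda>X x. 0) \<and>
     (\<forall>n X x. Ob X \<longrightarrow> x \<in> cr (P (Suc n)) X \<longrightarrow> D n X (D (Suc n) X x) = 0)"

definition acpx :: "('x, 't, 'a, 'n::ab_group_add) md \<Rightarrow> (nat \<Rightarrow> ('x, 't, 'a, 'p::ab_group_add) md) \<Rightarrow>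
    (nat \<Rightarrow> 'x \<Rightarrow> 'p \<Rightarrow> 'p) \<Rightarrow> ('x \<Rightarrow> 'p \<Rightarrow> 'n) \<Rightarrow> bool" where
  "acpx N P D \<eta> \<longleftrightarrow> cpx P D \<and> md N \<and> mhom (P 0) N \<eta> \<and>
     (\<forall>X x. Ob X \<longrightarrow> x \<in> cr (P 1) X \<longrightarrow> \<eta> X (D 1 X x) = 0)"

text \<open>Exactness without projectivity is kept as a notion of its own: a resolution over B stays
  exact over A, but its terms are in general no longer projective there.\<close>

definition resn :: "('x, 't, 'a, 'n::ab_group_add) md \<Rightarrow> (nat \<Rightarrow> ('x, 't, 'a, 'p::ab_group_add) md) \<Rightarrow>
    (nat \<Rightarrow> 'x \<Rightarrow> 'p \<Rightarrow> 'p) \<Rightarrow> ('x \<Rightarrow> 'p \<Rightarrow> 'n) \<Rightarrow> bool" where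
  "resn N P D \<eta> \<longleftrightarrow> acpx N P D \<eta> \<and>
     (\<forall>X z. Ob X \<longrightarrow> z \<in> cr N X \<longrightarrow> (\<exists>x\<in>cr (P 0) X. \<eta> X x = z)) \<and>
     (\<forall>X x. Ob X \<longrightarrow> x \<in> cr (P 0) X \<longrightarrow> \<eta> X x = 0 \<longrightarrow> (\<exists>y\<in>cr (P 1) X. D 1 X y = x)) \<and>
     (\<forall>n X x. Ob X \<longrightarrow> x \<in> cr (P (Suc n)) X \<longrightarrow> D (Suc n) X x = 0 \<longrightarrow>
        (\<exists>y\<in>cr (P (Suc (Suc n))) X. D (Suc (Suc n)) X y = x))"

definition res :: "('x, 't, 'a, 'n::ab_group_add) md \<Rightarrow> (nat \<Rightarrow> ('x, 't, 'a, 'p::ab_group_add) md) \<Rightarrow>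
    (nat \<Rightarrow> 'x \<Rightarrow> 'p \<Rightarrow> 'p) \<Rightarrow> ('x \<Rightarrow> 'p \<Rightarrow> 'n) \<Rightarrow> bool" where
  "res N P D \<eta> \<longleftrightarrow> resn N P D \<eta> \<and> (\<forall>n. proj (P n))"

lemma cpxD:
  assumes "cpx P D"
  shows "md (P n)" "mhom (P n) (P (n - 1)) (D n)" "mhom (P (Suc n)) (P n) (D (Suc n))" "D 0 X x = 0"
    "Ob X \<Longrightarrow> x \<in> cr (P (Suc n)) X \<Longrightarrow> D n X (D (Suc n) X x) = 0"
proof -
  show "mhom (P n) (P (n - 1)) (D n)" for n using assms unfolding cpx_def by blast
  from this[of "Suc n"] show "mhom (P (Suc n)) (P n) (D (Suc n))" by simp
qed (use assms in \<open>unfold cpx_def, simp_all\<close>)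

lemma acpxD:
  assumes "acpx N P D \<eta>"
  shows "cpx P D" "md N" "mhom (P 0) N \<eta>" "Ob X \<Longrightarrow> x \<in> cr (P 1) X \<Longrightarrow> \<eta> X (D 1 X x) = 0"
  using assms unfolding acpx_def by simp_all

lemma resnD:
  assumes "resn N P D \<eta>"
  shows "acpx N P D \<eta>" "Ob X \<Longrightarrow> z \<in> cr N X \<Longrightarrow> \<exists>x\<in>cr (P 0) X. \<eta> X x = z"
    "Ob X \<Longrightarrow> x \<in> cr (P 0) X \<Longrightarrow> \<eta> X x = 0 \<Longrightarrow> \<exists>y\<in>cr (P 1) X. D 1 X y = x"
    "Ob X \<Longrightarrow> x \<in> cr (P (Suc n)) X \<Longrightarrow> D (Suc n) X x = 0 \<Longrightarrow> \<exists>y\<in>cr (P (Suc (Suc n))) X. D (Suc (Suc n)) X y = x"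
  using assms unfolding resn_def by simp_all

lemma resD:
  assumes "res N P D \<eta>"
  shows "resn N P D \<eta>" "acpx N P D \<eta>" "cpx P D" "proj (P n)"
  using assms acpxD(1) unfolding res_def resn_def by blast+

definition cm :: "(nat \<Rightarrow> ('x, 't, 'a, 'p::ab_group_add) md) \<Rightarrow> (nat \<Rightarrow> 'x \<Rightarrow> 'p \<Rightarrow> 'p) \<Rightarrow>
    (nat \<Rightarrow> ('x, 't, 'a, 'r::ab_group_add) md) \<Rightarrow> (nat \<Rightarrow> 'x \<Rightarrow> 'r \<Rightarrow> 'r) \<Rightarrow> (nat \<Rightarrow> 'x \<Rightarrow> 'p \<Rightarrow> 'r) \<Rightarrow> bool" where
  "cm P D R D' F \<longleftrightarrow> (\<forall>n. mhom (P n) (R n) (F n)) \<and>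
     (\<forall>n X x. Ob X \<longrightarrow> x \<in> cr (P (Suc n)) X \<longrightarrow> D' (Suc n) X (F (Suc n) X x) = F n X (D (Suc n) X x))"

lemma cmD:
  assumes "cm P D R D' F"
  shows "mhom (P n) (R n) (F n)"
    "Ob X \<Longrightarrow> x \<in> cr (P (Suc n)) X \<Longrightarrow> D' (Suc n) X (F (Suc n) X x) = F n X (D (Suc n) X x)"
  using assms unfolding cm_def by simp_all

lemma cm_comm:
  assumes "cm P D R D' F" "cpx P D" "cpx R D'" "Ob X" "x \<in> cr (P n) X"
  shows "D' n X (F n X x) = F (n - 1) X (D n X x)"
proof (cases n)
  case 0
  then show ?thesis
    using cpxD(4)[OF assms(2)] cpxD(4)[OF assms(3)] mhom_simps(1)[OF cmD(1)[OF assms(1)] cpxD(1)[OF assms(2)] assms(4)]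
    by simp
next
  case (Suc m)
  then show ?thesis using cmD(2)[OF assms(1,4)] assms(5) by simp
qed

lemma cm_comp:
  assumes "cm P D R D' F" "cm R D' S D'' G"
  shows "cm P D S D'' (\<lambda>n X x. G n X (F n X x))"
  unfolding cm_def
proof (intro conjI allI impI)
  show "mhom (P n) (S n) (\<lambda>X x. G n X (F n X x))" for n
    by (rule mhom_comp[OF cmD(1)[OF assms(1)] cmD(1)[OF assms(2)]])
  fix n X x assume X: "Ob X" and x: "x \<in> cr (P (Suc n)) X"
  show "D'' (Suc n) X (G (Suc n) X (F (Suc n) X x)) = G n X (F n X (D (Suc n) X x))"
    using cmD(2)[OF assms(2) X mhomD(1)[OF cmD(1)[OF assms(1)] X x]] cmD(2)[OF assms(1) X x] by simp
qed

lemma cm_id: "cm P D P D (\<lambda>n X x. x)"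
  unfolding cm_def by (simp add: mhom_id)

lemma cm_diff:
  assumes "cm P D R D' F" "cm P D R D' G" "cpx P D" "cpx R D'"
  shows "cm P D R D' (\<lambda>n X x. F n X x - G n X x)"
  unfolding cm_def
proof (intro conjI allI impI)
  show "mhom (P n) (R n) (\<lambda>X x. F n X x - G n X x)" for n
    by (rule mhom_diff[OF cmD(1)[OF assms(1)] cmD(1)[OF assms(2)] cpxD(1)[OF assms(4)]])
  fix n X x assume X: "Ob X" and x: "x \<in> cr (P (Suc n)) X"
  show "D' (Suc n) X (F (Suc n) X x - G (Suc n) X x) = F n X (D (Suc n) X x) - G n X (D (Suc n) X x)"
    using mhom_simps(4)[OF cpxD(3)[OF assms(4)] cpxD(1)[OF assms(4)] X
        mhomD(1)[OF cmD(1)[OF assms(1)] X x] mhomD(1)[OF cmD(1)[OF assms(2)] X x]]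
      cmD(2)[OF assms(1) X x] cmD(2)[OF assms(2) X x] by simp
qed

text \<open>The comparison theorem: lift through the target degree by degree, by dependent
  choice.\<close>

lemma cm_exists:
  assumes P: "acpx N P D \<eta>" "\<And>n. proj (P n)" and R: "resn N' R D' \<eta>'" and f: "mhom N N' f"
  shows "\<exists>F. cm P D R D' F \<and> (\<forall>X x. Ob X \<longrightarrow> x \<in> cr (P 0) X \<longrightarrow> \<eta>' X (F 0 X x) = f X (\<eta> X x))"
proof -
  note cP = acpxD(1)[OF P(1)] and aR = resnD(1)[OF R]
  note cR = acpxD(1)[OF aR]
  \<comment> \<open>The invariant records that \<open>F\<close> composed with the next differential
    lands in boundaries of the target; this is exactly what the next lift requires.\<close>
  define I where "I n F \<longleftrightarrow> mhom (P n) (R n) F \<and>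
     (\<forall>X x. Ob X \<longrightarrow> x \<in> cr (P (Suc n)) X \<longrightarrow> (\<exists>y\<in>cr (R (Suc n)) X. D' (Suc n) X y = F X (D (Suc n) X x))) \<and>
     (n = 0 \<longrightarrow> (\<forall>X x. Ob X \<longrightarrow> x \<in> cr (P 0) X \<longrightarrow> \<eta>' X (F X x) = f X (\<eta> X x)))" for n F
  define Q where "Q n F F' \<longleftrightarrow> (\<forall>X x. Ob X \<longrightarrow> x \<in> cr (P (Suc n)) X \<longrightarrow>
     D' (Suc n) X (F' X x) = F X (D (Suc n) X x))" for n F F'
  have "\<exists>F. \<forall>n. I n (F n) \<and> Q n (F n) (F (Suc n))"
  proof (rule dependent_nat_choice)
    have h: "mhom (P 0) N' (\<lambda>X x. f X (\<eta> X x))" by (rule mhom_comp[OF acpxD(3)[OF P(1)] f])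
    obtain F where F: "mhom (P 0) (R 0) F" "\<And>X x. Ob X \<Longrightarrow> x \<in> cr (P 0) X \<Longrightarrow> \<eta>' X (F X x) = f X (\<eta> X x)"
      using proj_lift[OF P(2) cpxD(1)[OF cR] acpxD(2)[OF aR] h acpxD(3)[OF aR]] resnD(2)[OF R] mhomD(1)[OF h] by blast
    have "\<exists>y\<in>cr (R 1) X. D' 1 X y = F X (D 1 X x)" if X: "Ob X" and x: "x \<in> cr (P 1) X" for X x
    proof -
      have d: "D 1 X x \<in> cr (P 0) X" using mhomD(1)[OF cpxD(3)[OF cP, of 0] X] x by simp
      have "\<eta>' X (F X (D 1 X x)) = 0"
        using F(2)[OF X d] acpxD(4)[OF P(1) X x] mhom_simps(1)[OF f acpxD(2)[OF P(1)] X] by simp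
      then show ?thesis by (rule resnD(3)[OF R X mhomD(1)[OF F(1) X d]])
    qed
    then show "\<exists>F. I 0 F" using F unfolding I_def by auto
  next
    fix F n assume "I n F"
    then have F: "mhom (P n) (R n) F"
      and im: "\<And>X x. Ob X \<Longrightarrow> x \<in> cr (P (Suc n)) X \<Longrightarrow> \<exists>y\<in>cr (R (Suc n)) X. D' (Suc n) X y = F X (D (Suc n) X x)"
      unfolding I_def by simp_all
    obtain F' where F': "mhom (P (Suc n)) (R (Suc n)) F'"
      "\<And>X x. Ob X \<Longrightarrow> x \<in> cr (P (Suc n)) X \<Longrightarrow> D' (Suc n) X (F' X x) = F X (D (Suc n) X x)"
      using proj_lift[OF P(2) cpxD(1)[OF cR] cpxD(1)[OF cR] mhom_comp[OF cpxD(3)[OF cP] F] cpxD(3)[OF cR] im] by blast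
    have "\<exists>y\<in>cr (R (Suc (Suc n))) X. D' (Suc (Suc n)) X y = F' X (D (Suc (Suc n)) X x)"
      if X: "Ob X" and x: "x \<in> cr (P (Suc (Suc n))) X" for X x
    proof -
      have d: "D (Suc (Suc n)) X x \<in> cr (P (Suc n)) X" by (rule mhomD(1)[OF cpxD(3)[OF cP] X x])
      have "D' (Suc n) X (F' X (D (Suc (Suc n)) X x)) = 0"
        using F'(2)[OF X d] cpxD(5)[OF cP X x] mhom_simps(1)[OF F cpxD(1)[OF cP] X] by simp
      then show ?thesis by (rule resnD(4)[OF R X mhomD(1)[OF F'(1) X d]])
    qed
    then show "\<exists>F'. I (Suc n) F' \<and> Q n F F'" using F' unfolding I_def Q_def by blast
  qed
  then obtain F where F: "\<And>n. I n (F n)" "\<And>n. Q n (F n) (F (Suc n))" by blast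
  show ?thesis
    using F(1)[of 0] F unfolding cm_def I_def Q_def by blast
qed

lemma cm_lift:
  assumes P: "res N P D \<eta>" and R: "resn N' R D' \<eta>'" and f: "mhom N N' f"
  obtains F where "cm P D R D' F" "\<forall>X x. Ob X \<longrightarrow> x \<in> cr (P 0) X \<longrightarrow> \<eta>' X (F 0 X x) = f X (\<eta> X x)"
  using cm_exists[OF resD(2)[OF P] resD(4)[OF P] R f] by (elim exE conjE)

lemma homotopy_exists:
  assumes P: "cpx P D" "\<And>n. proj (P n)" and R: "resn N' R D' \<eta>'" and F: "cm P D R D' F"
    and z: "\<And>X x. Ob X \<Longrightarrow> x \<in> cr (P 0) X \<Longrightarrow> \<eta>' X (F 0 X x) = 0"
  shows "\<exists>h. (\<forall>n. mhom (P n) (R (Suc n)) (h n)) \<and> (\<forall>n X x. Ob X \<longrightarrow> x \<in> cr (P n) X \<longrightarrow>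
     F n X x = D' (Suc n) X (h n X x) + h (n - 1) X (D n X x))"
proof -
  note aR = resnD(1)[OF R]
  note cR = acpxD(1)[OF aR]
  \<comment> \<open>The second clause of \<open>J\<close> says that the next component of
    \<open>F\<close> minus \<open>h\<close> after the differential is a cycle, so that it can be
    lifted to give the next \<open>h\<close>.\<close>
  define J where "J n h \<longleftrightarrow> mhom (P n) (R (Suc n)) h \<and>
     (\<forall>X x. Ob X \<longrightarrow> x \<in> cr (P (Suc n)) X \<longrightarrow> D' (Suc n) X (h X (D (Suc n) X x)) = F n X (D (Suc n) X x)) \<and>
     (n = 0 \<longrightarrow> (\<forall>X x. Ob X \<longrightarrow> x \<in> cr (P 0) X \<longrightarrow> D' 1 X (h X x) = F 0 X x))" for n h
  define Q where "Q n h h' \<longleftrightarrow> (\<forall>X x. Ob X \<longrightarrow> x \<in> cr (P (Suc n)) X \<longrightarrow>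
     F (Suc n) X x = D' (Suc (Suc n)) X (h' X x) + h X (D (Suc n) X x))" for n h h'
  have "\<exists>h. \<forall>n. J n (h n) \<and> Q n (h n) (h (Suc n))"
  proof (rule dependent_nat_choice)
    obtain h where h: "mhom (P 0) (R 1) h" "\<And>X x. Ob X \<Longrightarrow> x \<in> cr (P 0) X \<Longrightarrow> D' 1 X (h X x) = F 0 X x"
      using proj_lift[OF P(2) cpxD(1)[OF cR] cpxD(1)[OF cR] cmD(1)[OF F] cpxD(3)[OF cR, of 0]]
        resnD(3)[OF R _ mhomD(1)[OF cmD(1)[OF F]] z] by auto
    show "\<exists>h. J 0 h"
      using h mhomD(1)[OF cpxD(3)[OF P(1), of 0]] unfolding J_def by auto
  next
    fix h n assume "J n h"
    then have h: "mhom (P n) (R (Suc n)) h"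
      and hD: "\<And>X x. Ob X \<Longrightarrow> x \<in> cr (P (Suc n)) X \<Longrightarrow> D' (Suc n) X (h X (D (Suc n) X x)) = F n X (D (Suc n) X x)"
      unfolding J_def by simp_all
    let ?g = "\<lambda>X x. F (Suc n) X x - h X (D (Suc n) X x)"
    note hd = mhom_comp[OF cpxD(3)[OF P(1)] h]
    have g: "mhom (P (Suc n)) (R (Suc n)) ?g"
      by (rule mhom_diff[OF cmD(1)[OF F] hd cpxD(1)[OF cR]])
    have im: "\<exists>y\<in>cr (R (Suc (Suc n))) X. D' (Suc (Suc n)) X y = ?g X x"
      if X: "Ob X" and x: "x \<in> cr (P (Suc n)) X" for X x
    proof (rule resnD(4)[OF R X mhomD(1)[OF g X x]])
      show "D' (Suc n) X (?g X x) = 0"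
        using mhom_simps(4)[OF cpxD(3)[OF cR] cpxD(1)[OF cR] X mhomD(1)[OF cmD(1)[OF F] X x] mhomD(1)[OF hd X x]]
          cmD(2)[OF F X x] hD[OF X x] by simp
    qed
    obtain h' where h': "mhom (P (Suc n)) (R (Suc (Suc n))) h'"
      "\<And>X x. Ob X \<Longrightarrow> x \<in> cr (P (Suc n)) X \<Longrightarrow> D' (Suc (Suc n)) X (h' X x) = ?g X x"
      using proj_lift[OF P(2) cpxD(1)[OF cR] cpxD(1)[OF cR] g cpxD(3)[OF cR] im] by blast
    have "D' (Suc (Suc n)) X (h' X (D (Suc (Suc n)) X x)) = F (Suc n) X (D (Suc (Suc n)) X x)"
      if X: "Ob X" and x: "x \<in> cr (P (Suc (Suc n))) X" for X x
      using h'(2)[OF X mhomD(1)[OF cpxD(3)[OF P(1)] X x]] cpxD(5)[OF P(1) X x]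
        mhom_simps(1)[OF h cpxD(1)[OF P(1)] X] by simp
    then show "\<exists>h'. J (Suc n) h' \<and> Q n h h'" using h' unfolding J_def Q_def by auto
  qed
  then obtain h where h: "\<And>n. J n (h n)" "\<And>n. Q n (h n) (h (Suc n))" by blast
  have hh: "mhom (P n) (R (Suc n)) (h n)" for n using h(1) unfolding J_def by blast
  have "F n X x = D' (Suc n) X (h n X x) + h (n - 1) X (D n X x)" if X: "Ob X" and x: "x \<in> cr (P n) X" for n X x
  proof (cases n)
    case 0
    then show ?thesis
      using h(1)[of 0] X x cpxD(4)[OF P(1)] mhom_simps(1)[OF hh cpxD(1)[OF P(1)] X] unfolding J_def by simp
  next
    case (Suc m)
    then show ?thesis using h(2)[of m] X x unfolding Q_def by simp
  qed
  then show ?thesis using hh by blast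
qed

text \<open>The difference of two lifts of the same map is Dh + hD. On an element that is a cycle
  modulo the ideal the second term falls into the ideal, since h is a module map.\<close>

lemma cm_homotopic:
  assumes P: "cpx P D" "\<And>n. proj (P n)" and R: "resn N' R D' \<eta>'" and F: "cm P D R D' F" and G: "cm P D R D' G"
    and eq: "\<And>X x. Ob X \<Longrightarrow> x \<in> cr (P 0) X \<Longrightarrow> \<eta>' X (F 0 X x) = \<eta>' X (G 0 X x)"
    and X: "Ob X" and x: "x \<in> cr (P n) X" "D n X x \<in> Pos (P (n - 1)) X"
  shows "\<exists>y\<in>cr (R (Suc n)) X. F n X x - G n X x - D' (Suc n) X y \<in> Pos (R n) X"
proof -
  note aR = resnD(1)[OF R]
  note cR = acpxD(1)[OF aR]
  note FG = cm_diff[OF F G P(1) cR]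
  have "\<eta>' X (F 0 X x - G 0 X x) = 0" if "Ob X" "x \<in> cr (P 0) X" for X x
    using mhom_simps(4)[OF acpxD(3)[OF aR] cpxD(1)[OF cR] that(1)] mhomD(1)[OF cmD(1)[OF F] that]
      mhomD(1)[OF cmD(1)[OF G] that] eq[OF that] by simp
  then obtain h where h: "\<And>n. mhom (P n) (R (Suc n)) (h n)" "\<And>n X x. Ob X \<Longrightarrow> x \<in> cr (P n) X \<Longrightarrow>
     F n X x - G n X x = D' (Suc n) X (h n X x) + h (n - 1) X (D n X x)"
    using homotopy_exists[OF P R FG] by blast
  have "h (n - 1) X (D n X x) \<in> Pos (R n) X"
  proof (cases n)
    case 0
    then show ?thesis using mhom_simps(1)[OF h(1) cpxD(1)[OF P(1)] X] cpxD(4)[OF P(1)] by (simp add: Pos.zero)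
  next
    case (Suc m)
    then show ?thesis using Pos_hom[OF x(2) h(1) cpxD(1)[OF P(1)] X] by simp
  qed
  then show ?thesis using h(2)[OF X x(1)] mhomD(1)[OF h(1) X x(1)] by force
qed

text \<open>If P resolves N, this says that \<open>Tor_i(k, N)\<close> vanishes at X, as the
  homology of P modulo the ideal written with representatives.\<close>

definition TorV :: "(nat \<Rightarrow> ('x, 't, 'a, 'p::ab_group_add) md) \<Rightarrow> (nat \<Rightarrow> 'x \<Rightarrow> 'p \<Rightarrow> 'p) \<Rightarrow> nat \<Rightarrow> 'x \<Rightarrow> bool" where
  "TorV P D i X \<longleftrightarrow> (\<forall>x\<in>cr (P i) X. D i X x \<in> Pos (P (i - 1)) X \<longrightarrow>
     (\<exists>y\<in>cr (P (Suc i)) X. x - D (Suc i) X y \<in> Pos (P i) X))"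

text \<open>Independence of the chosen resolution. The element types of the two resolutions may
  differ, which is needed because each construction of a resolution produces its own type.\<close>

lemma TorV_transfer:
  assumes P: "res N P D \<eta>" and R: "res N R D' \<eta>'" and X: "Ob X" and T: "TorV R D' i X"
  shows "TorV P D i X"
  unfolding TorV_def
proof (intro ballI impI)
  fix x assume x: "x \<in> cr (P i) X" "D i X x \<in> Pos (P (i - 1)) X"
  note cP = resD(3)[OF P] and cR = resD(3)[OF R]
  obtain F where F0: "cm P D R D' F" "\<forall>X x. Ob X \<longrightarrow> x \<in> cr (P 0) X \<longrightarrow> \<eta>' X (F 0 X x) = \<eta> X x"
    by (rule cm_lift[OF P resD(1)[OF R] mhom_id])
  note F = F0(1) F0(2)[rule_format]
  obtain G where G0: "cm R D' P D G" "\<forall>X x. Ob X \<longrightarrow> x \<in> cr (R 0) X \<longrightarrow> \<eta> X (G 0 X x) = \<eta>' X x"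
    by (rule cm_lift[OF R resD(1)[OF P] mhom_id])
  note G = G0(1) G0(2)[rule_format]
  have Fx: "F i X x \<in> cr (R i) X" by (rule mhomD(1)[OF cmD(1)[OF F(1)] X x(1)])
  have "D' i X (F i X x) \<in> Pos (R (i - 1)) X"
    using Pos_hom[OF x(2) cmD(1)[OF F(1)] cpxD(1)[OF cP] X] cm_comm[OF F(1) cP cR X x(1)] by simp
  then obtain y where y: "y \<in> cr (R (Suc i)) X" "F i X x - D' (Suc i) X y \<in> Pos (R i) X"
    using T Fx unfolding TorV_def by blast
  have Dy: "D' (Suc i) X y \<in> cr (R i) X" by (rule mhomD(1)[OF cpxD(3)[OF cR] X y(1)])
  have 1: "G i X (F i X x) - D (Suc i) X (G (Suc i) X y) \<in> Pos (P i) X"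
    using Pos_hom[OF y(2) cmD(1)[OF G(1)] cpxD(1)[OF cR] X] mhom_simps(4)[OF cmD(1)[OF G(1)] cpxD(1)[OF cR] X Fx Dy]
      cmD(2)[OF G(1) X y(1)] by simp
  have eq: "\<eta> X (G 0 X (F 0 X x)) = \<eta> X x" if "Ob X" "x \<in> cr (P 0) X" for X x
    using G(2)[OF that(1) mhomD(1)[OF cmD(1)[OF F(1)] that]] F(2)[OF that] by simp
  \<comment> \<open>Going to the other resolution and back is homotopic to the identity.\<close>
  have "\<exists>z\<in>cr (P (Suc i)) X. G i X (F i X x) - x - D (Suc i) X z \<in> Pos (P i) X"
  proof (rule cm_homotopic[where F = "\<lambda>n X x. G n X (F n X x)" and G = "\<lambda>n X x. x"])
    show "cpx P D" by (rule cP)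
    show "proj (P n)" for n by (rule resD(4)[OF P])
    show "resn N P D \<eta>" by (rule resD(1)[OF P])
    show "cm P D P D (\<lambda>n X x. G n X (F n X x))" by (rule cm_comp[OF F(1) G(1)])
    show "cm P D P D (\<lambda>n X x. x)" by (rule cm_id)
  qed (use eq X x in simp_all)
  then obtain z where z: "z \<in> cr (P (Suc i)) X" "G i X (F i X x) - x - D (Suc i) X z \<in> Pos (P i) X"
    by (elim bexE)
  have Gy: "G (Suc i) X y \<in> cr (P (Suc i)) X" by (rule mhomD(1)[OF cmD(1)[OF G(1)] X y(1)])
  have "x - D (Suc i) X (G (Suc i) X y - z) \<in> Pos (P i) X"
    unfolding mhom_simps(4)[OF cpxD(3)[OF cP] cpxD(1)[OF cP] X Gy z(1)]
    using Pos_diff[OF 1 z(2) cpxD(1)[OF cP]] by (simp add: algebra_simps)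
  then show "\<exists>y\<in>cr (P (Suc i)) X. x - D (Suc i) X y \<in> Pos (P i) X"
    using md_sgrp(2)[OF cpxD(1)[OF cP] X Gy z(1)] by blast
qed

section \<open>Mapping cones of short exact sequences\<close>

definition zmod :: "('x, 't, 'a, 'n::ab_group_add) md" where
  "zmod = (\<lambda>X. {0}, \<lambda>t a x. 0)"

lemma md_zmod: "md zmod"
  by (rule pmdI) (simp_all add: zmod_def sgrp_def additive_on_def)

lemma proj_zmod: "proj zmod"
  unfolding proj_def
proof (intro conjI exI allI impI)
  show "md zmod" by (rule md_zmod)
  show "mhom zmod (cov zmod) (\<lambda>X x. 0)" by (rule mhom_zero[OF md_cov])
  show "ev zmod snd 0 = x" if "x \<in> cr zmod X" for X x using that by (simp add: zmod_def ev_def)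
qed

text \<open>The mapping cone. In degree 0 the second factor is the zero module, so that the terms of
  all degrees have the same product type.\<close>

definition coneM :: "(nat \<Rightarrow> ('x, 't, 'a, 'p::ab_group_add) md) \<Rightarrow> (nat \<Rightarrow> ('x, 't, 'a, 'r::ab_group_add) md) \<Rightarrow>
    nat \<Rightarrow> ('x, 't, 'a, 'p \<times> 'r) md" where
  "coneM G S i = prd (G i) (case i of 0 \<Rightarrow> zmod | Suc j \<Rightarrow> S j)"

definition coneD :: "(nat \<Rightarrow> 'x \<Rightarrow> 'p::ab_group_add \<Rightarrow> 'p) \<Rightarrow> (nat \<Rightarrow> 'x \<Rightarrow> 'r::ab_group_add \<Rightarrow> 'r) \<Rightarrow>
    (nat \<Rightarrow> 'x \<Rightarrow> 'r \<Rightarrow> 'p) \<Rightarrow> nat \<Rightarrow> 'x \<Rightarrow> 'p \<times> 'r \<Rightarrow> 'p \<times> 'r" where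
  "coneD DG DS \<sigma> i X z = (case i of 0 \<Rightarrow> 0 | Suc j \<Rightarrow> (DG i X (fst z) + \<sigma> j X (snd z), - DS j X (snd z)))"

definition ses :: "('x, 't, 'a, 'k::ab_group_add) md \<Rightarrow> ('x, 't, 'a, 'q::ab_group_add) md \<Rightarrow>
    ('x, 't, 'a, 'n::ab_group_add) md \<Rightarrow> ('x \<Rightarrow> 'k \<Rightarrow> 'q) \<Rightarrow> ('x \<Rightarrow> 'q \<Rightarrow> 'n) \<Rightarrow> bool" where
  "ses K Q N \<iota> \<pi> \<longleftrightarrow> md K \<and> md Q \<and> md N \<and> mhom K Q \<iota> \<and> mhom Q N \<pi> \<and>
     (\<forall>X x. Ob X \<longrightarrow> x \<in> cr K X \<longrightarrow> \<iota> X x = 0 \<longrightarrow> x = 0) \<and>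
     (\<forall>X x. Ob X \<longrightarrow> x \<in> cr K X \<longrightarrow> \<pi> X (\<iota> X x) = 0) \<and>
     (\<forall>X x. Ob X \<longrightarrow> x \<in> cr Q X \<longrightarrow> \<pi> X x = 0 \<longrightarrow> (\<exists>y\<in>cr K X. \<iota> X y = x)) \<and>
     (\<forall>X z. Ob X \<longrightarrow> z \<in> cr N X \<longrightarrow> (\<exists>x\<in>cr Q X. \<pi> X x = z))"

lemma sesD:
  assumes "ses K Q N \<iota> \<pi>"
  shows "md K" "md Q" "md N" "mhom K Q \<iota>" "mhom Q N \<pi>"
    "Ob X \<Longrightarrow> x \<in> cr K X \<Longrightarrow> \<iota> X x = 0 \<Longrightarrow> x = 0"
    "Ob X \<Longrightarrow> x \<in> cr K X \<Longrightarrow> \<pi> X (\<iota> X x) = 0"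
    "Ob X \<Longrightarrow> y \<in> cr Q X \<Longrightarrow> \<pi> X y = 0 \<Longrightarrow> \<exists>x\<in>cr K X. \<iota> X x = y"
    "Ob X \<Longrightarrow> z \<in> cr N X \<Longrightarrow> \<exists>x\<in>cr Q X. \<pi> X x = z"
  using assms unfolding ses_def by simp_all

text \<open>The cone of a lift of the inclusion resolves the quotient. This replaces the horseshoe
  lemma and gives the long exact sequence by inspecting the two coordinates of cycles and
  boundaries.\<close>

lemma cone_res:
  assumes s: "ses K Q N \<iota> \<pi>" and S: "res K S DS \<eta>S" and G: "res Q G DG \<eta>G" and \<sigma>: "cm S DS G DG \<sigma>"
    and aug: "\<And>X x. Ob X \<Longrightarrow> x \<in> cr (S 0) X \<Longrightarrow> \<eta>G X (\<sigma> 0 X x) = \<iota> X (\<eta>S X x)"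
  shows "res N (coneM G S) (coneD DG DS \<sigma>) (\<lambda>X z. \<pi> X (\<eta>G X (fst z)))"
proof -
  note cS = resD(3)[OF S] and cG = resD(3)[OF G]
  note mS = cpxD(1)[OF cS] and mG = cpxD(1)[OF cG]
  note hS = cpxD(2)[OF cS] and hG = cpxD(3)[OF cG] and h\<sigma> = cmD(1)[OF \<sigma>]
  let ?C = "coneM G S" and ?D = "coneD DG DS \<sigma>"
  have C0: "cr (?C 0) X = cr (G 0) X \<times> {0}" for X by (simp add: coneM_def cr_prd zmod_def)
  have C1: "cr (?C (Suc n)) X = cr (G (Suc n)) X \<times> cr (S n) X" for n X by (simp add: coneM_def cr_prd)
  have D1: "?D (Suc n) X z = (DG (Suc n) X (fst z) + \<sigma> n X (snd z), - DS n X (snd z))" for n X z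
    by (simp add: coneD_def)
  have mC: "md (?C n)" for n unfolding coneM_def
    by (cases n) (auto intro!: md_prd mG mS md_zmod)
  have pC: "proj (?C n)" for n unfolding coneM_def
    by (cases n) (auto intro!: proj_prd proj_zmod resD(4)[OF S] resD(4)[OF G])
  have hD: "mhom (?C n) (?C (n - 1)) (?D n)" for n
  proof (cases n)
    case 0
    then show ?thesis using mhom_zero[OF mC] by (simp add: coneD_def[abs_def])
  next
    case (Suc m)
    have 1: "mhom (?C n) (G m) (\<lambda>X z. DG (Suc m) X (fst z) + \<sigma> m X (snd z))"
      unfolding Suc coneM_def nat.case
      by (rule mhom_add[OF mhom_comp[OF mhom_fst hG] mhom_comp[OF mhom_snd h\<sigma>] mG])
    have 2: "mhom (?C n) (case m of 0 \<Rightarrow> zmod | Suc j \<Rightarrow> S j) (\<lambda>X z. - DS m X (snd z))"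
    proof (cases m)
      case 0
      then show ?thesis using mhom_zero[OF md_zmod] by (simp add: cpxD(4)[OF cS])
    next
      case (Suc k)
      show ?thesis unfolding \<open>n = Suc m\<close> Suc coneM_def nat.case
        by (rule mhom_uminus[OF mhom_comp[OF mhom_snd cpxD(3)[OF cS]] mS])
    qed
    show ?thesis using mhom_pair[OF 1 2] by (simp add: Suc D1[abs_def] coneM_def[of _ _ m])
  qed
  have DD: "?D n X (?D (Suc n) X z) = 0" if X: "Ob X" and z: "z \<in> cr (?C (Suc n)) X" for n X z
  proof (cases n)
    case 0
    then show ?thesis by (simp add: coneD_def)
  next
    case (Suc m)
    obtain g s where gs: "z = (g, s)" "g \<in> cr (G (Suc n)) X" "s \<in> cr (S n) X" using z by (auto simp: C1)
    have s': "s \<in> cr (S (Suc m)) X" using gs Suc by simp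
    have ds: "DS (Suc m) X s \<in> cr (S m) X" by (rule mhomD(1)[OF cpxD(3)[OF cS] X s'])
    show ?thesis
      using cpxD(5)[OF cG X gs(2)] cpxD(5)[OF cS X s'] cmD(2)[OF \<sigma> X s'] mhomD(1)[OF hG X gs(2)]
        mhomD(1)[OF h\<sigma> X s'] mhom_simps(2)[OF hG mG X] mhom_simps(3)[OF h\<sigma> mS X ds]
        mhom_simps(3)[OF hS mS X ds] Suc
      by (simp add: gs D1 zero_prod_def)
  qed
  have cC: "cpx ?C ?D" unfolding cpx_def using mC hD DD by (simp add: coneD_def[abs_def])
  have h\<eta>: "mhom (?C 0) N (\<lambda>X z. \<pi> X (\<eta>G X (fst z)))"
    unfolding coneM_def
    by (rule mhom_comp[OF mhom_comp[OF mhom_fst acpxD(3)[OF resD(2)[OF G]]] sesD(5)[OF s]])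
  note h\<eta>G = acpxD(3)[OF resD(2)[OF G]] and h\<eta>S = acpxD(3)[OF resD(2)[OF S]]
  have \<eta>D: "\<pi> X (\<eta>G X (fst (?D 1 X z))) = 0" if X: "Ob X" and z: "z \<in> cr (?C 1) X" for X z
  proof -
    obtain g s where gs: "z = (g, s)" "g \<in> cr (G 1) X" "s \<in> cr (S 0) X" using z C1[of 0] by auto
    have dg: "DG 1 X g \<in> cr (G 0) X" using mhomD(1)[OF hG[of 0] X] gs(2) by simp
    show ?thesis
      using D1[of 0] gs acpxD(4)[OF resD(2)[OF G] X gs(2)] aug[OF X gs(3)]
        sesD(7)[OF assms(1) X mhomD(1)[OF h\<eta>S X gs(3)]]
        mhom_simps(2)[OF h\<eta>G mG X dg mhomD(1)[OF h\<sigma> X gs(3)]] by simp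
  qed
  have surj: "\<exists>x\<in>cr (?C 0) X. \<pi> X (\<eta>G X (fst x)) = z" if X: "Ob X" and z: "z \<in> cr N X" for X z
  proof -
    obtain q where q: "q \<in> cr Q X" "\<pi> X q = z" using sesD(9)[OF s X z] by blast
    obtain g where "g \<in> cr (G 0) X" "\<eta>G X g = q" using resnD(2)[OF resD(1)[OF G] X q(1)] by blast
    then show ?thesis using q by (intro bexI[of _ "(g, 0)"]) (auto simp: C0)
  qed
  have ex0: "\<exists>y\<in>cr (?C 1) X. ?D 1 X y = z"
    if X: "Ob X" and z: "z \<in> cr (?C 0) X" and e: "\<pi> X (\<eta>G X (fst z)) = 0" for X z
  proof -
    obtain g where g: "z = (g, 0)" "g \<in> cr (G 0) X" using z by (auto simp: C0)
    obtain k where k: "k \<in> cr K X" "\<iota> X k = \<eta>G X g"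
      using sesD(8)[OF s X mhomD(1)[OF h\<eta>G X g(2)]] e g by auto
    obtain t where t: "t \<in> cr (S 0) X" "\<eta>S X t = k" using resnD(2)[OF resD(1)[OF S] X k(1)] by blast
    note \<sigma>t = mhomD(1)[OF h\<sigma> X t(1)]
    have "\<eta>G X (g - \<sigma> 0 X t) = 0"
      using mhom_simps(4)[OF h\<eta>G mG X g(2) \<sigma>t] aug[OF X t(1)] t k by simp
    then obtain y where "y \<in> cr (G 1) X" "DG 1 X y = g - \<sigma> 0 X t"
      using resnD(3)[OF resD(1)[OF G] X md_sgrp(2)[OF mG X g(2) \<sigma>t]] by blast
    then show ?thesis using t g C1[of 0 X] D1[of 0 X] cpxD(4)[OF cS] by (intro bexI[of _ "(y, t)"]) auto
  qed
  have ex1: "\<exists>y\<in>cr (?C (Suc (Suc n))) X. ?D (Suc (Suc n)) X y = z"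
    if X: "Ob X" and z: "z \<in> cr (?C (Suc n)) X" and e: "?D (Suc n) X z = 0" for X z n
  proof -
    obtain g s where gs: "z = (g, s)" "g \<in> cr (G (Suc n)) X" "s \<in> cr (S n) X" using z by (auto simp: C1)
    have e1: "DG (Suc n) X g + \<sigma> n X s = 0" and e2: "DS n X s = 0" using e by (auto simp: D1 gs zero_prod_def)
    \<comment> \<open>In positive degrees this is exactness of S. In degree 0 every element of S is
      a cycle, and injectivity of the inclusion has to show that the augmentation of
      \<open>s\<close> vanishes.\<close>
    have "\<exists>t\<in>cr (S (Suc n)) X. DS (Suc n) X t = s"
    proof (cases n)
      case 0
      have s0: "s \<in> cr (S 0) X" using gs 0 by simp
      have g1: "g \<in> cr (G 1) X" using gs 0 by simp
      have dg: "DG 1 X g \<in> cr (G 0) X" using mhomD(1)[OF hG[of 0] X] g1 by simp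
      have "\<eta>G X (DG 1 X g + \<sigma> 0 X s) = \<iota> X (\<eta>S X s)"
        using mhom_simps(2)[OF h\<eta>G mG X dg mhomD(1)[OF h\<sigma> X s0]] acpxD(4)[OF resD(2)[OF G] X g1] aug[OF X s0] by simp
      then have "\<iota> X (\<eta>S X s) = 0" using e1 0 mhom_simps(1)[OF h\<eta>G mG X] by simp
      then have "\<eta>S X s = 0" by (rule sesD(6)[OF assms(1) X mhomD(1)[OF h\<eta>S X s0]])
      then show ?thesis using resnD(3)[OF resD(1)[OF S] X s0] 0 by simp
    next
      case (Suc m)
      then show ?thesis using resnD(4)[OF resD(1)[OF S] X, of s m] gs e2 by simp
    qed
    then obtain t where t: "t \<in> cr (S (Suc n)) X" "DS (Suc n) X t = s" by blast
    note \<sigma>t = mhomD(1)[OF h\<sigma> X t(1)]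
    have "DG (Suc n) X (g + \<sigma> (Suc n) X t) = 0"
      using mhom_simps(2)[OF hG mG X gs(2) \<sigma>t] cmD(2)[OF \<sigma> X t(1)] t e1 by simp
    then obtain y where y: "y \<in> cr (G (Suc (Suc n))) X" "DG (Suc (Suc n)) X y = g + \<sigma> (Suc n) X t"
      using resnD(4)[OF resD(1)[OF G] X md_sgrp(4)[OF mG X gs(2) \<sigma>t]] by blast
    show ?thesis
      by (rule bexI[of _ "(y, - t)"])
        (use y t gs mhom_simps(3)[OF h\<sigma> mS X t(1)] mhom_simps(3)[OF hS mS X t(1)] md_sgrp(3)[OF mS X t(1)] in
          \<open>auto simp: C1 D1\<close>)
  qed
  show ?thesis
    unfolding res_def resn_def acpx_def
    using cC sesD(3)[OF s] h\<eta> \<eta>D surj ex0 ex1 pC by blast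
qed

end

section \<open>Pieces of the long exact sequence of Tor\<close>

context gring
begin

text \<open>If Tor_i of the quotient vanishes, classes of the middle term come from the submodule. A
  cycle x of G gives the cycle (x, 0) of the cone; a chain (g, s) bounding it has the required s as
  second coordinate.\<close>

lemma Tor_exact_middle:
  assumes s: "ses K Q N \<iota> \<pi>" and S: "res K S DS \<eta>S" and G: "res Q G DG \<eta>G" and P: "res N P D \<eta>"
    and \<sigma>: "cm S DS G DG \<sigma>"
    and aug: "\<And>X x. Ob X \<Longrightarrow> x \<in> cr (S 0) X \<Longrightarrow> \<eta>G X (\<sigma> 0 X x) = \<iota> X (\<eta>S X x)"
    and T: "TorV P D i X" and X: "Ob X" and x: "x \<in> cr (G i) X" "DG i X x \<in> Pos (G (i - 1)) X"
  shows "\<exists>s\<in>cr (S i) X. DS i X s \<in> Pos (S (i - 1)) X \<and>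
    (\<exists>y\<in>cr (G (Suc i)) X. x - \<sigma> i X s - DG (Suc i) X y \<in> Pos (G i) X)"
proof -
  let ?C = "coneM G S" and ?D = "coneD DG DS \<sigma>"
  have C: "res N ?C ?D (\<lambda>X z. \<pi> X (\<eta>G X (fst z)))" by (rule cone_res[OF s S G \<sigma>]) (rule aug)
  note mG = cpxD(1)[OF resD(3)[OF G]] and mS = cpxD(1)[OF resD(3)[OF S]] and mC = cpxD(1)[OF resD(3)[OF C]]
  have TC: "TorV ?C ?D i X" by (rule TorV_transfer[OF C P X T])
  have m0: "md (case n of 0 \<Rightarrow> zmod | Suc j \<Rightarrow> S j)" for n by (cases n) (simp_all add: mS md_zmod)
  have in0: "mhom (G n) (?C n) (\<lambda>X x. (x, 0))" for n
    unfolding coneM_def by (rule mhom_pair[OF mhom_id mhom_zero[OF m0]])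
  have pr1: "mhom (?C n) (G n) (\<lambda>X. fst)" for n
    unfolding coneM_def by (rule mhom_fst)
  have pr2: "mhom (?C (Suc n)) (S n) (\<lambda>X. snd)" for n
    unfolding coneM_def nat.case by (rule mhom_snd)
  have z: "(x, 0) \<in> cr (?C i) X" by (rule mhomD(1)[OF in0 X x(1)])
  have "?D i X (x, 0) = (DG i X x, 0)"
    using cpxD(4)[OF resD(3)[OF G]] mhom_simps(1)[OF cmD(1)[OF \<sigma>] mS X] mhom_simps(1)[OF cpxD(2)[OF resD(3)[OF S]] mS X]
    by (cases i) (simp_all add: coneD_def zero_prod_def)
  then have "?D i X (x, 0) \<in> Pos (?C (i - 1)) X"
    using Pos_hom[OF x(2) in0 mG X] by simp
  then obtain w where w: "w \<in> cr (?C (Suc i)) X" "(x, 0) - ?D (Suc i) X w \<in> Pos (?C i) X"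
    using TC z unfolding TorV_def by blast
  obtain g s where gs: "w = (g, s)" "g \<in> cr (G (Suc i)) X" "s \<in> cr (S i) X"
    using w(1) by (auto simp: coneM_def cr_prd)
  have e: "(x, 0) - ?D (Suc i) X w = (x - (DG (Suc i) X g + \<sigma> i X s), DS i X s)"
    by (simp add: gs coneD_def)
  have "x - \<sigma> i X s - DG (Suc i) X g \<in> Pos (G i) X"
    using Pos_hom[OF w(2) pr1 mC X] by (simp add: e algebra_simps)
  moreover have "DS i X s \<in> Pos (S (i - 1)) X"
  proof (cases i)
    case 0
    then show ?thesis by (simp add: cpxD(4)[OF resD(3)[OF S]] Pos.zero)
  next
    case (Suc j)
    have "snd ((x, 0) - ?D (Suc i) X w) \<in> Pos (S j) X"
      by (rule Pos_hom[OF _ pr2 mC X]) (use w(2) Suc in simp)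
    then show ?thesis unfolding e by (simp add: Suc)
  qed
  ultimately show ?thesis using gs by blast
qed

text \<open>If Tor in degree i - 1 of the submodule vanishes, classes of the quotient come from the
  middle term; for i = 0 there is no condition. The class is carried to the cone, corrected there
  until it lies in G, and carried back.\<close>

lemma Tor_exact_right:
  assumes s: "ses K Q N \<iota> \<pi>" and S: "res K S DS \<eta>S" and G: "res Q G DG \<eta>G" and P: "res N P D \<eta>"
    and \<rho>: "cm G DG P D \<rho>"
    and aug\<rho>: "\<And>X x. Ob X \<Longrightarrow> x \<in> cr (G 0) X \<Longrightarrow> \<eta> X (\<rho> 0 X x) = \<pi> X (\<eta>G X x)"
    and T: "\<And>j. i = Suc j \<Longrightarrow> TorV S DS j X" and X: "Ob X" and x: "x \<in> cr (P i) X" "D i X x \<in> Pos (P (i - 1)) X"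
  shows "\<exists>g\<in>cr (G i) X. DG i X g \<in> Pos (G (i - 1)) X \<and>
    (\<exists>y\<in>cr (P (Suc i)) X. x - \<rho> i X g - D (Suc i) X y \<in> Pos (P i) X)"
proof -
  obtain \<sigma> where \<sigma>0: "cm S DS G DG \<sigma>" "\<forall>X x. Ob X \<longrightarrow> x \<in> cr (S 0) X \<longrightarrow> \<eta>G X (\<sigma> 0 X x) = \<iota> X (\<eta>S X x)"
    by (rule cm_lift[OF S resD(1)[OF G] sesD(4)[OF s]])
  note \<sigma> = \<sigma>0(1) and aug = \<sigma>0(2)[rule_format]
  let ?C = "coneM G S" and ?D = "coneD DG DS \<sigma>" and ?\<eta> = "\<lambda>X z. \<pi> X (\<eta>G X (fst z))"
  have C: "res N ?C ?D ?\<eta>" by (rule cone_res[OF s S G \<sigma>]) (rule aug)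
  note cG = resD(3)[OF G] and cS = resD(3)[OF S] and cC = resD(3)[OF C] and cP = resD(3)[OF P]
  note mG = cpxD(1)[OF cG] and mS = cpxD(1)[OF cS] and mC = cpxD(1)[OF cC] and mP = cpxD(1)[OF cP]
  have m0: "md (case n of 0 \<Rightarrow> zmod | Suc j \<Rightarrow> S j)" for n by (cases n) (simp_all add: mS md_zmod)
  have in0: "mhom (G n) (?C n) (\<lambda>X x. (x, 0))" for n
    unfolding coneM_def by (rule mhom_pair[OF mhom_id mhom_zero[OF m0]])
  have in1: "mhom (S n) (?C (Suc n)) (\<lambda>X x. (0, x))" for n
    unfolding coneM_def nat.case by (rule mhom_pair[OF mhom_zero[OF mG] mhom_id])
  have pr1: "mhom (?C n) (G n) (\<lambda>X. fst)" for n
    unfolding coneM_def by (rule mhom_fst)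
  have pr2: "mhom (?C (Suc n)) (S n) (\<lambda>X. snd)" for n
    unfolding coneM_def nat.case by (rule mhom_snd)
  have D_in0: "?D n X (g, 0) = (DG n X g, 0)" if "Ob X" for n X g
    using cpxD(4)[OF cG] mhom_simps(1)[OF cmD(1)[OF \<sigma>] mS that] mhom_simps(1)[OF cpxD(2)[OF cS] mS that]
    by (cases n) (simp_all add: coneD_def zero_prod_def)
  obtain F where F0: "cm P D ?C ?D F" "\<forall>X x. Ob X \<longrightarrow> x \<in> cr (P 0) X \<longrightarrow> ?\<eta> X (F 0 X x) = \<eta> X x"
    by (rule cm_lift[OF P resD(1)[OF C] mhom_id])
  note F = F0(1) F0(2)[rule_format]
  obtain J where J0: "cm ?C ?D P D J" "\<forall>X x. Ob X \<longrightarrow> x \<in> cr (?C 0) X \<longrightarrow> \<eta> X (J 0 X x) = ?\<eta> X x"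
    by (rule cm_lift[OF C resD(1)[OF P] mhom_id])
  note J = J0(1) J0(2)[rule_format]
  let ?z = "F i X x"
  have z: "?z \<in> cr (?C i) X" by (rule mhomD(1)[OF cmD(1)[OF F(1)] X x(1)])
  have Dz: "?D i X ?z \<in> Pos (?C (i - 1)) X"
    using Pos_hom[OF x(2) cmD(1)[OF F(1)] mP X] cm_comm[OF F(1) cP cC X x(1)] by simp
  \<comment> \<open>The second coordinate of the cycle is a cycle of S, hence a boundary modulo the
    ideal. Adding the boundary of (0, t) moves the cycle into the first factor up to an error p in
    the ideal.\<close>
  have "\<exists>g w p. g \<in> cr (G i) X \<and> w \<in> cr (?C (Suc i)) X \<and> p \<in> Pos (?C i) X \<and>
      ?z + ?D (Suc i) X w = (g, 0) + p"
  proof (cases i)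
    case 0
    obtain g where "?z = (g, 0)" "g \<in> cr (G 0) X" using z 0 by (auto simp: coneM_def cr_prd zmod_def)
    then show ?thesis
      using 0 md_sgrp(1)[OF mC X] Pos.zero[of "?C 0" X] mhom_simps(1)[OF cpxD(2)[OF cC] mC X]
      by (intro exI[of _ g] exI[of _ 0]) auto
  next
    case (Suc j)
    obtain g s where gs: "?z = (g, s)" "g \<in> cr (G i) X" "s \<in> cr (S j) X"
      using z by (auto simp: Suc coneM_def cr_prd)
    have "DS j X s \<in> Pos (S (j - 1)) X"
    proof (cases j)
      case 0
      then show ?thesis by (simp add: cpxD(4)[OF cS] Pos.zero)
    next
      case (Suc k)
      have "snd (?D i X ?z) \<in> Pos (S k) X"
        by (rule Pos_hom[OF _ pr2 mC X]) (use Dz \<open>i = Suc j\<close> Suc in simp)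
      then have "- DS j X s \<in> Pos (S k) X" using gs \<open>i = Suc j\<close> by (simp add: coneD_def)
      then show ?thesis using Pos_uminus[OF _ mS] Suc by fastforce
    qed
    then obtain t where t: "t \<in> cr (S (Suc j)) X" "s - DS (Suc j) X t \<in> Pos (S j) X"
      using T[OF Suc] gs(3) unfolding TorV_def by blast
    note \<sigma>t = mhomD(1)[OF cmD(1)[OF \<sigma>] X t(1)]
    have "(0, t) \<in> cr (?C (Suc i)) X" using mhomD(1)[OF in1 X t(1)] Suc by simp
    moreover have "g + \<sigma> i X t \<in> cr (G i) X" using md_sgrp(4)[OF mG X gs(2)] \<sigma>t Suc by simp
    moreover have "(0, s - DS (Suc j) X t) \<in> Pos (?C i) X"
      using Pos_hom[OF t(2) in1 mS X] Suc by simp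
    moreover have "?z + ?D (Suc i) X (0, t) = (g + \<sigma> i X t, 0) + (0, s - DS (Suc j) X t)"
      unfolding gs(1) using mhom_simps(1)[OF cpxD(2)[OF cG] mG X] Suc by (simp add: coneD_def)
    ultimately show ?thesis by blast
  qed
  then obtain g w p where g: "g \<in> cr (G i) X" and w: "w \<in> cr (?C (Suc i)) X" and p: "p \<in> Pos (?C i) X"
    and eq: "?z + ?D (Suc i) X w = (g, 0) + p" by blast
  have g': "(g, 0) \<in> cr (?C i) X" by (rule mhomD(1)[OF in0 X g])
  have p': "p \<in> cr (?C i) X" by (rule Pos_in[OF p mC X])
  have Dw: "?D (Suc i) X w \<in> cr (?C i) X" by (rule mhomD(1)[OF cpxD(3)[OF cC] X w])
  have Dp: "?D i X p \<in> Pos (?C (i - 1)) X" by (rule Pos_hom[OF p cpxD(2)[OF cC] mC X])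
  have zeq: "?z = (g, 0) + p - ?D (Suc i) X w" using eq by (simp add: eq_diff_eq)
  have Dg: "DG i X g \<in> Pos (G (i - 1)) X"
  proof -
    have "?D i X ?z = ?D i X (g, 0) + ?D i X p"
      unfolding zeq using mhom_simps[OF cpxD(2)[OF cC] mC X] g' p' Dw md_sgrp(4)[OF mC X g' p'] cpxD(5)[OF cC X w] by simp
    then have "(DG i X g, 0) \<in> Pos (?C (i - 1)) X"
      using Pos_diff[OF Dz Dp mC] D_in0[OF X] by simp
    then show ?thesis using Pos_hom[OF _ pr1 mC X] by fastforce
  qed
  have Jz: "J i X ?z = J i X (g, 0) + J i X p - D (Suc i) X (J (Suc i) X w)"
    unfolding zeq using mhom_simps[OF cmD(1)[OF J(1)] mC X] g' p' Dw md_sgrp(4)[OF mC X g' p'] cmD(2)[OF J(1) X w] by simp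
  have eq1: "\<eta> X (J 0 X (F 0 X x)) = \<eta> X x" if "Ob X" "x \<in> cr (P 0) X" for X x
    using J(2)[OF that(1) mhomD(1)[OF cmD(1)[OF F(1)] that]] F(2)[OF that] by simp
  \<comment> \<open>The composite of \<open>F\<close> and \<open>J\<close> lifts the identity of
    N.\<close>
  have "\<exists>y\<in>cr (P (Suc i)) X. J i X ?z - x - D (Suc i) X y \<in> Pos (P i) X"
  proof (rule cm_homotopic[where F = "\<lambda>n X x. J n X (F n X x)" and G = "\<lambda>n X x. x"])
    show "cpx P D" by (rule cP)
    show "proj (P n)" for n by (rule resD(4)[OF P])
    show "resn N P D \<eta>" by (rule resD(1)[OF P])
    show "cm P D P D (\<lambda>n X x. J n X (F n X x))" by (rule cm_comp[OF F(1) J(1)])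
    show "cm P D P D (\<lambda>n X x. x)" by (rule cm_id)
  qed (use eq1 X x in simp_all)
  then obtain y1 where y1: "y1 \<in> cr (P (Suc i)) X" "J i X ?z - x - D (Suc i) X y1 \<in> Pos (P i) X"
    by (elim bexE)
  have cin: "cm G DG ?C ?D (\<lambda>n X x. (x, 0))"
    unfolding cm_def using in0 D_in0 by simp
  have eq2: "\<eta> X (J 0 X (x, 0)) = \<eta> X (\<rho> 0 X x)" if "Ob X" "x \<in> cr (G 0) X" for X x
    using J(2)[OF that(1) mhomD(1)[OF in0 that]] aug\<rho>[OF that] by simp
  \<comment> \<open>The restriction of \<open>J\<close> to the first factor and
    \<open>\<rho>\<close> both lift the projection.\<close>
  have "\<exists>y\<in>cr (P (Suc i)) X. J i X (g, 0) - \<rho> i X g - D (Suc i) X y \<in> Pos (P i) X"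
  proof (rule cm_homotopic[where F = "\<lambda>n X x. J n X (x, 0)" and G = "\<rho>"])
    show "cpx G DG" by (rule cG)
    show "proj (G n)" for n by (rule resD(4)[OF G])
    show "resn N P D \<eta>" by (rule resD(1)[OF P])
    show "cm G DG P D (\<lambda>n X x. J n X (x, 0))" by (rule cm_comp[OF cin J(1)])
    show "cm G DG P D \<rho>" by (rule \<rho>)
  qed (use eq2 X g Dg in simp_all)
  then obtain y2 where y2: "y2 \<in> cr (P (Suc i)) X" "J i X (g, 0) - \<rho> i X g - D (Suc i) X y2 \<in> Pos (P i) X"
    by (elim bexE)
  define y where "y = y2 - J (Suc i) X w - y1"
  have Jw: "J (Suc i) X w \<in> cr (P (Suc i)) X" by (rule mhomD(1)[OF cmD(1)[OF J(1)] X w])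
  have y: "y \<in> cr (P (Suc i)) X" unfolding y_def by (intro md_sgrp(2)[OF mP X] y1 y2 Jw)
  have "D (Suc i) X y = D (Suc i) X y2 - D (Suc i) X (J (Suc i) X w) - D (Suc i) X y1"
    unfolding y_def using mhom_simps(4)[OF cpxD(3)[OF cP] mP X] y1(1) y2(1) Jw md_sgrp(2)[OF mP X y2(1) Jw] by simp
  then have e: "x - \<rho> i X g - D (Suc i) X y =
      (J i X (g, 0) - \<rho> i X g - D (Suc i) X y2) - (J i X ?z - x - D (Suc i) X y1) + J i X p"
    unfolding Jz by (simp add: algebra_simps)
  have "x - \<rho> i X g - D (Suc i) X y \<in> Pos (P i) X"
    unfolding e
    by (rule Pos_add[OF Pos_diff[OF y2(2) y1(2) mP] Pos_hom[OF p cmD(1)[OF J(1)] mC X]])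
  then show ?thesis using g Dg y by blast
qed

text \<open>In the long exact sequence Tor_i of the quotient lies between Tor_i of the middle term
  and Tor in degree i - 1 of the submodule.\<close>

lemma TorV_right:
  assumes s: "ses K Q N \<iota> \<pi>" and S: "res K S DS \<eta>S" and G: "res Q G DG \<eta>G" and P: "res N P D \<eta>"
    and TS: "\<And>j. i = Suc j \<Longrightarrow> TorV S DS j X" and TG: "TorV G DG i X" and X: "Ob X"
  shows "TorV P D i X"
  unfolding TorV_def
proof (intro ballI impI)
  fix x assume x: "x \<in> cr (P i) X" "D i X x \<in> Pos (P (i - 1)) X"
  note mG = cpxD(1)[OF resD(3)[OF G]] and mP = cpxD(1)[OF resD(3)[OF P]]
  obtain \<rho> where \<rho>0: "cm G DG P D \<rho>" "\<forall>X x. Ob X \<longrightarrow> x \<in> cr (G 0) X \<longrightarrow> \<eta> X (\<rho> 0 X x) = \<pi> X (\<eta>G X x)"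
    by (rule cm_lift[OF G resD(1)[OF P] sesD(5)[OF s]])
  note \<rho> = \<rho>0(1) \<rho>0(2)[rule_format]
  obtain g y where g: "g \<in> cr (G i) X" "DG i X g \<in> Pos (G (i - 1)) X" and y: "y \<in> cr (P (Suc i)) X"
    and e: "x - \<rho> i X g - D (Suc i) X y \<in> Pos (P i) X"
  proof -
    have "\<exists>g\<in>cr (G i) X. DG i X g \<in> Pos (G (i - 1)) X \<and>
       (\<exists>y\<in>cr (P (Suc i)) X. x - \<rho> i X g - D (Suc i) X y \<in> Pos (P i) X)"
      by (rule Tor_exact_right[OF s S G P \<rho>(1) _ _ X x]) (use \<rho>(2) TS in simp_all)
    then show thesis using that by blast
  qed
  obtain h where h: "h \<in> cr (G (Suc i)) X" "g - DG (Suc i) X h \<in> Pos (G i) X"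
    using TG g unfolding TorV_def by blast
  note Dh = mhomD(1)[OF cpxD(3)[OF resD(3)[OF G]] X h(1)]
  note \<rho>h = mhomD(1)[OF cmD(1)[OF \<rho>(1)] X h(1)]
  have "\<rho> i X g - D (Suc i) X (\<rho> (Suc i) X h) \<in> Pos (P i) X"
    using Pos_hom[OF h(2) cmD(1)[OF \<rho>(1)] mG X] mhom_simps(4)[OF cmD(1)[OF \<rho>(1)] mG X g(1) Dh]
      cmD(2)[OF \<rho>(1) X h(1)] by simp
  from Pos_add[OF e this] have "x - D (Suc i) X (y + \<rho> (Suc i) X h) \<in> Pos (P i) X"
    unfolding mhom_simps(2)[OF cpxD(3)[OF resD(3)[OF P]] mP X y \<rho>h] by (simp add: algebra_simps)
  then show "\<exists>y\<in>cr (P (Suc i)) X. x - D (Suc i) X y \<in> Pos (P i) X"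
    using md_sgrp(4)[OF mP X y \<rho>h] by blast
qed

section \<open>Resolutions of induced modules\<close>

text \<open>Componentwise choice that keeps the support finite: outside the support of p the choice
  is 0, which is admissible by \<open>R0\<close>.\<close>

lemma ind_choice:
  assumes N: "md N" and p: "p \<in> cr (ind E ob N) X" and M: "md M"
    and ex: "\<And>k. k \<in> terms E ob X \<Longrightarrow> \<exists>y\<in>cr M (cok (snd k)). R k (Poly_Mapping.lookup p k) y"
    and R0: "\<And>k. k \<in> terms E ob X \<Longrightarrow> R k 0 0"
  shows "\<exists>q\<in>cr (ind E ob M) X. \<forall>k\<in>terms E ob X. R k (Poly_Mapping.lookup p k) (Poly_Mapping.lookup q k)"
proof -
  define y where "y k = (if k \<in> Poly_Mapping.keys p
    then SOME y. y \<in> cr M (cok (snd k)) \<and> R k (Poly_Mapping.lookup p k) y else 0)" for k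
  have y: "y k \<in> cr M (cok (snd k)) \<and> R k (Poly_Mapping.lookup p k) (y k)" if k: "k \<in> terms E ob X" for k
  proof (cases "k \<in> Poly_Mapping.keys p")
    case True
    then show ?thesis using someI_ex[of "\<lambda>y. y \<in> cr M (cok (snd k)) \<and> R k (Poly_Mapping.lookup p k) y"] ex[OF k]
      by (auto simp: y_def)
  next
    case False
    then show ?thesis using R0[OF k] sgrpD(1)[OF terms_sgrp[OF M k]] by (simp add: y_def in_keys_iff)
  qed
  have fin: "finite {k. y k \<noteq> 0}"
    by (rule finite_subset[of _ "Poly_Mapping.keys p"]) (auto simp: y_def)
  define q where "q = Poly_Mapping.Abs_poly_mapping y"
  have lq: "Poly_Mapping.lookup q = y" unfolding q_def using fin by simp
  have "q \<in> cr (ind E ob M) X"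
    using p y by (auto simp: cr_ind dsum_def lq in_keys_iff y_def split: if_splits)
  then show ?thesis using y by (intro bexI[of _ q] ballI) (simp_all only: lq)
qed

lemma ind_eqI_lookup:
  assumes "p \<in> cr (ind E ob M) X" "q \<in> cr (ind E ob M) X"
    "\<And>k. k \<in> terms E ob X \<Longrightarrow> Poly_Mapping.lookup p k = Poly_Mapping.lookup q k"
  shows "p = q"
  by (rule poly_mapping_eqI) (metis assms lookup_ind_0)

lemma ind_im:
  assumes M: "md M" and N: "md N" and f: "mhom M N f" and p: "p \<in> cr (ind E ob N) X"
    and ex: "\<And>k. k \<in> terms E ob X \<Longrightarrow> \<exists>y\<in>cr M (cok (snd k)). f (cok (snd k)) y = Poly_Mapping.lookup p k"
    and X: "Ob X"
  shows "\<exists>q\<in>cr (ind E ob M) X. indmap f q = p"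
proof -
  have ob: "Ob (cok (snd k))" if "k \<in> terms E ob X" for k using that by (auto simp: terms_def hom_ob)
  have "\<exists>q\<in>cr (ind E ob M) X. \<forall>k\<in>terms E ob X. f (cok (snd k)) (Poly_Mapping.lookup q k) = Poly_Mapping.lookup p k"
    by (rule ind_choice[OF N p M, where R = "\<lambda>k x y. f (cok (snd k)) y = x"])
      (fact ex, rule mhom_simps(1)[OF f M ob])
  then obtain q where q0: "q \<in> cr (ind E ob M) X"
    "\<forall>k\<in>terms E ob X. f (cok (snd k)) (Poly_Mapping.lookup q k) = Poly_Mapping.lookup p k" by (elim bexE)
  note q = q0(1) q0(2)[rule_format]
  have "indmap f q = p"
    by (rule ind_eqI_lookup[OF mhomD(1)[OF indmap_mhom[OF M N f] X q(1)] p])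
      (simp add: lookup_indmap[OF M f q(1)] q(2))
  then show ?thesis using q by blast
qed

text \<open>An induced module is a direct sum of values of the given one, so exactness can be
  checked in each component, at the complement of the term.\<close>

lemma ind_resn:
  assumes "resn N P D \<eta>"
  shows "resn (ind E ob N) (\<lambda>n. ind E ob (P n)) (\<lambda>n X. indmap (D n)) (\<lambda>X. indmap \<eta>)"
proof -
  note a = resnD(1)[OF assms]
  note c = acpxD(1)[OF a]
  note mP = cpxD(1)[OF c] and h\<eta> = acpxD(3)[OF a] and mN = acpxD(2)[OF a]
  have ob: "Ob (cok (snd k))" if "k \<in> terms E ob X" for k X using that by (auto simp: terms_def hom_ob)
  have lk: "Poly_Mapping.lookup p k \<in> cr M (cok (snd k))" if "md M" "p \<in> cr (ind E ob M) X" "k \<in> terms E ob X"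
    for p M k X by (rule lookup_ind[OF that])
  note lD = lookup_indmap[OF mP cpxD(2)[OF c]] and lDS = lookup_indmap[OF mP cpxD(3)[OF c]]
    and l\<eta> = lookup_indmap[OF mP h\<eta>]
  have hD: "mhom (ind E ob (P (Suc n))) (ind E ob (P n)) (\<lambda>X. indmap (D (Suc n)))" for n
    by (rule indmap_mhom[OF mP mP cpxD(3)[OF c]])
  have hD1: "mhom (ind E ob (P 1)) (ind E ob (P 0)) (\<lambda>X. indmap (D 1))" using hD[of 0] by simp
  have D0: "indmap (D 0) = (\<lambda>x. 0)" by (simp add: indmap_def lin_def cpxD(4)[OF c] split_def fun_eq_iff)
  have DD: "indmap (D n) (indmap (D (Suc n)) x) = 0" if "Ob X" "x \<in> cr (ind E ob (P (Suc n))) X" for n X x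
    by (rule ind_eqI_lookup[OF mhomD(1)[OF indmap_mhom[OF mP mP cpxD(2)[OF c]] that(1) mhomD(1)[OF hD that]]
          md_sgrp(1)[OF ind_md[OF mP] that(1)]])
      (simp add: lD[OF mhomD(1)[OF hD that]] lDS[OF that(2)] cpxD(5)[OF c ob lk[OF mP that(2)]])
  have e1: "indmap \<eta> (indmap (D 1) x) = 0" if X: "Ob X" and x: "x \<in> cr (ind E ob (P 1)) X" for X x
  proof -
    have x': "x \<in> cr (ind E ob (P (Suc 0))) X" using x by simp
    show ?thesis
      by (rule ind_eqI_lookup[OF mhomD(1)[OF indmap_mhom[OF mP mN h\<eta>] X mhomD(1)[OF hD1 X x]]
            md_sgrp(1)[OF ind_md[OF mN] X]])
        (simp add: l\<eta>[OF mhomD(1)[OF hD X x']] lDS[OF x'] acpxD(4)[OF a ob lk[OF mP x], unfolded One_nat_def])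
  qed
  have e2: "\<exists>x\<in>cr (ind E ob (P 0)) X. indmap \<eta> x = z" if X: "Ob X" and z: "z \<in> cr (ind E ob N) X" for X z
    by (rule ind_im[OF mP mN h\<eta> z resnD(2)[OF assms ob lk[OF mN z]] X])
  have e3: "\<exists>y\<in>cr (ind E ob (P 1)) X. indmap (D 1) y = x"
    if X: "Ob X" and x: "x \<in> cr (ind E ob (P 0)) X" and z: "indmap \<eta> x = 0" for X x
  proof (rule ind_im[OF mP mP cpxD(3)[OF c, of 0, folded One_nat_def] x _ X])
    fix k assume k: "k \<in> terms E ob X"
    have "\<eta> (cok (snd k)) (Poly_Mapping.lookup x k) = 0" using l\<eta>[OF x k] z by simp
    then show "\<exists>y\<in>cr (P 1) (cok (snd k)). D 1 (cok (snd k)) y = Poly_Mapping.lookup x k"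
      by (rule resnD(3)[OF assms ob[OF k] lk[OF mP x k]])
  qed
  have e4: "\<exists>y\<in>cr (ind E ob (P (Suc (Suc n)))) X. indmap (D (Suc (Suc n))) y = x"
    if X: "Ob X" and x: "x \<in> cr (ind E ob (P (Suc n))) X" and z: "indmap (D (Suc n)) x = 0" for X x n
  proof (rule ind_im[OF mP mP cpxD(3)[OF c] x _ X])
    fix k assume k: "k \<in> terms E ob X"
    have "D (Suc n) (cok (snd k)) (Poly_Mapping.lookup x k) = 0" using lDS[OF x k] z by simp
    then show "\<exists>y\<in>cr (P (Suc (Suc n))) (cok (snd k)). D (Suc (Suc n)) (cok (snd k)) y = Poly_Mapping.lookup x k"
      by (rule resnD(4)[OF assms ob[OF k] lk[OF mP x k]])
  qed
  have "cpx (\<lambda>n. ind E ob (P n)) (\<lambda>n X. indmap (D n))"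
    unfolding cpx_def
  proof (intro conjI allI impI)
    show "md (ind E ob (P n))" for n by (rule ind_md[OF mP])
    show "mhom (ind E ob (P n)) (ind E ob (P (n - 1))) (\<lambda>X. indmap (D n))" for n
      by (rule indmap_mhom[OF mP mP cpxD(2)[OF c]])
    show "(\<lambda>X. indmap (D 0)) = (\<lambda>X x. 0)" by (simp add: D0)
  qed (rule DD)
  then have "acpx (ind E ob N) (\<lambda>n. ind E ob (P n)) (\<lambda>n X. indmap (D n)) (\<lambda>X. indmap \<eta>)"
    unfolding acpx_def using ind_md[OF mN] indmap_mhom[OF mP mN h\<eta>] e1 by blast
  then show ?thesis
    unfolding resn_def using e2 e3 e4 by blast
qed

lemma ind_res:
  "res N P D \<eta> \<Longrightarrow> res (ind E ob N) (\<lambda>n. ind E ob (P n)) (\<lambda>n X. indmap (D n)) (\<lambda>X. indmap \<eta>)"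
  unfolding res_def using ind_resn proj_ind by blast

text \<open>Tor commutes with induction: by \<open>Pos_ind\<close> both the cycle condition and the
  boundary condition split over the components, so vanishing at all complements of terms over X is
  enough.\<close>

lemma TorV_ind:
  assumes P: "cpx P D" and X: "Ob X" and T: "\<And>k. k \<in> terms E ob X \<Longrightarrow> TorV P D i (cok (snd k))"
  shows "TorV (\<lambda>n. ind E ob (P n)) (\<lambda>n X. indmap (D n)) i X"
  unfolding TorV_def
proof (intro ballI impI)
  note mP = cpxD(1)[OF P] and hD = cpxD(2)[OF P]
  fix x assume x: "x \<in> cr (ind E ob (P i)) X" and "indmap (D i) x \<in> Pos (ind E ob (P (i - 1))) X"
  then have 0: "Poly_Mapping.lookup (indmap (D i) x) k \<in> Pos (P (i - 1)) (cok (snd k))" if "k \<in> terms E ob X" for k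
    using Pos_ind[OF mP mhomD(1)[OF indmap_mhom[OF mP mP hD] X x]] that by blast
  have c: "D i (cok (snd k)) (Poly_Mapping.lookup x k) \<in> Pos (P (i - 1)) (cok (snd k))" if "k \<in> terms E ob X" for k
    using 0[OF that] unfolding lookup_indmap[OF mP hD x that] .
  have ob: "Ob (cok (snd k))" if "k \<in> terms E ob X" for k using that by (auto simp: terms_def hom_ob)
  have "\<exists>y\<in>cr (ind E ob (P (Suc i))) X. \<forall>k\<in>terms E ob X.
      Poly_Mapping.lookup x k - D (Suc i) (cok (snd k)) (Poly_Mapping.lookup y k) \<in> Pos (P i) (cok (snd k))"
  proof (rule ind_choice[OF mP x mP, where R = "\<lambda>k x y. x - D (Suc i) (cok (snd k)) y \<in> Pos (P i) (cok (snd k))"])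
    fix k assume k: "k \<in> terms E ob X"
    show "\<exists>y\<in>cr (P (Suc i)) (cok (snd k)). Poly_Mapping.lookup x k - D (Suc i) (cok (snd k)) y \<in> Pos (P i) (cok (snd k))"
      using T[OF k] c[OF k] lookup_ind[OF mP x k] unfolding TorV_def by blast
    show "0 - D (Suc i) (cok (snd k)) 0 \<in> Pos (P i) (cok (snd k))"
      using mhom_simps(1)[OF hD mP ob[OF k]] by (simp add: Pos.zero)
  qed
  then obtain y where y: "y \<in> cr (ind E ob (P (Suc i))) X" and e: "\<And>k. k \<in> terms E ob X \<Longrightarrow>
      Poly_Mapping.lookup x k - D (Suc i) (cok (snd k)) (Poly_Mapping.lookup y k) \<in> Pos (P i) (cok (snd k))"
    by (elim bexE) simp
  note hDS = cpxD(3)[OF P, of i]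
  have Dy: "indmap (D (Suc i)) y \<in> cr (ind E ob (P i)) X" by (rule mhomD(1)[OF indmap_mhom[OF mP mP hDS] X y])
  have "x - indmap (D (Suc i)) y \<in> Pos (ind E ob (P i)) X"
    using Pos_ind[OF mP md_sgrp(2)[OF ind_md[OF mP] X x Dy]] e
    by (simp add: lookup_minus lookup_indmap[OF mP hDS y])
  then show "\<exists>y\<in>cr (ind E ob (P (Suc i))) X. x - indmap (D (Suc i)) y \<in> Pos (ind E ob (P i)) X"
    using y by blast
qed

end

section \<open>Left exactness of Tor and graded Nakayama\<close>

context gring
begin

text \<open>A is a retract of the free module on one generator over the zero object, by way of the
  component of \<open>zm X\<close>.\<close>

lemma proj_A: "proj A"
proof -
  let ?I = "ind {()} (\<lambda>_. zr) A"
  have zt: "((), zm X) \<in> terms {()} (\<lambda>_. zr) X" if "Ob X" for X using zm(1)[OF that] by (simp add: terms_def)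
  have i: "mhom A ?I (\<lambda>X. Poly_Mapping.single ((), zm X))"
    unfolding phom_def
  proof (intro conjI allI impI ballI)
    fix X x assume "Ob X" "x \<in> cr A X"
    then show "Poly_Mapping.single ((), zm X) x \<in> cr ?I X"
      using single_ind[OF A_md zt] zm(2) by simp
  next
    fix X show "additive_on (cr A X) (Poly_Mapping.single ((), zm X))" by (rule additive_on_single)
  next
    fix Y X t a x assume t: "t \<in> Hom Y X" and a: "a \<in> cr A (cok t)" and x: "x \<in> cr A Y"
    show "Poly_Mapping.single ((), zm X) (ac A t a x) = ac ?I t a (Poly_Mapping.single ((), zm Y) x)"
      by (simp add: ac_ind_single[OF A_md zm(1)[OF hom_ob(1)[OF t]] t a] cmp_zm[OF t] push_zm[OF t])
  qed
  have r: "mhom ?I A (\<lambda>X. ev A (\<lambda>_. un))" by (rule ev_mhom[OF A_md]) (simp add: un)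
  show ?thesis
    by (rule proj_retract[OF proj_ind_A A_md i r])
      (simp add: ev_single[OF A_md zm(1)] un unit_z)
qed

lemma Ap_Pos: "Ob X \<Longrightarrow> a \<in> Ap X \<Longrightarrow> a \<in> Pos A X"
  using Pos_ac[OF zm(1), of X a un A] zm(2)[of X] un unit_z[OF _ Ap] by simp

text \<open>If Tor in degree i + 1 of the quotient vanishes, the map on Tor_i induced by the
  inclusion is injective. It is stated for chains with image in the ideal, which is how it will be
  applied. The chain (0, x) is then a cycle of the cone modulo the ideal.\<close>

lemma Tor_exact_left:
  assumes s: "ses K Q N \<iota> \<pi>" and S: "res K S DS \<eta>S" and G: "res Q G DG \<eta>G" and P: "res N P D \<eta>"
    and \<sigma>: "cm S DS G DG \<sigma>"
    and aug: "\<And>X x. Ob X \<Longrightarrow> x \<in> cr (S 0) X \<Longrightarrow> \<eta>G X (\<sigma> 0 X x) = \<iota> X (\<eta>S X x)"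
    and T: "TorV P D (Suc i) X" and X: "Ob X" and x: "x \<in> cr (S i) X" "DS i X x \<in> Pos (S (i - 1)) X"
    and \<sigma>x: "\<sigma> i X x \<in> Pos (G i) X"
  shows "\<exists>y\<in>cr (S (Suc i)) X. x - DS (Suc i) X y \<in> Pos (S i) X"
proof -
  let ?C = "coneM G S" and ?D = "coneD DG DS \<sigma>"
  have C: "res N ?C ?D (\<lambda>X z. \<pi> X (\<eta>G X (fst z)))" by (rule cone_res[OF s S G \<sigma>]) (rule aug)
  note mG = cpxD(1)[OF resD(3)[OF G]] and mS = cpxD(1)[OF resD(3)[OF S]] and mC = cpxD(1)[OF resD(3)[OF C]]
  have TC: "TorV ?C ?D (Suc i) X" by (rule TorV_transfer[OF C P X T])
  have m0: "md (case n of 0 \<Rightarrow> zmod | Suc j \<Rightarrow> S j)" for n by (cases n) (simp_all add: mS md_zmod)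
  have in0: "mhom (G n) (?C n) (\<lambda>X x. (x, 0))" for n
    unfolding coneM_def by (rule mhom_pair[OF mhom_id mhom_zero[OF m0]])
  have in1: "mhom (S n) (?C (Suc n)) (\<lambda>X x. (0, x))" for n
    unfolding coneM_def nat.case by (rule mhom_pair[OF mhom_zero[OF mG] mhom_id])
  have pr2: "mhom (?C (Suc n)) (S n) (\<lambda>X. snd)" for n
    unfolding coneM_def nat.case by (rule mhom_snd)
  have z: "(0, x) \<in> cr (?C (Suc i)) X" by (rule mhomD(1)[OF in1 X x(1)])
  have e: "?D (Suc i) X (0, x) = (\<sigma> i X x, 0) + (0, - DS i X x)"
    using mhom_simps(1)[OF cpxD(2)[OF resD(3)[OF G]] mG X] by (simp add: coneD_def)
  have e0: "(0, - DS i X x) \<in> Pos (?C i) X"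
  proof (cases i)
    case 0
    then show ?thesis using Pos.zero[of "?C 0" X] by (simp add: cpxD(4)[OF resD(3)[OF S]] zero_prod_def)
  next
    case (Suc j)
    show ?thesis using Pos_hom[OF Pos_uminus[OF x(2) mS] in1 mS X] Suc by simp
  qed
  have "?D (Suc i) X (0, x) \<in> Pos (?C (Suc i - 1)) X"
    unfolding e diff_Suc_1 by (rule Pos_add[OF Pos_hom[OF \<sigma>x in0 mG X] e0])
  then obtain w where w: "w \<in> cr (?C (Suc (Suc i))) X" "(0, x) - ?D (Suc (Suc i)) X w \<in> Pos (?C (Suc i)) X"
    using TC z unfolding TorV_def by blast
  have sw: "snd w \<in> cr (S (Suc i)) X" using w(1) by (auto simp: coneM_def cr_prd)
  have "snd ((0, x) - ?D (Suc (Suc i)) X w) \<in> Pos (S i) X" by (rule Pos_hom[OF w(2) pr2 mC X])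
  then have "x - DS (Suc i) X (- snd w) \<in> Pos (S i) X"
    using mhom_simps(3)[OF cpxD(2)[OF resD(3)[OF S]] mS X sw] by (simp add: coneD_def)
  then show ?thesis using md_sgrp(3)[OF mS X sw] by blast
qed

text \<open>Graded Nakayama: M has all generators and M' those up to degree d, and both map to L.
  Above degree d the image of M consists of sums of products with the ideal, whose second factors
  come from smaller degree, so induction on the degree shows that M' reaches the same image.\<close>

lemma nakayama_step:
  assumes M: "md M" "md M'" "md L" and b: "mhom M L b" "mhom M' L b"
    and small: "\<And>X p. Ob X \<Longrightarrow> dm X \<le> d \<Longrightarrow> p \<in> cr M X \<Longrightarrow> \<exists>p'\<in>cr M' X. b X p' = b X p"
    and big: "\<And>X p. Ob X \<Longrightarrow> d < dm X \<Longrightarrow> p \<in> cr M X \<Longrightarrow> \<exists>w\<in>Pos M X. b X w = b X p"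
    and X: "Ob X" and p: "p \<in> cr M X"
  shows "\<exists>p'\<in>cr M' X. b X p' = b X p"
  using X p
proof (induction "dm X" arbitrary: X p rule: less_induct)
  case less
  show ?case
  proof (cases "dm X \<le> d")
    case True
    then show ?thesis using small less.prems by blast
  next
    case False
    obtain w where w: "w \<in> Pos M X" "b X w = b X p" using big[OF less.prems(1) _ less.prems(2)] False by auto
    have "\<exists>p'\<in>cr M' X. b X p' = b X w"
      using w(1)
    proof (induction rule: Pos.induct)
      case zero
      then show ?case using mhom_simps(1)[OF b(1) M(1) less.prems(1)] mhom_simps(1)[OF b(2) M(2) less.prems(1)]
        md_sgrp(1)[OF M(2) less.prems(1)] by (intro bexI[of _ 0]) auto
    next
      case (step t Y a x y)
      obtain p' where p': "p' \<in> cr M' X" "b X p' = b X y" using step.IH by blast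
      note a = Ap[OF hom_ob(3)[OF step(1)] step(2)]
      note x = step(3)
      have e: "b X (ac M t a x + y) = ac L t a (b Y x) + b X y"
        using mhom_simps(2)[OF b(1) M(1) less.prems(1) mdD(2)[OF M(1) step(1) a x] Pos_in[OF step(4) M(1) less.prems(1)]]
          mhomD(3)[OF b(1) step(1) a x] by simp
      \<comment> \<open>The ideal vanishes in degree 0. So either the product is 0, or the
        complement has positive degree and Y is strictly smaller than X.\<close>
      show ?case
      proof (cases "dm (cok t) = 0")
        case True
        then have "a = 0" using Ap_0[OF hom_ob(3)[OF step(1)] _ step(2)] by simp
        then have "ac L t a (b Y x) = 0"
          using additive_onD(1)[OF mdD(4)[OF M(3) step(1) mhomD(1)[OF b(1) hom_ob(1)[OF step(1)] x]]
              mdD(1)[OF A_md hom_ob(3)[OF step(1)]]] by simp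
        then show ?thesis using e p' by auto
      next
        case False
        then have "dm Y < dm X" using dm[OF step(1)] by simp
        then obtain q where q: "q \<in> cr M' Y" "b Y q = b Y x" using less.hyps hom_ob(1)[OF step(1)] x by blast
        note aq = mdD(2)[OF M(2) step(1) a q(1)]
        have "b X (ac M' t a q + p') = ac L t a (b Y x) + b X y"
          using mhom_simps(2)[OF b(2) M(2) less.prems(1) aq p'(1)] mhomD(3)[OF b(2) step(1) a q(1)] q(2) p'(2) by simp
        then show ?thesis using e md_sgrp(4)[OF M(2) less.prems(1) aq p'(1)] by (intro bexI[of _ "ac M' t a q + p'"]) auto
      qed
    qed
    then show ?thesis using w(2) by simp
  qed
qed

text \<open>If every generator has degree below that of X, every coefficient has positive degree and
  so lies in the ideal.\<close>

lemma ind_all_Pos: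
  assumes E: "\<And>e. e \<in> E \<Longrightarrow> dm (ob e) < dm X" and p: "p \<in> cr (ind E ob A) X"
  shows "p \<in> Pos (ind E ob A) X"
  unfolding Pos_ind[OF A_md p]
proof
  fix k assume k: "k \<in> terms E ob X"
  obtain e t where et: "k = (e, t)" by fastforce
  note t = termsD(2)[OF k[unfolded et]] and e = termsD(1)[OF k[unfolded et]]
  have "dm (cok t) \<noteq> 0" using dm[OF t] E[OF e] by auto
  then show "Poly_Mapping.lookup p k \<in> Pos A (cok (snd k))"
    using lookup_ind[OF A_md p k] Ap_Pos[OF hom_ob(3)[OF t] Ap_pos[OF hom_ob(3)[OF t]]] by (simp add: et)
qed

end

section \<open>Canonical resolutions and bounds on the degrees of generators\<close>

text \<open>One type \<open>'s\<close> names the generators of all homological degrees, because all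
  terms of a complex have the same element type. Each name carries its object, the element
  \<open>d0\<close> of N that it hits when used in degree 0, and the combination \<open>d1\<close>
  of names that it hits when used in a later degree. The surjectivity assumptions say that there are
  enough names.\<close>

locale canres = gring Ob Hom cmp idm cok push zr zm dm A un Ap
  for Ob :: "'x \<Rightarrow> bool" and Hom :: "'x \<Rightarrow> 'x \<Rightarrow> 't set" and cmp idm cok push zr zm dm
    and A :: "('x, 't, 'a::ab_group_add, 'a) md" and un Ap +
  fixes N :: "('x, 't, 'a, 'n::ab_group_add) md" and ob :: "'s \<Rightarrow> 'x" and d0 :: "'s \<Rightarrow> 'n"
    and d1 :: "'s \<Rightarrow> ('s \<times> 't) \<Rightarrow>\<^sub>0 'a"
  assumes N_md: "md N"
    and d0_surj: "Ob Y \<Longrightarrow> y \<in> cr N Y \<Longrightarrow> \<exists>s. ob s = Y \<and> d0 s = y"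
    and d1_surj: "Ob Y \<Longrightarrow> z \<in> cr (ind UNIV ob A) Y \<Longrightarrow> \<exists>s. ob s = Y \<and> d1 s = z"
begin

text \<open>One map serves as differential in all positive degrees, since a name already carries its
  image.\<close>

definition \<delta> :: "('s \<times> 't \<Rightarrow>\<^sub>0 'a) \<Rightarrow> 's \<times> 't \<Rightarrow>\<^sub>0 'a" where "\<delta> = ev (ind UNIV ob A) d1"

text \<open>The condition on an element of the n-th term to be a cycle, with the augmentation as
  differential in degree 0.\<close>

definition nul :: "nat \<Rightarrow> ('s \<times> 't \<Rightarrow>\<^sub>0 'a) \<Rightarrow> bool" where
  "nul n z \<longleftrightarrow> (if n = 0 then ev N d0 z = 0 else \<delta> z = 0)"

text \<open>The generators of the \<open>n\<close>-th module: all elements of the \<open>n\<close>-th syzygy that lie over an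
  object allowed by \<open>\<beta> n\<close>.\<close>

primrec E :: "(nat \<Rightarrow> 'x \<Rightarrow> bool) \<Rightarrow> nat \<Rightarrow> 's set" where
  "E \<beta> 0 = {s. \<beta> 0 (ob s) \<and> Ob (ob s) \<and> d0 s \<in> cr N (ob s)}"
| "E \<beta> (Suc n) = {s. \<beta> (Suc n) (ob s) \<and> Ob (ob s) \<and> d1 s \<in> cr (ind (E \<beta> n) ob A) (ob s) \<and> nul n (d1 s)}"

definition P where "P \<beta> n = ind (E \<beta> n) ob A"

definition D :: "nat \<Rightarrow> 'x \<Rightarrow> ('s \<times> 't \<Rightarrow>\<^sub>0 'a) \<Rightarrow> 's \<times> 't \<Rightarrow>\<^sub>0 'a" where
  "D n = (case n of 0 \<Rightarrow> \<lambda>X x. 0 | Suc m \<Rightarrow> \<lambda>X. \<delta>)"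

lemma md_P: "md (P \<beta> n)" unfolding P_def by (rule ind_md[OF A_md])

lemma \<delta>_eq: "ev (ind E' ob A) d1 = \<delta>" by (simp add: \<delta>_def ev_def ac_ind)

lemma \<delta>_hom: "mhom (P \<beta> (Suc n)) (P \<beta> n) (\<lambda>X. \<delta>)"
  unfolding P_def \<delta>_eq[of "E \<beta> n", symmetric] by (rule ev_mhom[OF ind_md[OF A_md]]) simp

lemma \<eta>_hom: "mhom (P \<beta> 0) N (\<lambda>X. ev N d0)"
  unfolding P_def by (rule ev_mhom[OF N_md]) simp

lemma nul_\<delta>:
  assumes X: "Ob X" and p: "p \<in> cr (P \<beta> (Suc n)) X"
  shows "nul n (\<delta> p)"
proof -
  \<comment> \<open>The target is kept general because it is N for the augmentation and a free
    module for the differential.\<close>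
  have g: "f X (\<delta> p) = 0" if f: "mhom (P \<beta> n) L f" and L: "md L"
    and 0: "\<And>Y s. s \<in> E \<beta> (Suc n) \<Longrightarrow> f (ob s) (d1 s) = 0" for L :: "('x, 't, 'a, 'l::ab_group_add) md" and f
  proof -
    have "f X (ev (ind (E \<beta> n) ob A) d1 p) = 0"
    proof (rule mhom_ind_eqI[OF A_md mhom_comp[OF \<delta>_hom[unfolded P_def, folded \<delta>_eq[of "E \<beta> n"]] f[unfolded P_def]]
            mhom_zero[OF L] X p[unfolded P_def]])
      fix s t a assume st: "(s, t) \<in> terms (E \<beta> (Suc n)) ob X" and a: "a \<in> cr A (cok t)"
      note t = termsD(2)[OF st]
      have d: "d1 s \<in> cr (ind (E \<beta> n) ob A) (ob s)" using termsD(1)[OF st] by simp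
      show "f X (ev (ind (E \<beta> n) ob A) d1 (Poly_Mapping.single (s, t) a)) = 0"
        using ev_single[where n = d1 and e = s, OF ind_md[OF A_md] t d] mhomD(3)[OF f[unfolded P_def] t a d] 0[OF termsD(1)[OF st]]
          md_ac_simps(1)[OF L t a] by simp
    qed
    then show ?thesis by (simp add: \<delta>_eq)
  qed
  show ?thesis
  proof (cases n)
    case 0
    have "ev N d0 (\<delta> p) = 0"
      by (rule g[OF _ N_md]) (use \<eta>_hom 0 in \<open>auto simp: nul_def\<close>)
    then show ?thesis using 0 by (simp add: nul_def)
  next
    case (Suc m)
    have "\<delta> (\<delta> p) = 0"
      by (rule g[OF _ md_P[of \<beta> m]]) (use \<delta>_hom Suc in \<open>auto simp: nul_def\<close>)
    then show ?thesis using Suc by (simp add: nul_def)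
  qed
qed

text \<open>Exactness at the spot that the generators of degree n have to cover: at N for n = 0, at
  the term n - 1 otherwise.\<close>

definition bsurj :: "(nat \<Rightarrow> 'x \<Rightarrow> bool) \<Rightarrow> nat \<Rightarrow> bool" where
  "bsurj \<beta> n \<longleftrightarrow> (case n of
     0 \<Rightarrow> \<forall>X z. Ob X \<longrightarrow> z \<in> cr N X \<longrightarrow> (\<exists>p\<in>cr (P \<beta> 0) X. ev N d0 p = z)
   | Suc m \<Rightarrow> \<forall>X z. Ob X \<longrightarrow> z \<in> cr (P \<beta> m) X \<longrightarrow> nul m z \<longrightarrow> (\<exists>p\<in>cr (P \<beta> (Suc m)) X. \<delta> p = z))"

lemma res_canonical:
  assumes "\<And>n. bsurj \<beta> n"
  shows "res N (P \<beta>) D (\<lambda>X. ev N d0)"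
proof -
  have s0: "\<exists>p\<in>cr (P \<beta> 0) X. ev N d0 p = z" if "Ob X" "z \<in> cr N X" for X z
    using assms[of 0] that unfolding bsurj_def by simp
  have s1: "\<exists>p\<in>cr (P \<beta> (Suc m)) X. \<delta> p = z" if "Ob X" "z \<in> cr (P \<beta> m) X" "nul m z" for X z m
    using assms[of "Suc m"] that unfolding bsurj_def by simp
  have "cpx (P \<beta>) D"
    unfolding cpx_def
  proof (intro conjI allI impI)
    show "md (P \<beta> n)" for n by (rule md_P)
    show "mhom (P \<beta> n) (P \<beta> (n - 1)) (D n)" for n
      by (cases n) (simp_all add: D_def mhom_zero[OF md_P] \<delta>_hom)
    show "D 0 = (\<lambda>X x. 0)" by (simp add: D_def)
    show "D n X (D (Suc n) X x) = 0" if "Ob X" "x \<in> cr (P \<beta> (Suc n)) X" for n X x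
      using nul_\<delta>[OF that] by (cases n) (simp_all add: D_def nul_def)
  qed
  moreover have "ev N d0 (D 1 X x) = 0" if "Ob X" "x \<in> cr (P \<beta> 1) X" for X x
    using nul_\<delta>[of X x \<beta> 0] that by (simp add: D_def nul_def)
  moreover have "\<exists>y\<in>cr (P \<beta> 1) X. D 1 X y = x" if "Ob X" "x \<in> cr (P \<beta> 0) X" "ev N d0 x = 0" for X x
    using s1[of X x 0] that by (simp add: D_def nul_def)
  moreover have "\<exists>y\<in>cr (P \<beta> (Suc (Suc n))) X. D (Suc (Suc n)) X y = x"
    if "Ob X" "x \<in> cr (P \<beta> (Suc n)) X" "D (Suc n) X x = 0" for n X x
    using s1[of X x "Suc n"] that by (simp add: D_def nul_def)
  moreover have "proj (P \<beta> n)" for n unfolding P_def by (rule proj_ind_A)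
  ultimately show ?thesis
    unfolding res_def resn_def acpx_def using N_md \<eta>_hom s0 by blast
qed

text \<open>Over an allowed object every element is itself the image of a generator.\<close>

lemma pre_gen0:
  assumes X: "Ob X" and \<beta>: "\<beta> 0 X" and z: "z \<in> cr N X"
  shows "\<exists>p\<in>cr (P \<beta> 0) X. ev N d0 p = z"
proof -
  obtain s where s: "ob s = X" "d0 s = z" using d0_surj[OF X z] by blast
  have "s \<in> E \<beta> 0" using s X \<beta> z by simp
  then show ?thesis
    using gen_in[of s "E \<beta> 0" ob] ev_gen[OF N_md, of ob s d0] s X z unfolding P_def by auto
qed

lemma E_bound: "s \<in> E \<beta> n \<Longrightarrow> \<beta> n (ob s)"
  by (cases n) simp_all

lemma cr_P_UNIV: "p \<in> cr (P \<beta> n) X \<Longrightarrow> p \<in> cr (ind UNIV ob A) X"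
proof -
  assume p: "p \<in> cr (P \<beta> n) X"
  have "Poly_Mapping.lookup p k \<in> cr A (cok (snd k))" if k: "k \<in> terms UNIV ob X" for k
  proof (cases "k \<in> terms (E \<beta> n) ob X")
    case True
    then show ?thesis using lookup_ind[OF A_md p[unfolded P_def]] by blast
  next
    case False
    then show ?thesis using lookup_ind_0[OF p[unfolded P_def] False] sgrpD(1)[OF terms_sgrp[OF A_md k]] by simp
  qed
  moreover have "Poly_Mapping.keys p \<subseteq> terms UNIV ob X" using p by (auto simp: P_def cr_ind dsum_def terms_def)
  ultimately show ?thesis by (simp add: cr_ind dsum_def)
qed

lemma pre_gen1:
  assumes X: "Ob X" and \<beta>: "\<beta> (Suc m) X" and z: "z \<in> cr (P \<beta> m) X" "nul m z"
  shows "\<exists>p\<in>cr (P \<beta> (Suc m)) X. \<delta> p = z"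
proof -
  obtain s where s: "ob s = X" "d1 s = z" using d1_surj[OF X cr_P_UNIV[OF z(1)]] by blast
  have "s \<in> E \<beta> (Suc m)" using s X \<beta> z unfolding P_def by simp
  moreover have "\<delta> (gen ob s) = z"
    using ev_gen[OF ind_md[OF A_md], of ob s d1 UNIV ob] s X cr_P_UNIV[OF z(1)] unfolding \<delta>_def by simp
  ultimately show ?thesis
    using gen_in[of s "E \<beta> (Suc m)" ob] s X unfolding P_def by auto
qed

lemma bsurj_full: "(\<And>X. Ob X \<Longrightarrow> \<beta> n X) \<Longrightarrow> bsurj \<beta> n"
  unfolding bsurj_def by (cases n) (simp_all add: pre_gen0 pre_gen1)

lemma E_cong: "(\<And>m. m \<le> n \<Longrightarrow> \<beta> m = \<beta>' m) \<Longrightarrow> E \<beta> n = E \<beta>' n"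
  by (induction n) simp_all

lemma bsurj_cong: "(\<And>m. m \<le> n \<Longrightarrow> \<beta> m = \<beta>' m) \<Longrightarrow> bsurj \<beta> n = bsurj \<beta>' n"
  using E_cong[of n \<beta> \<beta>'] E_cong[of "n - 1" \<beta> \<beta>'] unfolding bsurj_def P_def
  by (cases n) simp_all

text \<open>Induction on the number m of homological degrees in which generators are already
  bounded. Later degrees keep all generators and are exact for trivial reasons, so each stage is a
  true resolution to which the vanishing of Tor can be transferred. Passing to m + 1 discards
  generators in degree m only, and Nakayama restores exactness there.\<close>

lemma bsurj_bounded:
  assumes R: "res N R DR \<eta>R" and T: "\<And>i X. Ob X \<Longrightarrow> i + 1 < dm X \<Longrightarrow> TorV R DR i X"
  shows "bsurj (\<lambda>n X. n < m \<longrightarrow> dm X \<le> n + 1) n"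
proof (induction m arbitrary: n)
  case 0
  then show ?case by (rule bsurj_full) simp
next
  case (Suc m)
  define b b' where "b = (\<lambda>n X. n < m \<longrightarrow> dm X \<le> n + 1)" and "b' = (\<lambda>n X. n < Suc m \<longrightarrow> dm X \<le> n + 1)"
  have IH: "bsurj b n" for n using Suc.IH by (simp add: b_def)
  note res = res_canonical[of b, OF IH]
  have Eb: "E b k = E b' k" if "k < m" for k by (rule E_cong) (use that in \<open>auto simp: b_def b'_def\<close>)
  \<comment> \<open>In degree above m + 1 an element of the m-th term is a cycle modulo the ideal,
    hence by vanishing of Tor_m a boundary modulo the ideal; the boundary is invisible to the map g
    out of that term.\<close>
  have big: "\<exists>w\<in>Pos (P b m) X. g X w = g X p"
    if X: "Ob X" and d: "m + 1 < dm X" and p: "p \<in> cr (P b m) X" and g: "mhom (P b m) L g" and L: "md L"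
      and g\<delta>: "\<And>y. y \<in> cr (P b (Suc m)) X \<Longrightarrow> g X (\<delta> y) = 0" for X p and L :: "('x, 't, 'a, 'l::ab_group_add) md" and g
  proof -
    have Dp: "D m X p \<in> cr (P b (m - 1)) X" by (rule mhomD(1)[OF cpxD(2)[OF resD(3)[OF res]] X p])
    have "D m X p \<in> Pos (P b (m - 1)) X"
    proof (cases m)
      case 0
      then show ?thesis by (simp add: D_def Pos.zero)
    next
      case (Suc k)
      \<comment> \<open>The generators one step lower have degree at most k + 1 = m, so over X the
        whole preceding term lies in the ideal.\<close>
      have "dm (ob s) < dm X" if "s \<in> E b k" for s
        using that d Suc by (cases k) (auto simp: b_def)
      from ind_all_Pos[OF this Dp[unfolded P_def Suc, simplified]] show ?thesis by (simp add: P_def Suc)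
    qed
    moreover have "TorV (P b) D m X" by (rule TorV_transfer[OF res R X T[OF X d]])
    ultimately obtain y where y: "y \<in> cr (P b (Suc m)) X" "p - D (Suc m) X y \<in> Pos (P b m) X"
      using p unfolding TorV_def by blast
    have \<delta>y: "\<delta> y \<in> cr (P b m) X" by (rule mhomD(1)[OF \<delta>_hom X y(1)])
    have "g X (p - \<delta> y) = g X p" using mhom_simps(4)[OF g md_P X p \<delta>y] g\<delta>[OF y(1)] by simp
    then show ?thesis using y(2) by (auto simp: D_def)
  qed
  show ?case
  proof (cases "n < m")
    case True
    then have "bsurj b n = bsurj b' n" by (intro bsurj_cong) (auto simp: b_def b'_def)
    then show ?thesis using IH by (simp add: b'_def)
  next
    case False
    show ?thesis
    proof (cases "n = m")
      case False
      then show ?thesis using \<open>\<not> n < m\<close> by (intro bsurj_full) simp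
    next
      case True
      have "bsurj b' m"
      proof (cases m)
        case 0
        have "\<exists>p\<in>cr (P b' 0) X. ev N d0 p = z" if X: "Ob X" and z: "z \<in> cr N X" for X z
        proof -
          obtain p where p: "p \<in> cr (P b 0) X" "ev N d0 p = z"
            using IH[of 0] X z unfolding bsurj_def by auto
          have "\<exists>p'\<in>cr (P b' 0) X. ev N d0 p' = ev N d0 p"
          proof (rule nakayama_step[OF md_P md_P N_md \<eta>_hom \<eta>_hom _ _ X p(1), where d = 1])
            show "\<exists>p'\<in>cr (P b' 0) X. ev N d0 p' = ev N d0 p" if "Ob X" "dm X \<le> 1" "p \<in> cr (P b 0) X" for X p
              by (rule pre_gen0[OF that(1) _ mhomD(1)[OF \<eta>_hom that(1,3)]]) (use that 0 in \<open>simp add: b'_def\<close>)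
            show "\<exists>w\<in>Pos (P b 0) X. ev N d0 w = ev N d0 p" if "Ob X" "1 < dm X" "p \<in> cr (P b 0) X" for X p
              using big[of X p N "\<lambda>X. ev N d0"] that 0 \<eta>_hom[of b] N_md nul_\<delta>[OF that(1), of _ b 0] by (simp add: nul_def)
          qed
          then show ?thesis using p(2) by simp
        qed
        then show ?thesis using 0 by (simp add: bsurj_def)
      next
        case (Suc k)
        have Pk: "P b k = P b' k" unfolding P_def using Eb[of k] Suc by simp
        have "\<exists>p\<in>cr (P b' (Suc k)) X. \<delta> p = z" if X: "Ob X" and z: "z \<in> cr (P b' k) X" "nul k z" for X z
        proof -
          obtain p where p: "p \<in> cr (P b (Suc k)) X" "\<delta> p = z"
            using IH[of "Suc k"] X z[folded Pk] unfolding bsurj_def by auto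
          have "\<exists>p'\<in>cr (P b' (Suc k)) X. \<delta> p' = \<delta> p"
          proof (rule nakayama_step[OF md_P md_P md_P[of b k] \<delta>_hom \<delta>_hom[of b' k, folded Pk] _ _ X p(1), where d = "m + 1"])
            show "\<exists>p'\<in>cr (P b' (Suc k)) X. \<delta> p' = \<delta> p" if "Ob X" "dm X \<le> m + 1" "p \<in> cr (P b (Suc k)) X" for X p
              by (rule pre_gen1[OF that(1) _ mhomD(1)[OF \<delta>_hom that(1,3), unfolded Pk] nul_\<delta>[OF that(1,3)]])
                (use that Suc in \<open>simp add: b'_def\<close>)
            show "\<exists>w\<in>Pos (P b (Suc k)) X. \<delta> w = \<delta> p" if "Ob X" "m + 1 < dm X" "p \<in> cr (P b (Suc k)) X" for X p
              using big[of X p "P b k" "\<lambda>X. \<delta>"] that Suc \<delta>_hom[of b k] md_P nul_\<delta>[OF that(1), of _ b "Suc k"] by (simp add: nul_def)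
          qed
          then show ?thesis using p(2) by simp
        qed
        then show ?thesis using Suc by (simp add: bsurj_def)
      qed
      then show ?thesis using True by (simp add: b'_def)
    qed
  qed
qed

lemma bounded_resolution:
  assumes R: "res N R DR \<eta>R" and T: "\<And>i X. Ob X \<Longrightarrow> i + 1 < dm X \<Longrightarrow> TorV R DR i X"
  shows "\<exists>F D'. res N (\<lambda>n. ind (F n) ob A) D' (\<lambda>X. ev N d0) \<and>
    (\<forall>n. \<forall>s\<in>F n. dm (ob s) \<le> n + 1) \<and> (\<forall>s\<in>F 0. d0 s \<in> cr N (ob s))"
proof -
  let ?b = "\<lambda>n X. dm X \<le> n + 1"
  have "bsurj ?b n" for n
  proof -
    \<comment> \<open>Exactness at stage n depends on the bounds up to n only, so a finite stage of
      the induction suffices.\<close>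
    have "bsurj ?b n = bsurj (\<lambda>k X. k < Suc n \<longrightarrow> dm X \<le> k + 1) n" by (rule bsurj_cong) simp
    then show ?thesis using bsurj_bounded[OF R T, of "Suc n" n] by (simp only:)
  qed
  then have "res N (P ?b) D (\<lambda>X. ev N d0)" by (rule res_canonical)
  moreover have "P ?b = (\<lambda>n. ind (E ?b n) ob A)" by (rule ext) (rule P_def)
  ultimately have r: "res N (\<lambda>n. ind (E ?b n) ob A) D (\<lambda>X. ev N d0)" by (simp only:)
  show ?thesis
  proof (rule exI[of _ "E ?b"], rule exI[of _ D], intro conjI allI ballI)
    show "res N (\<lambda>n. ind (E ?b n) ob A) D (\<lambda>X. ev N d0)" by (rule r)
    show "dm (ob s) \<le> n + 1" if "s \<in> E ?b n" for n s by (rule E_bound[OF that])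
    show "d0 s \<in> cr N (ob s)" if "s \<in> E ?b 0" for s using that by simp
  qed
qed

end

section \<open>Names for generators and existence of resolutions\<close>

text \<open>\<open>N0\<close> names an element of the resolved module. \<open>N1\<close> names a
  finite combination of earlier names, coded as a list to make the recursion a nested
  datatype.\<close>

datatype ('x, 't, 'a, 'n) nm = N0 'x 'n | N1 'x "(('x, 't, 'a, 'n) nm \<times> 't \<times> 'a) list"

primrec nm_ob :: "('x, 't, 'a, 'n) nm \<Rightarrow> 'x" where
  "nm_ob (N0 X y) = X" | "nm_ob (N1 X l) = X"

definition nm_d0 :: "('x, 't, 'a, 'n) nm \<Rightarrow> 'n" where
  "nm_d0 s = (case s of N0 X y \<Rightarrow> y | N1 X l \<Rightarrow> undefined)"

definition nm_d1 :: "('x, 't, 'a::ab_group_add, 'n) nm \<Rightarrow> (('x, 't, 'a, 'n) nm \<times> 't) \<Rightarrow>\<^sub>0 'a" where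
  "nm_d1 s = (case s of N0 X y \<Rightarrow> 0 | N1 X l \<Rightarrow> sum_list (map (\<lambda>(s, t, a). Poly_Mapping.single (s, t) a) l))"

text \<open>The list entries are actual coefficients of z at keys of z, so that facts about z pass
  to each entry.\<close>

lemma poly_mapping_eq_sum_list:
  fixes z :: "('s \<times> 't) \<Rightarrow>\<^sub>0 'a::ab_group_add"
  shows "\<exists>l. z = sum_list (map (\<lambda>(s, t, a). Poly_Mapping.single (s, t) a) l) \<and>
     (\<forall>(s, t, a)\<in>set l. a = Poly_Mapping.lookup z (s, t) \<and> (s, t) \<in> Poly_Mapping.keys z)"
proof -
  obtain ks where ks: "set ks = Poly_Mapping.keys z" "distinct ks"
    using finite_distinct_list[OF finite_keys[of z]] by blast
  let ?l = "map (\<lambda>(s, t). (s, t, Poly_Mapping.lookup z (s, t))) ks"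
  have "sum_list (map (\<lambda>(s, t, a). Poly_Mapping.single (s, t) a) ?l) =
      sum_list (map (\<lambda>k. Poly_Mapping.single k (Poly_Mapping.lookup z k)) ks)"
    by (simp add: split_def comp_def)
  also have "\<dots> = (\<Sum>k\<in>Poly_Mapping.keys z. Poly_Mapping.single k (Poly_Mapping.lookup z k))"
    using ks by (simp add: sum_list_distinct_conv_sum_set)
  also have "\<dots> = z"
    by (rule poly_mapping_eqI)
      (auto simp: lookup_sum lookup_single when_def in_keys_iff if_distrib cong: if_cong)
  finally have e: "z = sum_list (map (\<lambda>(s, t, a). Poly_Mapping.single (s, t) a) ?l)" by (rule sym)
  show ?thesis
  proof (rule exI[of _ ?l], rule conjI[OF e])
    show "\<forall>(s, t, a)\<in>set ?l. a = Poly_Mapping.lookup z (s, t) \<and> (s, t) \<in> Poly_Mapping.keys z"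
      using ks(1) by auto
  qed
qed

context gring
begin

lemma nm_canres:
  assumes "md (N :: ('x, 't, 'a, 'n::ab_group_add) md)"
  shows "canres Ob Hom cmp idm cok push zr zm dm A un Ap N nm_ob nm_d0 nm_d1"
proof (rule canres.intro[OF gring_axioms], rule canres_axioms.intro[OF assms])
  fix Y y
  show "\<exists>s. nm_ob s = Y \<and> nm_d0 s = y" by (rule exI[of _ "N0 Y y"]) (simp add: nm_d0_def)
next
  fix Y and z :: "(('x, 't, 'a, 'n) nm \<times> 't) \<Rightarrow>\<^sub>0 'a"
  obtain l where l: "z = sum_list (map (\<lambda>(s, t, a). Poly_Mapping.single (s, t) a) l)"
    using poly_mapping_eq_sum_list[of z] by (elim exE conjE)
  show "\<exists>s. nm_ob s = Y \<and> nm_d1 s = z" unfolding l by (rule exI[of _ "N1 Y l"]) (simp add: nm_d1_def)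
qed

text \<open>With no restriction on the generators, every element of each syzygy is hit by its own
  name.\<close>

lemma ex_res:
  assumes "md N"
  shows "\<exists>(P :: nat \<Rightarrow> ('x, 't, 'a, (('x, 't, 'a, 'n::ab_group_add) nm \<times> 't) \<Rightarrow>\<^sub>0 'a) md) D \<eta>.
    res (N :: ('x, 't, 'a, 'n) md) P D \<eta>"
proof -
  interpret canres Ob Hom cmp idm cok push zr zm dm A un Ap N nm_ob nm_d0 nm_d1
    by (rule nm_canres[OF assms])
  have "res N (P (\<lambda>_ _. True)) D (\<lambda>X. ev N nm_d0)" by (rule res_canonical[OF bsurj_full]) simp
  then show ?thesis by (intro exI)
qed

end

type_synonym ('x, 't, 'a, 'n) can = "(('x, 't, 'a, 'n) nm \<times> 't) \<Rightarrow>\<^sub>0 'a"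

section \<open>Syzygies and change of the resolved module\<close>

context gring
begin

text \<open>The n-th syzygy is a submodule of the n-th term, so it is the kernel of the augmentation
  for n = 0 and of the n-th differential afterwards.\<close>

definition syzygy :: "(nat \<Rightarrow> ('x, 't, 'a, 'p::ab_group_add) md) \<Rightarrow> (nat \<Rightarrow> 'x \<Rightarrow> 'p \<Rightarrow> 'p) \<Rightarrow>
    ('x \<Rightarrow> 'p \<Rightarrow> 'n::ab_group_add) \<Rightarrow> nat \<Rightarrow> ('x, 't, 'a, 'p) md" where
  "syzygy Q D \<eta> n = (\<lambda>X. {x \<in> cr (Q n) X. if n = 0 then \<eta> X x = 0 else D n X x = 0}, ac (Q n))"

definition kerM :: "('x, 't, 'a, 'm) md \<Rightarrow> ('x \<Rightarrow> 'm \<Rightarrow> 'n::ab_group_add) \<Rightarrow> ('x, 't, 'a, 'm) md" where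
  "kerM M f = (\<lambda>X. {x \<in> cr M X. f X x = 0}, ac M)"

lemma cr_kerM: "x \<in> cr (kerM M f) X \<longleftrightarrow> x \<in> cr M X \<and> f X x = 0" and ac_kerM: "ac (kerM M f) = ac M"
  by (simp_all add: kerM_def)

lemma md_kerM:
  assumes M: "md M" and N: "md N" and f: "mhom M N f"
  shows "md (kerM M f)"
proof (rule pmdI, unfold ac_kerM cr_kerM, goal_cases)
  case (1 X)
  show ?case unfolding sgrp_def Ball_def cr_kerM
    using md_sgrp[OF M 1] mhom_simps[OF f M 1] by auto
next
  case (2 Y X t a x)
  then show ?case using mdD(2)[OF M 2(1,2)] mhomD(3)[OF f 2(1,2)] md_ac_simps(1)[OF N 2(1,2)] by simp
next
  case (3 Y X t a)
  then show ?case using mdD(3)[OF M 3] unfolding additive_on_def Ball_def cr_kerM by blast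
next
  case (4 Y X t x)
  then show ?case using mdD(4)[OF M] by blast
next
  case (5 X x)
  then show ?case using mdD(5)[OF M] by blast
next
  case (6 Y X Z t u a b x)
  then show ?case using mdD(6)[OF M 6(1-4)] by blast
qed

lemma kerM_incl: "mhom (kerM M f) M (\<lambda>X x. x)"
  unfolding phom_def additive_on_def by (auto simp: cr_kerM ac_kerM)

lemma ses_kerM:
  assumes "md M" "md N" "mhom M N f" "\<And>X z. Ob X \<Longrightarrow> z \<in> cr N X \<Longrightarrow> \<exists>x\<in>cr M X. f X x = z"
  shows "ses (kerM M f) M N (\<lambda>X x. x) f"
  unfolding ses_def
proof (intro conjI allI impI)
  show "md (kerM M f)" by (rule md_kerM[OF assms(1-3)])
  show "mhom (kerM M f) M (\<lambda>X x. x)" by (rule kerM_incl)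
  show "\<exists>x\<in>cr M X. f X x = z" if "Ob X" "z \<in> cr N X" for X z by (rule assms(4)[OF that])
qed (use assms in \<open>simp_all only: cr_kerM, auto simp: cr_kerM\<close>)

lemma syzygy_eq: "syzygy Q D \<eta> 0 = kerM (Q 0) \<eta>" "syzygy Q D \<eta> (Suc n) = kerM (Q (Suc n)) (D (Suc n))"
  by (simp_all add: syzygy_def kerM_def)

lemma md_syzygy: "resn N Q D \<eta> \<Longrightarrow> md (syzygy Q D \<eta> n)"
proof (cases n)
  case 0
  assume "resn N Q D \<eta>"
  note a = resnD(1)[OF this]
  show ?thesis unfolding 0 syzygy_eq by (rule md_kerM[OF cpxD(1)[OF acpxD(1)[OF a]] acpxD(2,3)[OF a]])
next
  case (Suc m)
  assume "resn N Q D \<eta>"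
  note c = acpxD(1)[OF resnD(1)[OF this]]
  show ?thesis unfolding Suc syzygy_eq by (rule md_kerM[OF cpxD(1)[OF c] cpxD(1)[OF c] cpxD(3)[OF c]])
qed

lemma ses_syzygy0:
  assumes "resn N Q D \<eta>"
  shows "ses (syzygy Q D \<eta> 0) (Q 0) N (\<lambda>X x. x) \<eta>"
proof -
  note a = resnD(1)[OF assms]
  show ?thesis unfolding syzygy_eq
    by (rule ses_kerM[OF cpxD(1)[OF acpxD(1)[OF a]] acpxD(2,3)[OF a] resnD(2)[OF assms]])
qed

lemma ses_syzygy_Suc:
  assumes r: "resn N Q D \<eta>"
  shows "ses (syzygy Q D \<eta> (Suc n)) (Q (Suc n)) (syzygy Q D \<eta> n) (\<lambda>X x. x) (D (Suc n))"
proof -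
  note a = resnD(1)[OF r]
  note c = acpxD(1)[OF a]
  have z: "x \<in> cr (syzygy Q D \<eta> n) X \<longleftrightarrow> x \<in> cr (Q n) X \<and> (if n = 0 then \<eta> X x = 0 else D n X x = 0)" for x X
    by (simp add: syzygy_def)
  have in_z: "D (Suc n) X x \<in> cr (syzygy Q D \<eta> n) X" if "Ob X" "x \<in> cr (Q (Suc n)) X" for X x
    unfolding z using mhomD(1)[OF cpxD(3)[OF c] that] cpxD(5)[OF c that] acpxD(4)[OF a that(1)] that(2)
    by (cases n) simp_all
  have h: "mhom (Q (Suc n)) (syzygy Q D \<eta> n) (D (Suc n))"
    unfolding phom_def
  proof (intro conjI allI impI ballI)
    fix X x assume "Ob X" "x \<in> cr (Q (Suc n)) X"
    then show "D (Suc n) X x \<in> cr (syzygy Q D \<eta> n) X" by (rule in_z)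
  next
    fix X assume "Ob X" then show "additive_on (cr (Q (Suc n)) X) (D (Suc n) X)" by (rule mhomD(2)[OF cpxD(3)[OF c]])
  next
    fix Y X t b x assume "t \<in> Hom Y X" "b \<in> cr A (cok t)" "x \<in> cr (Q (Suc n)) Y"
    then show "D (Suc n) X (ac (Q (Suc n)) t b x) = ac (syzygy Q D \<eta> n) t b (D (Suc n) Y x)"
      using mhomD(3)[OF cpxD(3)[OF c]] by (simp add: syzygy_def)
  qed
  have s: "\<exists>x\<in>cr (Q (Suc n)) X. D (Suc n) X x = z" if X: "Ob X" and "z \<in> cr (syzygy Q D \<eta> n) X" for X z
    using that(2) resnD(3)[OF r X, of z] resnD(4)[OF r X, of z] unfolding z by (cases n) simp_all
  have "kerM (Q (Suc n)) (D (Suc n)) = syzygy Q D \<eta> (Suc n)" by (simp add: syzygy_eq)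
  then show ?thesis using ses_kerM[OF cpxD(1)[OF c] md_syzygy[OF r] h s] by simp
qed

text \<open>Two descriptions of a module may have actions that agree on the carriers without being
  equal as functions; a resolution of one is still a resolution of the other.\<close>

lemma res_cong:
  assumes r: "res N P D \<eta>" and N': "md N'" and c: "\<And>X. cr N' X = cr N X"
    and a: "\<And>Y X t b x. t \<in> Hom Y X \<Longrightarrow> b \<in> cr A (cok t) \<Longrightarrow> x \<in> cr N Y \<Longrightarrow> ac N' t b x = ac N t b x"
  shows "res N' P D \<eta>"
proof -
  note h = acpxD(3)[OF resD(2)[OF r]]
  have "mhom (P 0) N' \<eta>"
    unfolding phom_def
  proof (intro conjI allI impI ballI)
    fix X x assume "Ob X" "x \<in> cr (P 0) X" then show "\<eta> X x \<in> cr N' X" unfolding c by (rule mhomD(1)[OF h])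
  next
    fix X assume "Ob X" then show "additive_on (cr (P 0) X) (\<eta> X)" by (rule mhomD(2)[OF h])
  next
    fix Y X t b x assume t: "t \<in> Hom Y X" "b \<in> cr A (cok t)" "x \<in> cr (P 0) Y"
    show "\<eta> X (ac (P 0) t b x) = ac N' t b (\<eta> Y x)"
      using mhomD(3)[OF h t] a[OF t(1,2) mhomD(1)[OF h hom_ob(1)[OF t(1)] t(3)]] by simp
  qed
  then show ?thesis using r N' unfolding res_def resn_def acpx_def c by blast
qed

end

section \<open>Two rings and the inductive argument\<close>

text \<open>For t from Y to X, \<open>sw t\<close> is the inclusion of the complement of t, with the
  image of Y as its complement, and \<open>tr t a\<close> is a moved to that image, up to a sign.
  Thus \<open>ac M (sw t) (tr t a) y\<close> multiplies an element y over \<open>cok t\<close> by a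
  coefficient a over Y. The assumptions \<open>comm\<close> and \<open>comm_B\<close> are
  commutativity in this language and cover the skew case by the sign in \<open>tr\<close>.\<close>

locale two_rings =
  A: gring Ob Hom cmp idm cok push zr zm dm A un Ap + B: gring Ob Hom cmp idm cok push zr zm dm B unB Bp
  for Ob :: "'x \<Rightarrow> bool" and Hom :: "'x \<Rightarrow> 'x \<Rightarrow> 't set" and cmp idm cok push zr zm dm
    and A :: "('x, 't, 'a::ab_group_add, 'a) md" and un Ap
    and B :: "('x, 't, 'b::ab_group_add, 'b) md" and unB Bp +
  fixes \<phi> :: "'x \<Rightarrow> 'a \<Rightarrow> 'b" and sw :: "'t \<Rightarrow> 't" and tr :: "'t \<Rightarrow> 'a \<Rightarrow> 'a"
  assumes \<phi>_in: "Ob X \<Longrightarrow> a \<in> cr A X \<Longrightarrow> \<phi> X a \<in> cr B X"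
    and \<phi>_add: "Ob X \<Longrightarrow> additive_on (cr A X) (\<phi> X)"
    and \<phi>_surj: "Ob X \<Longrightarrow> c \<in> cr B X \<Longrightarrow> \<exists>a\<in>cr A X. \<phi> X a = c"
    and \<phi>_un: "\<phi> zr un = unB"
    and \<phi>_ac: "t \<in> Hom Y X \<Longrightarrow> a \<in> cr A (cok t) \<Longrightarrow> x \<in> cr A Y \<Longrightarrow> \<phi> X (ac A t a x) = ac B t (\<phi> (cok t) a) (\<phi> Y x)"
    and \<phi>_pos: "Ob X \<Longrightarrow> a \<in> cr A X \<Longrightarrow> a \<in> Ap X \<longleftrightarrow> \<phi> X a \<in> Bp X"
    and sw: "t \<in> Hom Y X \<Longrightarrow> sw t \<in> Hom (cok t) X"
    and tr: "t \<in> Hom Y X \<Longrightarrow> a \<in> cr A Y \<Longrightarrow> tr t a \<in> cr A (cok (sw t))"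
    and tr_pos: "t \<in> Hom Y X \<Longrightarrow> a \<in> Ap Y \<Longrightarrow> tr t a \<in> Ap (cok (sw t))"
    and cmp_sw: "t \<in> Hom Y X \<Longrightarrow> u \<in> Hom X Z \<Longrightarrow> cmp u (sw t) = cmp (sw (cmp u t)) (push u t)"
    and comm: "t \<in> Hom Y X \<Longrightarrow> u \<in> Hom X Z \<Longrightarrow> a \<in> cr A Y \<Longrightarrow> b \<in> cr A (cok u) \<Longrightarrow>
      ac A (push u (sw t)) b (tr t a) = ac A (push (sw (cmp u t)) (push u t)) (tr (cmp u t) a) b"
    and comm_B: "t \<in> Hom Y X \<Longrightarrow> a \<in> cr A Y \<Longrightarrow> c \<in> cr B (cok t) \<Longrightarrow>
      ac B t c (\<phi> Y a) = ac B (sw t) (\<phi> (cok (sw t)) (tr t a)) c"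
begin

text \<open>Restriction of scalars along \<open>\<phi>\<close>.\<close>

definition rs :: "('x, 't, 'b, 'n) md \<Rightarrow> ('x, 't, 'a, 'n) md" where
  "rs M = (cr M, \<lambda>t a. ac M t (\<phi> (cok t) a))"

lemma cr_rs: "cr (rs M) = cr M" and ac_rs: "ac (rs M) t a x = ac M t (\<phi> (cok t) a) x"
  by (simp_all add: rs_def)

lemma rs_md:
  assumes M: "B.md M"
  shows "A.md (rs M)"
proof (rule A.pmdI, unfold cr_rs ac_rs, goal_cases)
  case (1 X) then show ?case by (rule B.mdD(1)[OF M])
next
  case (2 Y X t a x)
  then show ?case using \<phi>_in[OF A.hom_ob(3)[OF 2(1)]] by (intro B.mdD(2)[OF M])
next
  case (3 Y X t a)
  have "ac (rs M) t a = ac M t (\<phi> (cok t) a)" by (simp add: rs_def)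
  then show ?case using B.mdD(3)[OF M 3(1) \<phi>_in[OF A.hom_ob(3)[OF 3(1)] 3(2)]] by simp
next
  case (4 Y X t x)
  show ?case
    by (rule additive_on_comp[OF \<phi>_add[OF A.hom_ob(3)[OF 4(1)]] B.mdD(4)[OF M 4]])
      (rule \<phi>_in[OF A.hom_ob(3)[OF 4(1)]])
next
  case (5 X x)
  then show ?case using B.mdD(5)[OF M] by (simp add: A.cok_idm \<phi>_un)
next
  case (6 Y X Z t u a b x)
  note ob = A.hom_ob(3)[OF 6(1)] A.hom_ob(3)[OF 6(2)]
  have b: "b \<in> cr A (cok (push u t))" using 6 A.cok_push[OF 6(1,2)] by simp
  show ?case
    using B.mdD(6)[OF M 6(1,2) \<phi>_in[OF ob(1) 6(3)] \<phi>_in[OF ob(2) 6(4)] 6(5)]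
      \<phi>_ac[OF A.push[OF 6(1,2)] b 6(3)] A.cok_push[OF 6(1,2)] by simp
qed

lemma rs_hom: "B.mhom M N f \<Longrightarrow> A.mhom (rs M) (rs N) f"
  unfolding A.phom_def cr_rs ac_rs using \<phi>_in[OF A.hom_ob(3)] by blast

lemma rs_resn:
  assumes r: "B.resn N Q D \<eta>"
  shows "A.resn (rs N) (\<lambda>n. rs (Q n)) D \<eta>"
proof -
  note a = B.resnD(1)[OF r]
  note c = B.acpxD(1)[OF a]
  have "A.cpx (\<lambda>n. rs (Q n)) D"
    unfolding A.cpx_def cr_rs
  proof (intro conjI allI impI)
    show "A.md (rs (Q n))" for n by (rule rs_md[OF B.cpxD(1)[OF c]])
    show "A.mhom (rs (Q n)) (rs (Q (n - 1))) (D n)" for n by (rule rs_hom[OF B.cpxD(2)[OF c]])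
    show "D 0 = (\<lambda>X x. 0)" using c unfolding B.cpx_def by (elim conjE)
  qed (rule B.cpxD(5)[OF c])
  then have "A.acpx (rs N) (\<lambda>n. rs (Q n)) D \<eta>"
    unfolding A.acpx_def cr_rs using rs_md[OF B.acpxD(2)[OF a]] rs_hom[OF B.acpxD(3)[OF a]] B.acpxD(4)[OF a] by blast
  then show ?thesis
    unfolding A.resn_def cr_rs using r unfolding B.resn_def by blast
qed

lemma rs_ses:
  assumes s: "B.ses K Q N \<iota> \<pi>"
  shows "A.ses (rs K) (rs Q) (rs N) \<iota> \<pi>"
  unfolding A.ses_def cr_rs
  by (intro conjI allI impI; (rule rs_md rs_hom)?; (rule B.sesD[OF s]; assumption?))

text \<open>Restriction and induction commute because a push along t has the same complement as t,
  so \<open>\<phi>\<close> is applied over the same object on both sides. The equality holds on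
  carriers.\<close>

lemma rs_ind_ac:
  assumes M: "B.md M" and t: "t \<in> Hom Y X" and a: "a \<in> cr A (cok t)" and p: "p \<in> cr (A.ind E ob M) Y"
  shows "ac (rs (A.ind E ob M)) t a p = ac (A.ind E ob (rs M)) t a p"
  unfolding ac_rs A.ac_ind lin_def
proof (rule sum.cong[OF refl])
  fix k assume "k \<in> Poly_Mapping.keys p"
  then have k: "k \<in> A.terms E ob Y" using p by (auto simp: A.cr_ind dsum_def)
  obtain e s where es: "k = (e, s)" by fastforce
  note s = A.termsD(2)[OF k[unfolded es]]
  show "A.push_single M t (\<phi> (cok t) a) k (Poly_Mapping.lookup p k) =
      A.push_single (rs M) t a k (Poly_Mapping.lookup p k)"
    by (simp add: A.push_single_def es ac_rs A.cok_push[OF s t])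
qed

text \<open>Here K plays the role of k, with \<open>e\<close> the augmentation of B. The crucial
  class in Tor_q of B is traced back to a chain g with values in the generators F 0, where the
  multiplication argument ends it; all remaining groups are covered by the induction
  hypothesis.\<close>

lemma main:
  assumes K: "B.md K" and e: "B.mhom B K e"
    and e_surj: "\<And>X z. Ob X \<Longrightarrow> z \<in> cr K X \<Longrightarrow> \<exists>b\<in>cr B X. e X b = z"
    and e_ker: "\<And>X b. Ob X \<Longrightarrow> b \<in> cr B X \<Longrightarrow> b \<in> Bp X \<longleftrightarrow> e X b = 0"
    and PK: "A.res (rs K) PK DK \<eta>K" and TK: "\<And>i X. Ob X \<Longrightarrow> i < dm X \<Longrightarrow> A.TorV PK DK i X"
    and PB: "B.res K PB DB \<eta>B" and TB: "\<And>i X. Ob X \<Longrightarrow> i < dm X \<Longrightarrow> B.TorV PB DB i X"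
    and P: "A.res (rs B) P D \<eta>"
    and X: "Ob X" and q: "2 * q < dm X"
  shows "A.TorV P D q X"
proof -
  let ?I = "B.kerM B e"
  have sI: "B.ses ?I B K (\<lambda>X x. x) e" by (rule B.ses_kerM[OF B.A_md K e]) (rule e_surj)
  note mI = B.md_kerM[OF B.A_md K e]
  obtain R :: "nat \<Rightarrow> ('x, 't, 'b, (('x, 't, 'b, 'b) nm \<times> 't) \<Rightarrow>\<^sub>0 'b) md" and DR \<eta>R where R: "B.res ?I R DR \<eta>R"
    using B.ex_res[OF mI] by (elim exE)
  \<comment> \<open>The ring B as a projective resolution of itself, concentrated in degree
    0.\<close>
  define G :: "nat \<Rightarrow> ('x, 't, 'b, 'b) md" where "G n = (case n of 0 \<Rightarrow> B | Suc m \<Rightarrow> B.zmod)" for n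
  have G: "B.res B G (\<lambda>n X x. 0) (\<lambda>X x. x)"
  proof -
    have m: "B.md (G n)" "B.proj (G n)" for n
      by (cases n; simp add: G_def B.md_zmod B.proj_zmod B.A_md B.proj_A)+
    have "B.mhom (G n) (G k) (\<lambda>X x. 0)" for n k by (rule B.mhom_zero[OF m(1)])
    moreover have "B.mhom (G 0) B (\<lambda>X x. x)" using B.mhom_id by (simp add: G_def)
    ultimately show ?thesis
      unfolding B.res_def B.resn_def B.acpx_def B.cpx_def using m B.A_md
      by (simp add: G_def B.zmod_def)
  qed
  \<comment> \<open>Degree shift from Tor of K in degree i + 1 to Tor of I in degree i. The
    connecting map is injective since I goes to 0 in B modulo its ideal.\<close>
  have TR: "B.TorV R DR i X" if X: "Ob X" and i: "i + 1 < dm X" for i X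
    unfolding B.TorV_def
  proof (intro ballI impI)
    fix x assume x: "x \<in> cr (R i) X" "DR i X x \<in> B.Pos (R (i - 1)) X"
    obtain \<sigma> where \<sigma>: "B.cm R DR G (\<lambda>n X x. 0) \<sigma>" "\<forall>X x. Ob X \<longrightarrow> x \<in> cr (R 0) X \<longrightarrow> \<sigma> 0 X x = \<eta>R X x"
      by (rule B.cm_lift[OF R B.resD(1)[OF G] B.kerM_incl])
    have \<sigma>x: "\<sigma> i X x \<in> cr (G i) X" by (rule B.mhomD(1)[OF B.cmD(1)[OF \<sigma>(1)] X x(1)])
    have "\<sigma> i X x \<in> B.Pos (G i) X"
    proof (cases i)
      case 0
      have "\<eta>R X x \<in> cr ?I X" using B.mhomD(1)[OF B.acpxD(3)[OF B.resD(2)[OF R]] X] x(1) 0 by simp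
      then have "\<eta>R X x \<in> B.Pos B X" unfolding B.cr_kerM using B.Ap_Pos[OF X] e_ker[OF X] by blast
      then show ?thesis using \<sigma>(2) X x(1) 0 by (simp add: G_def)
    next
      case (Suc j)
      then show ?thesis using \<sigma>x B.Pos.zero by (simp add: G_def B.zmod_def)
    qed
    then show "\<exists>y\<in>cr (R (Suc i)) X. x - DR (Suc i) X y \<in> B.Pos (R i) X"
      using B.Tor_exact_left[OF sI R G PB \<sigma>(1) _ TB[OF X] X x] \<sigma>(2) i by simp
  qed
  interpret C: canres Ob Hom cmp idm cok push zr zm dm B unB Bp ?I nm_ob nm_d0 nm_d1
    by (rule B.nm_canres[OF mI])
  let ?ob = "nm_ob :: ('x, 't, 'b, 'b) nm \<Rightarrow> 'x" and ?d0 = "nm_d0 :: ('x, 't, 'b, 'b) nm \<Rightarrow> 'b"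
  \<comment> \<open>Tor_n of I over B vanishes above degree n + 1, which bounds the generators F
    n.\<close>
  have "\<exists>F D'. B.res ?I (\<lambda>n. A.ind (F n) ?ob B) D' (\<lambda>X. B.ev ?I ?d0) \<and>
      (\<forall>n. \<forall>s\<in>F n. dm (?ob s) \<le> n + 1) \<and> (\<forall>s\<in>F 0. ?d0 s \<in> cr ?I (?ob s))"
    by (rule C.bounded_resolution[OF R]) (rule TR)
  then obtain F D' where Q: "B.res ?I (\<lambda>n. A.ind (F n) ?ob B) D' (\<lambda>X. B.ev ?I ?d0)"
    and F: "\<forall>n. \<forall>s\<in>F n. dm (?ob s) \<le> n + 1" and F0: "\<forall>s\<in>F 0. ?d0 s \<in> cr ?I (?ob s)"
    by (elim exE conjE)
  define Q' where "Q' n = rs (A.ind (F n) ?ob B)" for n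
  define Z where "Z = A.syzygy Q' D' (\<lambda>X. B.ev ?I ?d0)"
  have rQ: "A.resn (rs ?I) Q' D' (\<lambda>X. B.ev ?I ?d0)" unfolding Q'_def by (rule rs_resn[OF B.resD(1)[OF Q]])
  have mZ: "A.md (Z n)" for n unfolding Z_def by (rule A.md_syzygy[OF rQ])
  have "\<forall>n. \<exists>w :: (nat \<Rightarrow> ('x, 't, 'a, ('x, 't, 'a, ('x, 't, 'b, 'b) can) can) md) \<times> _ \<times> _. A.res (Z n) (fst w) (fst (snd w)) (snd (snd w))"
    (is "\<forall>n. ?ex n")
  proof
    fix n
    obtain W0 :: "nat \<Rightarrow> ('x, 't, 'a, ('x, 't, 'a, ('x, 't, 'b, 'b) can) can) md"
      and D0 \<eta>0 where r0: "A.res (Z n) W0 D0 \<eta>0"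
      using A.ex_res[OF mZ[of n]] by (elim exE)
    show "?ex n"
      by (rule exI[of _ "(W0, D0, \<eta>0)"]) (simp add: r0)
  qed
  from choice[OF this]
  obtain w :: "nat \<Rightarrow> (nat \<Rightarrow> ('x, 't, 'a, ('x, 't, 'a, ('x, 't, 'b, 'b) can) can) md) \<times> _ \<times> _"
    where w: "\<forall>n. A.res (Z n) (fst (w n)) (fst (snd (w n))) (snd (snd (w n)))"
    by (elim exE)
  define W DW \<eta>W where "W n = fst (w n)" and "DW n = fst (snd (w n))" and "\<eta>W n = snd (snd (w n))" for n
  have W: "A.res (Z n) (W n) (DW n) (\<eta>W n)" for n using w by (simp add: W_def DW_def \<eta>W_def)
  let ?GP = "\<lambda>n m. A.ind (F n) ?ob (P m)" and ?GD = "\<lambda>m X. A.indmap (D m)"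
  \<comment> \<open>Over A the n-th term is the induced module of B on F n, hence resolved by the
    induced modules of P.\<close>
  have GQ: "A.res (Q' n) (?GP n) ?GD (\<lambda>X. A.indmap \<eta>)" for n
    unfolding Q'_def
  proof (rule A.res_cong[OF A.ind_res[OF P]])
    show "A.md (rs (A.ind (F n) ?ob B))" by (rule rs_md[OF B.ind_md[OF B.A_md]])
    show "cr (rs (A.ind (F n) ?ob B)) X = cr (A.ind (F n) ?ob (rs B)) X" for X by (simp add: cr_rs A.cr_ind)
    show "ac (rs (A.ind (F n) ?ob B)) t b x = ac (A.ind (F n) ?ob (rs B)) t b x"
      if "t \<in> Hom Y X" "b \<in> cr A (cok t)" "x \<in> cr (A.ind (F n) ?ob (rs B)) Y" for Y X t b x
      by (rule rs_ind_ac[OF B.A_md that(1,2)]) (use that(3) in \<open>simp add: A.cr_ind cr_rs\<close>)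
  qed
  have sI': "A.ses (rs ?I) (rs B) (rs K) (\<lambda>X x. x) e"
    by (rule rs_ses[OF sI])
  obtain V :: "nat \<Rightarrow> ('x, 't, 'a, (('x, 't, 'a, 'b) nm \<times> 't) \<Rightarrow>\<^sub>0 'a) md" and DV \<eta>V where V: "A.res (rs ?I) V DV \<eta>V"
    using A.ex_res[OF rs_md[OF mI]] by (elim exE)
  show ?thesis using X q
  proof (induction q arbitrary: X rule: less_induct)
    case (less q X)
    note X = less.prems(1)
    \<comment> \<open>A generator of degree at most n + 1 leaves a complement of degree above 2j, to
      which the outer induction hypothesis applies. The condition j < q is what keeps Tor_q of the
      term Q 0 out of reach.\<close>
    have TG: "A.TorV (?GP n) ?GD j X" if "j < q" "Ob X" "2 * j + n + 1 < dm X" for j n X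
    proof (rule A.TorV_ind[OF A.resD(3)[OF P] that(2)])
      fix k assume "k \<in> A.terms (F n) ?ob X"
      then obtain s t where st: "k = (s, t)" "s \<in> F n" "t \<in> Hom (?ob s) X" by (auto simp: A.terms_def)
      have "dm (?ob s) \<le> n + 1" using F st(2) by blast
      then have "2 * j < dm (cok t)" using A.dm[OF st(3)] that(3) by linarith
      then show "A.TorV P D j (cok (snd k))" using less.IH[OF that(1) A.hom_ob(3)[OF st(3)]] st(1) by simp
    qed
    \<comment> \<open>The sequence of the syzygies n + 1 and n bounds Tor_j of the n-th one by Tor_j
      of Q (n + 1) and by Tor in degree j - 1 of the next syzygy. The first needs 2j + (n + 1) + 1,
      the second 2(j - 1) + (n + 1) + 2, and both are at most 2j + n + 2.\<close>
    have TW: "A.TorV (W n) (DW n) j X" if "j < q" "Ob X" "2 * j + n + 2 < dm X" for j n X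
      using that
    proof (induction j arbitrary: n rule: less_induct)
      case (less j)
      show ?case
        by (rule A.TorV_right[OF A.ses_syzygy_Suc[OF rQ, folded Z_def] W GQ W])
          (use less TG in auto)
    qed
    show ?case
      unfolding A.TorV_def
    proof (intro ballI impI)
      fix x assume x: "x \<in> cr (P q) X" "D q X x \<in> A.Pos (P (q - 1)) X"
      note cP = A.resD(3)[OF P] and cV = A.resD(3)[OF V]
      note mP = A.cpxD(1)[OF cP] and mV = A.cpxD(1)[OF cV]
      note cG = A.resD(3)[OF GQ[of 0]]
      obtain \<sigma> where \<sigma>: "A.cm V DV P D \<sigma>" "\<forall>X x. Ob X \<longrightarrow> x \<in> cr (V 0) X \<longrightarrow> \<eta> X (\<sigma> 0 X x) = \<eta>V X x"
        by (rule A.cm_lift[OF V A.resD(1)[OF P] A.sesD(4)[OF sI']])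
      have TKq: "A.TorV PK DK q X" using TK[OF X] less.prems(2) by simp
      \<comment> \<open>Tor_q of K vanishes at X, so the class comes from I.\<close>
      have "\<exists>s\<in>cr (V q) X. DV q X s \<in> A.Pos (V (q - 1)) X \<and>
          (\<exists>y\<in>cr (P (Suc q)) X. x - \<sigma> q X s - D (Suc q) X y \<in> A.Pos (P q) X)"
        by (rule A.Tor_exact_middle[OF sI' V P PK \<sigma>(1) _ TKq X x]) (use \<sigma>(2) in blast)
      then obtain s y1 where s: "s \<in> cr (V q) X" "DV q X s \<in> A.Pos (V (q - 1)) X"
        and y1: "y1 \<in> cr (P (Suc q)) X" "x - \<sigma> q X s - D (Suc q) X y1 \<in> A.Pos (P q) X" by blast
      note s0 = A.ses_syzygy0[OF rQ, folded Z_def]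
      obtain \<rho> where \<rho>: "A.cm (?GP 0) ?GD V DV \<rho>"
        "\<forall>X x. Ob X \<longrightarrow> x \<in> cr (?GP 0 0) X \<longrightarrow> \<eta>V X (\<rho> 0 X x) = B.ev ?I ?d0 (A.indmap \<eta> x)"
        by (rule A.cm_lift[OF GQ A.resD(1)[OF V] A.sesD(5)[OF s0]])
      \<comment> \<open>For q > 0 this uses Tor in degree q - 1 of the syzygy Z 0, which vanishes
        above degree 2(q - 1) + 2 = 2q. This is where the bound is attained.\<close>
      have "\<exists>g\<in>cr (?GP 0 q) X. A.indmap (D q) g \<in> A.Pos (?GP 0 (q - 1)) X \<and>
          (\<exists>y\<in>cr (V (Suc q)) X. s - \<rho> q X g - DV (Suc q) X y \<in> A.Pos (V q) X)"
        by (rule A.Tor_exact_right[OF s0 W GQ V \<rho>(1) _ _ X s])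
          (use \<rho>(2) TW[OF _ X, of _ 0] less.prems(2) in auto)
      then obtain g y2 where g: "g \<in> cr (?GP 0 q) X" "A.indmap (D q) g \<in> A.Pos (?GP 0 (q - 1)) X"
        and y2: "y2 \<in> cr (V (Suc q)) X" "s - \<rho> q X g - DV (Suc q) X y2 \<in> A.Pos (V q) X" by blast
      \<comment> \<open>Multiplication by lifts \<open>a s \<in> A\<^sub>+\<close> of the generators \<open>d0 s \<in> B\<^sub>+\<close>; it lifts the same map
         \<open>Q\<^sub>0 \<rightarrow> B\<close> as \<open>\<sigma> \<circ> \<rho>\<close> and vanishes modulo \<open>A\<^sub>+\<close>.\<close>
      have "\<forall>s\<in>F 0. \<exists>a. Ob (?ob s) \<longrightarrow> a \<in> Ap (?ob s) \<and> \<phi> (?ob s) a = ?d0 s"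
      proof
        fix s assume "s \<in> F 0"
        then have d: "?d0 s \<in> cr ?I (?ob s)" using F0 by blast
        show "\<exists>a. Ob (?ob s) \<longrightarrow> a \<in> Ap (?ob s) \<and> \<phi> (?ob s) a = ?d0 s"
        proof (cases "Ob (?ob s)")
          case True
          have d1: "?d0 s \<in> cr B (?ob s)" and d2: "?d0 s \<in> Bp (?ob s)"
            using d e_ker[OF True] unfolding B.cr_kerM by blast+
          obtain a where a: "a \<in> cr A (?ob s)" "\<phi> (?ob s) a = ?d0 s"
            using \<phi>_surj[OF True d1] by (elim bexE)
          have "a \<in> Ap (?ob s)" using \<phi>_pos[OF True a(1)] a(2) d2 by simp
          then show ?thesis using a(2) by blast
        qed simp
      qed
      from bchoice[OF this] obtain a
        where a0: "\<forall>s\<in>F 0. Ob (?ob s) \<longrightarrow> a s \<in> Ap (?ob s) \<and> \<phi> (?ob s) (a s) = ?d0 s" by (elim exE)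
      have a: "a s \<in> Ap (?ob s)" "\<phi> (?ob s) (a s) = ?d0 s" "a s \<in> cr A (?ob s)"
        if s: "s \<in> F 0" and t: "t \<in> Hom (?ob s) X" for s t X
      proof -
        note o = A.hom_ob(1)[OF t]
        show "a s \<in> Ap (?ob s)" "\<phi> (?ob s) (a s) = ?d0 s" using a0 s o by simp_all
        then show "a s \<in> cr A (?ob s)" using A.Ap[OF o] by simp
      qed
      \<comment> \<open>The lift \<open>a s\<close> sits over the object of s, while y sits over
        \<open>cok t\<close>; \<open>sw\<close> and \<open>tr\<close> let the former act on the
        latter.\<close>
      define m where "m = (\<lambda>n (s, t) y. ac (P n) (sw t) (tr t (a s)) y)"
      define \<mu> where "\<mu> = (\<lambda>n (X::'x). lin (m n))"
      have m_eq: "m n (s, t) y = ac (P n) (sw t) (tr t (a s)) y" for n s t y by (simp add: m_def)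
      have tra: "tr t (a s) \<in> cr A (cok (sw t))" "tr t (a s) \<in> Ap (cok (sw t))"
        if "(s, t) \<in> A.terms (F 0) ?ob X" for s t X
        by (rule tr[OF A.termsD(2)[OF that] a(3)[OF A.termsD[OF that]]])
          (rule tr_pos[OF A.termsD(2)[OF that] a(1)[OF A.termsD[OF that]]])
      have m_add: "additive_on (cr (P n) (cok t)) (m n (s, t))" if st: "(s, t) \<in> A.terms (F 0) ?ob X" for n s t X
        using A.mdD(3)[OF mP sw[OF A.termsD(2)[OF st]] tra(1)[OF st]] by (simp add: additive_on_def m_eq)
      have \<mu>_hom: "A.mhom (?GP 0 n) (P n) (\<mu> n)" for n
        unfolding \<mu>_def
      proof (rule A.lin_mhom[OF mP mP])
        fix s t X y assume st: "(s, t) \<in> A.terms (F 0) ?ob X" and y: "y \<in> cr (P n) (cok t)"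
        show "m n (s, t) y \<in> cr (P n) X"
          unfolding m_eq by (rule A.mdD(2)[OF mP sw[OF A.termsD(2)[OF st]] tra(1)[OF st] y])
      next
        fix s t X Z u b y assume st: "(s, t) \<in> A.terms (F 0) ?ob X" and u: "u \<in> Hom X Z"
          and b: "b \<in> cr A (cok u)" and y: "y \<in> cr (P n) (cok t)"
        note t = A.termsD(2)[OF st]
        note ut = A.terms_cmp[OF st u]
        have b': "b \<in> cr A (cok (push u t))" using b A.cok_push[OF t u] by simp
        \<comment> \<open>Linearity over A: the coefficient b has to pass the lift
          \<open>a s\<close>, which is the assumption \<open>comm\<close>.\<close>
        have "ac (P n) (sw (cmp u t)) (tr (cmp u t) (a s)) (ac (P n) (push u t) b y) =
            ac (P n) (cmp u (sw t)) (ac A (push u (sw t)) b (tr t (a s))) y"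
          using A.mdD(6)[OF mP A.push[OF t u] sw[OF A.termsD(2)[OF ut]] b' tra(1)[OF ut] y]
          by (simp add: cmp_sw[OF t u] comm[OF t u a(3)[OF A.termsD[OF st]] b])
        also have "\<dots> = ac (P n) u b (ac (P n) (sw t) (tr t (a s)) y)"
          by (rule A.mdD(6)[OF mP sw[OF t] u tra(1)[OF st] b y, symmetric])
        finally show "m n (s, cmp u t) (ac (P n) (push u t) b y) = ac (P n) u b (m n (s, t) y)"
          by (simp add: m_eq)
      qed (rule m_add)
      have \<mu>_single: "\<mu> n X (Poly_Mapping.single (s, t) y) = ac (P n) (sw t) (tr t (a s)) y"
        if st: "(s, t) \<in> A.terms (F 0) ?ob X" for n s t y X
        using A.lin_ind_single[where m = "m n" and e = s, OF mP A.termsD(2)[OF st] m_add[OF st]] by (simp add: \<mu>_def m_eq)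
      have \<mu>_cm: "A.cm (?GP 0) ?GD P D \<mu>"
        unfolding A.cm_def
      proof (intro conjI allI impI)
        show "A.mhom (?GP 0 n) (P n) (\<mu> n)" for n by (rule \<mu>_hom)
        fix n X p assume X: "Ob X" and p: "p \<in> cr (?GP 0 (Suc n)) X"
        note hD = A.cpxD(3)[OF cP, of n]
        show "D (Suc n) X (\<mu> (Suc n) X p) = \<mu> n X (A.indmap (D (Suc n)) p)"
        proof (rule A.mhom_ind_eqI[OF mP A.mhom_comp[OF \<mu>_hom hD] A.mhom_comp[OF A.indmap_mhom[OF mP mP hD] \<mu>_hom] X p])
          fix s t y assume st: "(s, t) \<in> A.terms (F 0) ?ob X" and y: "y \<in> cr (P (Suc n)) (cok t)"
          note t = A.termsD(2)[OF st]
          show "D (Suc n) X (\<mu> (Suc n) X (Poly_Mapping.single (s, t) y)) =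
              \<mu> n X (A.indmap (D (Suc n)) (Poly_Mapping.single (s, t) y))"
            by (simp add: \<mu>_single[OF st] A.indmap_single[OF mP hD t] A.mhomD(3)[OF hD sw[OF t] tra(1)[OF st] y])
        qed
      qed
      note h\<eta> = A.acpxD(3)[OF A.resD(2)[OF P]] and hev = B.acpxD(3)[OF B.resD(2)[OF Q]]
      have ev_hom: "A.mhom (?GP 0 0) (rs B) (\<lambda>X w. B.ev ?I ?d0 (A.indmap \<eta> w))"
        by (rule A.mhom_comp[OF A.mhom_comp[OF A.acpxD(3)[OF A.resD(2)[OF GQ[of 0]]] A.sesD(5)[OF s0]] A.sesD(4)[OF sI']])
      \<comment> \<open>In Q 0 the generator is multiplied by an element of B from the left, whereas
        \<open>\<mu>\<close> puts the lift of the generator first; \<open>comm_B\<close> exchanges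
        the two.\<close>
      have \<mu>_aug: "\<eta> X (\<mu> 0 X w) = B.ev ?I ?d0 (A.indmap \<eta> w)" if X: "Ob X" and w: "w \<in> cr (?GP 0 0) X" for X w
      proof (rule A.mhom_ind_eqI[OF mP A.mhom_comp[OF \<mu>_hom h\<eta>] ev_hom X w])
        fix s t y assume st: "(s, t) \<in> A.terms (F 0) ?ob X" and y: "y \<in> cr (P 0) (cok t)"
        note t = A.termsD(2)[OF st] and s = A.termsD(1)[OF st]
        have \<eta>y: "\<eta> (cok t) y \<in> cr B (cok t)" using A.mhomD(1)[OF h\<eta> A.hom_ob(3)[OF t] y] by (simp add: cr_rs)
        have d: "?d0 s \<in> cr ?I (?ob s)" using F0 s by blast
        have "\<eta> X (\<mu> 0 X (Poly_Mapping.single (s, t) y)) = ac B (sw t) (\<phi> (cok (sw t)) (tr t (a s))) (\<eta> (cok t) y)"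
          by (simp add: \<mu>_single[OF st] A.mhomD(3)[OF h\<eta> sw[OF t] tra(1)[OF st] y] ac_rs)
        also have "\<dots> = ac B t (\<eta> (cok t) y) (?d0 s)"
          using comm_B[OF t a(3)[OF s t] \<eta>y] a(2)[OF s t] by simp
        also have "\<dots> = B.ev ?I ?d0 (A.indmap \<eta> (Poly_Mapping.single (s, t) y))"
          using B.ev_single[where n = ?d0 and e = s, OF mI t d]
          by (simp add: A.indmap_single[OF mP h\<eta> t] B.ac_kerM)
        finally show "\<eta> X (\<mu> 0 X (Poly_Mapping.single (s, t) y)) =
            B.ev ?I ?d0 (A.indmap \<eta> (Poly_Mapping.single (s, t) y))" .
      qed
      have \<mu>_pos: "\<mu> n X w \<in> A.Pos (P n) X" if w: "w \<in> cr (?GP 0 n) X" for n w X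
        unfolding \<mu>_def lin_def
      proof (rule A.Pos_sum)
        fix k assume "k \<in> Poly_Mapping.keys w"
        then have k: "k \<in> A.terms (F 0) ?ob X" using w by (auto simp: A.cr_ind dsum_def)
        obtain s t where st: "k = (s, t)" by fastforce
        note st' = k[unfolded st]
        show "m n k (Poly_Mapping.lookup w k) \<in> A.Pos (P n) X"
          unfolding st m_eq
          by (rule A.Pos_ac[OF sw[OF A.termsD(2)[OF st']] tra(2)[OF st']])
            (use A.lookup_ind[OF mP w st'] in simp)
      qed
      \<comment> \<open>Both chain maps lift the map from Q 0 through I to B, and g is a cycle
        modulo the ideal, so they agree on g up to a boundary and the ideal.\<close>
      have "\<exists>y\<in>cr (P (Suc q)) X. \<sigma> q X (\<rho> q X g) - \<mu> q X g - D (Suc q) X y \<in> A.Pos (P q) X"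
      proof (rule A.cm_homotopic[where F = "\<lambda>n X x. \<sigma> n X (\<rho> n X x)" and G = \<mu>])
        show "A.cpx (?GP 0) ?GD" by (rule cG)
        show "A.proj (?GP 0 n)" for n by (rule A.resD(4)[OF GQ])
        show "A.resn (rs B) P D \<eta>" by (rule A.resD(1)[OF P])
        show "A.cm (?GP 0) ?GD P D (\<lambda>n X x. \<sigma> n X (\<rho> n X x))" by (rule A.cm_comp[OF \<rho>(1) \<sigma>(1)])
        show "A.cm (?GP 0) ?GD P D \<mu>" by (rule \<mu>_cm)
        show "\<eta> X (\<sigma> 0 X (\<rho> 0 X w)) = \<eta> X (\<mu> 0 X w)" if "Ob X" "w \<in> cr (?GP 0 0) X" for X w
          using \<sigma>(2)[rule_format, OF that(1) A.mhomD(1)[OF A.cmD(1)[OF \<rho>(1)] that]] \<rho>(2)[rule_format, OF that] \<mu>_aug[OF that]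
          by simp
      qed (rule X, rule g, rule g)
      then obtain y3 where y3: "y3 \<in> cr (P (Suc q)) X"
        "\<sigma> q X (\<rho> q X g) - \<mu> q X g - D (Suc q) X y3 \<in> A.Pos (P q) X" by (elim bexE)
      note \<rho>g = A.mhomD(1)[OF A.cmD(1)[OF \<rho>(1)] X g(1)]
      note Dy2 = A.mhomD(1)[OF A.cpxD(3)[OF cV] X y2(1)]
      note h\<sigma> = A.cmD(1)[OF \<sigma>(1)]
      have 2: "\<sigma> q X s - \<sigma> q X (\<rho> q X g) - D (Suc q) X (\<sigma> (Suc q) X y2) \<in> A.Pos (P q) X"
        using A.Pos_hom[OF y2(2) h\<sigma> mV X] A.mhom_simps(4)[OF h\<sigma> mV X _ Dy2] A.mhom_simps(4)[OF h\<sigma> mV X s(1) \<rho>g]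
          A.md_sgrp(2)[OF mV X s(1) \<rho>g] A.cmD(2)[OF \<sigma>(1) X y2(1)] by simp
      note \<sigma>y = A.mhomD(1)[OF h\<sigma> X y2(1)]
      define y where "y = y1 + \<sigma> (Suc q) X y2 + y3"
      have y: "y \<in> cr (P (Suc q)) X" unfolding y_def by (intro A.md_sgrp(4)[OF mP X] y1 y3 \<sigma>y)
      have Dy: "D (Suc q) X y = D (Suc q) X y1 + D (Suc q) X (\<sigma> (Suc q) X y2) + D (Suc q) X y3"
        unfolding y_def
        using A.mhom_simps(2)[OF A.cpxD(3)[OF cP] mP X] y1(1) y3(1) \<sigma>y A.md_sgrp(4)[OF mP X y1(1) \<sigma>y] by simp
      \<comment> \<open>A telescoping sum: x to \<open>\<sigma> s\<close>, then to the image of g,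
        then to its product with the lifts, which is in the ideal.\<close>
      have eq: "x - D (Suc q) X y = (x - \<sigma> q X s - D (Suc q) X y1) +
          (\<sigma> q X s - \<sigma> q X (\<rho> q X g) - D (Suc q) X (\<sigma> (Suc q) X y2)) +
          (\<sigma> q X (\<rho> q X g) - \<mu> q X g - D (Suc q) X y3) + \<mu> q X g"
        unfolding Dy by (simp add: algebra_simps)
      have "x - D (Suc q) X y \<in> A.Pos (P q) X"
        unfolding eq by (intro A.Pos_add y1(2) 2 y3(2) \<mu>_pos[OF g(1)])
      then show "\<exists>y\<in>cr (P (Suc q)) X. x - D (Suc q) X y \<in> A.Pos (P q) X" using y by blast
    qed
  qed
qed

end

section \<open>Finite-dimensional subspaces, decompositions and isomorphisms\<close>

lemma vb_sub:
  assumes "vb_obj X"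
  shows "0 \<in> X" "u \<in> X \<Longrightarrow> v \<in> X \<Longrightarrow> u + v \<in> X" "u \<in> X \<Longrightarrow> v \<in> X \<Longrightarrow> u - v \<in> X"
    "u \<in> X \<Longrightarrow> seq_scale c u \<in> X" "u \<in> X \<Longrightarrow> - u \<in> X"
  using assms unfolding vb_obj_def
  by (auto intro: Seq.span_zero Seq.span_add Seq.span_diff Seq.span_scale Seq.span_neg)

lemma vb_obj_zero: "vb_obj {0}"
  unfolding vb_obj_def by (rule exI[of _ "{}"]) simp

lemma vsum_iff: "x \<in> vsum A C \<longleftrightarrow> (\<exists>u\<in>A. \<exists>v\<in>C. x = u + v)"
  by (auto simp: vsum_def)

lemma vb_obj_vsum: "vb_obj A \<Longrightarrow> vb_obj C \<Longrightarrow> vb_obj (vsum A C)"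
proof -
  assume "vb_obj A" "vb_obj C"
  then obtain S T where "finite S" "A = Seq.span S" "finite T" "C = Seq.span T" unfolding vb_obj_def by blast
  then show ?thesis unfolding vb_obj_def vsum_def
    by (intro exI[of _ "S \<union> T"]) (auto simp: Seq.span_Un)
qed

lemma vsum_comm: "vsum A C = vsum C A"
proof -
  have "vsum A C \<subseteq> vsum C A" for A C :: "'a::field obj"
  proof
    fix x assume "x \<in> vsum A C"
    then obtain u v where "u \<in> A" "v \<in> C" "x = v + u" by (auto simp: vsum_iff add.commute)
    then show "x \<in> vsum C A" unfolding vsum_iff by blast
  qed
  then show ?thesis by blast
qed

lemma vsumI: "a \<in> A \<Longrightarrow> c \<in> C \<Longrightarrow> a + c \<in> vsum A C"
  unfolding vsum_iff by blast

lemma vsum_assoc: "vsum (vsum A C) E = vsum A (vsum C E)"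
proof
  show "vsum (vsum A C) E \<subseteq> vsum A (vsum C E)"
  proof
    fix x assume "x \<in> vsum (vsum A C) E"
    then obtain u v w where "u \<in> A" "v \<in> C" "w \<in> E" "x = (u + v) + w" unfolding vsum_def by blast
    then show "x \<in> vsum A (vsum C E)" by (simp only: add.assoc vsumI)
  qed
  show "vsum A (vsum C E) \<subseteq> vsum (vsum A C) E"
  proof
    fix x assume "x \<in> vsum A (vsum C E)"
    then obtain u v w where "u \<in> A" "v \<in> C" "w \<in> E" "x = u + (v + w)" unfolding vsum_def by blast
    then show "x \<in> vsum (vsum A C) E" by (simp only: add.assoc[symmetric] vsumI)
  qed
qed

lemma vsum_zero [simp]: "vsum A {0} = A" "vsum {0} A = A"
  by (auto simp: vsum_def)

lemma vsum_mono: "A \<subseteq> A' \<Longrightarrow> C \<subseteq> C' \<Longrightarrow> vsum A C \<subseteq> vsum A' C'"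
  by (auto simp: vsum_def)

lemma vsum_sub: "vb_obj A \<Longrightarrow> vb_obj C \<Longrightarrow> A \<subseteq> vsum A C" "vb_obj A \<Longrightarrow> vb_obj C \<Longrightarrow> C \<subseteq> vsum A C"
  using vsum_mono[of A A "{0}" C] vsum_mono[of "{0}" A C C] vb_sub(1) by auto

lemma decompD:
  assumes "decomp X A C"
  shows "vb_obj A" "vb_obj C" "X = vsum A C" "A \<inter> C = {0}" "vb_obj X" "A \<subseteq> X" "C \<subseteq> X" "decomp X C A"
  using assms vb_obj_vsum[of A C] vsum_sub[of A C] vsum_comm[of A C] unfolding decomp_def by auto

lemma decomp_zero: "vb_obj X \<Longrightarrow> decomp X {0} X" "vb_obj X \<Longrightarrow> decomp X X {0}"
  using vb_sub(1)[of X] by (auto simp: decomp_def vb_obj_zero)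

lemma decomp_unique:
  assumes "decomp X A C" "a \<in> A" "a' \<in> A" "c \<in> C" "c' \<in> C" "a + c = a' + c'"
  shows "a = a'" "c = c'"
proof -
  note d = decompD[OF assms(1)]
  have e: "a - a' = c' - c" using assms(6) by (simp add: algebra_simps)
  have "a - a' \<in> A \<inter> C" using vb_sub(3)[OF d(1) assms(2,3)] vb_sub(3)[OF d(2) assms(5,4)] e by simp
  then show "a = a'" "c = c'" using d(4) e by auto
qed

lemma decomp_assoc:
  assumes 1: "decomp X A C" and 2: "decomp A E F"
  shows "decomp X E (vsum F C)" "decomp (vsum F C) F C"
proof -
  note d = decompD[OF 1] and e = decompD[OF 2]
  have "F \<inter> C \<subseteq> {0}" using d(4) e(7) by blast
  then show 3: "decomp (vsum F C) F C"
    using d e vb_sub(1) by (auto simp: decomp_def)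
  have "x = 0" if x: "x \<in> E" "x \<in> vsum F C" for x
  proof -
    obtain f c where fc: "f \<in> F" "c \<in> C" "x = f + c" using x(2) by (auto simp: vsum_iff)
    have "x + 0 = f + c" using fc by simp
    then have "x = f" using decomp_unique(1)[OF 1 _ _ vb_sub(1)[OF d(2)] fc(2)] e(6,7) x(1) fc(1) by blast
    then show ?thesis using e(4) x(1) fc(1) by blast
  qed
  then have "E \<inter> vsum F C = {0}" using vb_sub(1)[OF e(1)] vb_sub(1)[OF decompD(5)[OF 3]] by blast
  then show "decomp X E (vsum F C)"
    using d(3) e(3) e(1) decompD(5)[OF 3] by (simp add: decomp_def vsum_assoc)
qed

lemma decomp_assoc':
  assumes "decomp X A C" "decomp C E F"
  shows "decomp X (vsum A E) F" "decomp (vsum A E) A E"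
  using decomp_assoc[OF decompD(8)[OF assms(1)] decompD(8)[OF assms(2)]]
  by (auto simp: vsum_comm dest: decompD(8))

text \<open>Triple decompositions are bracketed to the left by definition, while iterated actions
  produce the bracketing to the right.\<close>

lemma decomp3_iff: "decomp3 X A C E \<longleftrightarrow> decomp X A (vsum C E) \<and> decomp (vsum C E) C E"
proof
  assume "decomp3 X A C E"
  then show "decomp X A (vsum C E) \<and> decomp (vsum C E) C E"
    unfolding decomp3_def using decomp_assoc by blast
next
  assume "decomp X A (vsum C E) \<and> decomp (vsum C E) C E"
  then show "decomp3 X A C E" unfolding decomp3_def using decomp_assoc' by blast
qed

lemma isoD:
  assumes "f \<in> vb_iso X Y" "vb_obj X"
  shows "f \<in> extensional X" "f ` X = Y" "inj_on f X" "u \<in> X \<Longrightarrow> v \<in> X \<Longrightarrow> f (u + v) = f u + f v"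
    "v \<in> X \<Longrightarrow> f (seq_scale c v) = seq_scale c (f v)" "f 0 = 0"
proof -
  show a: "u \<in> X \<Longrightarrow> v \<in> X \<Longrightarrow> f (u + v) = f u + f v" for u v using assms(1) by (simp add: vb_iso_def)
  show "f 0 = 0" using a[of 0 0] vb_sub(1)[OF assms(2)] by simp
qed (use assms in \<open>simp_all add: vb_iso_def bij_betw_def\<close>)

lemma isoI:
  assumes "f \<in> extensional X" "f ` X = Y" "inj_on f X" "\<And>u v. u \<in> X \<Longrightarrow> v \<in> X \<Longrightarrow> f (u + v) = f u + f v"
    "\<And>v c. v \<in> X \<Longrightarrow> f (seq_scale c v) = seq_scale c (f v)"
  shows "f \<in> vb_iso X Y"
  using assms by (simp add: vb_iso_def bij_betw_def)

lemma iso_span: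
  assumes "f \<in> vb_iso X Y" "vb_obj X" "S \<subseteq> X"
  shows "f ` Seq.span S = Seq.span (f ` S)" "Seq.span S \<subseteq> X"
proof -
  obtain T where T: "X = Seq.span T" using assms(2) by (auto simp: vb_obj_def)
  show sub: "Seq.span S \<subseteq> X" using Seq.span_minimal[OF assms(3)] T by simp
  note i = isoD[OF assms(1,2)]
  show "f ` Seq.span S = Seq.span (f ` S)"
  proof
    have "x \<in> X \<and> f x \<in> Seq.span (f ` S)" if "x \<in> Seq.span S" for x
      using that
    proof (induction rule: Seq.span_induct_alt)
      case base
      then show ?case using i(6) Seq.span_zero[of "f ` S"] vb_sub(1)[OF assms(2)] by (simp add: zero_fun_def)
    next
      case (step c x y)
      have xX: "x \<in> X" using step(1) assms(3) by blast
      have yX: "y \<in> X" using step by blast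
      have "f (seq_scale c x + y) = seq_scale c (f x) + f y"
        using i(4)[OF vb_sub(4)[OF assms(2) xX] yX] i(5)[OF xX] by simp
      moreover have "seq_scale c (f x) + f y \<in> Seq.span (f ` S)"
        by (rule Seq.span_add[OF Seq.span_scale[OF Seq.span_base[OF imageI[OF step(1)]]]]) (use step in blast)
      ultimately show ?case using vb_sub(2)[OF assms(2) vb_sub(4)[OF assms(2) xX, of c] yX]
        by (simp add: plus_fun_def)
    qed
    then show "f ` Seq.span S \<subseteq> Seq.span (f ` S)" by blast
    have "Seq.subspace (f ` Seq.span S)"
      unfolding Seq.subspace_def
    proof (intro conjI ballI allI)
      show "0 \<in> f ` Seq.span S" by (rule image_eqI[of _ _ 0]) (simp_all add: i(6) Seq.span_zero)
      fix x y assume "x \<in> f ` Seq.span S" "y \<in> f ` Seq.span S"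
      then obtain a b where ab: "x = f a" "a \<in> Seq.span S" "y = f b" "b \<in> Seq.span S" by blast
      show "x + y \<in> f ` Seq.span S"
        by (rule image_eqI[of _ _ "a + b"]) (use ab i(4)[OF subsetD[OF sub ab(2)] subsetD[OF sub ab(4)]] Seq.span_add[of a S b] in simp_all)
    next
      fix c x assume "x \<in> f ` Seq.span S"
      then obtain a where a: "x = f a" "a \<in> Seq.span S" by blast
      show "seq_scale c x \<in> f ` Seq.span S"
        by (rule image_eqI[of _ _ "seq_scale c a"]) (use a i(5)[OF subsetD[OF sub a(2)]] Seq.span_scale[of a S c] in simp_all)
    qed
    then show "Seq.span (f ` S) \<subseteq> f ` Seq.span S"
      by (intro Seq.span_minimal image_mono Seq.span_superset)
  qed
qed

lemma iso_image_obj: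
  assumes "f \<in> vb_iso X Y" "vb_obj X" "vb_obj V" "V \<subseteq> X"
  shows "vb_obj (f ` V)"
proof -
  obtain S where S: "finite S" "V = Seq.span S" using assms(3) by (auto simp: vb_obj_def)
  have "S \<subseteq> X" using S(2) Seq.span_superset assms(4) by blast
  then have "f ` V = Seq.span (f ` S)" using iso_span(1)[OF assms(1,2)] S by simp
  then show ?thesis using S(1) unfolding vb_obj_def by blast
qed

lemma iso_restrict:
  assumes "f \<in> vb_iso X Y" "vb_obj X" "vb_obj V" "V \<subseteq> X"
  shows "restrict f V \<in> vb_iso V (f ` V)"
proof (rule isoI)
  note i = isoD[OF assms(1,2)]
  show "inj_on (restrict f V) V" using inj_on_subset[OF i(3) assms(4)] by (simp add: inj_on_def)
  show "restrict f V (u + v) = restrict f V u + restrict f V v" if "u \<in> V" "v \<in> V" for u v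
    using that i(4)[of u v] vb_sub(2)[OF assms(3)] assms(4) by auto
  show "restrict f V (seq_scale c v) = seq_scale c (restrict f V v)" if "v \<in> V" for v c
    using that i(5)[of v c] vb_sub(4)[OF assms(3)] assms(4) by auto
qed auto

lemma iso_compose:
  assumes "f \<in> vb_iso X Y" "vb_obj X" "g \<in> vb_iso Y Z" "vb_obj Y"
  shows "compose X g f \<in> vb_iso X Z"
proof (rule isoI)
  note i = isoD[OF assms(1,2)] and j = isoD[OF assms(3,4)]
  have f: "f x \<in> Y" if "x \<in> X" for x using that i(2) by blast
  show "compose X g f \<in> extensional X" by (simp add: compose_def)
  have "compose X g f ` X = g ` f ` X" unfolding image_image by (rule image_cong) (simp_all add: compose_def)
  then show "compose X g f ` X = Z" using i(2) j(2) by simp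
  show "inj_on (compose X g f) X" using i(3) j(3) f unfolding inj_on_def compose_def by simp
  show "compose X g f (u + v) = compose X g f u + compose X g f v" if "u \<in> X" "v \<in> X" for u v
    using that i(4) j(4) f vb_sub(2)[OF assms(2)] by (simp add: compose_def)
  show "compose X g f (seq_scale c v) = seq_scale c (compose X g f v)" if "v \<in> X" for v c
    using that i(5) j(5) f vb_sub(4)[OF assms(2)] by (simp add: compose_def)
qed

lemma iso_id: "(\<lambda>v\<in>X. v) \<in> vb_iso X X" if "vb_obj X"
  by (rule isoI) (use vb_sub[OF that] in \<open>auto simp: inj_on_def\<close>)

lemma iso_image_vsum:
  assumes "f \<in> vb_iso X Y" "vb_obj X" "A \<subseteq> X" "C \<subseteq> X"
  shows "f ` vsum A C = vsum (f ` A) (f ` C)"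
proof -
  have add: "f (u + v) = f u + f v" if "u \<in> A" "v \<in> C" for u v using that assms(3,4) isoD(4)[OF assms(1,2)] by blast
  show ?thesis
  proof
    show "f ` vsum A C \<subseteq> vsum (f ` A) (f ` C)"
    proof
      fix y assume "y \<in> f ` vsum A C"
      then obtain u v where uv: "u \<in> A" "v \<in> C" "y = f (u + v)" unfolding vsum_def by blast
      show "y \<in> vsum (f ` A) (f ` C)" unfolding uv(3) add[OF uv(1,2)] by (intro vsumI imageI uv)
    qed
    show "vsum (f ` A) (f ` C) \<subseteq> f ` vsum A C"
    proof
      fix y assume "y \<in> vsum (f ` A) (f ` C)"
      then obtain u v where uv: "u \<in> A" "v \<in> C" "y = f u + f v" unfolding vsum_def by blast
      show "y \<in> f ` vsum A C" unfolding uv(3) add[OF uv(1,2), symmetric] by (intro vsumI imageI uv)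
    qed
  qed
qed

lemma iso_decomp:
  assumes "f \<in> vb_iso X Y" "decomp X A C"
  shows "decomp Y (f ` A) (f ` C)"
proof -
  note d = decompD[OF assms(2)]
  note i = isoD[OF assms(1) d(5)]
  have "f ` A \<inter> f ` C = f ` (A \<inter> C)" using inj_on_image_Int[OF i(3) d(6,7)] by simp
  then have "f ` A \<inter> f ` C = {0}" using d(4) i(6) by simp
  then show ?thesis
    using iso_image_obj[OF assms(1) d(5) d(1,6)] iso_image_obj[OF assms(1) d(5) d(2,7)]
      iso_image_vsum[OF assms(1) d(5,6,7)] d(3) i(2) by (simp add: decomp_def)
qed

lemma vb_basis:
  assumes "vb_obj X"
  obtains B where "finite B" "\<not> Seq.dependent B" "Seq.span B = X" "card B = Seq.dim X" "B \<subseteq> X"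
proof -
  obtain S where S: "finite S" "X = Seq.span S" using assms by (auto simp: vb_obj_def)
  obtain B where B: "B \<subseteq> S" "\<not> Seq.dependent B" "S \<subseteq> Seq.span B"
    using Seq.maximal_independent_subset[of S] by blast
  have "Seq.span B = X" using B S(2) Seq.span_mono[OF B(1)] Seq.span_minimal[OF B(3)] by auto
  then show ?thesis
    using that[of B] finite_subset[OF B(1) S(1)] B(2) Seq.dim_span_eq_card_independent[OF B(2)] Seq.span_superset[of B] by simp
qed

lemma dim_iso:
  assumes "f \<in> vb_iso X Y" "vb_obj X"
  shows "Seq.dim Y = Seq.dim X"
proof -
  note i = isoD[OF assms]
  obtain B where B: "finite B" "\<not> Seq.dependent B" "Seq.span B = X" "card B = Seq.dim X" "B \<subseteq> X"
    using vb_basis[OF assms(2)] .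
  have "\<not> Seq.dependent (f ` B)"
  proof
    assume "Seq.dependent (f ` B)"
    then obtain a where a: "a \<in> B" "f a \<in> Seq.span (f ` B - {f a})" unfolding Seq.dependent_def by blast
    have "f ` B - {f a} = f ` (B - {a})" using i(3) B(5) a(1) by (auto simp: inj_on_def)
    then have "f a \<in> f ` Seq.span (B - {a})" using iso_span(1)[OF assms, of "B - {a}"] B(5) a(2) by auto
    then obtain b where b: "b \<in> Seq.span (B - {a})" "f a = f b" by blast
    have "b \<in> X" using iso_span(2)[OF assms, of "B - {a}"] B(5) b(1) by blast
    then have "a = b" using b(2) i(3) a(1) B(5) by (auto dest: inj_onD)
    then show False using b(1) a(1) B(2) unfolding Seq.dependent_def by blast
  qed
  moreover have "Seq.span (f ` B) = Y" using iso_span(1)[OF assms B(5)] B(3) i(2) by simp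
  ultimately have "Seq.dim Y = card (f ` B)" using Seq.dim_span_eq_card_independent by metis
  also have "card (f ` B) = card B" by (rule card_image[OF inj_on_subset[OF i(3) B(5)]])
  finally show ?thesis using B(4) by simp
qed

lemma dim_decomp:
  assumes "decomp X A C"
  shows "Seq.dim X = Seq.dim A + Seq.dim C"
proof -
  note d = decompD[OF assms]
  obtain S where S: "finite S" "\<not> Seq.dependent S" "Seq.span S = A" "card S = Seq.dim A" "S \<subseteq> A"
    using vb_basis[OF d(1)] .
  obtain T where T: "finite T" "\<not> Seq.dependent T" "Seq.span T = C" "card T = Seq.dim C" "T \<subseteq> C"
    using vb_basis[OF d(2)] .
  have disj: "S \<inter> T = {}"
  proof -
    have "S \<inter> T \<subseteq> {0}" using S(5) T(5) d(4) by blast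
    moreover have "0 \<notin> S" using S(2) Seq.dependent_zero by blast
    ultimately show ?thesis by blast
  qed
  have "\<not> Seq.dependent (S \<union> T)"
  proof
    assume "Seq.dependent (S \<union> T)"
    then obtain u v where v: "v \<in> S \<union> T" "u v \<noteq> 0" and 0: "(\<Sum>v\<in>S \<union> T. seq_scale (u v) v) = 0"
      using Seq.dependent_finite[of "S \<union> T"] S(1) T(1) by auto
    let ?s = "\<Sum>v\<in>S. seq_scale (u v) v" and ?t = "\<Sum>v\<in>T. seq_scale (u v) v"
    have s: "?s \<in> A" unfolding S(3)[symmetric] by (intro Seq.span_sum Seq.span_scale Seq.span_base)
    have t: "?t \<in> C" unfolding T(3)[symmetric] by (intro Seq.span_sum Seq.span_scale Seq.span_base)
    have "?s + ?t = 0 + 0" using 0 sum.union_disjoint[OF S(1) T(1) disj, of "\<lambda>v. seq_scale (u v) v"] by simp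
    then have "?s = 0" "?t = 0"
      using decomp_unique[OF assms s vb_sub(1)[OF d(1)] t vb_sub(1)[OF d(2)]] by blast+
    then show False using v S(1,2) T(1,2) Seq.dependent_finite by blast
  qed
  moreover have "Seq.span (S \<union> T) = X" unfolding Seq.span_Un S(3) T(3) d(3) vsum_def by blast
  ultimately have "Seq.dim X = card (S \<union> T)" using Seq.dim_span_eq_card_independent by metis
  then show ?thesis using card_Un_disjoint[OF S(1) T(1) disj] S(4) T(4) by simp
qed

lemma dim_0: "vb_obj X \<Longrightarrow> Seq.dim X = 0 \<longleftrightarrow> X = {0}"
proof -
  assume "vb_obj X"
  then obtain B where B: "finite B" "\<not> Seq.dependent B" "Seq.span B = X" "card B = Seq.dim X"
    using vb_basis by metis
  show ?thesis
  proof
    assume "Seq.dim X = 0"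
    then have "B = {}" using B(1,4) by simp
    then show "X = {0}" using B(3) by simp
  next
    assume "X = {0}"
    then show "Seq.dim X = 0" using Seq.dim_span[of "{}"] Seq.dim_span_eq_card_independent[OF Seq.independent_empty] by simp
  qed
qed

section \<open>The category of injective linear maps with chosen complements\<close>

type_synonym 'f vmor = "'f obj \<times> 'f obj \<times> 'f mor"

text \<open>The category whose morphisms \<open>(Y, X1, f)\<close> from \<open>Y\<close> to \<open>X\<close> are the injections \<open>f\<close> with a chosen
  complement \<open>X1\<close> of the image in \<open>X\<close>.\<close>

definition vhom :: "'f::field obj \<Rightarrow> 'f obj \<Rightarrow> 'f vmor set" where
  "vhom Y X = {(Y', X1, f). Y' = Y \<and> vb_obj Y \<and> f \<in> vb_iso Y (f ` Y) \<and> decomp X X1 (f ` Y)}"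

definition vcmp :: "'f::field vmor \<Rightarrow> 'f vmor \<Rightarrow> 'f vmor" where
  "vcmp = (\<lambda>(X, Z1, g) (Y, X1, f). (Y, vsum Z1 (g ` X1), compose Y g f))"

definition vid :: "'f::field obj \<Rightarrow> 'f vmor" where "vid X = (X, {0}, \<lambda>v\<in>X. v)"

definition vcok :: "'f vmor \<Rightarrow> 'f obj" where "vcok t = fst (snd t)"

definition vpush :: "'f vmor \<Rightarrow> 'f vmor \<Rightarrow> 'f vmor" where
  "vpush = (\<lambda>(X, Z1, g) (Y, X1, f). (X1, Z1, restrict g X1))"

definition vzm :: "'f::field obj \<Rightarrow> 'f vmor" where "vzm X = ({0}, X, \<lambda>v\<in>{0}. v)"

lemma vhomE:
  assumes "t \<in> vhom Y X"
  obtains X1 f where "t = (Y, X1, f)" "vb_obj Y" "f \<in> vb_iso Y (f ` Y)" "decomp X X1 (f ` Y)"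
  using assms by (auto simp: vhom_def)

lemma vhom_iff: "(Y', X1, f) \<in> vhom Y X \<longleftrightarrow> Y' = Y \<and> vb_obj Y \<and> f \<in> vb_iso Y (f ` Y) \<and> decomp X X1 (f ` Y)"
  by (simp add: vhom_def)

lemma vsimps: "vcmp (X, Z1, g) (Y, X1, f) = (Y, vsum Z1 (g ` X1), compose Y g f)"
  "vcok (Y, X1, f) = X1" "vpush (X, Z1, g) (Y, X1, f) = (X1, Z1, restrict g X1)"
  by (simp_all add: vcmp_def vcok_def vpush_def)

lemma vhom_cmp:
  assumes "t \<in> vhom Y X" "u \<in> vhom X Z"
  shows "vcmp u t \<in> vhom Y Z" "vpush u t \<in> vhom (vcok t) (vcok (vcmp u t))"
proof -
  obtain X1 f where t: "t = (Y, X1, f)" "vb_obj Y" "f \<in> vb_iso Y (f ` Y)" "decomp X X1 (f ` Y)"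
    using assms(1) by (rule vhomE)
  obtain Z1 g where u: "u = (X, Z1, g)" "vb_obj X" "g \<in> vb_iso X (g ` X)" "decomp Z Z1 (g ` X)"
    using assms(2) by (rule vhomE)
  note d = decompD[OF t(4)]
  have g: "decomp (g ` X) (g ` X1) (g ` f ` Y)" by (rule iso_decomp[OF u(3) t(4)])
  have im: "compose Y g f ` Y = g ` f ` Y" by (auto simp: compose_def)
  have "compose Y (restrict g (f ` Y)) f \<in> vb_iso Y (g ` f ` Y)"
    by (rule iso_compose[OF t(3,2) iso_restrict[OF u(3,2) d(2,7)] d(2)])
  moreover have "compose Y (restrict g (f ` Y)) f = compose Y g f" by (auto simp: compose_def fun_eq_iff)
  ultimately have c: "compose Y g f \<in> vb_iso Y (g ` f ` Y)" by simp
  have dd: "decomp Z (vsum Z1 (g ` X1)) (g ` f ` Y)" "decomp (vsum Z1 (g ` X1)) Z1 (g ` X1)"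
    using decomp_assoc'[OF u(4) g] by blast+
  show "vcmp u t \<in> vhom Y Z" using c dd(1) t(2) by (simp add: t(1) u(1) vsimps vhom_iff im)
  show "vpush u t \<in> vhom (vcok t) (vcok (vcmp u t))"
    using iso_restrict[OF u(3,2) d(1,6)] dd(2) d(1) by (simp add: t(1) u(1) vsimps vhom_iff)
qed

text \<open>The direct sum of Y and W is realised inside the given X as the sum of the images. A map
  out of it is determined by its restrictions to the two summands, and its complement by what is
  left over.\<close>

lemma vpair:
  assumes "t \<in> vhom Y X" "s \<in> vhom W (vcok t)"
  shows "\<exists>X0 t0 s0. t0 \<in> vhom Y X0 \<and> s0 \<in> vhom W (vcok t0) \<and> vcok s0 = {0} \<and>
        (\<forall>X t s. t \<in> vhom Y X \<and> s \<in> vhom W (vcok t) \<longrightarrow>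
           (\<exists>!u. u \<in> vhom X0 X \<and> vcmp u t0 = t \<and> vcmp (vpush u t0) s0 = s)) \<and>
        (\<forall>X u. u \<in> vhom X0 X \<longrightarrow> vcok (vcmp (vpush u t0) s0) = vcok u)"
proof -
  obtain X1 f where t: "t = (Y, X1, f)" "vb_obj Y" "f \<in> vb_iso Y (f ` Y)" "decomp X X1 (f ` Y)"
    using assms(1) by (rule vhomE)
  obtain S1 g where s: "s = (W, S1, g)" "vb_obj W" "g \<in> vb_iso W (g ` W)" "decomp X1 S1 (g ` W)"
    using assms(2) unfolding t(1) vsimps by (rule vhomE)
  let ?F = "f ` Y" and ?G = "g ` W"
  let ?X0 = "vsum ?G ?F" and ?t0 = "(Y, ?G, f)" and ?s0 = "(W, {0}, g)"
  have d0: "decomp ?X0 ?G ?F" by (rule decomp_assoc(2)[OF t(4) s(4)])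
  note d = decompD[OF d0]
  note isof = isoD[OF t(3,2)] and isog = isoD[OF s(3,2)]
  have t0: "?t0 \<in> vhom Y ?X0" using t d0 by (simp add: vhom_iff)
  have s0: "?s0 \<in> vhom W (vcok ?t0)" using s decomp_zero(1)[OF d(1)] by (simp add: vhom_iff vsimps)
  \<comment> \<open>The second map of the universal pair has zero complement, so nothing is added to
    the complement of u.\<close>
  have cu: "vcok (vcmp (vpush u ?t0) ?s0) = vcok u" if u0: "u \<in> vhom ?X0 X'" for X' u
  proof -
    obtain U1 h where u: "u = (?X0, U1, h)" "vb_obj ?X0" "h \<in> vb_iso ?X0 (h ` ?X0)"
      "decomp X' U1 (h ` ?X0)" using u0 by (rule vhomE)
    show ?thesis using isoD(6)[OF u(3,2)] vb_sub(1)[OF d(1)] by (simp add: u(1) vsimps)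
  qed
  have "\<exists>!u. u \<in> vhom ?X0 X' \<and> vcmp u ?t0 = t' \<and> vcmp (vpush u ?t0) ?s0 = s'"
    if t': "t' \<in> vhom Y X'" and s': "s' \<in> vhom W (vcok t')" for X' t' s'
  proof -
    obtain X1' f' where T: "t' = (Y, X1', f')" "vb_obj Y" "f' \<in> vb_iso Y (f' ` Y)" "decomp X' X1' (f' ` Y)"
      using t' by (rule vhomE)
    obtain S1' g' where S: "s' = (W, S1', g')" "vb_obj W" "g' \<in> vb_iso W (g' ` W)" "decomp X1' S1' (g' ` W)"
      using s' unfolding T(1) vsimps by (rule vhomE)
    let ?F' = "f' ` Y" and ?G' = "g' ` W"
    note isof' = isoD[OF T(3,2)] and isog' = isoD[OF S(3,2)]
    have d1: "decomp X' S1' (vsum ?G' ?F')" "decomp (vsum ?G' ?F') ?G' ?F'"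
      by (rule decomp_assoc[OF T(4) S(4)])+
    \<comment> \<open>The only candidate: on g(W) it undoes g and applies g', on f(Y) it undoes f
      and applies f'. \<open>uniq\<close> makes the description unambiguous.\<close>
    define h where "h = (\<lambda>x\<in>?X0. THE z. \<exists>w\<in>W. \<exists>y\<in>Y. x = g w + f y \<and> z = g' w + f' y)"
    have uniq: "w = w' \<and> y = y'" if "w \<in> W" "w' \<in> W" "y \<in> Y" "y' \<in> Y" "g w + f y = g w' + f y'" for w w' y y'
      using decomp_unique[OF d0, of "g w" "g w'" "f y" "f y'"] that isof(3) isog(3) by (auto dest: inj_onD)
    have uniq': "w = w' \<and> y = y'" if "w \<in> W" "w' \<in> W" "y \<in> Y" "y' \<in> Y" "g' w + f' y = g' w' + f' y'" for w w' y y'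
      using decomp_unique[OF d1(2), of "g' w" "g' w'" "f' y" "f' y'"] that isof'(3) isog'(3) by (auto dest: inj_onD)
    have X0E: "\<exists>w\<in>W. \<exists>y\<in>Y. x = g w + f y" if "x \<in> ?X0" for x using that by (auto simp: vsum_iff)
    have X0I: "g w + f y \<in> ?X0" if "w \<in> W" "y \<in> Y" for w y using that by (auto simp: vsum_iff)
    have h: "h (g w + f y) = g' w + f' y" if wy: "w \<in> W" "y \<in> Y" for w y
    proof -
      have "(THE z. \<exists>w'\<in>W. \<exists>y'\<in>Y. g w + f y = g w' + f y' \<and> z = g' w' + f' y') = g' w + f' y"
      proof (rule the_equality)
        show "\<exists>w'\<in>W. \<exists>y'\<in>Y. g w + f y = g w' + f y' \<and> g' w + f' y = g' w' + f' y'" using wy by blast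
        fix z assume "\<exists>w'\<in>W. \<exists>y'\<in>Y. g w + f y = g w' + f y' \<and> z = g' w' + f' y'"
        then show "z = g' w + f' y" using uniq wy by blast
      qed
      then show ?thesis using X0I[OF wy] by (simp add: h_def)
    qed
    have hf: "h (f y) = f' y" if "y \<in> Y" for y
      using h[OF vb_sub(1)[OF s(2)] that] isog(6) isog'(6) by simp
    have hg: "h (g w) = g' w" if "w \<in> W" for w
      using h[OF that vb_sub(1)[OF t(2)]] isof(6) isof'(6) by simp
    have him: "h ` ?X0 = vsum ?G' ?F'"
    proof
      show "h ` ?X0 \<subseteq> vsum ?G' ?F'" using X0E h by (fastforce simp: vsum_iff)
      show "vsum ?G' ?F' \<subseteq> h ` ?X0"
      proof
        fix z assume "z \<in> vsum ?G' ?F'"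
        then obtain w y where "w \<in> W" "y \<in> Y" "z = g' w + f' y" by (auto simp: vsum_iff)
        then show "z \<in> h ` ?X0" using h X0I by (metis imageI)
      qed
    qed
    have hiso: "h \<in> vb_iso ?X0 (vsum ?G' ?F')"
    proof (rule isoI[OF _ him])
      show "h \<in> extensional ?X0" by (simp add: h_def)
      show "inj_on h ?X0"
      proof (rule inj_onI)
        fix x x' assume "x \<in> ?X0" "x' \<in> ?X0" and e: "h x = h x'"
        then obtain w y w' y' where wy: "w \<in> W" "y \<in> Y" "x = g w + f y" "w' \<in> W" "y' \<in> Y" "x' = g w' + f y'"
          using X0E by meson
        then show "x = x'" using uniq'[of w w' y y'] h e by simp
      qed
      show "h (x + x') = h x + h x'" if xx: "x \<in> ?X0" "x' \<in> ?X0" for x x'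
      proof -
        obtain w y w' y' where wy: "w \<in> W" "y \<in> Y" "x = g w + f y" "w' \<in> W" "y' \<in> Y" "x' = g w' + f y'"
          using X0E[OF xx(1)] X0E[OF xx(2)] by blast
        have "x + x' = g (w + w') + f (y + y')" using wy isof(4) isog(4) by (simp add: algebra_simps)
        then have "h (x + x') = g' (w + w') + f' (y + y')"
          using h vb_sub(2)[OF s(2) wy(1,4)] vb_sub(2)[OF t(2) wy(2,5)] by simp
        then show ?thesis using wy h isof'(4) isog'(4) by (simp add: algebra_simps)
      qed
      show "h (seq_scale c x) = seq_scale c (h x)" if xx: "x \<in> ?X0" for x c
      proof -
        obtain w y where wy: "w \<in> W" "y \<in> Y" "x = g w + f y" using X0E[OF xx] by blast
        have "seq_scale c x = g (seq_scale c w) + f (seq_scale c y)"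
          using wy isof(5) isog(5) by (simp add: Seq.scale_right_distrib)
        then have "h (seq_scale c x) = g' (seq_scale c w) + f' (seq_scale c y)"
          using h vb_sub(4)[OF s(2) wy(1)] vb_sub(4)[OF t(2) wy(2)] by simp
        then show ?thesis using wy h isof'(5) isog'(5) by (simp add: Seq.scale_right_distrib)
      qed
    qed
    let ?u = "(?X0, S1', h)"
    have u: "?u \<in> vhom ?X0 X'" using d(5) hiso d1(1) him by (simp add: vhom_iff)
    have "h ` ?G = ?G'" using hg by (auto simp: image_iff)
    moreover have "vsum S1' ?G' = X1'" using decompD(3)[OF S(4)] by simp
    moreover have "compose Y h f = f'" using hf isof'(1) by (auto simp: compose_def fun_eq_iff extensional_def)
    moreover have "compose W (restrict h ?G) g = g'" using hg isog'(1) by (auto simp: compose_def fun_eq_iff extensional_def)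
    moreover have "h 0 = 0" using hg[OF vb_sub(1)[OF s(2)]] isog(6) isog'(6) by simp
    ultimately have ut: "vcmp ?u ?t0 = t'" and us: "vcmp (vpush ?u ?t0) ?s0 = s'"
      using vb_sub(1)[OF d(1)] by (simp_all add: vsimps T(1) S(1))
    have "v = ?u" if v: "v \<in> vhom ?X0 X'" and vt: "vcmp v ?t0 = t'" and vs: "vcmp (vpush v ?t0) ?s0 = s'" for v
    proof -
      obtain U1 k where k: "v = (?X0, U1, k)" "vb_obj ?X0" "k \<in> vb_iso ?X0 (k ` ?X0)"
        "decomp X' U1 (k ` ?X0)" using v by (rule vhomE)
      note isok = isoD[OF k(3,2)]
      have U1: "U1 = S1'" using cu[OF v] vs by (simp add: k(1) S(1) vsimps)
      have kf: "k (f y) = f' y" if "y \<in> Y" for y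
      proof -
        have "compose Y k f = f'" using vt by (simp add: k(1) vsimps T(1))
        then show ?thesis using that by (metis compose_eq)
      qed
      have kg: "k (g w) = g' w" if "w \<in> W" for w
      proof -
        have "compose W (restrict k ?G) g = g'" using vs by (simp add: k(1) vsimps S(1))
        then have "restrict k ?G (g w) = g' w" using that by (metis compose_eq)
        then show ?thesis using that by simp
      qed
      have "k = h"
      proof (rule extensionalityI[OF isok(1) isoD(1)[OF hiso d(5)]])
        fix x assume "x \<in> ?X0"
        then obtain w y where wy: "w \<in> W" "y \<in> Y" "x = g w + f y" using X0E by meson
        have "g w \<in> ?X0" "f y \<in> ?X0" using wy d(6,7) by auto
        then show "k x = h x" using wy isok(4) kf kg h by simp
      qed
      then show ?thesis using k(1) U1 by simp
    qed
    then show ?thesis using u ut us by blast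
  qed
  then show ?thesis using t0 s0 cu by (intro exI[of _ ?X0] exI[of _ ?t0] exI[of _ ?s0]) (simp add: vsimps)
qed

interpretation V: vic "vb_obj :: 'f::field obj \<Rightarrow> bool" vhom vcmp vid vcok vpush "{0}" vzm Seq.dim
proof (unfold_locales, goal_cases)
  case (1 t Y X)
  obtain X1 f where t: "t = (Y, X1, f)" "vb_obj Y" "f \<in> vb_iso Y (f ` Y)" "decomp X X1 (f ` Y)" using 1 by (rule vhomE)
  show ?case by (rule t(2))
next
  case (2 t Y X)
  obtain X1 f where t: "t = (Y, X1, f)" "vb_obj Y" "f \<in> vb_iso Y (f ` Y)" "decomp X X1 (f ` Y)" using 2 by (rule vhomE)
  show ?case by (rule decompD(5)[OF t(4)])
next
  case (3 t Y X)
  obtain X1 f where t: "t = (Y, X1, f)" "vb_obj Y" "f \<in> vb_iso Y (f ` Y)" "decomp X X1 (f ` Y)" using 3 by (rule vhomE)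
  show ?case unfolding t(1) vsimps by (rule decompD(1)[OF t(4)])
next
  case (4 t Y X X')
  obtain X1 f where t: "t = (Y, X1, f)" "vb_obj Y" "f \<in> vb_iso Y (f ` Y)" "decomp X X1 (f ` Y)" using 4(1) by (rule vhomE)
  have "decomp X' X1 (f ` Y)" using 4(2) by (simp add: t(1) vhom_iff)
  then show ?case using decompD(3)[OF t(4)] decompD(3) by blast
next
  case (5 X)
  then show ?case using iso_id[OF 5] decomp_zero(1)[OF 5] by (simp add: vid_def vhom_iff)
next
  case (6 X) then show ?case by (simp add: vid_def vsimps)
next
  case (7 t Y X u Z) then show ?case by (rule vhom_cmp)
next
  case (8 t Y X)
  obtain X1 f where t: "t = (Y, X1, f)" "vb_obj Y" "f \<in> vb_iso Y (f ` Y)" "decomp X X1 (f ` Y)" using 8 by (rule vhomE)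
  have "compose Y (\<lambda>v\<in>X. v) f = f"
    using isoD(1)[OF t(3,2)] decompD(7)[OF t(4)] by (auto simp: compose_def fun_eq_iff extensional_def)
  moreover have "(\<lambda>v\<in>X. v) ` X1 = X1" 
  proof -
    have "(\<lambda>v\<in>X. v) ` X1 = (\<lambda>v. v) ` X1" by (intro image_cong) (use decompD(6)[OF t(4)] in auto)
    then show ?thesis by simp
  qed
  ultimately show ?case by (simp add: vid_def t(1) vsimps)
next
  case (9 t Y X)
  obtain X1 f where t: "t = (Y, X1, f)" "vb_obj Y" "f \<in> vb_iso Y (f ` Y)" "decomp X X1 (f ` Y)" using 9 by (rule vhomE)
  have "compose Y f (\<lambda>v\<in>Y. v) = f"
    using isoD(1)[OF t(3,2)] by (auto simp: compose_def fun_eq_iff extensional_def)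
  then show ?case using isoD(6)[OF t(3,2)] by (simp add: vid_def t(1) vsimps)
next
  case (10 t W Y u X v Z)
  obtain Y1 f where t: "t = (W, Y1, f)" "vb_obj W" "f \<in> vb_iso W (f ` W)" "decomp Y Y1 (f ` W)" using 10(1) by (rule vhomE)
  obtain X1 g where u: "u = (Y, X1, g)" "vb_obj Y" "g \<in> vb_iso Y (g ` Y)" "decomp X X1 (g ` Y)" using 10(2) by (rule vhomE)
  obtain Z1 h where v: "v = (X, Z1, h)" "vb_obj X" "h \<in> vb_iso X (h ` X)" "decomp Z Z1 (h ` X)" using 10(3) by (rule vhomE)
  note d = decompD[OF t(4)] and e = decompD[OF u(4)]
  have fW: "f w \<in> Y" if "w \<in> W" for w using that d(7) by blast
  have "compose Y h g ` Y1 = h ` g ` Y1"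
    unfolding image_image by (rule image_cong) (use d(6) in \<open>simp_all add: compose_def subset_eq\<close>)
  moreover have "h ` vsum X1 (g ` Y1) = vsum (h ` X1) (h ` g ` Y1)"
    by (rule iso_image_vsum[OF v(3,2) e(6) subset_trans[OF image_mono[OF d(6)] e(7)]])
  moreover have "compose W (compose Y h g) f = compose W h (compose W g f)"
    by (rule ext) (simp add: compose_def fW)
  ultimately show ?case by (simp only: t(1) u(1) v(1) vsimps vsum_assoc)
next
  case (11 t Y X u Z) then show ?case by (rule vhom_cmp)
next
  case (12 t Y X u Z)
  obtain X1 f where t: "t = (Y, X1, f)" "vb_obj Y" "f \<in> vb_iso Y (f ` Y)" "decomp X X1 (f ` Y)" using 12(1) by (rule vhomE)
  obtain Z1 g where u: "u = (X, Z1, g)" "vb_obj X" "g \<in> vb_iso X (g ` X)" "decomp Z Z1 (g ` X)" using 12(2) by (rule vhomE)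
  show ?case by (simp add: t(1) u(1) vsimps)
next
  case (13 t Y X)
  obtain X1 f where t: "t = (Y, X1, f)" "vb_obj Y" "f \<in> vb_iso Y (f ` Y)" "decomp X X1 (f ` Y)" using 13 by (rule vhomE)
  have "restrict (\<lambda>v\<in>X. v) X1 = (\<lambda>v\<in>X1. v)"
    using decompD(6)[OF t(4)] by (simp add: restrict_restrict Int_absorb1)
  then show ?case by (simp add: t(1) vid_def vsimps)
next
  case (14 t W Y u X v Z)
  obtain Y1 f where t: "t = (W, Y1, f)" "vb_obj W" "f \<in> vb_iso W (f ` W)" "decomp Y Y1 (f ` W)" using 14(1) by (rule vhomE)
  obtain X1 g where u: "u = (Y, X1, g)" "vb_obj Y" "g \<in> vb_iso Y (g ` Y)" "decomp X X1 (g ` Y)" using 14(2) by (rule vhomE)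
  obtain Z1 h where v: "v = (X, Z1, h)" "vb_obj X" "h \<in> vb_iso X (h ` X)" "decomp Z Z1 (h ` X)" using 14(3) by (rule vhomE)
  note d = decompD[OF t(4)] and e = decompD[OF u(4)]
  have gY: "vb_obj (g ` Y1)" "g ` Y1 \<subseteq> X" using iso_image_obj[OF u(3,2) d(1,6)] e(7) d(6) by auto
  have sub: "X1 \<subseteq> vsum X1 (g ` Y1)" "g ` Y1 \<subseteq> vsum X1 (g ` Y1)" using vsum_sub[OF e(1) gY(1)] by auto
  have "restrict h (vsum X1 (g ` Y1)) ` X1 = h ` X1" using sub(1) by (intro image_cong) auto
  moreover have "restrict (compose Y h g) Y1 = compose Y1 (restrict h (vsum X1 (g ` Y1))) (restrict g Y1)"
    using sub(2) d(6) by (auto simp: compose_def fun_eq_iff)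
  ultimately show ?case by (simp add: t(1) u(1) v(1) vsimps)
next
  case (15 t W Y u X v Z)
  obtain Y1 f where t: "t = (W, Y1, f)" "vb_obj W" "f \<in> vb_iso W (f ` W)" "decomp Y Y1 (f ` W)" using 15(1) by (rule vhomE)
  obtain X1 g where u: "u = (Y, X1, g)" "vb_obj Y" "g \<in> vb_iso Y (g ` Y)" "decomp X X1 (g ` Y)" using 15(2) by (rule vhomE)
  obtain Z1 h where v: "v = (X, Z1, h)" "vb_obj X" "h \<in> vb_iso X (h ` X)" "decomp Z Z1 (h ` X)" using 15(3) by (rule vhomE)
  note d = decompD[OF t(4)] and e = decompD[OF u(4)]
  have gY: "vb_obj (g ` Y1)" using iso_image_obj[OF u(3,2) d(1,6)] .
  have "X1 \<subseteq> vsum X1 (g ` Y1)" using vsum_sub(1)[OF e(1) gY] .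
  then show ?case by (simp add: t(1) u(1) v(1) vsimps restrict_restrict Int_absorb1)
next
  case (16 X)
  then show ?case using iso_id[OF vb_obj_zero] decomp_zero(2)[OF 16] by (simp add: vzm_def vhom_iff vb_obj_zero)
next
  case (17 X) then show ?case by (simp add: vzm_def vsimps)
next
  case (18 t Y X)
  obtain X1 f where t: "t = (Y, X1, f)" "vb_obj Y" "f \<in> vb_iso Y (f ` Y)" "decomp X X1 (f ` Y)" using 18 by (rule vhomE)
  have "compose {0} f (\<lambda>v\<in>{0}. v) = (\<lambda>v\<in>{0}. v)" 
    by (rule ext) (use isoD(6)[OF t(3,2)] in \<open>simp add: compose_def\<close>)
  then show ?case using decompD(3)[OF t(4)] by (simp add: t(1) vzm_def vsimps)
next
  case (19 t Y X)
  obtain X1 f where t: "t = (Y, X1, f)" "vb_obj Y" "f \<in> vb_iso Y (f ` Y)" "decomp X X1 (f ` Y)" using 19 by (rule vhomE)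
  show ?case using isoD(1)[OF t(3,2)] by (simp add: t(1) vzm_def vsimps extensional_restrict)
next
  case (20 t Y X)
  obtain X1 f where t: "t = (Y, X1, f)" "vb_obj Y" "f \<in> vb_iso Y (f ` Y)" "decomp X X1 (f ` Y)" using 20 by (rule vhomE)
  show ?case using dim_decomp[OF t(4)] dim_iso[OF t(3,2)] by (simp add: t(1) vsimps)
next
  case (21 t Y X s W) then show ?case by (rule vpair)
qed

text \<open>A record for an abelian group with carrier in \<open>'a\<close> is embedded into a type of class
  \<open>ab_group_add\<close>, namely into the product of all such groups.\<close>

typedef 'a uni = "{F :: 'a ring \<Rightarrow> 'a. \<forall>G. if abelian_group G then F G \<in> carrier G else F G = undefined}"
  by (rule exI[of _ "\<lambda>G. if abelian_group G then \<zero>\<^bsub>G\<^esub> else undefined"])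
    (simp add: abelian_monoid.zero_closed abelian_group.axioms)

instantiation uni :: (type) ab_group_add
begin

definition "0 = Abs_uni (\<lambda>G. if abelian_group G then \<zero>\<^bsub>G\<^esub> else undefined)"
definition "x + y = Abs_uni (\<lambda>G. if abelian_group G then Rep_uni x G \<oplus>\<^bsub>G\<^esub> Rep_uni y G else undefined)"
definition "- x = Abs_uni (\<lambda>G. if abelian_group G then \<ominus>\<^bsub>G\<^esub> Rep_uni x G else undefined)" for x :: "'a uni"
definition "x - y = x + - y" for x y :: "'a uni"

lemma Rep_uni_in: "abelian_group G \<Longrightarrow> Rep_uni x G \<in> carrier G"
  and Rep_uni_undef: "\<not> abelian_group G \<Longrightarrow> Rep_uni x G = undefined"
  using Rep_uni[of x] by (auto dest: spec[of _ G])

lemma Rep_uni_zero: "Rep_uni 0 G = (if abelian_group G then \<zero>\<^bsub>G\<^esub> else undefined)"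
  unfolding zero_uni_def
  by (subst Abs_uni_inverse) (simp_all add: abelian_monoid.zero_closed abelian_group.axioms)

lemma Rep_uni_plus: "Rep_uni (x + y) G = (if abelian_group G then Rep_uni x G \<oplus>\<^bsub>G\<^esub> Rep_uni y G else undefined)"
  unfolding plus_uni_def
  by (subst Abs_uni_inverse) (simp_all add: abelian_monoid.a_closed abelian_group.axioms Rep_uni_in)

lemma Rep_uni_uminus: "Rep_uni (- x) G = (if abelian_group G then \<ominus>\<^bsub>G\<^esub> Rep_uni x G else undefined)"
  unfolding uminus_uni_def
  by (subst Abs_uni_inverse) (simp_all add: abelian_group.a_inv_closed Rep_uni_in)

lemma uni_eqI: "(\<And>G. abelian_group G \<Longrightarrow> Rep_uni x G = Rep_uni y G) \<Longrightarrow> x = y"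
  unfolding Rep_uni_inject[symmetric] by (rule ext) (metis Rep_uni_undef)

instance
proof
  fix x y z :: "'a uni"
  show "x + y + z = x + (y + z)"
    by (rule uni_eqI) (simp add: Rep_uni_plus abelian_monoid.a_assoc abelian_group.axioms Rep_uni_in)
  show "x + y = y + x"
    by (rule uni_eqI) (simp add: Rep_uni_plus abelian_monoid.a_comm abelian_group.axioms Rep_uni_in)
  show "0 + x = x"
    by (rule uni_eqI) (simp add: Rep_uni_plus Rep_uni_zero abelian_monoid.l_zero abelian_group.axioms Rep_uni_in)
  show "- x + x = 0"
    by (rule uni_eqI) (simp add: Rep_uni_plus Rep_uni_zero Rep_uni_uminus abelian_group.l_neg Rep_uni_in)
  show "x - y = x + - y" by (rule minus_uni_def)
qed

end

text \<open>Keeps the additive structure only, with fixed junk in the multiplicative fields, so that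
  it has the type of the indices of \<open>uni\<close>.\<close>

definition ugrp :: "('k, 'm) module \<Rightarrow> 'm ring" where
  "ugrp M = \<lparr>carrier = carrier M, mult = undefined, one = undefined, zero = \<zero>\<^bsub>M\<^esub>, add = add M\<rparr>"

text \<open>The embedding as a factor of the product of all groups: x in the coordinate of the given
  group and zero in every other; \<open>ue\<close> is the projection back.\<close>

definition em :: "('k, 'm) module \<Rightarrow> 'm \<Rightarrow> 'm uni" where
  "em M x = Abs_uni (\<lambda>H. if abelian_group H then (if H = ugrp M then x else \<zero>\<^bsub>H\<^esub>) else undefined)"

definition ue :: "('k, 'm) module \<Rightarrow> 'm uni \<Rightarrow> 'm" where
  "ue M u = Rep_uni u (ugrp M)"

lemma ugrp_ag:
  assumes "abelian_group M"
  shows "abelian_group (ugrp M)"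
proof -
  note m = abelian_group.axioms(1)[OF assms]
  have "\<exists>y\<in>carrier M. y \<oplus>\<^bsub>M\<^esub> x = \<zero>\<^bsub>M\<^esub>" if "x \<in> carrier M" for x
    using abelian_group.l_neg[OF assms that] abelian_group.a_inv_closed[OF assms that] by blast
  then show ?thesis
    by (intro abelian_groupI)
      (simp_all add: ugrp_def abelian_monoid.a_closed[OF m] abelian_monoid.zero_closed[OF m]
        abelian_monoid.a_assoc[OF m] abelian_monoid.l_zero[OF m], rule abelian_monoid.a_comm[OF m])
qed

lemma Rep_em:
  assumes "abelian_group M" "x \<in> carrier M"
  shows "Rep_uni (em M x) H = (if abelian_group H then (if H = ugrp M then x else \<zero>\<^bsub>H\<^esub>) else undefined)"
  unfolding em_def using assms
  by (subst Abs_uni_inverse) (auto simp: ugrp_def abelian_monoid.zero_closed abelian_group.axioms)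

lemma ue_em [simp]: "abelian_group M \<Longrightarrow> x \<in> carrier M \<Longrightarrow> ue M (em M x) = x"
  by (simp add: ue_def Rep_em ugrp_ag)

lemma em_add:
  fixes M :: "('k, 'm) module"
  assumes "abelian_group M" "x \<in> carrier M" "y \<in> carrier M"
  shows "em M (x \<oplus>\<^bsub>M\<^esub> y) = em M x + em M y"
proof (rule uni_eqI)
  fix G :: "'m ring" assume G: "abelian_group G"
  show "Rep_uni (em M (x \<oplus>\<^bsub>M\<^esub> y)) G = Rep_uni (em M x + em M y) G"
    using G abelian_monoid.a_closed[OF abelian_group.axioms(1)[OF assms(1)] assms(2,3)]
      abelian_monoid.l_zero[OF abelian_group.axioms(1)[OF G]] abelian_monoid.zero_closed[OF abelian_group.axioms(1)[OF G]]
    by (simp add: Rep_uni_plus Rep_em assms) (simp add: ugrp_def)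
qed

lemma em_zero: "abelian_group M \<Longrightarrow> em M \<zero>\<^bsub>M\<^esub> = 0"
  by (rule uni_eqI)
    (simp add: Rep_em Rep_uni_zero abelian_monoid.zero_closed abelian_group.axioms, simp add: ugrp_def)

lemma em_inj: "abelian_group M \<Longrightarrow> x \<in> carrier M \<Longrightarrow> y \<in> carrier M \<Longrightarrow> em M x = em M y \<longleftrightarrow> x = y"
  by (metis ue_em)

lemma em_uminus: "abelian_group M \<Longrightarrow> x \<in> carrier M \<Longrightarrow> em M (\<ominus>\<^bsub>M\<^esub> x) = - em M x"
  using em_add[of M "\<ominus>\<^bsub>M\<^esub> x" x] em_zero[of M] abelian_group.a_inv_closed[of M x] abelian_group.l_neg[of M x]
  by (simp add: eq_neg_iff_add_eq_0)

lemma em_eq_zero: "abelian_group M \<Longrightarrow> x \<in> carrier M \<Longrightarrow> em M x = 0 \<longleftrightarrow> x = \<zero>\<^bsub>M\<^esub>"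
  using em_inj[of M x "\<zero>\<^bsub>M\<^esub>"] em_zero[of M] abelian_monoid.zero_closed[of M] abelian_group.axioms(1)[of M] by simp

lemma em_sgrp:
  assumes M: "abelian_group M"
  shows "sgrp (em M ` carrier M)"
  unfolding sgrp_def
proof (intro conjI ballI)
  show "0 \<in> em M ` carrier M"
    using em_zero[OF M] abelian_monoid.zero_closed[OF abelian_group.axioms(1)[OF M]] by (metis imageI)
  fix x y assume "x \<in> em M ` carrier M" "y \<in> em M ` carrier M"
  then obtain a b where ab: "x = em M a" "a \<in> carrier M" "y = em M b" "b \<in> carrier M" by blast
  note nb = abelian_group.a_inv_closed[OF M ab(4)]
  show "x - y \<in> em M ` carrier M"
    using em_add[OF M ab(2) nb] em_uminus[OF M ab(4)] abelian_monoid.a_closed[OF abelian_group.axioms(1)[OF M] ab(2) nb]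
    by (intro image_eqI[of _ _ "a \<oplus>\<^bsub>M\<^esub> \<ominus>\<^bsub>M\<^esub> b"]) (simp_all add: ab)
qed

lemma em_additive:
  assumes "abelian_group M" "abelian_group N" "\<And>x. x \<in> carrier M \<Longrightarrow> h x \<in> carrier N"
    "\<And>x y. x \<in> carrier M \<Longrightarrow> y \<in> carrier M \<Longrightarrow> h (x \<oplus>\<^bsub>M\<^esub> y) = h x \<oplus>\<^bsub>N\<^esub> h y"
  shows "additive_on (em M ` carrier M) (\<lambda>u. em N (h (ue M u)))"
  unfolding additive_on_def
proof (intro ballI)
  fix x y assume "x \<in> em M ` carrier M" "y \<in> em M ` carrier M"
  then obtain a b where ab: "x = em M a" "a \<in> carrier M" "y = em M b" "b \<in> carrier M" by blast
  have c: "a \<oplus>\<^bsub>M\<^esub> b \<in> carrier M" by (rule abelian_monoid.a_closed[OF abelian_group.axioms(1)[OF assms(1)] ab(2,4)])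
  show "em N (h (ue M (x + y))) = em N (h (ue M x)) + em N (h (ue M y))"
    unfolding ab em_add[OF assms(1) ab(2,4), symmetric]
    by (simp add: assms(1) ab(2,4) c assms(4) em_add[OF assms(2) assms(3)[OF ab(2)] assms(3)[OF ab(4)]])
qed

section \<open>Records as modules over the abstract category\<close>

lemma klinearD:
  assumes "klinear M N h"
  shows "x \<in> carrier M \<Longrightarrow> h x \<in> carrier N"
    "x \<in> carrier M \<Longrightarrow> y \<in> carrier M \<Longrightarrow> h (x \<oplus>\<^bsub>M\<^esub> y) = h x \<oplus>\<^bsub>N\<^esub> h y"
    "x \<in> carrier M \<Longrightarrow> h (c \<odot>\<^bsub>M\<^esub> x) = c \<odot>\<^bsub>N\<^esub> h x"
  using assms unfolding klinear_def by auto

lemma vb_moduleD: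
  assumes "vb_module M"
  shows "vb_obj X \<Longrightarrow> Module.module kring (val M X)" "vb_obj X \<Longrightarrow> abelian_group (val M X)"
    "f \<in> vb_iso X Y \<Longrightarrow> vb_obj X \<Longrightarrow> vb_obj Y \<Longrightarrow> klinear (val M X) (val M Y) (act M X Y f)"
    "vb_obj X \<Longrightarrow> x \<in> car M X \<Longrightarrow> act M X X (\<lambda>v\<in>X. v) x = x"
    "f \<in> vb_iso X Y \<Longrightarrow> g \<in> vb_iso Y Z \<Longrightarrow> vb_obj X \<Longrightarrow> vb_obj Y \<Longrightarrow> vb_obj Z \<Longrightarrow> x \<in> car M X \<Longrightarrow>
       act M X Z (compose X g f) x = act M Y Z g (act M X Y f x)"
proof -
  show m: "vb_obj X \<Longrightarrow> Module.module kring (val M X)" using assms unfolding vb_module_def by blast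
  then show "vb_obj X \<Longrightarrow> abelian_group (val M X)" by (simp add: Module.module_def)
  show "f \<in> vb_iso X Y \<Longrightarrow> vb_obj X \<Longrightarrow> vb_obj Y \<Longrightarrow> klinear (val M X) (val M Y) (act M X Y f)"
    using assms unfolding vb_module_def by blast
  show "vb_obj X \<Longrightarrow> x \<in> car M X \<Longrightarrow> act M X X (\<lambda>v\<in>X. v) x = x"
    using assms unfolding vb_module_def by blast
  show "f \<in> vb_iso X Y \<Longrightarrow> g \<in> vb_iso Y Z \<Longrightarrow> vb_obj X \<Longrightarrow> vb_obj Y \<Longrightarrow> vb_obj Z \<Longrightarrow> x \<in> car M X \<Longrightarrow>
       act M X Z (compose X g f) x = act M Y Z g (act M X Y f x)"
    using assms unfolding vb_module_def by blast
qed

lemma left_moduleD: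
  assumes "left_module A N"
  shows "vb_module N"
    "decomp X X1 X2 \<Longrightarrow> a \<in> car A X1 \<Longrightarrow> klinear (val N X2) (val N X) (lact N X1 X2 a)"
    "decomp X X1 X2 \<Longrightarrow> x \<in> car N X2 \<Longrightarrow> klinear (val A X1) (val N X) (\<lambda>a. lact N X1 X2 a x)"
    "decomp X X1 X2 \<Longrightarrow> vb_obj Y \<Longrightarrow> f \<in> vb_iso X Y \<Longrightarrow> a \<in> car A X1 \<Longrightarrow> x \<in> car N X2 \<Longrightarrow>
       act N X Y f (lact N X1 X2 a x) = lact N (f ` X1) (f ` X2) (act A X1 (f ` X1) (restrict f X1) a)
         (act N X2 (f ` X2) (restrict f X2) x)"
    "vb_obj X \<Longrightarrow> x \<in> car N X \<Longrightarrow> lact N {0} X (mone A) x = x"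
    "decomp3 X X1 X2 X3 \<Longrightarrow> a \<in> car A X1 \<Longrightarrow> b \<in> car A X2 \<Longrightarrow> x \<in> car N X3 \<Longrightarrow>
       lact N (vsum X1 X2) X3 (mmul A X1 X2 a b) x = lact N X1 (vsum X2 X3) a (lact N X2 X3 b x)"
proof -
  note L = assms[unfolded left_module_def]
  note p = L[THEN conjunct2, THEN conjunct1, unfolded vb_pairing_def kbilinear_def]
  show "vb_module N" by (rule L[THEN conjunct1])
  show "decomp X X1 X2 \<Longrightarrow> a \<in> car A X1 \<Longrightarrow> klinear (val N X2) (val N X) (lact N X1 X2 a)"
    using p[THEN conjunct1] by blast
  show "decomp X X1 X2 \<Longrightarrow> x \<in> car N X2 \<Longrightarrow> klinear (val A X1) (val N X) (\<lambda>a. lact N X1 X2 a x)"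
    using p[THEN conjunct1] by blast
  show "decomp X X1 X2 \<Longrightarrow> vb_obj Y \<Longrightarrow> f \<in> vb_iso X Y \<Longrightarrow> a \<in> car A X1 \<Longrightarrow> x \<in> car N X2 \<Longrightarrow>
       act N X Y f (lact N X1 X2 a x) = lact N (f ` X1) (f ` X2) (act A X1 (f ` X1) (restrict f X1) a)
         (act N X2 (f ` X2) (restrict f X2) x)"
    using p[THEN conjunct2] by blast
  show "vb_obj X \<Longrightarrow> x \<in> car N X \<Longrightarrow> lact N {0} X (mone A) x = x"
    using L[THEN conjunct2, THEN conjunct2, THEN conjunct1] by blast
  show "decomp3 X X1 X2 X3 \<Longrightarrow> a \<in> car A X1 \<Longrightarrow> b \<in> car A X2 \<Longrightarrow> x \<in> car N X3 \<Longrightarrow>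
       lact N (vsum X1 X2) X3 (mmul A X1 X2 a b) x = lact N X1 (vsum X2 X3) a (lact N X2 X3 b x)"
    using L[THEN conjunct2, THEN conjunct2, THEN conjunct2] by blast
qed

abbreviation self :: "('f, 'k, 'a) vbmonoid \<Rightarrow> ('f, 'k, 'a, 'a) vblmod" where
  "self A \<equiv> left_via (\<lambda>X a. a) A"

lemma left_via_simps [simp]: "val (left_via \<phi> B) = val B" "act (left_via \<phi> B) = act B"
  "lact (left_via \<phi> B) X1 X2 a x = mmul B X1 X2 (\<phi> X1 a) x"
  by (simp_all add: left_via_def)

lemma vb_module_left_via: "vb_module (left_via \<phi> B) = vb_module B"
  unfolding vb_module_def by simp

lemma vb_monoidD:
  assumes "vb_monoid A"
  shows "vb_module A" "mone A \<in> car A {0}" "vb_obj X \<Longrightarrow> a \<in> car A X \<Longrightarrow> mmul A X {0} a (mone A) = a"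
    "left_module A (self A)" "vb_pairing A A A (mmul A)"
    "vb_obj X \<Longrightarrow> a \<in> car A X \<Longrightarrow> mmul A {0} X (mone A) a = a"
proof -
  note L = assms[unfolded vb_monoid_def]
  show "vb_module A" "mone A \<in> car A {0}" "vb_pairing A A A (mmul A)" using L by blast+
  show "vb_obj X \<Longrightarrow> a \<in> car A X \<Longrightarrow> mmul A X {0} a (mone A) = a"
    "vb_obj X \<Longrightarrow> a \<in> car A X \<Longrightarrow> mmul A {0} X (mone A) a = a" using L by blast+
  have p: "vb_pairing A (self A) (self A) (lact (self A)) = vb_pairing A A A (mmul A)"
    unfolding vb_pairing_def kbilinear_def by (simp add: left_via_def)
  show "left_module A (self A)"
    unfolding left_module_def vb_module_left_via p using L by simp
qed

text \<open>The element x is moved along f and then multiplied by a. The target is not an argument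
  of the action and is rebuilt as the sum of the complement and the image.\<close>

definition mdl :: "('f::field, 'k, 'a) vbmonoid \<Rightarrow> ('f, 'k, 'a, 'n) vblmod \<Rightarrow>
    ('f obj, 'f vmor, 'a uni, 'n uni) md" where
  "mdl A M = (\<lambda>X. em (val M X) ` car M X, \<lambda>(Y, X1, f) a x. em (val M (vsum X1 (f ` Y)))
     (lact M X1 (f ` Y) (ue (val A X1) a) (act M Y (f ` Y) f (ue (val M Y) x))))"

lemma cr_mdl: "cr (mdl A M) X = em (val M X) ` car M X" by (simp add: mdl_def)

lemma vb_ag: "vb_module M \<Longrightarrow> vb_obj X \<Longrightarrow> abelian_group (val M X)" by (rule vb_moduleD(2))

lemma act_in: "vb_module M \<Longrightarrow> f \<in> vb_iso X Y \<Longrightarrow> vb_obj X \<Longrightarrow> vb_obj Y \<Longrightarrow> x \<in> car M X \<Longrightarrow> act M X Y f x \<in> car M Y"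
  by (rule klinearD(1)[OF vb_moduleD(3)])

lemma lact_in: "left_module A M \<Longrightarrow> decomp X X1 X2 \<Longrightarrow> a \<in> car A X1 \<Longrightarrow> x \<in> car M X2 \<Longrightarrow> lact M X1 X2 a x \<in> car M X"
  by (rule klinearD(1)[OF left_moduleD(2)])

lemma ac_mdl:
  assumes "vb_module A" "vb_module M" "(Y, X1, f) \<in> vhom Y X" "a \<in> car A X1" "x \<in> car M Y"
  shows "ac (mdl A M) (Y, X1, f) (em (val A X1) a) (em (val M Y) x) =
    em (val M X) (lact M X1 (f ` Y) a (act M Y (f ` Y) f x))"
proof -
  have t: "vb_obj Y" "f \<in> vb_iso Y (f ` Y)" "decomp X X1 (f ` Y)" using assms(3) by (simp_all add: vhom_iff)
  note d = decompD[OF t(3)]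
  show ?thesis
    using vb_ag[OF assms(1) d(1)] vb_ag[OF assms(2) t(1)] assms(4,5) d(3) by (simp add: mdl_def)
qed

abbreviation uone :: "('f::field, 'k, 'a) vbmonoid \<Rightarrow> 'a uni" where "uone A \<equiv> em (val A {0}) (mone A)"

lemma vhomE':
  assumes "t \<in> vhom Y X" "a \<in> cr (mdl A (self A)) (vcok t)"
  obtains X1 f b where "t = (Y, X1, f)" "vb_obj Y" "f \<in> vb_iso Y (f ` Y)" "decomp X X1 (f ` Y)"
    "a = em (val A X1) b" "b \<in> car A X1" "vb_obj (f ` Y)" "vb_obj X1" "vb_obj X"
proof -
  obtain X1 f where t: "t = (Y, X1, f)" "vb_obj Y" "f \<in> vb_iso Y (f ` Y)" "decomp X X1 (f ` Y)"
    using assms(1) by (rule vhomE)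
  obtain b where "a = em (val A X1) b" "b \<in> car A X1" using assms(2) unfolding t(1) vsimps cr_mdl by auto
  then show thesis using that[OF t] decompD[OF t(4)] by blast
qed

lemma mdl_md:
  assumes A: "vb_monoid A" and M: "left_module A M"
  shows "V.pmd (mdl A (self A)) (uone A) (mdl A M)"
proof (rule V.pmdI, goal_cases)
  note vA = vb_monoidD(1)[OF A] and vM = left_moduleD(1)[OF M]
  {
    case (1 X)
    then show ?case unfolding cr_mdl by (rule em_sgrp[OF vb_ag[OF vM]])
  next
    case (2 Y X t a x)
    obtain X1 f b where t: "t = (Y, X1, f)" "vb_obj Y" "f \<in> vb_iso Y (f ` Y)" "decomp X X1 (f ` Y)"
      "a = em (val A X1) b" "b \<in> car A X1" "vb_obj (f ` Y)" "vb_obj X1" "vb_obj X" using 2(1,2) by (rule vhomE')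
    obtain y where y: "x = em (val M Y) y" "y \<in> car M Y" using 2(3) unfolding cr_mdl by blast
    show ?case unfolding t(1,5) y(1) ac_mdl[OF vA vM 2(1)[unfolded t(1)] t(6) y(2)] cr_mdl
      by (intro imageI lact_in[OF M t(4,6)] act_in[OF vM t(3,2,7) y(2)])
  next
    case (3 Y X t a)
    obtain X1 f b where t: "t = (Y, X1, f)" "vb_obj Y" "f \<in> vb_iso Y (f ` Y)" "decomp X X1 (f ` Y)"
      "a = em (val A X1) b" "b \<in> car A X1" "vb_obj (f ` Y)" "vb_obj X1" "vb_obj X" using 3(1,2) by (rule vhomE')
    have "additive_on (em (val M Y) ` car M Y) (\<lambda>u. em (val M X) (lact M X1 (f ` Y) b (act M Y (f ` Y) f (ue (val M Y) u))))"
      by (rule em_additive[OF vb_ag[OF vM t(2)] vb_ag[OF vM t(9)]])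
        (simp_all add: lact_in[OF M t(4,6)] act_in[OF vM t(3,2,7)] klinearD(2)[OF vb_moduleD(3)[OF vM t(3,2,7)]]
          klinearD(2)[OF left_moduleD(2)[OF M t(4,6)]])
    then show ?case
      using vb_ag[OF vA t(8)] t(6) decompD(3)[OF t(4)] unfolding cr_mdl t(1,5) by (simp add: mdl_def)
  next
    case (4 Y X t x)
    obtain X1 f where t: "t = (Y, X1, f)" "vb_obj Y" "f \<in> vb_iso Y (f ` Y)" "decomp X X1 (f ` Y)"
      using 4(1) by (rule vhomE)
    note d = decompD[OF t(4)]
    obtain y where y: "x = em (val M Y) y" "y \<in> car M Y" using 4(2) unfolding cr_mdl by blast
    let ?z = "act M Y (f ` Y) f y"
    note z = act_in[OF vM t(3,2) d(2) y(2)]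
    have "additive_on (em (val A X1) ` car A X1) (\<lambda>u. em (val M X) (lact M X1 (f ` Y) (ue (val A X1) u) ?z))"
      by (rule em_additive[OF vb_ag[OF vA d(1)] vb_ag[OF vM d(5)]])
        (simp_all add: lact_in[OF M t(4) _ z] klinearD(2)[OF left_moduleD(3)[OF M t(4) z]])
    then show ?case
      using vb_ag[OF vM t(2)] y(2) d(3) unfolding cr_mdl t(1) y(1) vsimps by (simp add: mdl_def)
  next
    case (5 X x)
    obtain y where y: "x = em (val M X) y" "y \<in> car M X" using 5(2) unfolding cr_mdl by blast
    have "(X, {0}, \<lambda>v\<in>X. v) \<in> vhom X X" using V.idm[OF 5(1)] by (simp add: vid_def)
    from ac_mdl[OF vA vM this vb_monoidD(2)[OF A] y(2)]
    show ?case using vb_moduleD(4)[OF vM 5(1) y(2)] left_moduleD(5)[OF M 5(1) y(2)] y(1)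
      by (simp add: vid_def)
  next
    case (6 Y X Z t u a b x)
    obtain X1 f a' where t: "t = (Y, X1, f)" "vb_obj Y" "f \<in> vb_iso Y (f ` Y)" "decomp X X1 (f ` Y)"
      "a = em (val A X1) a'" "a' \<in> car A X1" "vb_obj (f ` Y)" "vb_obj X1" "vb_obj X" using 6(1,3) by (rule vhomE')
    obtain Z1 g b' where u: "u = (X, Z1, g)" "vb_obj X" "g \<in> vb_iso X (g ` X)" "decomp Z Z1 (g ` X)"
      "b = em (val A Z1) b'" "b' \<in> car A Z1" "vb_obj (g ` X)" "vb_obj Z1" "vb_obj Z" using 6(2,4) by (rule vhomE')
    obtain y where y: "x = em (val M Y) y" "y \<in> car M Y" using 6(5) unfolding cr_mdl by blast
    note dX = decompD[OF t(4)]
    note gd = iso_decomp[OF u(3) t(4)]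
    let ?y = "act M Y (f ` Y) f y" and ?g1 = "restrict g X1" and ?g2 = "restrict g (f ` Y)"
    note y' = act_in[OF vM t(3,2,7) y(2)]
    note fy = lact_in[OF M t(4,6) y']
    note g1 = iso_restrict[OF u(3,2) dX(1,6)] and g2 = iso_restrict[OF u(3,2) dX(2,7)]
    have ob: "vb_obj (g ` X1)" "vb_obj (g ` f ` Y)" using decompD[OF gd] by blast+
    note a1 = act_in[OF vA g1 t(8) ob(1) t(6)] and y2 = act_in[OF vM g2 t(7) ob(2) y']
    have d3: "decomp3 Z Z1 (g ` X1) (g ` f ` Y)"
      unfolding decomp3_iff using u(4) gd decompD(3)[OF gd] by simp
    have comp: "compose Y ?g2 f = compose Y g f" by (rule ext) (simp add: compose_def)
    have ut: "(Y, vsum Z1 (g ` X1), compose Y g f) \<in> vhom Y Z"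
      using V.cmp[OF 6(1,2)] by (simp add: t(1) u(1) vsimps)
    have pt: "(X1, Z1, ?g1) \<in> vhom X1 (vsum Z1 (g ` X1))"
      using V.push[OF 6(1,2)] by (simp add: t(1) u(1) vsimps)
    have im: "compose Y g f ` Y = g ` f ` Y" unfolding image_image by (rule image_cong) (simp_all add: compose_def)
    have im1: "?g1 ` X1 = g ` X1" by auto
    have m: "mmul A Z1 (g ` X1) b' (act A X1 (g ` X1) ?g1 a') \<in> car A (vsum Z1 (g ` X1))"
      using lact_in[OF vb_monoidD(4)[OF A] _ u(6), of "vsum Z1 (g ` X1)" "g ` X1"] a1 d3 unfolding decomp3_def by simp
    \<comment> \<open>The composite action is rewritten by naturality of the multiplication, then
      associativity, then functoriality; the resulting coefficient is the product along the
      push.\<close>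
    have "ac (mdl A M) u b (ac (mdl A M) t a x) =
        em (val M Z) (lact M Z1 (g ` X) b' (act M X (g ` X) g (lact M X1 (f ` Y) a' ?y)))"
      unfolding t(1,5) y(1) ac_mdl[OF vA vM 6(1)[unfolded t(1)] t(6) y(2)] u(1,5)
      by (rule ac_mdl[OF vA vM 6(2)[unfolded u(1)] u(6) fy])
    also have "act M X (g ` X) g (lact M X1 (f ` Y) a' ?y) =
        lact M (g ` X1) (g ` f ` Y) (act A X1 (g ` X1) ?g1 a') (act M (f ` Y) (g ` f ` Y) ?g2 ?y)"
      by (rule left_moduleD(4)[OF M t(4) u(7,3) t(6) y'])
    also have "lact M Z1 (g ` X) b' \<dots> =
        lact M (vsum Z1 (g ` X1)) (g ` f ` Y) (mmul A Z1 (g ` X1) b' (act A X1 (g ` X1) ?g1 a'))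
          (act M (f ` Y) (g ` f ` Y) ?g2 ?y)"
      using left_moduleD(6)[OF M d3 u(6) a1 y2] decompD(3)[OF gd] by simp
    also have "act M (f ` Y) (g ` f ` Y) ?g2 ?y = act M Y (g ` f ` Y) (compose Y g f) y"
      using vb_moduleD(5)[OF vM t(3) g2 t(2,7) ob(2) y(2)] comp by simp
    also have "em (val M Z) (lact M (vsum Z1 (g ` X1)) (g ` f ` Y) (mmul A Z1 (g ` X1) b' (act A X1 (g ` X1) ?g1 a'))
          (act M Y (g ` f ` Y) (compose Y g f) y)) =
        ac (mdl A M) (vcmp u t) (em (val A (vsum Z1 (g ` X1))) (mmul A Z1 (g ` X1) b' (act A X1 (g ` X1) ?g1 a'))) x"
      unfolding t(1) u(1) vsimps y(1) using ac_mdl[OF vA vM ut m y(2)] im by simp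
    also have "em (val A (vsum Z1 (g ` X1))) (mmul A Z1 (g ` X1) b' (act A X1 (g ` X1) ?g1 a')) =
        ac (mdl A (self A)) (vpush u t) b a"
      unfolding t(1,5) u(1,5) vsimps
      using ac_mdl[OF vA vb_module_left_via[THEN iffD2, OF vA] pt u(6), where x = a'] t(6) im1 by simp
    finally show ?case .
  }
qed

definition upos :: "('f::field, 'k, 'a) vbmonoid \<Rightarrow> ('f obj \<Rightarrow> 'a \<Rightarrow> 'k::zero) \<Rightarrow> 'f obj \<Rightarrow> 'a uni set" where
  "upos A \<epsilon> X = em (val A X) ` {a \<in> car A X. \<epsilon> X a = 0}"

lemma augmentedD:
  assumes "augmented A \<epsilon>"
  shows "vb_monoid A" "monoid_hom A vb_unit \<epsilon>" "vb_surj A vb_unit \<epsilon>"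
    "vb_obj X \<Longrightarrow> a \<in> car A X \<Longrightarrow> X \<noteq> {0} \<Longrightarrow> \<epsilon> X a = 0"
    "a \<in> car A {0} \<Longrightarrow> \<epsilon> {0} a = 0 \<Longrightarrow> a = \<zero>\<^bsub>val A {0}\<^esub>"
proof -
  show A: "vb_monoid A" and h: "monoid_hom A vb_unit \<epsilon>" and "vb_surj A vb_unit \<epsilon>"
    using assms unfolding augmented_def by blast+
  have k: "klinear (val A X) (val vb_unit X) (\<epsilon> X)" if "vb_obj X" for X
    using h that unfolding monoid_hom_def vb_hom_def by blast
  show "vb_obj X \<Longrightarrow> a \<in> car A X \<Longrightarrow> X \<noteq> {0} \<Longrightarrow> \<epsilon> X a = 0"
    using klinearD(1)[OF k, of X a] by (simp add: vb_unit_def)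
  assume a: "a \<in> car A {0}" "\<epsilon> {0} a = 0"
  have "0 \<notin> vb_supp (vb_kernel A vb_unit \<epsilon>)" using assms unfolding augmented_def by auto
  then have "kzero (val (vb_kernel A vb_unit \<epsilon>) {0})"
    using vb_obj_zero dim_0[OF vb_obj_zero] unfolding vb_supp_def by force
  then show "a = \<zero>\<^bsub>val A {0}\<^esub>" using a unfolding kzero_def vb_kernel_def by (auto simp: vb_unit_def)
qed

lemma mdl_gring:
  assumes aug: "augmented A \<epsilon>"
  shows "gring vb_obj vhom vcmp vid vcok vpush {0} vzm Seq.dim (mdl A (self A)) (uone A) (upos A \<epsilon>)"
proof (rule gring.intro[OF V.vic_axioms], rule gring_axioms.intro, goal_cases)
  note A = augmentedD(1)[OF aug]
  note vA = vb_monoidD(1)[OF A] and vS = vb_module_left_via[THEN iffD2, OF vb_monoidD(1)[OF A]]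
  {
    case 1 show ?case by (rule mdl_md[OF A vb_monoidD(4)[OF A]])
  next
    case 2 show ?case using vb_monoidD(2)[OF A] by (simp add: cr_mdl)
  next
    case (3 w V Y u X a)
    obtain Y1 f where w: "w = (V, Y1, f)" "vb_obj V" "f \<in> vb_iso V (f ` V)" "decomp Y Y1 (f ` V)"
      using 3(1) by (rule vhomE)
    have Y1: "Y1 = {0}" using 3(2) by (simp add: w(1) vsimps)
    obtain U1 g b where u: "u = (Y, U1, g)" "vb_obj Y" "g \<in> vb_iso Y (g ` Y)" "decomp X U1 (g ` Y)"
      "a = em (val A U1) b" "b \<in> car A U1" "vb_obj (g ` Y)" "vb_obj U1" "vb_obj X" using 3(3,4) by (rule vhomE')
    have g0: "restrict g {0} = (\<lambda>v\<in>{0}. v)" 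
      by (rule ext) (use isoD(6)[OF u(3,2)] in simp)
    have p: "vpush u w = vzm U1" by (simp add: u(1) w(1) vsimps Y1 g0 vzm_def)
    have z: "({0}, U1, \<lambda>v\<in>{0}. v) \<in> vhom {0} U1" using V.zm(1)[OF u(8)] by (simp add: vzm_def)
    show ?case unfolding p vzm_def u(5)
      using ac_mdl[OF vA vS z u(6), where x = "mone A"] vb_monoidD(2,3)[OF A] u(6,8) vb_moduleD(4)[OF vA vb_obj_zero] by simp
  next
    case (4 X a)
    obtain b where b: "a = em (val A X) b" "b \<in> car A X" using 4(2) by (auto simp: cr_mdl)
    have z: "({0}, X, \<lambda>v\<in>{0}. v) \<in> vhom {0} X" using V.zm(1)[OF 4(1)] by (simp add: vzm_def)
    show ?case unfolding vzm_def b(1)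
      using ac_mdl[OF vA vS z b(2), where x = "mone A"] vb_monoidD(2,3)[OF A] b(2) 4(1) vb_moduleD(4)[OF vA vb_obj_zero] by simp
  next
    case (5 X a) then show ?case by (auto simp: upos_def cr_mdl)
  next
    case (6 X a)
    have "X = {0}" using dim_0[OF 6(1)] 6(2) by simp
    then show ?case using 6(3) augmentedD(5)[OF aug] em_zero[OF vb_ag[OF vA vb_obj_zero]] by (auto simp: upos_def)
  next
    case (7 X a)
    have "X \<noteq> {0}" using dim_0[OF 7(1)] 7(2) by simp
    then show ?case using 7 augmentedD(4)[OF aug] by (auto simp: upos_def cr_mdl)
  }
qed

section \<open>Augmented monoids, homomorphisms and free modules\<close>

locale aug_monoid =
  fixes A :: "('f::field, 'k::{comm_ring,monoid_mult}, 'a) vbmonoid" and \<epsilon> :: "'f obj \<Rightarrow> 'a \<Rightarrow> 'k"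
  assumes aug: "augmented A \<epsilon>"

sublocale aug_monoid \<subseteq> G: gring "vb_obj :: 'f obj \<Rightarrow> bool" vhom vcmp vid vcok vpush "{0}" vzm Seq.dim
    "mdl A (self A)" "uone A" "upos A \<epsilon>"
  by (rule mdl_gring[OF aug])

context aug_monoid
begin

lemmas A_mon = augmentedD(1)[OF aug]
lemmas A_vb = vb_monoidD(1)[OF A_mon]

definition umap :: "('f, 'k, 'a, 'm) vblmod \<Rightarrow> ('f, 'k, 'a, 'n) vblmod \<Rightarrow> ('f obj \<Rightarrow> 'm \<Rightarrow> 'n) \<Rightarrow>
    'f obj \<Rightarrow> 'm uni \<Rightarrow> 'n uni" where
  "umap M N h X u = em (val N X) (h X (ue (val M X) u))"

lemma umap_em: "left_module A M \<Longrightarrow> vb_obj X \<Longrightarrow> x \<in> car M X \<Longrightarrow> umap M N h X (em (val M X) x) = em (val N X) (h X x)"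
  by (simp add: umap_def vb_ag[OF left_moduleD(1)])

lemma left_homD:
  assumes "left_hom A M N h"
  shows "vb_obj X \<Longrightarrow> klinear (val M X) (val N X) (h X)"
    "f \<in> vb_iso X Y \<Longrightarrow> vb_obj X \<Longrightarrow> vb_obj Y \<Longrightarrow> x \<in> car M X \<Longrightarrow> h Y (act M X Y f x) = act N X Y f (h X x)"
    "decomp X X1 X2 \<Longrightarrow> a \<in> car A X1 \<Longrightarrow> x \<in> car M X2 \<Longrightarrow> h X (lact M X1 X2 a x) = lact N X1 X2 a (h X2 x)"
  using assms unfolding left_hom_def vb_hom_def by blast+

lemma umap_hom:
  assumes M: "left_module A M" and N: "left_module A N" and h: "left_hom A M N h"
  shows "G.mhom (mdl A M) (mdl A N) (umap M N h)"
  unfolding G.phom_def cr_mdl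
proof (intro conjI allI impI ballI)
  note vM = left_moduleD(1)[OF M] and vN = left_moduleD(1)[OF N]
  fix X :: "'f obj" assume X: "vb_obj X"
  note l = left_homD(1)[OF h X]
  show "umap M N h X u \<in> em (val N X) ` car N X" if u: "u \<in> em (val M X) ` car M X" for u
  proof -
    obtain x where x: "u = em (val M X) x" "x \<in> car M X" using u by blast
    show ?thesis unfolding x(1) umap_em[OF M X x(2), where N = N and h = h] by (rule imageI[OF klinearD(1)[OF l x(2)]])
  qed
  show "additive_on (em (val M X) ` car M X) (umap M N h X)"
    unfolding umap_def[abs_def] by (rule em_additive[OF vb_ag[OF vM X] vb_ag[OF vN X] klinearD(1,2)[OF l]])
next
  note vM = left_moduleD(1)[OF M] and vN = left_moduleD(1)[OF N]
  fix Y X :: "'f obj" and t a u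
  assume 1: "t \<in> vhom Y X" "a \<in> em (val (self A) (vcok t)) ` car (self A) (vcok t)" and u: "u \<in> em (val M Y) ` car M Y"
  obtain X1 f b where t: "t = (Y, X1, f)" "vb_obj Y" "f \<in> vb_iso Y (f ` Y)" "decomp X X1 (f ` Y)"
      "a = em (val A X1) b" "b \<in> car A X1" "vb_obj (f ` Y)" "vb_obj X1" "vb_obj X"
    using 1(1) 1(2)[folded cr_mdl[of A "self A"]] by (rule vhomE')
  obtain y where y: "u = em (val M Y) y" "y \<in> car M Y" using u by blast
  note ay = act_in[OF vM t(3,2,7) y(2)]
  note ly = lact_in[OF M t(4,6) ay]
  note hy = klinearD(1)[OF left_homD(1)[OF h t(2)] y(2)]
  show "umap M N h X (ac (mdl A M) t a u) = ac (mdl A N) t a (umap M N h Y u)"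
    unfolding t(1,5) y(1) umap_em[OF M t(2) y(2)] ac_mdl[OF A_vb vM 1(1)[unfolded t(1)] t(6) y(2)]
      ac_mdl[OF A_vb vN 1(1)[unfolded t(1)] t(6) hy] umap_em[OF M t(9) ly]
    using left_homD(3)[OF h t(4,6) ay] left_homD(2)[OF h t(3,2,7) y(2)] by simp
qed

text \<open>Scalars act through multiples of the unit at the zero space, so the coefficient ring
  need not be visible in the abstract setting.\<close>

lemma smult_eq:
  assumes M: "left_module A M" and X: "vb_obj X" and x: "x \<in> car M X"
  shows "c \<odot>\<^bsub>val M X\<^esub> x = lact M {0} X (c \<odot>\<^bsub>val A {0}\<^esub> mone A) x"
  using klinearD(3)[OF left_moduleD(3)[OF M decomp_zero(1)[OF X] x] vb_monoidD(2)[OF A_mon], of c]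
    left_moduleD(5)[OF M X x] by simp

lemma sm_in: "c \<odot>\<^bsub>val A {0}\<^esub> mone A \<in> car A {0}"
  using module.smult_closed[OF vb_moduleD(1)[OF A_vb vb_obj_zero], of c] vb_monoidD(2)[OF A_mon] by (simp add: kring_def)

lemma id_vhom: "vb_obj X \<Longrightarrow> (X, {0}, \<lambda>v\<in>X. v) \<in> vhom X X"
  using V.idm by (simp add: vid_def)

text \<open>Inclusions of a summand recover the multiplication, isomorphisms with unit coefficient
  recover the functor; every morphism is a composite of one of each kind.\<close>

lemma mult_vhom: "decomp X X1 X2 \<Longrightarrow> (X2, X1, \<lambda>v\<in>X2. v) \<in> vhom X2 X"
  using decompD(2)[of X X1 X2] iso_id[of X2] by (simp add: vhom_iff)

lemma iso_vhom: "f \<in> vb_iso X Y \<Longrightarrow> vb_obj X \<Longrightarrow> vb_obj Y \<Longrightarrow> (X, {0}, f) \<in> vhom X Y"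
  using isoD(2)[of f X Y] decomp_zero(1)[of Y] by (simp add: vhom_iff)

lemma ac_lact:
  assumes M: "left_module A M" and d: "decomp X X1 X2" and a: "a \<in> car A X1" and x: "x \<in> car M X2"
  shows "ac (mdl A M) (X2, X1, \<lambda>v\<in>X2. v) (em (val A X1) a) (em (val M X2) x) = em (val M X) (lact M X1 X2 a x)"
  using ac_mdl[OF A_vb left_moduleD(1)[OF M] mult_vhom[OF d] a x] vb_moduleD(4)[OF left_moduleD(1)[OF M] decompD(2)[OF d] x]
  by simp

lemma ac_act:
  assumes M: "left_module A M" and f: "f \<in> vb_iso X Y" "vb_obj X" "vb_obj Y" and x: "x \<in> car M X"
  shows "ac (mdl A M) (X, {0}, f) (uone A) (em (val M X) x) = em (val M Y) (act M X Y f x)"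
  using ac_mdl[OF A_vb left_moduleD(1)[OF M] iso_vhom[OF f] vb_monoidD(2)[OF A_mon] x] isoD(2)[OF f(1,2)]
    left_moduleD(5)[OF M f(3) act_in[OF left_moduleD(1)[OF M] f x]] by simp

text \<open>Equivariance along inclusions gives compatibility with the multiplication, along
  isomorphisms naturality. Linearity over the coefficients is the case of multiples of the
  unit.\<close>

lemma left_hom_of:
  assumes M: "left_module A M" and N: "left_module A N" and g: "G.mhom (mdl A M) (mdl A N) g"
  shows "left_hom A M N (\<lambda>X x. ue (val N X) (g X (em (val M X) x)))"
proof -
  let ?h = "\<lambda>X x. ue (val N X) (g X (em (val M X) x))"
  note vM = left_moduleD(1)[OF M] and vN = left_moduleD(1)[OF N]
  have h: "em (val N X) (?h X x) = g X (em (val M X) x)" "?h X x \<in> car N X" if X: "vb_obj X" and x: "x \<in> car M X" for X x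
  proof -
    have "g X (em (val M X) x) \<in> em (val N X) ` car N X"
      using G.mhomD(1)[OF g X, of "em (val M X) x"] x by (simp add: cr_mdl)
    then obtain z where z: "g X (em (val M X) x) = em (val N X) z" "z \<in> car N X" by blast
    show "em (val N X) (?h X x) = g X (em (val M X) x)" "?h X x \<in> car N X"
      using z vb_ag[OF vN X] by simp_all
  qed
  have eqI: "?h X x = z" if "vb_obj X" "x \<in> car M X" "z \<in> car N X" "g X (em (val M X) x) = em (val N X) z" for X x z
    using that vb_ag[OF vN that(1)] by simp
  have lact: "?h X (lact M X1 X2 a x) = lact N X1 X2 a (?h X2 x)"
    if d: "decomp X X1 X2" and a: "a \<in> car A X1" and x: "x \<in> car M X2" for X X1 X2 a x
  proof (rule eqI[OF decompD(5)[OF d] lact_in[OF M d a x] lact_in[OF N d a h(2)[OF decompD(2)[OF d] x]]])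
    have a': "em (val A X1) a \<in> cr (mdl A (self A)) (vcok (X2, X1, \<lambda>v\<in>X2. v))" using a by (simp add: cr_mdl vsimps)
    have x': "em (val M X2) x \<in> cr (mdl A M) X2" using x by (simp add: cr_mdl)
    show "g X (em (val M X) (lact M X1 X2 a x)) = em (val N X) (lact N X1 X2 a (?h X2 x))"
      using G.mhomD(3)[OF g mult_vhom[OF d] a' x'] ac_lact[OF M d a x] ac_lact[OF N d a h(2)[OF decompD(2)[OF d] x]]
        h(1)[OF decompD(2)[OF d] x] by simp
  qed
  have act: "?h Y (act M X Y f x) = act N X Y f (?h X x)"
    if f: "f \<in> vb_iso X Y" "vb_obj X" "vb_obj Y" and x: "x \<in> car M X" for X Y f x
  proof (rule eqI[OF f(3) act_in[OF vM f x] act_in[OF vN f h(2)[OF f(2) x]]])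
    have a': "uone A \<in> cr (mdl A (self A)) (vcok (X, {0}, f))" using vb_monoidD(2)[OF A_mon] by (simp add: cr_mdl vsimps)
    have x': "em (val M X) x \<in> cr (mdl A M) X" using x by (simp add: cr_mdl)
    show "g Y (em (val M Y) (act M X Y f x)) = em (val N Y) (act N X Y f (?h X x))"
      using G.mhomD(3)[OF g iso_vhom[OF f] a' x'] ac_act[OF M f x] ac_act[OF N f h(2)[OF f(2) x]] h(1)[OF f(2) x] by simp
  qed
  have add: "?h X (x \<oplus>\<^bsub>val M X\<^esub> y) = ?h X x \<oplus>\<^bsub>val N X\<^esub> ?h X y" if X: "vb_obj X" and xy: "x \<in> car M X" "y \<in> car M X" for X x y
  proof (rule eqI[OF X])
    show "x \<oplus>\<^bsub>val M X\<^esub> y \<in> car M X" "?h X x \<oplus>\<^bsub>val N X\<^esub> ?h X y \<in> car N X"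
      using abelian_monoid.a_closed[OF abelian_group.axioms(1)[OF vb_ag[OF vM X]]]
        abelian_monoid.a_closed[OF abelian_group.axioms(1)[OF vb_ag[OF vN X]]] h(2)[OF X] xy by auto
    show "g X (em (val M X) (x \<oplus>\<^bsub>val M X\<^esub> y)) = em (val N X) (?h X x \<oplus>\<^bsub>val N X\<^esub> ?h X y)"
      using em_add[OF vb_ag[OF vM X] xy] em_add[OF vb_ag[OF vN X] h(2)[OF X xy(1)] h(2)[OF X xy(2)]] h(1)[OF X] xy
        G.mhomD(2)[OF g X] unfolding additive_on_def by (simp add: cr_mdl)
  qed
  have "klinear (val M X) (val N X) (?h X)" if X: "vb_obj X" for X
    unfolding klinear_def
  proof (intro conjI ballI allI)
    show "?h X \<in> car M X \<rightarrow> car N X" using h(2)[OF X] by auto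
    fix x y assume "x \<in> car M X" "y \<in> car M X"
    then show "?h X (x \<oplus>\<^bsub>val M X\<^esub> y) = ?h X x \<oplus>\<^bsub>val N X\<^esub> ?h X y" by (rule add[OF X])
  next
    fix c x assume x: "x \<in> car M X"
    show "?h X (c \<odot>\<^bsub>val M X\<^esub> x) = c \<odot>\<^bsub>val N X\<^esub> ?h X x"
      unfolding smult_eq[OF M X x] smult_eq[OF N X h(2)[OF X x]]
      by (rule lact[OF decomp_zero(1)[OF X] sm_in x])
  qed
  then show ?thesis unfolding left_hom_def vb_hom_def using act lact by blast
qed

lemma em_finsum:
  assumes M: "abelian_group M" and "finite S" "\<And>s. s \<in> S \<Longrightarrow> f s \<in> carrier M"
  shows "em M (finsum M f S) = (\<Sum>s\<in>S. em M (f s)) \<and> finsum M f S \<in> carrier M"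
  using assms(2,3)
proof (induction S rule: finite_induct)
  case empty
  then show ?case
    using em_zero[OF M] abelian_monoid.zero_closed[OF abelian_group.axioms(1)[OF M]]
      abelian_monoid.finsum_empty[OF abelian_group.axioms(1)[OF M], of f] by simp
next
  case (insert s S)
  have "finsum M f (insert s S) = f s \<oplus>\<^bsub>M\<^esub> finsum M f S"
    by (rule abelian_monoid.finsum_insert[OF abelian_group.axioms(1)[OF M] insert(1,2)]) (use insert in auto)
  then show ?case
    using insert em_add[OF M, of "f s" "finsum M f S"]
      abelian_monoid.a_closed[OF abelian_group.axioms(1)[OF M], of "f s" "finsum M f S"] by simp
qed

text \<open>Coefficient families and elements of the abstract free module are the same data, and
  under this identification the combination of basis elements becomes the evaluation map.\<close>

lemma basis_bij:
  assumes P: "left_module A P" and E: "\<And>Y e. (Y, e) \<in> E \<Longrightarrow> vb_obj Y \<and> e \<in> car P Y" and X: "vb_obj X"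
  shows "bij_betw (basis_comb A P E X) (coeff_families A E X) (car P X) \<longleftrightarrow>
    bij_betw (G.ev (mdl A P) (\<lambda>(Y, e). em (val P Y) e)) (cr (V.ind E fst (mdl A (self A))) X) (cr (mdl A P) X)"
proof -
  let ?n = "\<lambda>(Y, e). em (val P Y) e" and ?I = "cr (V.ind E fst (mdl A (self A))) X" and ?F = "coeff_families A E X"
  let ?B = "basis_terms E X"
  note vP = left_moduleD(1)[OF P]
  \<comment> \<open>\<open>\<tau>\<close> and \<open>\<rho>\<close> only rearrange components; an
    abstract term mentions its source twice, in the generator and in the morphism.\<close>
  define \<tau> :: "'f obj \<times> 'b \<times> 'f obj \<times> 'f mor \<Rightarrow> ('f obj \<times> 'b) \<times> 'f vmor"
    where "\<tau> = (\<lambda>(Y, e, X1, f). ((Y, e), (Y, X1, f)))"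
  define \<rho> :: "('f obj \<times> 'b) \<times> 'f vmor \<Rightarrow> 'f obj \<times> 'b \<times> 'f obj \<times> 'f mor"
    where "\<rho> = (\<lambda>((Y, e), (Y', X1, f)). (Y, e, X1, f))"
  have \<tau>: "\<tau> k \<in> V.terms E fst X" "\<rho> (\<tau> k) = k" if "k \<in> ?B" for k
    using that E by (auto simp: \<tau>_def \<rho>_def basis_terms_def V.terms_def vhom_def)
  have \<rho>: "\<rho> k \<in> ?B" "\<tau> (\<rho> k) = k" if "k \<in> V.terms E fst X" for k
    using that by (auto simp: \<tau>_def \<rho>_def basis_terms_def V.terms_def vhom_def)
  define cx :: "'f obj \<times> 'b \<times> 'f obj \<times> 'f mor \<Rightarrow> 'f obj" where "cx = (\<lambda>(Y, e, X1, f). X1)"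
  have cx: "vcok (snd k) = cx (\<rho> k)" for k by (auto simp: cx_def \<rho>_def vcok_def split: prod.splits)
  have ob: "vb_obj (cx k)" if "k \<in> ?B" for k using that by (auto simp: cx_def basis_terms_def dest: decompD(1))
  note agA = vb_ag[OF A_vb ob]
  have F_iff: "c \<in> ?F \<longleftrightarrow> c \<in> extensional ?B \<and> (\<forall>k\<in>?B. c k \<in> car A (cx k)) \<and> finite {k \<in> ?B. c k \<noteq> \<zero>\<^bsub>val A (cx k)\<^esub>}" for c
  proof -
    have "{(Y, e, X1, f) \<in> ?B. c (Y, e, X1, f) \<noteq> \<zero>\<^bsub>val A X1\<^esub>} = {k \<in> ?B. c k \<noteq> \<zero>\<^bsub>val A (cx k)\<^esub>}"
      by (auto simp: cx_def)
    moreover have "(\<lambda>(Y, e, X1, f). car A X1) = (\<lambda>k. car A (cx k))" by (auto simp: cx_def fun_eq_iff)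
    ultimately show ?thesis unfolding coeff_families_def PiE_iff by auto
  qed
  \<comment> \<open>Families are \<open>undefined\<close> off the index set, finitely supported
    functions are 0 there. On the index set a zero coefficient becomes 0, so the supports
    match.\<close>
  define cv where "cv c k = (if k \<in> V.terms E fst X then em (val A (cx (\<rho> k))) (c (\<rho> k)) else 0)" for c k
  have fin: "finite {k. cv c k \<noteq> 0}" and keys: "{k. cv c k \<noteq> 0} = \<tau> ` {k \<in> ?B. c k \<noteq> \<zero>\<^bsub>val A (cx k)\<^esub>}" if c: "c \<in> ?F" for c
  proof -
    show e: "{k. cv c k \<noteq> 0} = \<tau> ` {k \<in> ?B. c k \<noteq> \<zero>\<^bsub>val A (cx k)\<^esub>}"
    proof (rule Set.set_eqI)
      fix k
      show "k \<in> {k. cv c k \<noteq> 0} \<longleftrightarrow> k \<in> \<tau> ` {k \<in> ?B. c k \<noteq> \<zero>\<^bsub>val A (cx k)\<^esub>}"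
      proof
        assume "k \<in> {k. cv c k \<noteq> 0}"
        then have k: "k \<in> V.terms E fst X" "em (val A (cx (\<rho> k))) (c (\<rho> k)) \<noteq> 0" by (auto simp: cv_def split: if_splits)
        then have "c (\<rho> k) \<noteq> \<zero>\<^bsub>val A (cx (\<rho> k))\<^esub>"
          using em_zero[OF agA[OF \<rho>(1)[OF k(1)]]] by auto
        then show "k \<in> \<tau> ` {k \<in> ?B. c k \<noteq> \<zero>\<^bsub>val A (cx k)\<^esub>}" using \<rho>[OF k(1)] by (intro image_eqI[of _ _ "\<rho> k"]) auto
      next
        assume "k \<in> \<tau> ` {k \<in> ?B. c k \<noteq> \<zero>\<^bsub>val A (cx k)\<^esub>}"
        then obtain j where j: "k = \<tau> j" "j \<in> ?B" "c j \<noteq> \<zero>\<^bsub>val A (cx j)\<^esub>" by blast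
        have "c j \<in> car A (cx j)" using c j(2) by (simp add: F_iff)
        then show "k \<in> {k. cv c k \<noteq> 0}"
          using \<tau>[OF j(2)] em_eq_zero[OF agA[OF j(2)]] j by (simp add: cv_def)
      qed
    qed
    show "finite {k. cv c k \<noteq> 0}" unfolding e using c by (simp add: F_iff)
  qed
  define conv where "conv c = Poly_Mapping.Abs_poly_mapping (cv c)" for c
  have lk: "Poly_Mapping.lookup (conv c) = cv c" if "c \<in> ?F" for c unfolding conv_def using fin[OF that] by simp
  have conv_bij: "bij_betw conv ?F ?I"
  proof (rule bij_betwI[where g = "\<lambda>p. \<lambda>k\<in>?B. ue (val A (cx k)) (Poly_Mapping.lookup p (\<tau> k))"])
    show "conv \<in> ?F \<rightarrow> ?I"
    proof
      fix c assume c: "c \<in> ?F"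
      have "Poly_Mapping.keys (conv c) \<subseteq> V.terms E fst X"
        unfolding Poly_Mapping.keys.rep_eq lk[OF c] by (auto simp: cv_def split: if_splits)
      moreover have "Poly_Mapping.lookup (conv c) k \<in> cr (mdl A (self A)) (vcok (snd k))" if k: "k \<in> V.terms E fst X" for k
      proof -
        have "c (\<rho> k) \<in> car A (cx (\<rho> k))" using c \<rho>(1)[OF k] unfolding F_iff by blast
        then show ?thesis using k by (simp add: lk[OF c] cv_def cr_mdl cx)
      qed
      ultimately show "conv c \<in> ?I" unfolding V.cr_ind dsum_def by blast
    qed
    have inI: "Poly_Mapping.lookup p (\<tau> k) \<in> em (val A (cx k)) ` car A (cx k)" if "p \<in> ?I" "k \<in> ?B" for p k
    proof -
      have "Poly_Mapping.lookup p (\<tau> k) \<in> cr (mdl A (self A)) (vcok (snd (\<tau> k)))"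
        using that(1) \<tau>(1)[OF that(2)] unfolding V.cr_ind dsum_def by blast
      then show ?thesis unfolding cr_mdl cx \<tau>(2)[OF that(2)] by simp
    qed
    show inF: "(\<lambda>p. \<lambda>k\<in>?B. ue (val A (cx k)) (Poly_Mapping.lookup p (\<tau> k))) \<in> ?I \<rightarrow> ?F"
    proof
      fix p assume p: "p \<in> ?I"
      have u: "ue (val A (cx k)) (Poly_Mapping.lookup p (\<tau> k)) \<in> car A (cx k)" if kB: "k \<in> ?B" for k
      proof -
        obtain b where "Poly_Mapping.lookup p (\<tau> k) = em (val A (cx k)) b" "b \<in> car A (cx k)"
          using inI[OF p kB] by (rule imageE)
        then show ?thesis using agA[OF kB] by simp
      qed
      have "k \<in> \<rho> ` Poly_Mapping.keys p"
        if k: "k \<in> ?B" "ue (val A (cx k)) (Poly_Mapping.lookup p (\<tau> k)) \<noteq> \<zero>\<^bsub>val A (cx k)\<^esub>" for k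
      proof -
        have "ue (val A (cx k)) 0 = \<zero>\<^bsub>val A (cx k)\<^esub>"
          using ue_em[OF agA[OF k(1)] abelian_monoid.zero_closed[OF abelian_group.axioms(1)[OF agA[OF k(1)]]]]
          unfolding em_zero[OF agA[OF k(1)]] .
        then have "Poly_Mapping.lookup p (\<tau> k) \<noteq> 0" using k(2) by metis
        then have "\<tau> k \<in> Poly_Mapping.keys p" by (simp add: in_keys_iff)
        then have "\<rho> (\<tau> k) \<in> \<rho> ` Poly_Mapping.keys p" by (rule imageI)
        then show ?thesis unfolding \<tau>(2)[OF k(1)] .
      qed
      then have "{k \<in> ?B. ue (val A (cx k)) (Poly_Mapping.lookup p (\<tau> k)) \<noteq> \<zero>\<^bsub>val A (cx k)\<^esub>} \<subseteq> \<rho> ` Poly_Mapping.keys p"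
        by blast
      from finite_subset[OF this]
      have f: "finite {k \<in> ?B. ue (val A (cx k)) (Poly_Mapping.lookup p (\<tau> k)) \<noteq> \<zero>\<^bsub>val A (cx k)\<^esub>}" by simp
      show "(\<lambda>k\<in>?B. ue (val A (cx k)) (Poly_Mapping.lookup p (\<tau> k))) \<in> ?F"
        unfolding F_iff
      proof (intro conjI ballI)
        show "finite {k \<in> ?B. (\<lambda>k\<in>?B. ue (val A (cx k)) (Poly_Mapping.lookup p (\<tau> k))) k \<noteq> \<zero>\<^bsub>val A (cx k)\<^esub>}"
          by (rule finite_subset[OF _ f]) auto
      qed (use u in auto)
    qed
    show "(\<lambda>k\<in>?B. ue (val A (cx k)) (Poly_Mapping.lookup (conv c) (\<tau> k))) = c" if c: "c \<in> ?F" for c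
    proof (rule extensionalityI[of _ ?B])
      show "c \<in> extensional ?B" using c by (simp add: F_iff)
      fix k assume k: "k \<in> ?B"
      show "(\<lambda>k\<in>?B. ue (val A (cx k)) (Poly_Mapping.lookup (conv c) (\<tau> k))) k = c k"
      proof -
        have "c k \<in> car A (cx k)" using c k unfolding F_iff by blast
        then show ?thesis using k \<tau>[OF k] agA[OF k] by (simp add: lk[OF c] cv_def)
      qed
    qed simp
    show "conv (\<lambda>k\<in>?B. ue (val A (cx k)) (Poly_Mapping.lookup p (\<tau> k))) = p" if p: "p \<in> ?I" for p
    proof (rule poly_mapping_eqI)
      fix k
      let ?c = "\<lambda>k\<in>?B. ue (val A (cx k)) (Poly_Mapping.lookup p (\<tau> k))"
      have "?c \<in> ?F" by (rule funcset_mem[OF inF p])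
      note l = lk[OF this]
      show "Poly_Mapping.lookup (conv ?c) k = Poly_Mapping.lookup p k"
      proof (cases "k \<in> V.terms E fst X")
        case True
        obtain b where "Poly_Mapping.lookup p k = em (val A (cx (\<rho> k))) b" "b \<in> car A (cx (\<rho> k))"
          using inI[OF p \<rho>(1)[OF True]] unfolding \<rho>(2)[OF True] by (rule imageE)
        then show ?thesis using \<rho>[OF True] True agA[OF \<rho>(1)[OF True]] by (simp add: l cv_def)
      next
        case False
        have "k \<notin> Poly_Mapping.keys p" using p False unfolding V.cr_ind dsum_def by blast
        then have "Poly_Mapping.lookup p k = 0" by (simp add: in_keys_iff)
        then show ?thesis using False by (simp add: l cv_def)
      qed
    qed
  qed
  have ev: "G.ev (mdl A P) ?n (conv c) = em (val P X) (basis_comb A P E X c) \<and> basis_comb A P E X c \<in> car P X"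
    if c: "c \<in> ?F" for c
  proof -
    let ?S = "{k \<in> ?B. c k \<noteq> \<zero>\<^bsub>val A (cx k)\<^esub>}"
    let ?g = "\<lambda>(Y, e, X1, f). lact P X1 (f ` Y) (c (Y, e, X1, f)) (act P Y (f ` Y) f e)"
    have S: "{(Y, e, X1, f) \<in> ?B. c (Y, e, X1, f) \<noteq> \<zero>\<^bsub>val A X1\<^esub>} = ?S" by (auto simp: cx_def)
    have k: "?g k \<in> car P X \<and> ac (mdl A P) (snd (\<tau> k)) (em (val A (cx k)) (c k)) (?n (fst (\<tau> k))) = em (val P X) (?g k)"
      if "k \<in> ?S" for k
    proof -
      obtain Y e X1 f where kk: "k = (Y, e, X1, f)" by (cases k) auto
      have b: "(Y, e) \<in> E" "f \<in> vb_iso Y (f ` Y)" "decomp X X1 (f ` Y)" using that by (auto simp: kk basis_terms_def)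
      have e: "vb_obj Y" "e \<in> car P Y" using E[OF b(1)] by auto
      have ck: "c (Y, e, X1, f) \<in> car A X1" using c that by (auto simp: F_iff kk cx_def)
      have t: "(Y, X1, f) \<in> vhom Y X" using b e by (simp add: vhom_iff)
      show ?thesis
        using lact_in[OF P b(3) ck act_in[OF vP b(2) e(1) decompD(2)[OF b(3)] e(2)]] ac_mdl[OF A_vb vP t ck e(2)]
        by (simp add: kk \<tau>_def cx_def)
    qed
    have inj: "inj_on \<tau> ?S" using \<tau>(2) by (intro inj_on_inverseI[of _ \<rho>]) auto
    have fs: "em (val P X) (finsum (val P X) ?g ?S) = (\<Sum>k\<in>?S. em (val P X) (?g k)) \<and> finsum (val P X) ?g ?S \<in> car P X"
    proof (rule em_finsum[OF vb_ag[OF vP X]])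
      show "finite ?S" using c unfolding F_iff by blast
      show "?g s \<in> car P X" if "s \<in> ?S" for s by (rule conjunct1[OF k[OF that]])
    qed
    have "G.ev (mdl A P) ?n (conv c) = (\<Sum>k\<in>\<tau> ` ?S. ac (mdl A P) (snd k) (cv c k) (?n (fst k)))"
      unfolding G.ev_def lin_def using keys[OF c] lk[OF c]
      by (simp add: Poly_Mapping.keys.rep_eq split_def)
    also have "\<dots> = (\<Sum>k\<in>?S. em (val P X) (?g k))"
      unfolding sum.reindex[OF inj]
    proof (rule sum.cong[OF refl])
      fix s assume s: "s \<in> ?S"
      show "((\<lambda>k. ac (mdl A P) (snd k) (cv c k) (?n (fst k))) \<circ> \<tau>) s = em (val P X) (?g s)"
        using conjunct2[OF k[OF s]] \<tau>[of s] s by (simp add: cv_def)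
    qed
    also have "\<dots> = em (val P X) (finsum (val P X) ?g ?S)"
      by (rule conjunct1[OF fs, symmetric])
    finally show ?thesis using conjunct2[OF fs] unfolding basis_comb_def S by simp
  qed
  have emb: "bij_betw (em (val P X)) (car P X) (cr (mdl A P) X)"
    unfolding bij_betw_def cr_mdl using em_inj[OF vb_ag[OF vP X]] by (auto simp: inj_on_def)
  have "bij_betw (basis_comb A P E X) ?F (car P X) \<longleftrightarrow> bij_betw (em (val P X) \<circ> basis_comb A P E X) ?F (cr (mdl A P) X)"
    by (rule bij_betw_comp_iff2[OF emb]) (use ev in auto)
  also have "\<dots> \<longleftrightarrow> bij_betw (G.ev (mdl A P) ?n \<circ> conv) ?F (cr (mdl A P) X)"
    by (rule bij_betw_cong) (use ev in simp)
  also have "\<dots> \<longleftrightarrow> bij_betw (G.ev (mdl A P) ?n) ?I (cr (mdl A P) X)"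
    by (rule bij_betw_comp_iff[OF conv_bij, symmetric])
  finally show ?thesis .
qed

lemma mdl_left: "left_module A M \<Longrightarrow> G.md (mdl A M)" by (rule mdl_md[OF A_mon])

lemma free_proj:
  assumes "free_left_module A P"
  shows "G.proj (mdl A P)"
proof -
  from assms obtain E where P: "left_module A P" and E: "\<forall>(Y, e)\<in>E. vb_obj Y \<and> e \<in> car P Y"
    and b: "\<forall>X. vb_obj X \<longrightarrow> bij_betw (basis_comb A P E X) (coeff_families A E X) (car P X)"
    unfolding free_left_module_def by blast
  have E': "\<And>Y e. (Y, e) \<in> E \<Longrightarrow> vb_obj Y \<and> e \<in> car P Y" using E by blast
  show ?thesis
  proof (rule G.proj_free[OF mdl_left[OF P], where E = E and ob = fst and n = "\<lambda>(Y, e). em (val P Y) e"])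
    show "(case e of (Y, e) \<Rightarrow> em (val P Y) e) \<in> cr (mdl A P) (fst e)" if "e \<in> E" for e
    proof -
      obtain Y y where e: "e = (Y, y)" by (cases e)
      show ?thesis using that E'[of Y y] by (simp add: e cr_mdl)
    qed
    show "bij_betw (G.ev (mdl A P) (\<lambda>(Y, e). em (val P Y) e)) (cr (V.ind E fst (mdl A (self A))) X) (cr (mdl A P) X)"
      if "vb_obj X" for X using basis_bij[OF P E' that] b that by blast
  qed
qed

text \<open>Shifts the index: \<open>d n\<close> starts at the term n + 1, whereas an abstract
  differential is numbered by its source.\<close>

definition udiff :: "(nat \<Rightarrow> ('f, 'k, 'a, 'p) vblmod) \<Rightarrow> (nat \<Rightarrow> 'f obj \<Rightarrow> 'p \<Rightarrow> 'p) \<Rightarrow> nat \<Rightarrow> 'f obj \<Rightarrow> 'p uni \<Rightarrow> 'p uni" where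
  "udiff P d n = (case n of 0 \<Rightarrow> \<lambda>X u. 0 | Suc m \<Rightarrow> umap (P (Suc m)) (P m) (d m))"

lemma free_resolution_res:
  assumes N: "left_module A N" and r: "free_resolution A N P d \<eta>"
  shows "G.res (mdl A N) (\<lambda>n. mdl A (P n)) (udiff P d) (umap (P 0) N \<eta>)"
proof -
  have fr: "free_left_module A (P n)" and d: "left_hom A (P (Suc n)) (P n) (d n)" for n
    using r unfolding free_resolution_def by blast+
  have \<eta>: "left_hom A (P 0) N \<eta>" and su: "vb_surj (P 0) N \<eta>" using r unfolding free_resolution_def by blast+
  have e0: "d 0 X ` car (P 1) X = {x \<in> car (P 0) X. \<eta> X x = \<zero>\<^bsub>val N X\<^esub>}"
    and e1: "d (Suc n) X ` car (P (Suc (Suc n))) X = {x \<in> car (P (Suc n)) X. d n X x = \<zero>\<^bsub>val (P n) X\<^esub>}"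
    if "vb_obj X" for X n using r that unfolding free_resolution_def by blast+
  have P: "left_module A (P n)" for n using fr unfolding free_left_module_def by blast
  note agP = vb_ag[OF left_moduleD(1)[OF P]] and agN = vb_ag[OF left_moduleD(1)[OF N]]
  note hd = umap_hom[OF P P d] and h\<eta> = umap_hom[OF P N \<eta>]
  have dz: "umap (P (Suc n)) (P n) (d n) X (em (val (P (Suc n)) X) x) = 0 \<longleftrightarrow> d n X x = \<zero>\<^bsub>val (P n) X\<^esub>"
    if X: "vb_obj X" and x: "x \<in> car (P (Suc n)) X" for X x n
    using em_eq_zero[OF agP[OF X] klinearD(1)[OF left_homD(1)[OF d X] x]] umap_em[OF P X x, of "P n" "d n"] by simp
  have \<eta>z: "umap (P 0) N \<eta> X (em (val (P 0) X) x) = 0 \<longleftrightarrow> \<eta> X x = \<zero>\<^bsub>val N X\<^esub>"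
    if X: "vb_obj X" and x: "x \<in> car (P 0) X" for X x
    using em_eq_zero[OF agN[OF X] klinearD(1)[OF left_homD(1)[OF \<eta> X] x]] umap_em[OF P X x, of N \<eta>] by simp
  have c: "G.cpx (\<lambda>n. mdl A (P n)) (udiff P d)"
    unfolding G.cpx_def
  proof (intro conjI allI impI)
    show "G.md (mdl A (P n))" for n by (rule mdl_left[OF P])
    show "G.mhom (mdl A (P n)) (mdl A (P (n - 1))) (udiff P d n)" for n
      by (cases n) (simp_all add: udiff_def G.mhom_zero[OF mdl_left[OF P]] hd)
    show "udiff P d 0 = (\<lambda>X x. 0)" by (simp add: udiff_def)
    fix n X u assume X: "vb_obj X" and "u \<in> cr (mdl A (P (Suc n))) X"
    then obtain x where x: "u = em (val (P (Suc n)) X) x" "x \<in> car (P (Suc n)) X" by (auto simp: cr_mdl)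
    show "udiff P d n X (udiff P d (Suc n) X u) = 0"
    proof (cases n)
      case (Suc m)
      have "d n X x \<in> {x \<in> car (P (Suc m)) X. d m X x = \<zero>\<^bsub>val (P m) X\<^esub>}"
        using e1[OF X, of m] x(2) Suc by blast
      then show ?thesis using dz[OF X, of "d n X x" m] umap_em[OF P X x(2), of "P n" "d n"] Suc by (simp add: udiff_def x(1))
    qed (simp add: udiff_def)
  qed
  have a: "G.acpx (mdl A N) (\<lambda>n. mdl A (P n)) (udiff P d) (umap (P 0) N \<eta>)"
    unfolding G.acpx_def
  proof (intro conjI allI impI c mdl_left[OF N] h\<eta>)
    fix X u assume X: "vb_obj X" and "u \<in> cr (mdl A (P 1)) X"
    then obtain x where x: "u = em (val (P 1) X) x" "x \<in> car (P 1) X" by (auto simp: cr_mdl)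
    have "d 0 X x \<in> {x \<in> car (P 0) X. \<eta> X x = \<zero>\<^bsub>val N X\<^esub>}" using e0[OF X] x(2) by blast
    then show "umap (P 0) N \<eta> X (udiff P d 1 X u) = 0"
      using \<eta>z[OF X, of "d 0 X x"] umap_em[OF P X x(2), of "P 0" "d 0"] x by (simp add: udiff_def)
  qed
  have r1: "\<exists>u\<in>cr (mdl A (P 0)) X. umap (P 0) N \<eta> X u = z" if X: "vb_obj X" and uz: "z \<in> cr (mdl A N) X" for X z
  proof -
    from uz obtain y where y: "z = em (val N X) y" "y \<in> car N X" by (auto simp: cr_mdl)
    have "\<eta> X ` car (P 0) X = car N X" using su X unfolding vb_surj_def by (elim allE impE)
    with y(2) have "y \<in> \<eta> X ` car (P 0) X" by simp
    then obtain x where x: "\<eta> X x = y" "x \<in> car (P 0) X" by (elim imageE) simp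
    show ?thesis
    proof (rule bexI)
      show "umap (P 0) N \<eta> X (em (val (P 0) X) x) = z" unfolding umap_em[OF P X x(2), of N \<eta>] x(1) y(1) ..
    qed (simp add: cr_mdl x(2))
  qed
  have r2: "\<exists>v\<in>cr (mdl A (P 1)) X. udiff P d 1 X v = u" if X: "vb_obj X" and uz: "u \<in> cr (mdl A (P 0)) X" and z: "umap (P 0) N \<eta> X u = 0" for X u
  proof -
    from uz obtain x where x: "u = em (val (P 0) X) x" "x \<in> car (P 0) X" by (auto simp: cr_mdl)
    have "x \<in> d 0 X ` car (P 1) X" unfolding e0[OF X] using \<eta>z[OF X x(2)] z[unfolded x(1)] x(2) by blast
    then obtain y where y: "x = d 0 X y" "y \<in> car (P 1) X" by (rule imageE)
    show ?thesis
    proof (rule bexI)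
      have "udiff P d 1 = umap (P 1) (P 0) (d 0)" by (simp add: udiff_def)
      moreover have "y \<in> car (P (Suc 0)) X" using y(2) by simp
      ultimately show "udiff P d 1 X (em (val (P 1) X) y) = u"
        using umap_em[OF P X, of y "Suc 0" "P 0" "d 0"] by (simp add: y(1)[symmetric] x(1))
    qed (simp add: cr_mdl y(2)[simplified])
  qed
  have r3: "\<exists>v\<in>cr (mdl A (P (Suc (Suc n)))) X. udiff P d (Suc (Suc n)) X v = u" if X: "vb_obj X" and uz: "u \<in> cr (mdl A (P (Suc n))) X" and z: "udiff P d (Suc n) X u = 0" for n X u
  proof -
    from uz obtain x where x: "u = em (val (P (Suc n)) X) x" "x \<in> car (P (Suc n)) X" by (auto simp: cr_mdl)
    have "x \<in> d (Suc n) X ` car (P (Suc (Suc n))) X" unfolding e1[OF X] using dz[OF X x(2)] z[unfolded x(1)] x(2) by (simp add: udiff_def)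
    then obtain y where y: "x = d (Suc n) X y" "y \<in> car (P (Suc (Suc n))) X" by (rule imageE)
    show ?thesis
    proof (rule bexI)
      have "udiff P d (Suc (Suc n)) = umap (P (Suc (Suc n))) (P (Suc n)) (d (Suc n))" by (simp add: udiff_def)
      then show "udiff P d (Suc (Suc n)) X (em (val (P (Suc (Suc n))) X) y) = u"
        using umap_em[OF P X y(2), of "P (Suc n)" "d (Suc n)"] by (simp add: y(1)[symmetric] x(1))
    qed (simp add: cr_mdl y(2))
  qed
  show ?thesis
    unfolding G.res_def G.resn_def by (intro conjI allI impI a free_proj[OF fr] r1 r2 r3)
qed

end

section \<open>The tensor product with k as reduction modulo the augmentation ideal\<close>

lemma kmodD:
  fixes M :: "('k::{comm_ring,monoid_mult}, 'm) module"
  assumes "Module.module kring M"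
  shows "x \<in> carrier M \<Longrightarrow> c \<odot>\<^bsub>M\<^esub> x \<in> carrier M"
    "x \<in> carrier M \<Longrightarrow> (a + b) \<odot>\<^bsub>M\<^esub> x = a \<odot>\<^bsub>M\<^esub> x \<oplus>\<^bsub>M\<^esub> b \<odot>\<^bsub>M\<^esub> x"
    "x \<in> carrier M \<Longrightarrow> (a * b) \<odot>\<^bsub>M\<^esub> x = a \<odot>\<^bsub>M\<^esub> (b \<odot>\<^bsub>M\<^esub> x)"
    "x \<in> carrier M \<Longrightarrow> 1 \<odot>\<^bsub>M\<^esub> x = x"
    "x \<in> carrier M \<Longrightarrow> y \<in> carrier M \<Longrightarrow> c \<odot>\<^bsub>M\<^esub> (x \<oplus>\<^bsub>M\<^esub> y) = c \<odot>\<^bsub>M\<^esub> x \<oplus>\<^bsub>M\<^esub> c \<odot>\<^bsub>M\<^esub> y"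
    "x \<in> carrier M \<Longrightarrow> 0 \<odot>\<^bsub>M\<^esub> x = \<zero>\<^bsub>M\<^esub>"
    "c \<odot>\<^bsub>M\<^esub> \<zero>\<^bsub>M\<^esub> = \<zero>\<^bsub>M\<^esub>"
    "abelian_group M" "\<zero>\<^bsub>M\<^esub> \<in> carrier M" "x \<in> carrier M \<Longrightarrow> y \<in> carrier M \<Longrightarrow> x \<oplus>\<^bsub>M\<^esub> y \<in> carrier M"
proof -
  interpret Module.module kring M by (rule assms)
  have k: "carrier (kring :: 'k ring) = UNIV" "\<one>\<^bsub>kring\<^esub> = (1::'k)" "\<zero>\<^bsub>kring\<^esub> = (0::'k)"
    "\<And>a b::'k. a \<oplus>\<^bsub>kring\<^esub> b = a + b" "\<And>a b::'k. a \<otimes>\<^bsub>kring\<^esub> b = a * b" by (simp_all add: kring_def)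
  show "x \<in> carrier M \<Longrightarrow> c \<odot>\<^bsub>M\<^esub> x \<in> carrier M" using smult_closed[of c x] by (simp add: k)
  show "x \<in> carrier M \<Longrightarrow> (a + b) \<odot>\<^bsub>M\<^esub> x = a \<odot>\<^bsub>M\<^esub> x \<oplus>\<^bsub>M\<^esub> b \<odot>\<^bsub>M\<^esub> x" using smult_l_distr[of a b x] by (simp add: k)
  show "x \<in> carrier M \<Longrightarrow> (a * b) \<odot>\<^bsub>M\<^esub> x = a \<odot>\<^bsub>M\<^esub> (b \<odot>\<^bsub>M\<^esub> x)" using smult_assoc1[of a b x] by (simp add: k)
  show "x \<in> carrier M \<Longrightarrow> 1 \<odot>\<^bsub>M\<^esub> x = x" using smult_one[of x] by (simp add: k)
  show "x \<in> carrier M \<Longrightarrow> y \<in> carrier M \<Longrightarrow> c \<odot>\<^bsub>M\<^esub> (x \<oplus>\<^bsub>M\<^esub> y) = c \<odot>\<^bsub>M\<^esub> x \<oplus>\<^bsub>M\<^esub> c \<odot>\<^bsub>M\<^esub> y"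
    using smult_r_distr[of c x y] by (simp add: k)
  show "x \<in> carrier M \<Longrightarrow> 0 \<odot>\<^bsub>M\<^esub> x = \<zero>\<^bsub>M\<^esub>" using smult_l_null[of x] by (simp add: k)
  show "c \<odot>\<^bsub>M\<^esub> \<zero>\<^bsub>M\<^esub> = \<zero>\<^bsub>M\<^esub>" using smult_r_null[of c] by (simp add: k)
  show "abelian_group M" by (rule M.abelian_group_axioms)
  show "\<zero>\<^bsub>M\<^esub> \<in> carrier M" by simp
  show "x \<in> carrier M \<Longrightarrow> y \<in> carrier M \<Longrightarrow> x \<oplus>\<^bsub>M\<^esub> y \<in> carrier M" by simp
qed

abbreviation pscale :: "'k \<Rightarrow> ('s \<Rightarrow>\<^sub>0 'k) \<Rightarrow> ('s \<Rightarrow>\<^sub>0 'k::{comm_ring,monoid_mult})" where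
  "pscale c \<equiv> Poly_Mapping.map ((*) c)"

lemma lookup_pscale: "Poly_Mapping.lookup (pscale c p) s = c * Poly_Mapping.lookup p s"
  by (simp add: Poly_Mapping.map.rep_eq when_def)

lemma pscale_single: "pscale c (Poly_Mapping.single s z) = Poly_Mapping.single s (c * z)"
  by (rule poly_mapping_eqI) (simp add: lookup_pscale lookup_single when_def)

lemma pscale_add: "pscale c (p + q) = pscale c p + pscale c q"
  by (rule poly_mapping_eqI) (simp add: lookup_pscale lookup_add distrib_left)

lemma pscale_diff: "pscale c (p - q) = pscale c p - pscale c q"
  by (rule poly_mapping_eqI) (simp add: lookup_pscale lookup_minus right_diff_distrib)

lemma pscale_uminus: "pscale (- 1) p = - p"
  by (rule poly_mapping_eqI) (simp add: lookup_pscale)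

lemma kfree_simps: "carrier (kfree S) = dsum S (\<lambda>_. UNIV)" "add (kfree S) = (+)" "\<zero>\<^bsub>kfree S\<^esub> = 0"
  "smult (kfree S) = pscale"
  by (simp_all add: kfree_def dsum_def)

lemma kfree_closed:
  shows "sgrp (dsum S (\<lambda>_. UNIV :: 'k::{comm_ring,monoid_mult} set))"
    "p \<in> dsum S (\<lambda>_. UNIV) \<Longrightarrow> pscale c p \<in> dsum S (\<lambda>_. UNIV)"
    "s \<in> S \<Longrightarrow> Poly_Mapping.single s z \<in> dsum S (\<lambda>_. UNIV)"
proof -
  show "sgrp (dsum S (\<lambda>_. UNIV :: 'k set))" by (rule sgrp_dsum) (simp add: sgrp_def)
  have "Poly_Mapping.keys (pscale c p) \<subseteq> Poly_Mapping.keys p"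
  proof
    fix x assume "x \<in> Poly_Mapping.keys (pscale c p)"
    then have "c * Poly_Mapping.lookup p x \<noteq> 0" by (simp add: in_keys_iff lookup_pscale)
    then have "Poly_Mapping.lookup p x \<noteq> 0" by (metis mult_zero_right)
    then show "x \<in> Poly_Mapping.keys p" by (simp add: in_keys_iff)
  qed
  then show "p \<in> dsum S (\<lambda>_. UNIV) \<Longrightarrow> pscale c p \<in> dsum S (\<lambda>_. UNIV)" by (auto simp: dsum_def)
  show "s \<in> S \<Longrightarrow> Poly_Mapping.single s z \<in> dsum S (\<lambda>_. UNIV)" by (auto simp: dsum_def)
qed

lemma kfree_module:
  assumes "cring (kring :: 'k::{comm_ring,monoid_mult} ring)"
  shows "Module.module kring (kfree S :: ('k, 's \<Rightarrow>\<^sub>0 'k) module)"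
proof (rule moduleI[OF assms])
  have "sgrp (dsum S (\<lambda>_. UNIV :: 'k set))" by (rule kfree_closed(1))
  note g = sgrpD[OF this]
  show "abelian_group (kfree S :: ('k, 's \<Rightarrow>\<^sub>0 'k) module)"
  proof (rule abelian_groupI)
    fix x :: "'s \<Rightarrow>\<^sub>0 'k" assume "x \<in> carrier (kfree S)"
    then show "\<exists>y\<in>carrier (kfree S). y \<oplus>\<^bsub>kfree S\<^esub> x = \<zero>\<^bsub>kfree S\<^esub>"
      using g(3)[of x] by (intro bexI[of _ "- x"]) (simp_all add: kfree_simps)
  qed (simp_all add: kfree_simps g add_ac)
qed (simp_all add: kfree_simps kring_def kfree_closed poly_mapping_eq_iff fun_eq_iff lookup_pscale lookup_add
      distrib_left distrib_right mult.assoc)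

text \<open>The last clause bounds a span from above. Closure under negatives is not asked for, as
  it is scaling by -1.\<close>

lemma kspan_facts:
  fixes G :: "('s \<Rightarrow>\<^sub>0 'k::{comm_ring,monoid_mult}) set" and S :: "'s set"
  assumes R: "cring (kring :: 'k ring)"
  defines "H \<equiv> kspan (kfree S) G"
  shows "g \<in> G \<Longrightarrow> g \<in> H" "0 \<in> H" "p \<in> H \<Longrightarrow> q \<in> H \<Longrightarrow> p + q \<in> H" "p \<in> H \<Longrightarrow> pscale c p \<in> H"
    "p \<in> H \<Longrightarrow> - p \<in> H" "p \<in> H \<Longrightarrow> q \<in> H \<Longrightarrow> p - q \<in> H"
    "Q \<subseteq> dsum S (\<lambda>_. UNIV) \<Longrightarrow> 0 \<in> Q \<Longrightarrow> (\<And>p q. p \<in> Q \<Longrightarrow> q \<in> Q \<Longrightarrow> p + q \<in> Q) \<Longrightarrow>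
      (\<And>c p. p \<in> Q \<Longrightarrow> pscale c p \<in> Q) \<Longrightarrow> G \<subseteq> Q \<Longrightarrow> H \<subseteq> Q"
proof -
  interpret Module.module kring "kfree S :: ('k, 's \<Rightarrow>\<^sub>0 'k) module" by (rule kfree_module[OF R])
  have sub: "0 \<in> H'" "p \<in> H' \<Longrightarrow> q \<in> H' \<Longrightarrow> p + q \<in> H'" "p \<in> H' \<Longrightarrow> pscale c p \<in> H'"
    if H': "submodule H' kring (kfree S)" for H' and p q :: "'s \<Rightarrow>\<^sub>0 'k" and c
  proof -
    note E = submoduleE[OF H']
    show a: "p \<in> H' \<Longrightarrow> q \<in> H' \<Longrightarrow> p + q \<in> H'" for p q using E(5)[of p q] by (simp add: kfree_simps)
    show m: "p \<in> H' \<Longrightarrow> pscale c p \<in> H'" for p c using E(4)[of c p] by (simp add: kfree_simps kring_def)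
    obtain p where "p \<in> H'" using E(2) by blast
    then show "0 \<in> H'" using a[OF _ m, of p p "- 1"] by (simp add: pscale_uminus)
  qed
  show "g \<in> G \<Longrightarrow> g \<in> H" unfolding H_def kspan_def by blast
  show "0 \<in> H" unfolding H_def kspan_def using sub(1) by blast
  show add: "p \<in> H \<Longrightarrow> q \<in> H \<Longrightarrow> p + q \<in> H" for p q unfolding H_def kspan_def using sub(2) by blast
  show scale: "p \<in> H \<Longrightarrow> pscale c p \<in> H" for c p unfolding H_def kspan_def using sub(3) by blast
  show minus: "p \<in> H \<Longrightarrow> - p \<in> H" for p using scale[of p "- 1"] by (simp add: pscale_uminus)
  show "p \<in> H \<Longrightarrow> q \<in> H \<Longrightarrow> p - q \<in> H" using add[OF _ minus, of p q] by simp
  assume Q: "Q \<subseteq> dsum S (\<lambda>_. UNIV)" "0 \<in> Q" "\<And>p q. p \<in> Q \<Longrightarrow> q \<in> Q \<Longrightarrow> p + q \<in> Q" "\<And>c p. p \<in> Q \<Longrightarrow> pscale c p \<in> Q" "G \<subseteq> Q"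
  have neg: "\<ominus>\<^bsub>kfree S\<^esub> p = - p" if "p \<in> dsum S (\<lambda>_. UNIV)" for p :: "'s \<Rightarrow>\<^sub>0 'k"
  proof -
    have "- p \<in> dsum S (\<lambda>_. UNIV)" by (rule sgrpD(3)[OF kfree_closed(1) that])
    then show ?thesis
      using that M.minus_equality[of "- p" p] by (simp add: kfree_simps)
  qed
  have "submodule Q kring (kfree S)"
  proof (rule submoduleI)
    show "Q \<subseteq> carrier (kfree S)" using Q(1) by (simp add: kfree_simps)
    show "\<ominus>\<^bsub>kfree S\<^esub> p \<in> Q" if "p \<in> Q" for p
      using Q(4)[OF that, of "- 1"] neg[of p] that Q(1) by (auto simp: pscale_uminus)
  qed (simp_all add: kfree_simps Q)
  then show "H \<subseteq> Q" unfolding H_def kspan_def using Q(5) by blast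
qed

lemma bilin_relsI:
  assumes "decomp X X1 X2" "m \<in> car M X1" "n \<in> car N X2"
  shows "n' \<in> car N X2 \<Longrightarrow> symb1 X1 X2 m (n \<oplus>\<^bsub>val N X2\<^esub> n') - symb1 X1 X2 m n - symb1 X1 X2 m n' \<in> bilin_rels M N X"
    "symb1 X1 X2 (c \<odot>\<^bsub>val M X1\<^esub> m) n - Poly_Mapping.single (X1, X2, m, n) c \<in> bilin_rels M N X"
    "symb1 X1 X2 m (c \<odot>\<^bsub>val N X2\<^esub> n) - Poly_Mapping.single (X1, X2, m, n) c \<in> bilin_rels M N X"
  unfolding bilin_rels_def using assms by blast+

lemma balanced_relsI:
  assumes "decomp3 X X1 X2 X3" "m \<in> car M X1" "a \<in> car A X2" "n \<in> car N X3"
  shows "symb1 (vsum X1 X2) X3 (ract M X1 X2 m a) n - symb1 X1 (vsum X2 X3) m (lact N X2 X3 a n) \<in> balanced_rels A M N X"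
  unfolding balanced_rels_def using assms by blast

context aug_monoid
begin

lemma kring_cring: "cring (kring :: 'k ring)"
  by (rule module.axioms(1)[OF vb_moduleD(1)[OF A_vb vb_obj_zero]])

abbreviation "kR \<equiv> right_via \<epsilon> vb_unit"
abbreviation "sy P X \<equiv> symbs kR P X"
abbreviation "fr P X \<equiv> dsum (sy P X) (\<lambda>_. UNIV :: 'k set)"
abbreviation "rl P X \<equiv> tensor_rels A kR P X"

lemma kR_simps: "car kR X = (if X = {0} then UNIV else {0})" "ract kR X1 X2 m a = m * \<epsilon> X2 a"
  "add (val kR X) = (+)" "smult (val kR X) = (*)"
  by (simp_all add: right_via_def vb_unit_def)

lemma eps:
  assumes "vb_obj X" "a \<in> car A X"
  shows "\<epsilon> X (c \<odot>\<^bsub>val A X\<^esub> a) = c * \<epsilon> X a" "b \<in> car A X \<Longrightarrow> \<epsilon> X (a \<oplus>\<^bsub>val A X\<^esub> b) = \<epsilon> X a + \<epsilon> X b"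
  "X \<noteq> {0} \<Longrightarrow> \<epsilon> X a = 0"
proof -
  have "klinear (val A X) (val vb_unit X) (\<epsilon> X)"
    using augmentedD(2)[OF aug] assms(1) unfolding monoid_hom_def vb_hom_def by blast
  note k = klinearD[OF this]
  show "\<epsilon> X (c \<odot>\<^bsub>val A X\<^esub> a) = c * \<epsilon> X a" using k(3)[OF assms(2)] by (simp add: vb_unit_def)
  show "b \<in> car A X \<Longrightarrow> \<epsilon> X (a \<oplus>\<^bsub>val A X\<^esub> b) = \<epsilon> X a + \<epsilon> X b" using k(2)[OF assms(2)] by (simp add: vb_unit_def)
  show "X \<noteq> {0} \<Longrightarrow> \<epsilon> X a = 0" using augmentedD(4)[OF aug assms] .
qed

lemma eps_one: "\<epsilon> {0} (mone A) = 1"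
  using augmentedD(2)[OF aug] unfolding monoid_hom_def by (simp add: vb_unit_def)

text \<open>The element and the multiple of the unit have the same augmentation, and the
  augmentation is injective in degree 0.\<close>

lemma A_zero:
  assumes a: "a \<in> car A {0}"
  shows "a = \<epsilon> {0} a \<odot>\<^bsub>val A {0}\<^esub> mone A"
proof -
  note m = kmodD[OF vb_moduleD(1)[OF A_vb vb_obj_zero]] and o = vb_monoidD(2)[OF A_mon]
  let ?b = "(- \<epsilon> {0} a) \<odot>\<^bsub>val A {0}\<^esub> mone A" and ?c = "\<epsilon> {0} a \<odot>\<^bsub>val A {0}\<^esub> mone A"
  have b: "?b \<in> car A {0}" and c: "?c \<in> car A {0}" using m(1)[OF o] by auto
  have "\<epsilon> {0} (a \<oplus>\<^bsub>val A {0}\<^esub> ?b) = 0"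
    using eps(2)[OF vb_obj_zero a b] eps(1)[OF vb_obj_zero o] eps_one by simp
  then have z: "a \<oplus>\<^bsub>val A {0}\<^esub> ?b = \<zero>\<^bsub>val A {0}\<^esub>" using augmentedD(5)[OF aug m(10)[OF a b]] by blast
  have "?c \<oplus>\<^bsub>val A {0}\<^esub> ?b = \<zero>\<^bsub>val A {0}\<^esub>" using m(2)[OF o, of "\<epsilon> {0} a" "- \<epsilon> {0} a"] m(6)[OF o] by simp
  then have "em (val A {0}) a = em (val A {0}) ?c"
    using z em_add[OF m(8) a b] em_add[OF m(8) c b] by simp
  then show ?thesis using em_inj[OF m(8) a c] by simp
qed

text \<open>The evaluation of a symbol with entries c and n as c n. As k is concentrated in degree
  0, a symbol whose first object is not the zero space has c = 0 and contributes nothing. Modulo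
  relations this becomes the isomorphism from \<open>k \<otimes>_A P\<close> to P modulo the
  ideal.\<close>

definition W :: "('f, 'k, 'a, 'p) vblmod \<Rightarrow> 'f obj \<Rightarrow> (('f, 'k, 'p) symb \<Rightarrow>\<^sub>0 'k) \<Rightarrow> 'p uni" where
  "W P X = lin (\<lambda>(X1, X2, c, n) z. if X1 = {0} then em (val P X) ((z * c) \<odot>\<^bsub>val P X\<^esub> n) else 0)"

lemma sy_iff: "(X1, X2, c, n) \<in> sy P X \<longleftrightarrow> decomp X X1 X2 \<and> (X1 = {0} \<or> c = 0) \<and> n \<in> car P X2"
  by (auto simp: symbs_def kR_simps)

lemma decomp_zeroD: "decomp X {0} X2 \<Longrightarrow> X2 = X"
  using vsum_zero(1)[of X2] by (simp add: decomp_def)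

context
  fixes P :: "('f, 'k, 'a, 'p) vblmod" and X :: "'f obj"
  assumes P: "left_module A P" and X: "vb_obj X"
begin

lemmas vP = left_moduleD(1)[OF P]
lemmas mP = kmodD[OF vb_moduleD(1)[OF vP X]]
lemmas kf = kspan_facts[OF kring_cring, where G = "bilin_rels kR P X \<union> balanced_rels A kR P X" and S = "sy P X", folded tensor_rels_def]

lemma W_single:
  "s = (X1, X2, c, n) \<Longrightarrow> s \<in> sy P X \<Longrightarrow>
    W P X (Poly_Mapping.single s z) = (if X1 = {0} then em (val P X) ((z * c) \<odot>\<^bsub>val P X\<^esub> n) else 0)"
proof -
  assume s: "s = (X1, X2, c, n)" "s \<in> sy P X"
  have "X1 = {0} \<Longrightarrow> n \<in> car P X" using s decomp_zeroD[of X X2] by (auto simp: sy_iff)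
  then show ?thesis unfolding W_def s(1) by (subst lin_single) (use mP(6) em_zero[OF mP(8)] in auto)
qed

lemma W_add: "additive_on (fr P X) (W P X)"
  unfolding W_def
proof (rule lin_additive)
  fix s assume s: "s \<in> sy P X"
  obtain X1 X2 c n where e: "s = (X1, X2, c, n)" by (cases s) auto
  have "X1 = {0} \<Longrightarrow> n \<in> car P X" using s decomp_zeroD[of X X2] by (auto simp: sy_iff e)
  then show "additive_on UNIV ((\<lambda>(X1, X2, c, n) z. if X1 = {0} then em (val P X) ((z * c) \<odot>\<^bsub>val P X\<^esub> n) else 0) s)"
    by (auto simp: additive_on_def e distrib_right mP(2) em_add[OF mP(8) mP(1) mP(1)])
qed (simp add: sgrp_def)

lemmas Ws = additive_onD[OF W_add kfree_closed(1)]
lemma fr_sgrp: "sgrp (fr P X)" by (rule kfree_closed(1))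
lemmas frg = sgrpD[OF fr_sgrp]

lemma fr_single: "s \<in> sy P X \<Longrightarrow> Poly_Mapping.single s z \<in> fr P X"
  by (rule kfree_closed(3))

lemma W_in:
  assumes "p \<in> fr P X"
  obtains x where "x \<in> car P X" "W P X p = em (val P X) x"
proof -
  have "W P X p \<in> em (val P X) ` car P X"
    using assms
  proof (induction p rule: dsum_induct)
    case zero
    then show ?case using Ws(1) em_zero[OF mP(8)] mP(9) by (metis imageI)
  next
    case (add s z p)
    obtain X1 X2 c n where e: "s = (X1, X2, c, n)" by (cases s) auto
    have n: "X1 = {0} \<Longrightarrow> n \<in> car P X" using add(1) decomp_zeroD[of X X2] by (auto simp: sy_iff e)
    have "W P X (Poly_Mapping.single s z) \<in> em (val P X) ` car P X"
      unfolding W_single[OF e add(1)] using n mP(1) sgrpD(1)[OF em_sgrp[OF mP(8)]] by auto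
    then show ?case
      using sgrpD(4)[OF em_sgrp[OF mP(8)] _ add.IH] Ws(2)[OF fr_single[OF add(1)] add(3)] by simp
  qed (simp add: sgrp_def)
  then show thesis using that by blast
qed

lemma W_scale:
  assumes p: "p \<in> fr P X" and x: "x \<in> car P X" "W P X p = em (val P X) x"
  shows "W P X (pscale c p) = em (val P X) (c \<odot>\<^bsub>val P X\<^esub> x)"
proof -
  let ?g = "\<lambda>u. em (val P X) (c \<odot>\<^bsub>val P X\<^esub> ue (val P X) u)"
  have g: "additive_on (em (val P X) ` car P X) ?g"
    by (rule em_additive[OF mP(8) mP(8)]) (simp_all add: mP(1,5))
  have "W P X (pscale c p) = ?g (W P X p)"
  proof (rule additive_dsum_eq[OF p])
    show "additive_on (fr P X) (\<lambda>p. W P X (pscale c p))"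
      unfolding additive_on_def pscale_add using Ws(2)[OF kfree_closed(2) kfree_closed(2)] by blast
    show "additive_on (fr P X) (\<lambda>p. ?g (W P X p))"
      by (rule additive_on_comp[OF W_add g]) (use W_in in blast)
    fix s z assume s: "s \<in> sy P X"
    obtain X1 X2 d n where e: "s = (X1, X2, d, n)" by (cases s) auto
    have n: "X1 = {0} \<Longrightarrow> n \<in> car P X" using s decomp_zeroD[of X X2] by (auto simp: sy_iff e)
    show "W P X (pscale c (Poly_Mapping.single s z)) = ?g (W P X (Poly_Mapping.single s z))"
    proof (cases "X1 = {0}")
      case True
      then show ?thesis unfolding pscale_single W_single[OF e s] using n[OF True] mP(8) mP(1) mP(3)
        by (simp add: mult.assoc)
    next
      case False
      have "ue (val P X) 0 = \<zero>\<^bsub>val P X\<^esub>" using ue_em[OF mP(8,9)] em_zero[OF mP(8)] by simp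
      then show ?thesis unfolding pscale_single W_single[OF e s] using False em_zero[OF mP(8)] mP(7) by simp
    qed
  qed (simp add: sgrp_def)
  then show ?thesis using x mP(8) by simp
qed

definition q1 :: "'p \<Rightarrow> ('f, 'k, 'p) symb \<Rightarrow>\<^sub>0 'k" where "q1 x = symb1 {0} X 1 x"

lemma q1_sy: "x \<in> car P X \<Longrightarrow> ({0}, X, c, x) \<in> sy P X"
  using decomp_zero(1)[OF X] by (simp add: sy_iff)

lemma W_q1: "x \<in> car P X \<Longrightarrow> q1 x \<in> fr P X \<and> W P X (q1 x) = em (val P X) x"
  using fr_single[OF q1_sy[of x 1]] W_single[OF refl q1_sy, of x 1 1] mP(4) by (simp add: q1_def)

lemma single_zero_rl: "(X1, X2, 0, n) \<in> sy P X \<Longrightarrow> Poly_Mapping.single (X1, X2, 0, n) z \<in> rl P X"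
proof -
  assume s: "(X1, X2, 0, n) \<in> sy P X"
  have "symb1 X1 X2 (0 \<odot>\<^bsub>val kR X1\<^esub> 0) n - Poly_Mapping.single (X1, X2, 0, n) 0 \<in> bilin_rels kR P X"
    by (rule bilin_relsI(2)) (use s in \<open>auto simp: sy_iff kR_simps\<close>)
  then have "symb1 X1 X2 0 n \<in> rl P X" using kf(1) by (simp add: kR_simps)
  from kf(4)[OF this, of z] show ?thesis by (simp add: pscale_single)
qed

lemma q1_scale:
  assumes x: "x \<in> car P X"
  shows "q1 (c \<odot>\<^bsub>val P X\<^esub> x) - Poly_Mapping.single ({0}, X, 1, x) c \<in> rl P X"
proof -
  have "symb1 {0} X 1 (c \<odot>\<^bsub>val P X\<^esub> x) - Poly_Mapping.single ({0}, X, 1, x) c \<in> bilin_rels kR P X"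
    by (rule bilin_relsI(3)) (use x decomp_zero(1)[OF X] in \<open>auto simp: kR_simps\<close>)
  then show ?thesis using kf(1) by (simp add: q1_def)
qed

lemma q1_zero: "q1 \<zero>\<^bsub>val P X\<^esub> \<in> rl P X"
  using q1_scale[OF mP(9), of 0] mP(7) by simp

lemma q1_add:
  assumes "x \<in> car P X" "y \<in> car P X"
  shows "q1 (x \<oplus>\<^bsub>val P X\<^esub> y) - q1 x - q1 y \<in> rl P X"
proof -
  have "symb1 {0} X 1 (x \<oplus>\<^bsub>val P X\<^esub> y) - symb1 {0} X 1 x - symb1 {0} X 1 y \<in> bilin_rels kR P X"
    by (rule bilin_relsI(1)) (use assms decomp_zero(1)[OF X] in \<open>auto simp: kR_simps\<close>)
  then show ?thesis using kf(1) by (simp add: q1_def)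
qed

text \<open>All scalars can be moved into P, symbols with c = 0 are relations, and the rest adds up,
  so a combination is congruent to the single symbol of its value under \<open>W\<close>.\<close>

lemma fr_reduce:
  assumes "p \<in> fr P X"
  shows "\<exists>x\<in>car P X. W P X p = em (val P X) x \<and> p - q1 x \<in> rl P X"
  using assms
proof (induction p rule: dsum_induct)
  case zero
  then show ?case using kf(5)[OF q1_zero] em_zero[OF mP(8)] Ws(1) mP(9) by (intro bexI[of _ "\<zero>\<^bsub>val P X\<^esub>"]) simp_all
next
  case (add s z p)
  then obtain y where y: "y \<in> car P X" "W P X p = em (val P X) y" "p - q1 y \<in> rl P X" by blast
  obtain X1 X2 c n where e: "s = (X1, X2, c, n)" by (cases s) auto
  have "\<exists>x\<in>car P X. W P X (Poly_Mapping.single s z) = em (val P X) x \<and> Poly_Mapping.single s z - q1 x \<in> rl P X"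
  proof (cases "X1 = {0}")
    case True
    have s: "s = ({0}, X, c, n)" and n: "n \<in> car P X" using True add(1) decomp_zeroD[of X X2] by (auto simp: e sy_iff)
    have "symb1 {0} X (c \<odot>\<^bsub>val kR {0}\<^esub> 1) n - Poly_Mapping.single ({0}, X, 1, n) c \<in> bilin_rels kR P X"
      by (rule bilin_relsI(2)) (use n decomp_zero(1)[OF X] in \<open>auto simp: kR_simps\<close>)
    then have "symb1 {0} X c n - Poly_Mapping.single ({0}, X, 1, n) c \<in> rl P X" using kf(1) by (simp add: kR_simps)
    from kf(4)[OF this, of z]
    have "Poly_Mapping.single s z - Poly_Mapping.single ({0}, X, 1, n) (z * c) \<in> rl P X"
      by (simp add: pscale_diff pscale_single s)
    from kf(6)[OF this q1_scale[OF n, of "z * c"]]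
    have "Poly_Mapping.single s z - q1 ((z * c) \<odot>\<^bsub>val P X\<^esub> n) \<in> rl P X" by simp
    then show ?thesis using W_single[OF s add(1), of z] mP(1)[OF n] by auto
  next
    case False
    then have "c = 0" using add(1) by (simp add: e sy_iff)
    then have "Poly_Mapping.single s z \<in> rl P X" using single_zero_rl[of X1 X2 n z] add(1) e by simp
    then have "Poly_Mapping.single s z - q1 \<zero>\<^bsub>val P X\<^esub> \<in> rl P X" by (rule kf(6)[OF _ q1_zero])
    then show ?thesis using W_single[OF e add(1), of z] False em_zero[OF mP(8)] mP(9) by auto
  qed
  then obtain x where x: "x \<in> car P X" "W P X (Poly_Mapping.single s z) = em (val P X) x" "Poly_Mapping.single s z - q1 x \<in> rl P X"
    by blast
  have "(Poly_Mapping.single s z - q1 x) + (p - q1 y) - (q1 (x \<oplus>\<^bsub>val P X\<^esub> y) - q1 x - q1 y) \<in> rl P X"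
    by (rule kf(6)[OF kf(3)[OF x(3) y(3)] q1_add[OF x(1) y(1)]])
  then have "Poly_Mapping.single s z + p - q1 (x \<oplus>\<^bsub>val P X\<^esub> y) \<in> rl P X" by (simp add: algebra_simps)
  then show ?case
    using Ws(2)[OF fr_single[OF add(1), of z] add(3)] x(2) y(2) mP(10)[OF x(1) y(1)] em_add[OF mP(8) x(1) y(1)]
    by (intro bexI[of _ "x \<oplus>\<^bsub>val P X\<^esub> y"]) simp_all
qed (simp add: sgrp_def)

text \<open>A product with a coefficient of augmentation 0 becomes trivial after tensoring with k.
  The clause about scalars is proved alongside because the ideal submodule was generated by sums
  alone, whereas the relations form a submodule over the coefficients.\<close>

lemma Pos_q1:
  assumes "u \<in> G.Pos (mdl A P) X"
  shows "\<exists>x\<in>car P X. u = em (val P X) x \<and> q1 x \<in> rl P X \<and> (\<forall>c. em (val P X) (c \<odot>\<^bsub>val P X\<^esub> x) \<in> G.Pos (mdl A P) X)"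
  using assms
proof (induction rule: G.Pos.induct)
  case zero
  then show ?case using q1_zero em_zero[OF mP(8)] mP(7,9) G.Pos.zero by (intro bexI[of _ "\<zero>\<^bsub>val P X\<^esub>"]) simp_all
next
  case (step t Y a y u)
  then obtain x where x: "x \<in> car P X" "u = em (val P X) x" "q1 x \<in> rl P X"
    "\<And>c. em (val P X) (c \<odot>\<^bsub>val P X\<^esub> x) \<in> G.Pos (mdl A P) X" by blast
  obtain X1 f where t: "t = (Y, X1, f)" "vb_obj Y" "f \<in> vb_iso Y (f ` Y)" "decomp X X1 (f ` Y)"
    using step(1) by (rule vhomE)
  obtain b where b: "a = em (val A X1) b" "b \<in> car A X1" "\<epsilon> X1 b = 0" using step(2) by (auto simp: t(1) upos_def vsimps)
  obtain v where v: "y = em (val P Y) v" "v \<in> car P Y" using step(3) by (auto simp: cr_mdl)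
  note d = decompD[OF t(4)]
  let ?v = "act P Y (f ` Y) f v"
  note av = act_in[OF vP t(3,2) d(2) v(2)]
  let ?w = "lact P X1 (f ` Y) b ?v"
  note w = lact_in[OF P t(4) b(2) av]
  have ac: "ac (mdl A P) t (em (val A X1) b) y = em (val P X) (lact P X1 (f ` Y) b ?v)" if "b \<in> car A X1" for b
    unfolding t(1) v(1) by (rule ac_mdl[OF A_vb vP step(1)[unfolded t(1)] that v(2)])
  have d3: "decomp3 X {0} X1 (f ` Y)" unfolding decomp3_def using decomp_zero(1)[OF d(1)] t(4) by (simp add: vsum_zero)
  \<comment> \<open>The balanced relation for 1, b and the moved element: its left side carries the
    augmentation of b, which is 0.\<close>
  have "symb1 (vsum {0} X1) (f ` Y) (ract kR {0} X1 1 b) ?v - symb1 {0} (vsum X1 (f ` Y)) 1 ?w \<in> balanced_rels A kR P X"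
    by (rule balanced_relsI[OF d3 _ b(2) av]) (simp add: kR_simps)
  then have "symb1 X1 (f ` Y) 0 ?v - q1 ?w \<in> rl P X"
    using kf(1)[OF UnI2, of "symb1 (vsum {0} X1) (f ` Y) (ract kR {0} X1 1 b) ?v - symb1 {0} (vsum X1 (f ` Y)) 1 ?w"] b(3)
    unfolding q1_def d(3)[symmetric] by (simp add: kR_simps vsum_zero)
  note bal = this
  have "symb1 X1 (f ` Y) 0 ?v \<in> rl P X" by (rule single_zero_rl) (use t(4) av in \<open>simp add: sy_iff\<close>)
  from kf(6)[OF this bal] have qw: "q1 ?w \<in> rl P X" by simp
  have cw: "em (val P X) (c \<odot>\<^bsub>val P X\<^esub> ?w) \<in> G.Pos (mdl A P) X" for c
  proof -
    have cb: "c \<odot>\<^bsub>val A X1\<^esub> b \<in> car A X1" by (rule kmodD(1)[OF vb_moduleD(1)[OF A_vb d(1)] b(2)])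
    have "em (val A X1) (c \<odot>\<^bsub>val A X1\<^esub> b) \<in> upos A \<epsilon> (vcok t)"
      using cb eps(1)[OF d(1) b(2)] b(3) by (simp add: upos_def t(1) vsimps)
    from G.Pos_ac[OF step(1) this step(3)]
    show ?thesis unfolding ac[OF cb] using klinearD(3)[OF left_moduleD(3)[OF P t(4) av] b(2), of c] by simp
  qed
  show ?case
  proof (intro bexI[of _ "?w \<oplus>\<^bsub>val P X\<^esub> x"] conjI allI)
    show "ac (mdl A P) t a y + u = em (val P X) (?w \<oplus>\<^bsub>val P X\<^esub> x)"
      unfolding b(1) ac[OF b(2)] x(2) by (rule em_add[OF mP(8) w x(1), symmetric])
    show "q1 (?w \<oplus>\<^bsub>val P X\<^esub> x) \<in> rl P X"
      using kf(3)[OF kf(3)[OF q1_add[OF w x(1)] qw] x(3)] by (simp add: algebra_simps)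
    show "em (val P X) (c \<odot>\<^bsub>val P X\<^esub> (?w \<oplus>\<^bsub>val P X\<^esub> x)) \<in> G.Pos (mdl A P) X" for c
      unfolding mP(5)[OF w x(1)] em_add[OF mP(8) mP(1)[OF w] mP(1)[OF x(1)]] by (rule G.Pos_add[OF cw x(4)])
    show "?w \<oplus>\<^bsub>val P X\<^esub> x \<in> car P X" by (rule mP(10)[OF w x(1)])
  qed
qed

text \<open>The bilinear relations evaluate to 0. A balanced relation evaluates to the difference
  between multiplying by the augmentation of a and multiplying by a, which lies in the ideal
  submodule.\<close>

lemma W_rels:
  assumes "r \<in> bilin_rels kR P X \<union> balanced_rels A kR P X"
  shows "r \<in> fr P X \<and> W P X r \<in> G.Pos (mdl A P) X"
proof -
  have n: "X1 = {0} \<Longrightarrow> n \<in> car P X2 \<Longrightarrow> n \<in> car P X" "X1 = {0} \<Longrightarrow> X2 = X" if "decomp X X1 X2" for X1 X2 n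
    using that decomp_zeroD[of X X2] by auto
  have Wd: "W P X (Poly_Mapping.single s a - Poly_Mapping.single s' b) =
      W P X (Poly_Mapping.single s a) - W P X (Poly_Mapping.single s' b)" if "s \<in> sy P X" "s' \<in> sy P X" for s s' a b
    by (rule Ws(4)[OF fr_single[OF that(1)] fr_single[OF that(2)]])
  have Wd3: "W P X (symb1 X1 X2 c m - symb1 Y1 Y2 c' m' - symb1 Z1 Z2 c'' m'') =
      W P X (symb1 X1 X2 c m) - W P X (symb1 Y1 Y2 c' m') - W P X (symb1 Z1 Z2 c'' m'')"
    if "(X1, X2, c, m) \<in> sy P X" "(Y1, Y2, c', m') \<in> sy P X" "(Z1, Z2, c'', m'') \<in> sy P X"
    for X1 X2 c m Y1 Y2 c' m' Z1 Z2 c'' m''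
    using Ws(4)[OF frg(2)[OF fr_single[OF that(1)] fr_single[OF that(2)]] fr_single[OF that(3)]]
      Wd[OF that(1,2)] by simp
  show ?thesis
    using assms unfolding bilin_rels_def balanced_rels_def
  proof (elim UnE, goal_cases)
    case 1
    then obtain X1 X2 m m' x where 1: "r = symb1 X1 X2 (m \<oplus>\<^bsub>val kR X1\<^esub> m') x - symb1 X1 X2 m x - symb1 X1 X2 m' x"
      "decomp X X1 X2" "m \<in> car kR X1" "m' \<in> car kR X1" "x \<in> car P X2" by blast
    have s: "(X1, X2, m + m', x) \<in> sy P X" "(X1, X2, m, x) \<in> sy P X" "(X1, X2, m', x) \<in> sy P X"
      using 1 by (auto simp: sy_iff kR_simps split: if_splits)
    have "W P X r = 0"
      unfolding 1(1) kR_simps Wd3[OF s] W_single[OF refl s(1)] W_single[OF refl s(2)] W_single[OF refl s(3)]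
      using n(1)[OF 1(2) _ 1(5)] mP(1,2) by (simp add: em_add[OF mP(8)])
    then show ?thesis using 1(1) s frg(2) fr_single G.Pos.zero by (simp add: kR_simps)
  next
    case 2
    then obtain X1 X2 m x x' where 2: "r = symb1 X1 X2 m (x \<oplus>\<^bsub>val P X2\<^esub> x') - symb1 X1 X2 m x - symb1 X1 X2 m x'"
      "decomp X X1 X2" "m \<in> car kR X1" "x \<in> car P X2" "x' \<in> car P X2" by blast
    note X2 = decompD(2)[OF 2(2)]
    have s: "(X1, X2, m, x \<oplus>\<^bsub>val P X2\<^esub> x') \<in> sy P X" "(X1, X2, m, x) \<in> sy P X" "(X1, X2, m, x') \<in> sy P X"
      using 2 kmodD(10)[OF vb_moduleD(1)[OF vP X2]] by (auto simp: sy_iff kR_simps split: if_splits)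
    have "W P X r = 0"
    proof (cases "X1 = {0}")
      case True
      then show ?thesis
        unfolding 2(1) Wd3[OF s] W_single[OF refl s(1)] W_single[OF refl s(2)] W_single[OF refl s(3)]
        using n(1)[OF 2(2) _ 2(4)] n(1)[OF 2(2) _ 2(5)] n(2)[OF 2(2)] mP(1,5) by (simp add: em_add[OF mP(8)])
    next
      case False
      then show ?thesis
        unfolding 2(1) Wd3[OF s] W_single[OF refl s(1)] W_single[OF refl s(2)] W_single[OF refl s(3)] by simp
    qed
    then show ?thesis using 2(1) s frg(2) fr_single G.Pos.zero by simp
  next
    case 3
    then obtain X1 X2 c m x where 3: "r = symb1 X1 X2 (c \<odot>\<^bsub>val kR X1\<^esub> m) x - Poly_Mapping.single (X1, X2, m, x) c"
      "decomp X X1 X2" "m \<in> car kR X1" "x \<in> car P X2" by blast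
    have s: "(X1, X2, c * m, x) \<in> sy P X" "(X1, X2, m, x) \<in> sy P X"
      using 3 by (auto simp: sy_iff kR_simps split: if_splits)
    have "W P X r = 0"
      unfolding 3(1) kR_simps Wd[OF s] W_single[OF refl s(1)] W_single[OF refl s(2)] by simp
    then show ?thesis using 3(1) s frg(2) fr_single G.Pos.zero by (simp add: kR_simps)
  next
    case 4
    then obtain X1 X2 c m x where 4: "r = symb1 X1 X2 m (c \<odot>\<^bsub>val P X2\<^esub> x) - Poly_Mapping.single (X1, X2, m, x) c"
      "decomp X X1 X2" "m \<in> car kR X1" "x \<in> car P X2" by blast
    note X2 = decompD(2)[OF 4(2)]
    have s: "(X1, X2, m, c \<odot>\<^bsub>val P X2\<^esub> x) \<in> sy P X" "(X1, X2, m, x) \<in> sy P X"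
      using 4 kmodD(1)[OF vb_moduleD(1)[OF vP X2]] by (auto simp: sy_iff kR_simps split: if_splits)
    have "W P X r = 0"
      unfolding 4(1) Wd[OF s] W_single[OF refl s(1)] W_single[OF refl s(2)]
      using n(1)[OF 4(2) _ 4(4)] n(2)[OF 4(2)] mP(1) by (auto simp: mP(3)[symmetric] mult.commute)
    then show ?thesis using 4(1) s frg(2) fr_single G.Pos.zero by simp
  next
    case 5
    then obtain X1 X2 X3 m a x where 5: "r = symb1 (vsum X1 X2) X3 (ract kR X1 X2 m a) x - symb1 X1 (vsum X2 X3) m (lact P X2 X3 a x)"
      "decomp3 X X1 X2 X3" "m \<in> car kR X1" "a \<in> car A X2" "x \<in> car P X3" by blast
    have d: "decomp (vsum X1 X2) X1 X2" "decomp X (vsum X1 X2) X3" using 5(2) unfolding decomp3_def by blast+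
    have d': "decomp X X1 (vsum X2 X3)" "decomp (vsum X2 X3) X2 X3" using 5(2) by (simp_all add: decomp3_iff)
    note o = decompD(1)[OF d(1)] decompD(2)[OF d(1)] decompD(2)[OF d(2)]
    note l = lact_in[OF P d'(2) 5(4,5)]
    have z: "vsum X1 X2 = {0} \<Longrightarrow> X1 = {0} \<and> X2 = {0}" using decompD(6,7)[OF d(1)] decomp_def[of "vsum X1 X2" X1 X2] d(1) by auto
    have me: "m * \<epsilon> X2 a = 0" if "vsum X1 X2 \<noteq> {0}"
    proof (cases "X1 = {0}")
      case True
      then have "X2 \<noteq> {0}" using that by (simp add: vsum_zero)
      then show ?thesis using eps(3)[OF o(2) 5(4)] by simp
    next
      case False
      then show ?thesis using 5(3) by (simp add: kR_simps)
    qed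
    have s: "(vsum X1 X2, X3, m * \<epsilon> X2 a, x) \<in> sy P X" "(X1, vsum X2 X3, m, lact P X2 X3 a x) \<in> sy P X"
      using d d' 5 l me by (auto simp: sy_iff kR_simps split: if_splits)
    have W: "W P X r = W P X (symb1 (vsum X1 X2) X3 (m * \<epsilon> X2 a) x) - W P X (symb1 X1 (vsum X2 X3) m (lact P X2 X3 a x))"
      unfolding 5(1) kR_simps by (rule Wd[OF s])
    have "W P X r \<in> G.Pos (mdl A P) X"
    proof (cases "X1 = {0}")
      case False
      then have "vsum X1 X2 \<noteq> {0}" using z by blast
      with False have "W P X r = 0" unfolding W W_single[OF refl s(1)] W_single[OF refl s(2)] by simp
      then show ?thesis using G.Pos.zero by simp
    next
      case True
      have e: "vsum X1 X2 = X2" "vsum X2 X3 = X" "decomp X X2 X3" using True d(2) d' decomp_zeroD[of X "vsum X2 X3"]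
        by (simp_all add: vsum_zero)
      note ml = klinearD(3)[OF left_moduleD(3)[OF P e(3) 5(5)] 5(4), of m]
      have ma: "m \<odot>\<^bsub>val A X2\<^esub> a \<in> car A X2" by (rule kmodD(1)[OF vb_moduleD(1)[OF A_vb o(2)] 5(4)])
      \<comment> \<open>Over the zero space a is a scalar and the two sides agree by
        \<open>A_zero\<close>. Otherwise a has augmentation 0, and what remains is a product with an
        element of the ideal.\<close>
      show ?thesis
      proof (cases "X2 = {0}")
        case X2: True
        have X3: "X3 = X" using e(3) decomp_zeroD X2 by blast
        note A0 = kmodD[OF vb_moduleD(1)[OF A_vb vb_obj_zero]]
        have "m \<odot>\<^bsub>val A {0}\<^esub> a = (m * \<epsilon> {0} a) \<odot>\<^bsub>val A {0}\<^esub> mone A"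
          using A_zero[of a] A0(3)[OF vb_monoidD(2)[OF A_mon], of m "\<epsilon> {0} a"] 5(4) X2 by simp
        then have "(m * \<epsilon> {0} a) \<odot>\<^bsub>val P X\<^esub> x = m \<odot>\<^bsub>val P X\<^esub> lact P {0} X a x"
          using ml smult_eq[OF P X, of x "m * \<epsilon> {0} a"] 5(5) X2 X3 by simp
        then have "W P X r = 0" unfolding W W_single[OF refl s(1)] W_single[OF refl s(2)] using True X2 X3 e by simp
        then show ?thesis using G.Pos.zero by simp
      next
        case X2: False
        have up: "em (val A X2) (m \<odot>\<^bsub>val A X2\<^esub> a) \<in> upos A \<epsilon> (vcok (X3, X2, \<lambda>v\<in>X3. v))"
          using ma eps(3)[OF o(2) ma X2] by (simp add: upos_def vsimps)
        have "em (val P X) (lact P X2 X3 (m \<odot>\<^bsub>val A X2\<^esub> a) x) \<in> G.Pos (mdl A P) X"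
          using G.Pos_ac[OF mult_vhom[OF e(3)] up, of "em (val P X3) x" "mdl A P"] 5(5) ac_lact[OF P e(3) ma 5(5)]
          by (simp add: cr_mdl)
        then have "- em (val P X) (m \<odot>\<^bsub>val P X\<^esub> lact P X2 X3 a x) \<in> G.Pos (mdl A P) X"
          unfolding ml by (rule G.Pos_uminus[OF _ mdl_left[OF P]])
        then show ?thesis unfolding W W_single[OF refl s(1)] W_single[OF refl s(2)] using True X2 e by simp
      qed
    qed
    then show ?thesis using 5(1) s frg(2) fr_single by (simp add: kR_simps)
  qed
qed

text \<open>From left to right by \<open>W_rels\<close>, since the right side is a submodule.
  Conversely \<open>fr_reduce\<close> reduces to a single symbol, which is a relation by
  \<open>Pos_q1\<close>.\<close>

lemma rl_iff: "p \<in> rl P X \<longleftrightarrow> p \<in> fr P X \<and> W P X p \<in> G.Pos (mdl A P) X"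
proof
  let ?Q = "{p \<in> fr P X. W P X p \<in> G.Pos (mdl A P) X}"
  have "rl P X \<subseteq> ?Q"
  proof (rule kf(7))
    show "0 \<in> ?Q" using frg(1) Ws(1) G.Pos.zero by simp
    show "p + q \<in> ?Q" if "p \<in> ?Q" "q \<in> ?Q" for p q
      using that frg(4)[of p q] Ws(2)[of p q] G.Pos_add[of "W P X p" "mdl A P" X "W P X q"] by simp
    show "pscale c p \<in> ?Q" if p: "p \<in> ?Q" for c p
    proof -
      obtain x where x: "x \<in> car P X" "W P X p = em (val P X) x" "\<forall>c. em (val P X) (c \<odot>\<^bsub>val P X\<^esub> x) \<in> G.Pos (mdl A P) X"
        using Pos_q1[of "W P X p"] p by blast
      show ?thesis using W_scale[of p x c] x p kfree_closed(2)[of p "sy P X" c] by simp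
    qed
  qed (use W_rels in auto)
  then show "p \<in> rl P X \<Longrightarrow> p \<in> fr P X \<and> W P X p \<in> G.Pos (mdl A P) X" by blast
  assume p: "p \<in> fr P X \<and> W P X p \<in> G.Pos (mdl A P) X"
  obtain x where x: "x \<in> car P X" "W P X p = em (val P X) x" "p - q1 x \<in> rl P X" using fr_reduce p by blast
  obtain y where y: "y \<in> car P X" "W P X p = em (val P X) y" "q1 y \<in> rl P X" using Pos_q1 p by blast
  have "x = y" using x y em_inj[OF mP(8) x(1) y(1)] by simp
  then show "p \<in> rl P X" using kf(3)[OF x(3), of "q1 x"] y(3) by simp
qed

end

section \<open>Cosets of relations and the homology of the reduced complex\<close>

definition cs :: "('f, 'k, 'a, 'p) vblmod \<Rightarrow> 'f obj \<Rightarrow> (('f, 'k, 'p) symb \<Rightarrow>\<^sub>0 'k) \<Rightarrow> (('f, 'k, 'p) symb \<Rightarrow>\<^sub>0 'k) set" where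
  "cs P X p = {h + p |h. h \<in> rl P X}"

lemma tens_simps: "car (tensor_over A kR P) X = cs P X ` fr P X"
  "\<zero>\<^bsub>val (tensor_over A kR P) X\<^esub> = rl P X"
  "add (val (tensor_over A kR P) X) S T = {s + t |s t. s \<in> S \<and> t \<in> T}"
  by (auto simp: tensor_over_def kquot_def A_RCOSETS_def' a_r_coset_def' set_add_def' kfree_simps cs_def)

context
  fixes P :: "('f, 'k, 'a, 'p) vblmod" and X :: "'f obj"
  assumes P: "left_module A P" and X: "vb_obj X"
begin

lemmas rlD = kspan_facts(2,3,5,6)[OF kring_cring, where G = "bilin_rels kR P X \<union> balanced_rels A kR P X" and S = "sy P X", folded tensor_rels_def]

lemma cs_eq: "cs P X p = cs P X r \<longleftrightarrow> p - r \<in> rl P X"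
proof
  assume "cs P X p = cs P X r"
  moreover have "0 + p \<in> cs P X p" unfolding cs_def using rlD(1) by blast
  ultimately obtain h where "0 + p = h + r" "h \<in> rl P X" unfolding cs_def by blast
  then show "p - r \<in> rl P X" by (simp add: diff_eq_eq)
next
  assume d: "p - r \<in> rl P X"
  have "h + p \<in> cs P X r" if "h \<in> rl P X" for h
    unfolding cs_def using rlD(2)[OF that d] by (intro CollectI exI[of _ "h + (p - r)"]) simp
  moreover have "h + r \<in> cs P X p" if "h \<in> rl P X" for h
    unfolding cs_def using rlD(4)[OF that d] by (intro CollectI exI[of _ "h - (p - r)"]) simp
  ultimately show "cs P X p = cs P X r" by (auto simp: cs_def)
qed

lemma cs_add: "{s + t |s t. s \<in> cs P X p \<and> t \<in> cs P X r} = cs P X (p + r)"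
proof (rule Set.set_eqI, rule iffI)
  fix u assume "u \<in> {s + t |s t. s \<in> cs P X p \<and> t \<in> cs P X r}"
  then obtain h k where "u = (h + p) + (k + r)" "h \<in> rl P X" "k \<in> rl P X" unfolding cs_def by blast
  then show "u \<in> cs P X (p + r)"
    unfolding cs_def using rlD(2) by (intro CollectI exI[of _ "h + k"]) (simp add: algebra_simps)
next
  fix u assume "u \<in> cs P X (p + r)"
  then obtain h where "u = h + (p + r)" "h \<in> rl P X" unfolding cs_def by blast
  then have "u = (h + p) + (0 + r)" "h + p \<in> cs P X p" "0 + r \<in> cs P X r"
    using rlD(1) by (auto simp: cs_def add.assoc)
  then show "u \<in> {s + t |s t. s \<in> cs P X p \<and> t \<in> cs P X r}" by blast
qed

lemma cs_zero: "cs P X 0 = rl P X"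
  by (auto simp: cs_def)

lemma W_onto:
  assumes "u \<in> cr (mdl A P) X"
  shows "\<exists>p\<in>fr P X. W P X p = u"
  using W_q1[OF P X] assms unfolding cr_mdl by blast

lemma W_cr:
  assumes "p \<in> fr P X"
  shows "W P X p \<in> cr (mdl A P) X"
  by (rule W_in[OF P X assms]) (simp add: cr_mdl)

lemma W_diff: "p \<in> fr P X \<Longrightarrow> r \<in> fr P X \<Longrightarrow> p - r \<in> rl P X \<longleftrightarrow> W P X p - W P X r \<in> G.Pos (mdl A P) X"
  using rl_iff[OF P X, of "p - r"] Ws(4)[OF P X, of p r] sgrpD(2)[OF kfree_closed(1)] by metis

end

context
  fixes P :: "('f, 'k, 'a, 'p) vblmod" and Q :: "('f, 'k, 'a, 'q) vblmod" and d and X :: "'f obj"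
  assumes P: "left_module A P" and Q: "left_module A Q" and d: "left_hom A P Q d" and X: "vb_obj X"
begin

definition sg :: "('f, 'k, 'p) symb \<Rightarrow> ('f, 'k, 'q) symb" where "sg = (\<lambda>(X1, X2, m, n). (X1, X2, m, d X2 n))"

lemma kfree_map_lin: "kfree_map sg p = lin (\<lambda>s z. Poly_Mapping.single (sg s) z) (p :: ('f, 'k, 'p) symb \<Rightarrow>\<^sub>0 'k)"
  by (simp add: kfree_map_def lin_def)

lemma sg_sy: "s \<in> sy P X \<Longrightarrow> sg s \<in> sy Q X"
proof -
  assume s: "s \<in> sy P X"
  obtain X1 X2 m n where e: "s = (X1, X2, m, n)" by (cases s) auto
  have "d X2 n \<in> car Q X2"
    using s klinearD(1)[OF left_homD(1)[OF d]] decompD(2)[of X X1 X2] by (auto simp: e sy_iff)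
  then show ?thesis using s by (simp add: e sg_def sy_iff)
qed

lemma kfree_map_add: "additive_on (fr P X) (kfree_map sg)"
  unfolding kfree_map_lin[abs_def] by (rule lin_additive) (auto simp: sgrp_def additive_on_def single_add)

lemma kfree_map_in:
  assumes "p \<in> fr P X"
  shows "kfree_map sg p \<in> fr Q X"
  unfolding kfree_map_lin by (rule lin_in_sgrp[OF assms]) (auto intro: kfree_closed(1,3) sg_sy)

text \<open>Naturality of the evaluation, which carries the induced maps of tensor products to the
  abstract differentials.\<close>

lemma W_kfree_map:
  assumes p: "p \<in> fr P X"
  shows "W Q X (kfree_map sg p) = umap P Q d X (W P X p)"
proof (rule additive_dsum_eq[OF p])
  note h = umap_hom[OF P Q d]
  show "additive_on (fr P X) (\<lambda>p. W Q X (kfree_map sg p))"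
    by (rule additive_on_comp[OF kfree_map_add W_add[OF Q X]]) (rule kfree_map_in)
  show "additive_on (fr P X) (\<lambda>p. umap P Q d X (W P X p))"
    by (rule additive_on_comp[OF W_add[OF P X] G.mhomD(2)[OF h X]]) (rule W_cr[OF P X])
  fix s and z :: 'k assume s: "s \<in> sy P X"
  obtain X1 X2 m n where e: "s = (X1, X2, m, n)" by (cases s) auto
  have sg: "sg s = (X1, X2, m, d X2 n)" by (simp add: e sg_def)
  have n: "X1 = {0} \<Longrightarrow> n \<in> car P X \<and> X2 = X" using s decomp_zeroD[of X X2] by (auto simp: sy_iff e)
  have "kfree_map sg (Poly_Mapping.single s z) = Poly_Mapping.single (sg s) z"
    using lin_single[of "\<lambda>s z. Poly_Mapping.single (sg s) z" s z] by (simp add: kfree_map_lin)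
  then have l: "W Q X (kfree_map sg (Poly_Mapping.single s z)) =
      (if X1 = {0} then em (val Q X) ((z * m) \<odot>\<^bsub>val Q X\<^esub> d X2 n) else 0)"
    using W_single[OF Q X sg sg_sy[OF s], of z] by simp
  note r = W_single[OF P X e s, of z]
  show "W Q X (kfree_map sg (Poly_Mapping.single s z)) = umap P Q d X (W P X (Poly_Mapping.single s z))"
  proof (cases "X1 = {0}")
    case True
    note n = n[OF True, THEN conjunct1] n[OF True, THEN conjunct2]
    show ?thesis
      using klinearD(3)[OF left_homD(1)[OF d X] n(1), of "z * m"]
        umap_em[OF P X kmodD(1)[OF vb_moduleD(1)[OF left_moduleD(1)[OF P] X] n(1), of "z * m"], of Q d]
      unfolding l r by (simp add: True n(2))
  next
    case False
    then show ?thesis unfolding l r using G.mhom_simps(1)[OF h mdl_left[OF P] X] by simp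
  qed
qed (simp add: sgrp_def)

lemma tensor_map_cs:
  assumes p: "p \<in> fr P X"
  shows "tensor_map A kR Q d X (cs P X p) = cs Q X (kfree_map sg p)"
proof -
  note rlQ = rlD[OF Q X]
  have sub: "kfree_map sg h \<in> rl Q X" if h: "h \<in> rl P X" for h
  proof -
    have h': "h \<in> fr P X" "W P X h \<in> G.Pos (mdl A P) X" using rl_iff[OF P X] h by auto
    have "umap P Q d X (W P X h) \<in> G.Pos (mdl A Q) X"
      by (rule G.Pos_hom[OF h'(2) umap_hom[OF P Q d] mdl_left[OF P] X])
    then show ?thesis using rl_iff[OF Q X] kfree_map_in[OF h'(1)] W_kfree_map[OF h'(1)] by simp
  qed
  have e: "kfree_map sg (h + p) = kfree_map sg h + kfree_map sg p" if "h \<in> rl P X" for h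
    using kfree_map_add that p rl_iff[OF P X, of h] unfolding additive_on_def by blast
  have "tensor_map A kR Q d X (cs P X p) = {s + t |s t. s \<in> rl Q X \<and> t \<in> kfree_map sg ` cs P X p}"
    by (auto simp: tensor_map_def set_add_def' kfree_simps sg_def)
  also have "\<dots> = cs Q X (kfree_map sg p)"
  proof (rule Set.set_eqI, rule iffI)
    fix u assume "u \<in> {s + t |s t. s \<in> rl Q X \<and> t \<in> kfree_map sg ` cs P X p}"
    then obtain s h where s: "u = s + kfree_map sg (h + p)" "s \<in> rl Q X" "h \<in> rl P X" unfolding cs_def by blast
    then show "u \<in> cs Q X (kfree_map sg p)"
      unfolding cs_def using rlQ(2)[OF s(2) sub[OF s(3)]] e[OF s(3)]
      by (intro CollectI exI[of _ "s + kfree_map sg h"]) (simp add: add.assoc)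
  next
    fix u assume "u \<in> cs Q X (kfree_map sg p)"
    then obtain h where h: "u = h + kfree_map sg p" "h \<in> rl Q X" unfolding cs_def by blast
    have "0 + p \<in> cs P X p" unfolding cs_def using rlD(1)[OF P X] by blast
    then have "kfree_map sg p \<in> kfree_map sg ` cs P X p" by simp
    then show "u \<in> {s + t |s t. s \<in> rl Q X \<and> t \<in> kfree_map sg ` cs P X p}" using h by blast
  qed
  finally show ?thesis .
qed

end

text \<open>By \<open>rl_iff\<close> the cosets modulo relations are elements of P modulo the ideal.
  The homology record is a set of cosets of boundaries, and it is trivial exactly when every cycle
  is a boundary.\<close>

theorem kzero_TorV:
  assumes P: "\<And>n. left_module A (P n)" and d: "\<And>n. left_hom A (P (Suc n)) (P n) (d n)" and X: "vb_obj X"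
  shows "kzero (val (homology (\<lambda>n. tensor_over A kR (P n)) (\<lambda>n. tensor_map A kR (P n) (d n)) i) X) \<longleftrightarrow>
    G.TorV (\<lambda>n. mdl A (P n)) (udiff P d) i X"
proof -
  let ?C = "\<lambda>n. tensor_over A kR (P n)" and ?d = "\<lambda>n. tensor_map A kR (P n) (d n)"
  let ?Z = "cycles ?C ?d i X" and ?B = "?d i X ` car (?C (Suc i)) X"
  let ?s = "\<lambda>n. sg (d n)"
  note tm = tensor_map_cs[OF P P d X] and ki = kfree_map_in[OF P P d X] and Wk = W_kfree_map[OF P P d X]
  have zc: "p \<in> fr (P n) X \<Longrightarrow> cs (P n) X p = rl (P n) X \<longleftrightarrow> W (P n) X p \<in> G.Pos (mdl A (P n)) X" for n p
    using cs_eq[OF P X, of n p 0] rl_iff[OF P X, of p] cs_zero[OF P X, of n] by simp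
  have Z: "?Z = cs (P i) X ` {p \<in> fr (P i) X. udiff P d i X (W (P i) X p) \<in> G.Pos (mdl A (P (i - 1))) X}"
  proof (cases i)
    case 0
    then show ?thesis by (simp add: cycles_def tens_simps udiff_def G.Pos.zero)
  next
    case (Suc j)
    have "tensor_map A kR (P j) (d j) X (cs (P i) X p) = rl (P j) X \<longleftrightarrow> udiff P d i X (W (P i) X p) \<in> G.Pos (mdl A (P j)) X"
      if p: "p \<in> fr (P i) X" for p
      using tm[of p j] zc[OF ki[of p j]] Wk[of p j] p unfolding Suc by (simp add: udiff_def)
    then show ?thesis unfolding cycles_def Suc by (auto simp: tens_simps Suc)
  qed
  have B: "?B = cs (P i) X ` kfree_map (?s i) ` fr (P (Suc i)) X"
    unfolding tens_simps image_image using tm by (intro image_cong) auto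
  have Bin: "cs (P i) X p \<in> ?B \<longleftrightarrow>
      (\<exists>y\<in>cr (mdl A (P (Suc i))) X. W (P i) X p - udiff P d (Suc i) X y \<in> G.Pos (mdl A (P i)) X)"
    if p: "p \<in> fr (P i) X" for p
  proof -
    have "cs (P i) X p \<in> ?B \<longleftrightarrow> (\<exists>r\<in>fr (P (Suc i)) X. cs (P i) X p = cs (P i) X (kfree_map (?s i) r))"
      unfolding B by blast
    also have "\<dots> \<longleftrightarrow> (\<exists>r\<in>fr (P (Suc i)) X. W (P i) X p - udiff P d (Suc i) X (W (P (Suc i)) X r) \<in> G.Pos (mdl A (P i)) X)"
      using cs_eq[OF P X, of i p] W_diff[OF P X p ki] Wk by (auto simp: udiff_def)
    also have "\<dots> \<longleftrightarrow> (\<exists>y\<in>cr (mdl A (P (Suc i))) X. W (P i) X p - udiff P d (Suc i) X y \<in> G.Pos (mdl A (P i)) X)"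
      using W_onto[OF P X] W_cr[OF P X] by metis
    finally show ?thesis .
  qed
  let ?c = "\<lambda>S. {s + t |s t. s \<in> S \<and> t \<in> T}" and ?r = "\<lambda>z. (\<lambda>b. {s + t |s t. s \<in> b \<and> t \<in> z}) ` ?B"
  have q: "kzero (val (homology ?C ?d i) X) \<longleftrightarrow> ?r ` ?Z = {?B}"
    unfolding kzero_def homology_def kquot_def A_RCOSETS_def' a_r_coset_def'
    by (simp add: tens_simps UNION_singleton_eq_range)
  have zfr: "0 \<in> fr (P n) X" for n by (rule sgrpD(1)[OF kfree_closed(1)])
  have k0: "kfree_map (?s i) (0 :: ('f, 'k, _) symb \<Rightarrow>\<^sub>0 'k) = 0" by (simp add: kfree_map_def)
  have "cs (P i) X (kfree_map (?s i) 0) \<in> ?B" unfolding B by (intro imageI zfr)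
  then have rlB: "cs (P i) X 0 \<in> ?B" unfolding k0 .
  have z0: "cs (P i) X 0 \<in> ?Z"
  proof -
    have "udiff P d i X (W (P i) X 0) = 0"
      using Ws(1)[OF P X] G.mhom_simps(1)[OF umap_hom[OF P P d] mdl_left[OF P] X]
      by (simp add: udiff_def split: nat.split)
    then show ?thesis unfolding Z using zfr G.Pos.zero by (intro imageI) simp
  qed
  have "?r ` ?Z = {?B} \<longleftrightarrow> ?Z \<subseteq> ?B"
  proof
    assume a: "?r ` ?Z = {?B}"
    show "?Z \<subseteq> ?B"
    proof
      fix z assume z: "z \<in> ?Z"
      obtain p where p: "z = cs (P i) X p" using z unfolding Z by (rule imageE)
      have "{s + t |s t. s \<in> cs (P i) X 0 \<and> t \<in> z} \<in> ?r z" by (rule imageI[OF rlB])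
      moreover have "?r z \<in> {?B}" unfolding a[symmetric] using z by (rule imageI)
      then have "?r z = ?B" by (rule singletonD)
      ultimately have "{s + t |s t. s \<in> cs (P i) X 0 \<and> t \<in> z} \<in> ?B" by (rule back_subst)
      then show "z \<in> ?B" unfolding p cs_add[OF P X] add_0 .
    qed
  next
    assume a: "?Z \<subseteq> ?B"
    \<comment> \<open>Translation by a boundary permutes the boundaries.\<close>
    have rz: "?r z = ?B" if z: "z \<in> ?Z" for z
    proof -
      have "z \<in> ?B" using a z by (rule subsetD)
      then obtain r where r: "z = cs (P i) X (kfree_map (?s i) r)" "r \<in> fr (P (Suc i)) X"
        unfolding B image_image by (rule imageE)
      have "?r z = (\<lambda>x. cs (P i) X (kfree_map (?s i) (x + r))) ` fr (P (Suc i)) X"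
        unfolding B r(1) image_image cs_add[OF P X]
      proof (rule image_cong[OF refl])
        fix x assume "x \<in> fr (P (Suc i)) X"
        then show "cs (P i) X (kfree_map (?s i) x + kfree_map (?s i) r) = cs (P i) X (kfree_map (?s i) (x + r))"
          using kfree_map_add[OF P P d X, of i] r(2) unfolding additive_on_def by simp
      qed
      also have "\<dots> = ?B"
        unfolding B image_image
      proof (rule Set.set_eqI, rule iffI)
        fix u assume "u \<in> (\<lambda>x. cs (P i) X (kfree_map (?s i) (x + r))) ` fr (P (Suc i)) X"
        then obtain x where x: "u = cs (P i) X (kfree_map (?s i) (x + r))" "x \<in> fr (P (Suc i)) X" by (rule imageE)
        show "u \<in> (\<lambda>x. cs (P i) X (kfree_map (?s i) x)) ` fr (P (Suc i)) X"
          using x(1) by (rule image_eqI) (rule sgrpD(4)[OF kfree_closed(1) x(2) r(2)])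
      next
        fix u assume "u \<in> (\<lambda>x. cs (P i) X (kfree_map (?s i) x)) ` fr (P (Suc i)) X"
        then obtain x where x: "u = cs (P i) X (kfree_map (?s i) x)" "x \<in> fr (P (Suc i)) X" by (rule imageE)
        have "u = cs (P i) X (kfree_map (?s i) (x - r + r))" using x(1) by simp
        then show "u \<in> (\<lambda>x. cs (P i) X (kfree_map (?s i) (x + r))) ` fr (P (Suc i)) X"
          by (rule image_eqI) (rule sgrpD(2)[OF kfree_closed(1) x(2) r(2)])
      qed
      finally show ?thesis .
    qed
    have "?r ` ?Z = (\<lambda>z. ?B) ` ?Z" by (rule image_cong[OF refl]) (rule rz)
    also have "\<dots> = {?B}" using z0 by (rule image_constant)
    finally show "?r ` ?Z = {?B}" .
  qed
  also have "\<dots> \<longleftrightarrow> G.TorV (\<lambda>n. mdl A (P n)) (udiff P d) i X"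
  proof
    assume a: "?Z \<subseteq> ?B"
    show "G.TorV (\<lambda>n. mdl A (P n)) (udiff P d) i X"
      unfolding G.TorV_def
    proof (intro ballI impI)
      fix x assume x: "x \<in> cr (mdl A (P i)) X" "udiff P d i X x \<in> G.Pos (mdl A (P (i - 1))) X"
      from W_onto[OF P X x(1)] obtain p where p: "W (P i) X p = x" "p \<in> fr (P i) X" by (rule bexE)
      have "cs (P i) X p \<in> ?Z" unfolding Z by (rule imageI) (use p x(2) in simp)
      with a have "cs (P i) X p \<in> ?B" by (rule subsetD)
      then show "\<exists>y\<in>cr (mdl A (P (Suc i))) X. x - udiff P d (Suc i) X y \<in> G.Pos (mdl A (P i)) X"
        by (rule Bin[OF p(2), unfolded p(1), THEN iffD1])
    qed
  next
    assume t: "G.TorV (\<lambda>n. mdl A (P n)) (udiff P d) i X"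
    show "?Z \<subseteq> ?B"
    proof
      fix z assume "z \<in> ?Z"
      then obtain p where p: "z = cs (P i) X p"
        "p \<in> {p \<in> fr (P i) X. udiff P d i X (W (P i) X p) \<in> G.Pos (mdl A (P (i - 1))) X}"
        unfolding Z by (rule imageE)
      then have p': "p \<in> fr (P i) X" "udiff P d i X (W (P i) X p) \<in> G.Pos (mdl A (P (i - 1))) X" by blast+
      have "\<exists>y\<in>cr (mdl A (P (Suc i))) X. W (P i) X p - udiff P d (Suc i) X y \<in> G.Pos (mdl A (P i)) X"
        using t[unfolded G.TorV_def, THEN bspec, OF W_cr[OF P X p'(1)], THEN mp, OF p'(2)] .
      then show "z \<in> ?B" unfolding p(1) by (rule Bin[OF p'(1), THEN iffD2])
    qed
  qed
  finally show ?thesis unfolding q .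
qed

end

section \<open>Abstract modules turned back into records\<close>

context aug_monoid
begin

text \<open>The composition law with the product in A unfolded; the record axioms below are obtained
  from it by specialising the morphisms.\<close>

lemma ac_ac:
  assumes M: "G.md M" and t: "(Y, X1, f) \<in> vhom Y X" and u: "(X, Z1, g) \<in> vhom X Z"
    and a: "a \<in> car A X1" and b: "b \<in> car A Z1" and x: "x \<in> cr M Y"
  shows "ac M (X, Z1, g) (em (val A Z1) b) (ac M (Y, X1, f) (em (val A X1) a) x) =
    ac M (Y, vsum Z1 (g ` X1), compose Y g f)
      (em (val A (vsum Z1 (g ` X1))) (mmul A Z1 (g ` X1) b (act A X1 (g ` X1) (restrict g X1) a))) x"
proof -
  have pt: "(X1, Z1, restrict g X1) \<in> vhom X1 (vsum Z1 (g ` X1))"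
    using V.push[OF t u] by (simp add: vsimps)
  have im: "restrict g X1 ` X1 = g ` X1" by auto
  have "em (val A X1) a \<in> cr (mdl A (self A)) (vcok (Y, X1, f))" "em (val A Z1) b \<in> cr (mdl A (self A)) (vcok (X, Z1, g))"
    using a b by (simp_all add: cr_mdl vsimps)
  from G.mdD(6)[OF M t u this x]
  show ?thesis
    using ac_mdl[OF A_vb vb_module_left_via[THEN iffD2, OF A_vb] pt b, where x = a] a unfolding vsimps im by simp
qed

lemma mone_mult:
  assumes "vb_obj X" "a \<in> car A X"
  shows "mmul A {0} X (c \<odot>\<^bsub>val A {0}\<^esub> mone A) a = c \<odot>\<^bsub>val A X\<^esub> a"
    "mmul A X {0} a (c \<odot>\<^bsub>val A {0}\<^esub> mone A) = c \<odot>\<^bsub>val A X\<^esub> a"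
proof -
  note S = vb_monoidD(4)[OF A_mon]
  show "mmul A {0} X (c \<odot>\<^bsub>val A {0}\<^esub> mone A) a = c \<odot>\<^bsub>val A X\<^esub> a"
    using smult_eq[OF S assms(1), of a c] assms(2) by simp
  show "mmul A X {0} a (c \<odot>\<^bsub>val A {0}\<^esub> mone A) = c \<odot>\<^bsub>val A X\<^esub> a"
    using klinearD(3)[OF left_moduleD(2)[OF S decomp_zero(2)[OF assms(1)] assms(2)], of "mone A" c]
      vb_monoidD(2)[OF A_mon] vb_monoidD(3)[OF A_mon assms] by simp
qed

text \<open>Scalar multiplication, recovered from the action of multiples of the unit at the zero
  space.\<close>

definition sc :: "('f obj, 'f vmor, 'a uni, 'm) md \<Rightarrow> 'k \<Rightarrow> 'f obj \<Rightarrow> 'm \<Rightarrow> 'm" where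
  "sc M c X = ac M (X, {0}, \<lambda>v\<in>X. v) (em (val A {0}) (c \<odot>\<^bsub>val A {0}\<^esub> mone A))"

text \<open>Inverse to \<open>mdl\<close> up to isomorphism. The injection \<open>enc\<close> moves
  the elements into the type prescribed for the chosen resolutions.\<close>

definition record_of :: "('f obj, 'f vmor, 'a uni, 'm::ab_group_add) md \<Rightarrow> ('m \<Rightarrow> 'r) \<Rightarrow> ('f, 'k, 'a, 'r) vblmod" where
  "record_of M enc =
     \<lparr>val = \<lambda>X. \<lparr>carrier = enc ` cr M X, mult = undefined, one = undefined, zero = enc 0,
        add = \<lambda>r s. enc (inv_into (cr M X) enc r + inv_into (cr M X) enc s),
        smult = \<lambda>c r. enc (sc M c X (inv_into (cr M X) enc r))\<rparr>,
      act = \<lambda>X Y f r. enc (ac M (X, {0}, f) (uone A) (inv_into (cr M X) enc r)),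
      lact = \<lambda>X1 X2 a r. enc (ac M (X2, X1, \<lambda>v\<in>X2. v) (em (val A X1) a) (inv_into (cr M X2) enc r))\<rparr>"

context
  fixes M :: "('f obj, 'f vmor, 'a uni, 'm::ab_group_add) md" and enc :: "'m \<Rightarrow> 'r"
  assumes M: "G.md M" and inj: "\<And>X. vb_obj X \<Longrightarrow> inj_on enc (cr M X)"
begin

abbreviation "RR \<equiv> record_of M enc"

lemma rec_simps:
  assumes "vb_obj X" "p \<in> cr M X"
  shows "inv_into (cr M X) enc (enc p) = p"
    "q \<in> cr M X \<Longrightarrow> enc p \<oplus>\<^bsub>val RR X\<^esub> enc q = enc (p + q)"
    "c \<odot>\<^bsub>val RR X\<^esub> enc p = enc (sc M c X p)"
    "act RR X Y f (enc p) = enc (ac M (X, {0}, f) (uone A) p)"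
    "lact RR X1 X a (enc p) = enc (ac M (X, X1, \<lambda>v\<in>X. v) (em (val A X1) a) p)"
  using assms inj[OF assms(1)] by (simp_all add: record_of_def inv_into_f_f)

lemma rec_car: "car RR X = enc ` cr M X" and rec_zero: "\<zero>\<^bsub>val RR X\<^esub> = enc 0"
  by (simp_all add: record_of_def)

lemma ac_cr: "(Y, X1, f) \<in> vhom Y X \<Longrightarrow> a \<in> car A X1 \<Longrightarrow> p \<in> cr M Y \<Longrightarrow> ac M (Y, X1, f) (em (val A X1) a) p \<in> cr M X"
  by (rule G.mdD(2)[OF M]) (auto simp: cr_mdl vsimps)

lemma sc_in: "vb_obj X \<Longrightarrow> p \<in> cr M X \<Longrightarrow> sc M c X p \<in> cr M X"
  unfolding sc_def by (rule ac_cr[OF id_vhom sm_in])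

lemma restrict_zero:
  assumes "f \<in> vb_iso Y Z" "vb_obj Y"
  shows "f ` {0} = {0}" "restrict f {0} = (\<lambda>v\<in>{0}. v)"
proof -
  have f: "f 0 = 0" by (rule isoD(6)[OF assms])
  then show "f ` {0} = {0}" by simp
  show "restrict f {0} = (\<lambda>v\<in>{0}. v)" by (rule ext) (use f in simp)
qed

lemma compose_id: "f \<in> vb_iso Y Z \<Longrightarrow> compose Y (\<lambda>v\<in>Z. v) f = f" "f \<in> vb_iso Y Z \<Longrightarrow> compose Y f (\<lambda>v\<in>Y. v) = f"
  unfolding vb_iso_def by (auto simp: compose_def fun_eq_iff extensional_def bij_betw_def)

lemma sc_ac:
  assumes t: "(Y, X1, f) \<in> vhom Y X" and a: "a \<in> car A X1" and x: "x \<in> cr M Y"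
  shows "sc M c X (ac M (Y, X1, f) (em (val A X1) a) x) = ac M (Y, X1, f) (em (val A X1) (c \<odot>\<^bsub>val A X1\<^esub> a)) x"
    "ac M (Y, X1, f) (em (val A X1) a) (sc M c Y x) = ac M (Y, X1, f) (em (val A X1) (c \<odot>\<^bsub>val A X1\<^esub> a)) x"
proof -
  have h: "vb_obj Y" "f \<in> vb_iso Y (f ` Y)" "decomp X X1 (f ` Y)" using t by (simp_all add: vhom_iff)
  note d = decompD[OF h(3)]
  have r: "(\<lambda>v\<in>X. v) ` X1 = X1" "restrict (\<lambda>v\<in>X. v) X1 = (\<lambda>v\<in>X1. v)" using d(6) by (auto simp: fun_eq_iff)
  have c: "compose Y (\<lambda>v\<in>X. v) f = f"
    using d(7) h(2) unfolding vb_iso_def by (auto simp: compose_def fun_eq_iff extensional_def)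
  show "sc M c X (ac M (Y, X1, f) (em (val A X1) a) x) = ac M (Y, X1, f) (em (val A X1) (c \<odot>\<^bsub>val A X1\<^esub> a)) x"
    unfolding sc_def ac_ac[OF M t id_vhom[OF d(5)] a sm_in x] r c vsum_zero
    using mone_mult(1)[OF d(1) a] vb_moduleD(4)[OF A_vb d(1) a] by simp
  note f0 = restrict_zero[OF h(2,1)]
  show "ac M (Y, X1, f) (em (val A X1) a) (sc M c Y x) = ac M (Y, X1, f) (em (val A X1) (c \<odot>\<^bsub>val A X1\<^esub> a)) x"
    unfolding sc_def ac_ac[OF M id_vhom[OF h(1)] t sm_in a x] f0 compose_id(2)[OF h(2)] vsum_zero
    using mone_mult(2)[OF d(1) a] vb_moduleD(4)[OF A_vb vb_obj_zero sm_in] by simp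
qed

text \<open>Every morphism is an isomorphism onto its image followed by the inclusion of the image,
  and the unit coefficient of the first factor disappears from the product.\<close>

lemma ac_ac1:
  assumes t: "(Y, X1, f) \<in> vhom Y X" and a: "a \<in> car A X1" and x: "x \<in> cr M Y"
  shows "ac M (f ` Y, X1, \<lambda>v\<in>f ` Y. v) (em (val A X1) a) (ac M (Y, {0}, f) (uone A) x) = ac M (Y, X1, f) (em (val A X1) a) x"
proof -
  have h: "vb_obj Y" "f \<in> vb_iso Y (f ` Y)" "decomp X X1 (f ` Y)" using t by (simp_all add: vhom_iff)
  note d = decompD[OF h(3)]
  have "(\<lambda>v\<in>f ` Y. v) \<in> vb_iso (f ` Y) (f ` Y)" by (rule iso_id[OF d(2)])
  note r = restrict_zero[OF this d(2)]
  show ?thesis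
    unfolding ac_ac[OF M iso_vhom[OF h(2,1) d(2)] mult_vhom[OF h(3)] vb_monoidD(2)[OF A_mon] a x] r compose_id(1)[OF h(2)] vsum_zero
    using vb_monoidD(3)[OF A_mon d(1) a] vb_moduleD(4)[OF A_vb vb_obj_zero vb_monoidD(2)[OF A_mon]] by simp
qed

lemma rec_klinear:
  assumes t: "(Y, X1, f) \<in> vhom Y X" and a: "a \<in> car A X1"
  shows "klinear (val RR Y) (val RR X) (\<lambda>r. enc (ac M (Y, X1, f) (em (val A X1) a) (inv_into (cr M Y) enc r)))"
proof -
  note o = V.hom_ob(1,2)[OF t]
  have a': "em (val A X1) a \<in> cr (mdl A (self A)) (vcok (Y, X1, f))" using a by (simp add: cr_mdl vsimps)
  note add = G.md_ac_simps(2)[OF M t a']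
  show ?thesis
    unfolding klinear_def rec_car
    using ac_cr[OF t a] add sc_ac[OF t a] sc_in o G.md_sgrp(4)[OF M o(1)]
    by (auto simp: rec_simps)
qed

lemma rec_klinear':
  assumes t: "(Y, X1, f) \<in> vhom Y X" and p: "p \<in> cr M Y"
  shows "klinear (val A X1) (val RR X) (\<lambda>a. enc (ac M (Y, X1, f) (em (val A X1) a) p))"
proof -
  note o = V.hom_ob(2)[OF t]
  have X1: "vb_obj X1" using V.hom_ob(3)[OF t] by (simp add: vsimps)
  have add: "additive_on (em (val A X1) ` car A X1) (\<lambda>a. ac M (Y, X1, f) a p)"
    using G.mdD(4)[OF M t p] by (simp add: cr_mdl vsimps)
  show ?thesis
    unfolding klinear_def rec_car
    using ac_cr[OF t _ p] add sc_ac(1)[OF t _ p] o em_add[OF vb_ag[OF A_vb X1]]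
    unfolding additive_on_def by (auto simp: rec_simps)
qed

lemma rec_module:
  assumes X: "vb_obj X"
  shows "Module.module kring (val RR X)"
proof (rule moduleI)
  show "cring (kring :: 'k ring)" by (rule module.axioms(1)[OF vb_moduleD(1)[OF A_vb vb_obj_zero]])
  note g = G.md_sgrp[OF M X] and s = rec_simps[OF X]
  show "abelian_group (val RR X)"
  proof (rule abelian_groupI, unfold rec_car)
    fix x assume "x \<in> enc ` cr M X"
    then obtain p where p: "x = enc p" "p \<in> cr M X" by blast
    show "\<exists>y\<in>enc ` cr M X. y \<oplus>\<^bsub>val RR X\<^esub> x = \<zero>\<^bsub>val RR X\<^esub>"
      using g(3)[OF p(2)] s(2)[of "- p" p] p by (intro bexI[of _ "enc (- p)"]) (simp_all add: rec_zero)
  qed (auto simp: s g rec_zero add_ac)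
  note t = id_vhom[OF X] and o = vb_monoidD(2)[OF A_mon]
  have dist: "sc M c X (p + q) = sc M c X p + sc M c X q" if "p \<in> cr M X" "q \<in> cr M X" for c p q
    unfolding sc_def by (rule G.md_ac_simps(2)[OF M t _ that]) (use sm_in in \<open>simp add: cr_mdl vsimps\<close>)
  have m0: "Module.module kring (val A {0})" by (rule vb_moduleD(1)[OF A_vb vb_obj_zero])
  have dist': "sc M (a + b) X p = sc M a X p + sc M b X p" if p: "p \<in> cr M X" for a b p
  proof -
    have "(a + b) \<odot>\<^bsub>val A {0}\<^esub> mone A = a \<odot>\<^bsub>val A {0}\<^esub> mone A \<oplus>\<^bsub>val A {0}\<^esub> b \<odot>\<^bsub>val A {0}\<^esub> mone A"
      using module.smult_l_distr[OF m0, of a b "mone A"] o by (simp add: kring_def)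
    moreover have "additive_on (em (val A {0}) ` car A {0}) (\<lambda>a. ac M (X, {0}, \<lambda>v\<in>X. v) a p)"
      using G.mdD(4)[OF M t p] by (simp add: cr_mdl vsimps)
    ultimately show ?thesis
      unfolding sc_def additive_on_def using sm_in em_add[OF vb_ag[OF A_vb vb_obj_zero] sm_in sm_in] by simp
  qed
  have assoc: "sc M (a * b) X p = sc M a X (sc M b X p)" if p: "p \<in> cr M X" for a b p
  proof -
    have "(a * b) \<odot>\<^bsub>val A {0}\<^esub> mone A = a \<odot>\<^bsub>val A {0}\<^esub> (b \<odot>\<^bsub>val A {0}\<^esub> mone A)"
      using module.smult_assoc1[OF m0, of a b "mone A"] o by (simp add: kring_def)
    then show ?thesis using sc_ac(1)[OF t sm_in p, of a b] by (simp add: sc_def)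
  qed
  have one: "sc M 1 X p = p" if p: "p \<in> cr M X" for p
  proof -
    have "1 \<odot>\<^bsub>val A {0}\<^esub> mone A = mone A" using module.smult_one[OF m0 o] by (simp add: kring_def)
    then show ?thesis using G.mdD(5)[OF M X p] by (simp add: sc_def vid_def)
  qed
  show "c \<odot>\<^bsub>val RR X\<^esub> x \<in> car RR X" if "x \<in> car RR X" for c x
    using that by (auto simp: rec_car s sc_in[OF X])
  show "(a \<oplus>\<^bsub>kring\<^esub> b) \<odot>\<^bsub>val RR X\<^esub> x = a \<odot>\<^bsub>val RR X\<^esub> x \<oplus>\<^bsub>val RR X\<^esub> b \<odot>\<^bsub>val RR X\<^esub> x" if "x \<in> car RR X" for a b x
    using that by (auto simp: rec_car s sc_in[OF X] dist' kring_def)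
  show "c \<odot>\<^bsub>val RR X\<^esub> (x \<oplus>\<^bsub>val RR X\<^esub> y) = c \<odot>\<^bsub>val RR X\<^esub> x \<oplus>\<^bsub>val RR X\<^esub> c \<odot>\<^bsub>val RR X\<^esub> y"
    if "x \<in> car RR X" "y \<in> car RR X" for c x y
    using that by (auto simp: rec_car s sc_in[OF X] dist g)
  show "(a \<otimes>\<^bsub>kring\<^esub> b) \<odot>\<^bsub>val RR X\<^esub> x = a \<odot>\<^bsub>val RR X\<^esub> (b \<odot>\<^bsub>val RR X\<^esub> x)" if "x \<in> car RR X" for a b x
    using that by (auto simp: rec_car s sc_in[OF X] assoc kring_def)
  show "\<one>\<^bsub>kring\<^esub> \<odot>\<^bsub>val RR X\<^esub> x = x" if "x \<in> car RR X" for x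
    using that by (auto simp: rec_car s one kring_def)
qed

lemma rec_left: "left_module A RR"
proof -
  note o = vb_monoidD(2)[OF A_mon]
  have k1: "klinear (val RR X) (val RR Y) (act RR X Y f)" if "vb_obj X" "vb_obj Y" "f \<in> vb_iso X Y" for X Y f
    using rec_klinear[OF iso_vhom[OF that(3,1,2)] o] by (simp add: record_of_def)
  have k2: "klinear (val RR X2) (val RR X) (lact RR X1 X2 a)" if "decomp X X1 X2" "a \<in> car A X1" for X X1 X2 a
    using rec_klinear[OF mult_vhom[OF that(1)] that(2)] by (simp add: record_of_def)
  have k3: "klinear (val A X1) (val RR X) (\<lambda>a. lact RR X1 X2 a x)" if d: "decomp X X1 X2" and x: "x \<in> car RR X2" for X X1 X2 x
  proof -
    obtain p where p: "x = enc p" "p \<in> cr M X2" using x by (auto simp: rec_car)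
    show ?thesis using rec_klinear'[OF mult_vhom[OF d] p(2)] rec_simps(5)[OF decompD(2)[OF d] p(2)] p(1) by simp
  qed
  have id: "act RR X X (\<lambda>v\<in>X. v) x = x" if X: "vb_obj X" and x: "x \<in> car RR X" for X x
    using x G.mdD(5)[OF M X] by (auto simp: rec_car rec_simps[OF X] vid_def)
  have comp: "act RR X Z (compose X g f) x = act RR Y Z g (act RR X Y f x)"
    if ob: "vb_obj X" "vb_obj Y" "vb_obj Z" and f: "f \<in> vb_iso X Y" and g: "g \<in> vb_iso Y Z" and x: "x \<in> car RR X" for X Y Z f g x
  proof -
    obtain p where p: "x = enc p" "p \<in> cr M X" using x by (auto simp: rec_car)
    note t = iso_vhom[OF f ob(1,2)] and u = iso_vhom[OF g ob(2,3)]
    note g0 = restrict_zero[OF g ob(2)]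
    have "ac M (Y, {0}, g) (uone A) (ac M (X, {0}, f) (uone A) p) = ac M (X, {0}, compose X g f) (uone A) p"
      unfolding ac_ac[OF M t u o o p(2)] g0 vsum_zero
      using vb_monoidD(3)[OF A_mon vb_obj_zero o] vb_moduleD(4)[OF A_vb vb_obj_zero o] by simp
    then show ?thesis using rec_simps[OF ob(1) p(2)] rec_simps[OF ob(2) ac_cr[OF t o p(2)]] p(1) by simp
  qed
  have nat: "act RR X Y f (lact RR X1 X2 a x) = lact RR (f ` X1) (f ` X2) (act A X1 (f ` X1) (restrict f X1) a)
      (act RR X2 (f ` X2) (restrict f X2) x)"
    if d: "decomp X X1 X2" and Y: "vb_obj Y" and f: "f \<in> vb_iso X Y" and a: "a \<in> car A X1" and x: "x \<in> car RR X2" for X X1 X2 Y f a x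
  proof -
    obtain p where p: "x = enc p" "p \<in> cr M X2" using x by (auto simp: rec_car)
    note D = decompD[OF d]
    have fY: "f ` X = Y" by (rule isoD(2)[OF f D(5)])
    have d': "decomp Y (f ` X1) (f ` X2)" by (rule iso_decomp[OF f d])
    note D' = decompD[OF d']
    have f1: "restrict f X1 \<in> vb_iso X1 (f ` X1)" and f2: "restrict f X2 \<in> vb_iso X2 (f ` X2)"
      by (rule iso_restrict[OF f D(5) D(1,6)], rule iso_restrict[OF f D(5) D(2,7)])
    note a' = act_in[OF A_vb f1 D(1) D'(1) a]
    note t = mult_vhom[OF d] and u = iso_vhom[OF f D(5) Y]
    note t' = iso_vhom[OF f2 D(2) D'(2)] and u' = mult_vhom[OF d']
    have c: "compose X2 f (\<lambda>v\<in>X2. v) = restrict f X2" by (auto simp: compose_def fun_eq_iff)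
    have l: "ac M (X, {0}, f) (uone A) (ac M (X2, X1, \<lambda>v\<in>X2. v) (em (val A X1) a) p) =
        ac M (X2, f ` X1, restrict f X2) (em (val A (f ` X1)) (act A X1 (f ` X1) (restrict f X1) a)) p"
      unfolding ac_ac[OF M t u a o p(2)] c vsum_zero using vb_monoidD(6)[OF A_mon D'(1) a'] by simp
    have t2: "(X2, f ` X1, restrict f X2) \<in> vhom X2 Y" using f2 d' D(2) by (simp add: vhom_iff)
    have im: "restrict f X2 ` X2 = f ` X2" by auto
    note r = ac_ac1[OF t2 a' p(2), unfolded im]
    show ?thesis
      using rec_simps[OF D(2) p(2)] rec_simps[OF D(5) ac_cr[OF t a p(2)]] rec_simps[OF D'(2) ac_cr[OF t' o p(2)]] p(1) l r by simp
  qed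
  have unit: "lact RR {0} X (mone A) x = x" if X: "vb_obj X" and x: "x \<in> car RR X" for X x
    using x G.mdD(5)[OF M X] by (auto simp: rec_car rec_simps[OF X] vid_def)
  have assoc: "lact RR (vsum X1 X2) X3 (mmul A X1 X2 a b) x = lact RR X1 (vsum X2 X3) a (lact RR X2 X3 b x)"
    if d: "decomp3 X X1 X2 X3" and a: "a \<in> car A X1" and b: "b \<in> car A X2" and x: "x \<in> car RR X3" for X X1 X2 X3 a b x
  proof -
    obtain p where p: "x = enc p" "p \<in> cr M X3" using x by (auto simp: rec_car)
    have d1: "decomp X X1 (vsum X2 X3)" and d2: "decomp (vsum X2 X3) X2 X3" using d by (simp_all add: decomp3_iff)
    note D1 = decompD[OF d1] and D2 = decompD[OF d2]
    note t = mult_vhom[OF d2] and u = mult_vhom[OF d1]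
    have c: "(\<lambda>v\<in>vsum X2 X3. v) ` X2 = X2" "restrict (\<lambda>v\<in>vsum X2 X3. v) X2 = (\<lambda>v\<in>X2. v)"
      "compose X3 (\<lambda>v\<in>vsum X2 X3. v) (\<lambda>v\<in>X3. v) = (\<lambda>v\<in>X3. v)" using D2(6,7) by (auto simp: fun_eq_iff compose_def)
    have "ac M (vsum X2 X3, X1, \<lambda>v\<in>vsum X2 X3. v) (em (val A X1) a) (ac M (X3, X2, \<lambda>v\<in>X3. v) (em (val A X2) b) p) =
        ac M (X3, vsum X1 X2, \<lambda>v\<in>X3. v) (em (val A (vsum X1 X2)) (mmul A X1 X2 a b)) p"
      unfolding ac_ac[OF M t u b a p(2)] c using vb_moduleD(4)[OF A_vb D2(1) b] by simp
    then show ?thesis using rec_simps[OF D2(2) p(2)] rec_simps[OF D2(5) ac_cr[OF t b p(2)]] p(1) by simp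
  qed
  have vb: "vb_module RR" unfolding vb_module_def using rec_module k1 id comp by blast
  have pr: "vb_pairing A RR RR (lact RR)" unfolding vb_pairing_def kbilinear_def using k2 k3 nat by blast
  show ?thesis unfolding left_module_def using vb pr unit assoc by blast
qed

definition kap :: "'f obj \<Rightarrow> 'm \<Rightarrow> 'r uni" where "kap X p = em (val RR X) (enc p)"

lemma kap_hom: "G.mhom M (mdl A RR) kap" and kap_bij: "vb_obj X \<Longrightarrow> bij_betw (kap X) (cr M X) (cr (mdl A RR) X)"
proof -
  note ag = vb_ag[OF left_moduleD(1)[OF rec_left]]
  show "bij_betw (kap X) (cr M X) (cr (mdl A RR) X)" if X: "vb_obj X" for X
    unfolding bij_betw_def
  proof
    show "inj_on (kap X) (cr M X)"
      using em_inj[OF ag[OF X]] inj[OF X] by (auto simp: inj_on_def kap_def rec_car)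
    show "kap X ` cr M X = cr (mdl A RR) X" by (simp add: cr_mdl rec_car kap_def image_image)
  qed
  show "G.mhom M (mdl A RR) kap"
    unfolding G.phom_def
  proof (intro conjI allI impI ballI)
    fix X :: "'f obj" assume X: "vb_obj X"
    show "kap X p \<in> cr (mdl A RR) X" if "p \<in> cr M X" for p using that by (simp add: kap_def cr_mdl rec_car)
    show "additive_on (cr M X) (kap X)"
      unfolding additive_on_def kap_def
      using em_add[OF ag[OF X]] rec_simps(2)[OF X] by (metis imageI rec_car)
  next
    fix Y X t a p assume t: "t \<in> vhom Y X" and a: "a \<in> cr (mdl A (self A)) (vcok t)" and p: "p \<in> cr M Y"
    obtain X1 f b where T: "t = (Y, X1, f)" "vb_obj Y" "f \<in> vb_iso Y (f ` Y)" "decomp X X1 (f ` Y)"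
      "a = em (val A X1) b" "b \<in> car A X1" "vb_obj (f ` Y)" "vb_obj X1" "vb_obj X" using t a by (rule vhomE')
    note t' = t[unfolded T(1)]
    have e: "enc p \<in> car RR Y" using p by (simp add: rec_car)
    note fp = ac_cr[OF iso_vhom[OF T(3,2,7)] vb_monoidD(2)[OF A_mon] p]
    show "kap X (ac M t a p) = ac (mdl A RR) t a (kap Y p)"
      unfolding kap_def T(1,5) ac_mdl[OF A_vb left_moduleD(1)[OF rec_left] t' T(6) e]
      using ac_ac1[OF t' T(6) p] rec_simps(4)[OF T(2) p] rec_simps(5)[OF T(7) fp] by simp
  qed
qed

end

lemma inv_mhom:
  assumes M: "G.md M" and h: "G.mhom M N h" and b: "\<And>X. vb_obj X \<Longrightarrow> bij_betw (h X) (cr M X) (cr N X)"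
  shows "G.mhom N M (\<lambda>X. inv_into (cr M X) (h X))"
proof -
  let ?i = "\<lambda>X. inv_into (cr M X) (h X)"
  have i: "y \<in> cr N X \<Longrightarrow> ?i X y \<in> cr M X \<and> h X (?i X y) = y" "x \<in> cr M X \<Longrightarrow> ?i X (h X x) = x" if X: "vb_obj X" for X x y
    using b[OF X] by (auto simp: bij_betw_def inv_into_into f_inv_into_f inv_into_f_f)
  show ?thesis
    unfolding G.phom_def additive_on_def
  proof (intro conjI allI impI ballI)
    fix X :: "'f obj" assume X: "vb_obj X"
    show "?i X y \<in> cr M X" if "y \<in> cr N X" for y using i(1)[OF X that] by blast
    fix y z assume yz: "y \<in> cr N X" "z \<in> cr N X"
    show "?i X (y + z) = ?i X y + ?i X z"
      using i(2)[OF X, of "?i X y + ?i X z"] i(1)[OF X yz(1)] i(1)[OF X yz(2)] G.md_sgrp(4)[OF M X] G.mhom_simps(2)[OF h M X] by metis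
  next
    fix Y X t a y assume t: "t \<in> vhom Y X" and a: "a \<in> cr (mdl A (self A)) (vcok t)" and y: "y \<in> cr N Y"
    note o = V.hom_ob(1,2)[OF t]
    show "?i X (ac N t a y) = ac M t a (?i Y y)"
      using i(2)[OF o(2), of "ac M t a (?i Y y)"] i(1)[OF o(1) y] G.mdD(2)[OF M t a] G.mhomD(3)[OF h t a] by metis
  qed
qed

text \<open>The encoded generators form a basis: the evaluation map from the free module on them is
  inverted by decoding and renaming the generators.\<close>

lemma free_record:
  fixes E :: "'s set" and ob :: "'s \<Rightarrow> 'f obj" and enc :: "_ \<Rightarrow> 'r"
  assumes E: "\<And>s. s \<in> E \<Longrightarrow> vb_obj (ob s)"
  defines "M \<equiv> V.ind E ob (mdl A (self A))"
  assumes inj: "\<And>X. vb_obj X \<Longrightarrow> inj_on enc (cr M X)"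
  shows "free_left_module A (record_of M enc)"
proof -
  let ?R = "record_of M enc" and ?S = "mdl A (self A)"
  have M: "G.md M" unfolding M_def by (rule G.ind_md[OF G.A_md])
  let ?k = "kap M enc"
  have L: "left_module A ?R" by (rule rec_left[OF M]) (rule inj)
  have K: "G.mhom M (mdl A ?R) ?k" by (rule kap_hom[OF M]) (rule inj)
  have Kb: "bij_betw (?k X) (cr M X) (cr (mdl A ?R) X)" if X: "vb_obj X" for X by (rule kap_bij[OF M _ X]) (rule inj)
  have Ki: "G.mhom (mdl A ?R) M (\<lambda>X. inv_into (cr M X) (?k X))" by (rule inv_mhom[OF M K Kb])
  note Lm = mdl_left[OF L]
  let ?g = "G.gen ob :: 's \<Rightarrow> _"
  \<comment> \<open>\<open>e\<close> need not be injective: if the unit is 0, all generators over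
    one object coincide. Mutually inverse module maps are used in place of a bijection of index
    sets.\<close>
  define e where "e s = (ob s, enc (?g s))" for s
  define E' where "E' = e ` E"
  let ?n = "\<lambda>(Y, y). em (val ?R Y) y" and ?J = "V.ind E' fst ?S" and ?g' = "G.gen fst :: ('f obj \<times> 'r) \<Rightarrow> _"
  have gen: "?g s \<in> cr M (ob s)" if "s \<in> E" for s unfolding M_def by (rule G.gen_in[where ob = ob and e = s and E = E, OF that E[OF that]])
  have E': "vb_obj Y \<and> y \<in> car ?R Y" if "(Y, y) \<in> E'" for Y y
    using that E gen by (auto simp: E'_def e_def rec_car[OF M inj])
  have nk: "?n (e s) = ?k (ob s) (?g s)" for s by (simp add: e_def kap_def[OF M inj])
  have J: "G.md ?J" by (rule G.ind_md[OF G.A_md])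
  have n_in: "?n x \<in> cr (mdl A ?R) (fst x)" if "x \<in> E'" for x
    using that E' by (cases x) (auto simp: cr_mdl)
  have h1: "G.mhom ?J (mdl A ?R) (\<lambda>X. G.ev (mdl A ?R) ?n)" by (rule G.ev_mhom[OF Lm n_in])
  have g'_in: "?g' (e s) \<in> cr ?J (ob s)" if "s \<in> E" for s
    using G.gen_in[of "e s" E' fst] that E[OF that] by (simp add: E'_def e_def)
  have h2: "G.mhom M ?J (\<lambda>X. G.ev ?J (\<lambda>s. ?g' (e s)))" unfolding M_def by (rule G.ev_mhom[OF J g'_in])
  have 12: "G.ev (mdl A ?R) ?n (G.ev ?J (\<lambda>s. ?g' (e s)) p) = ?k X p" if X: "vb_obj X" and p: "p \<in> cr M X" for X p
  proof (rule G.mhom_ind_eqI[where M = ?S and E = E and ob = ob, folded M_def, OF G.A_md G.mhom_comp[OF h2 h1] K X p])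
    fix s t x assume st: "(s, t) \<in> V.terms E ob X" and x: "x \<in> cr ?S (vcok t)"
    note s = G.termsD(1)[OF st] and t = G.termsD(2)[OF st]
    have es: "e s \<in> E'" using s by (simp add: E'_def)
    have "G.ev ?J (\<lambda>s. ?g' (e s)) (Poly_Mapping.single (s, t) x) = ac ?J t x (?g' (e s))"
      by (rule G.ev_single[where n = "\<lambda>s. ?g' (e s)" and e = s, OF J t g'_in[OF s]])
    also have "G.ev (mdl A ?R) ?n \<dots> = ac (mdl A ?R) t x (G.ev (mdl A ?R) ?n (?g' (e s)))"
      by (rule G.mhomD(3)[OF h1 t x g'_in[OF s]])
    also have "G.ev (mdl A ?R) ?n (?g' (e s)) = ?n (e s)"
      by (rule G.ev_gen[OF Lm]) (use n_in[OF es] E[OF s] in \<open>simp_all add: e_def\<close>)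
    also have "ac (mdl A ?R) t x (?n (e s)) = ?k X (ac M t x (?g s))"
      unfolding nk by (rule G.mhomD(3)[OF K t x gen[OF s], symmetric])
    also have "ac M t x (?g s) = Poly_Mapping.single (s, t) x" unfolding M_def by (rule G.ac_gen[where ob = ob and e = s, OF t x])
    finally show "G.ev (mdl A ?R) ?n (G.ev ?J (\<lambda>s. ?g' (e s)) (Poly_Mapping.single (s, t) x)) = ?k X (Poly_Mapping.single (s, t) x)" .
  qed
  have 21: "G.ev ?J (\<lambda>s. ?g' (e s)) (inv_into (cr M X) (?k X) (G.ev (mdl A ?R) ?n p)) = p" if X: "vb_obj X" and p: "p \<in> cr ?J X" for X p
  proof (rule G.mhom_ind_eqI[OF G.A_md G.mhom_comp[OF G.mhom_comp[OF h1 Ki] h2] G.mhom_id X p])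
    fix x t a assume xt: "(x, t) \<in> V.terms E' fst X" and a: "a \<in> cr ?S (vcok t)"
    note x = G.termsD(1)[OF xt] and t = G.termsD(2)[OF xt]
    obtain s where s: "x = e s" "s \<in> E" using x by (auto simp: E'_def)
    have fx: "fst x = ob s" by (simp add: s(1) e_def)
    have "G.ev (mdl A ?R) ?n (Poly_Mapping.single (x, t) a) = ac (mdl A ?R) t a (?n x)"
      by (rule G.ev_single[where n = ?n and e = x, OF Lm t n_in[OF x]])
    also have "\<dots> = ?k X (ac M t a (?g s))"
      unfolding s(1) nk by (rule G.mhomD(3)[OF K t[unfolded fx] a gen[OF s(2)], symmetric])
    also have "ac M t a (?g s) = Poly_Mapping.single (s, t) a" unfolding M_def by (rule G.ac_gen[where ob = ob and e = s, OF t[unfolded fx] a])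
    finally have "inv_into (cr M X) (?k X) (G.ev (mdl A ?R) ?n (Poly_Mapping.single (x, t) a)) = Poly_Mapping.single (s, t) a"
      using Kb[OF X] G.single_ind[OF G.A_md, of s t E ob X a] s(2) t a fx
      by (simp add: bij_betw_def inv_into_f_f M_def V.terms_def)
    moreover have "G.ev ?J (\<lambda>s. ?g' (e s)) (Poly_Mapping.single (s, t) a) = ac ?J t a (?g' x)"
      unfolding s(1) by (rule G.ev_single[where n = "\<lambda>s. ?g' (e s)" and e = s, OF J t[unfolded fx] g'_in[OF s(2)]])
    ultimately show "G.ev ?J (\<lambda>s. ?g' (e s)) (inv_into (cr M X) (?k X) (G.ev (mdl A ?R) ?n (Poly_Mapping.single (x, t) a))) =
        Poly_Mapping.single (x, t) a" using G.ac_gen[where ob = fst and e = x, OF t a] by simp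
  qed
  have bij: "bij_betw (G.ev (mdl A ?R) ?n) (cr ?J X) (cr (mdl A ?R) X)" if X: "vb_obj X" for X
  proof (rule bij_betwI[where g = "\<lambda>y. G.ev ?J (\<lambda>s. ?g' (e s)) (inv_into (cr M X) (?k X) y)"])
    show "G.ev (mdl A ?R) ?n \<in> cr ?J X \<rightarrow> cr (mdl A ?R) X" using G.mhomD(1)[OF h1 X] by blast
    show "(\<lambda>y. G.ev ?J (\<lambda>s. ?g' (e s)) (inv_into (cr M X) (?k X) y)) \<in> cr (mdl A ?R) X \<rightarrow> cr ?J X"
      using G.mhomD(1)[OF h2 X] G.mhomD(1)[OF Ki X] by blast
    show "G.ev ?J (\<lambda>s. ?g' (e s)) (inv_into (cr M X) (?k X) (G.ev (mdl A ?R) ?n p)) = p" if "p \<in> cr ?J X" for p by (rule 21[OF X that])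
    show "G.ev (mdl A ?R) ?n (G.ev ?J (\<lambda>s. ?g' (e s)) (inv_into (cr M X) (?k X) y)) = y" if y: "y \<in> cr (mdl A ?R) X" for y
      using 12[OF X G.mhomD(1)[OF Ki X y]] Kb[OF X] y by (simp add: bij_betw_def f_inv_into_f)
  qed
  have "\<forall>(Y, y)\<in>E'. vb_obj Y \<and> y \<in> car ?R Y" using E' by blast
  moreover have "\<forall>X. vb_obj X \<longrightarrow> bij_betw (basis_comb A ?R E' X) (coeff_families A E' X) (car ?R X)"
    using basis_bij[OF L E'] bij by blast
  ultimately show ?thesis unfolding free_left_module_def using L by blast
qed


section \<open>Free resolutions with elements in the prescribed type\<close>

definition sob :: "('f, 'a, 'n) syz \<Rightarrow> 'f obj" where
  "sob s = (case s of Elt Y y \<Rightarrow> Y | Syz Y l \<Rightarrow> Y)"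

definition sd0 :: "('f, 'k, 'a, 'n) vblmod \<Rightarrow> ('f, 'a, 'n) syz \<Rightarrow> 'n uni" where
  "sd0 N s = (case s of Elt Y y \<Rightarrow> em (val N Y) y | Syz Y l \<Rightarrow> 0)"

definition sd1 :: "('f, 'a, 'n) syz \<Rightarrow> (('f, 'a, 'n) syz \<times> 'f vmor) \<Rightarrow>\<^sub>0 'a uni" where
  "sd1 s = (case s of Elt Y y \<Rightarrow> 0
     | Syz Y l \<Rightarrow> sum_list (map (\<lambda>(s, X1, f, a). Poly_Mapping.single (s, (sob s, X1, f)) (em (val A X1) a)) l))"

text \<open>The coefficients of an element as a plain family. The source of a morphism is left out
  of the index, since it is the object of the generator.\<close>

definition renc :: "((('f, 'a, 'n) syz \<times> 'f vmor) \<Rightarrow>\<^sub>0 'a uni) \<Rightarrow> ('f, 'a, 'n) res" where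
  "renc p = (\<lambda>(s, X1, f). ue (val A X1) (Poly_Mapping.lookup p (s, (sob s, X1, f))))"

lemma ind_lookup:
  assumes "p \<in> cr (V.ind E sob (mdl A (self A))) X"
  shows "(s, Y, X1, f) \<in> V.terms E sob X \<Longrightarrow> Y = sob s \<and>
      em (val A X1) (ue (val A X1) (Poly_Mapping.lookup p (s, Y, X1, f))) = Poly_Mapping.lookup p (s, Y, X1, f)"
    "k \<notin> V.terms E sob X \<Longrightarrow> Poly_Mapping.lookup p k = 0"
proof -
  assume k: "(s, Y, X1, f) \<in> V.terms E sob X"
  then have t: "(Y, X1, f) \<in> vhom (sob s) X" by (rule G.termsD(2))
  obtain X1' f' where "(Y, X1, f) = (sob s, X1', f')" "decomp X X1' (f' ` sob s)"
    using t by (rule vhomE)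
  then have Y: "Y = sob s" and X1: "vb_obj X1" by (auto dest: decompD(1))
  have "Poly_Mapping.lookup p (s, Y, X1, f) \<in> em (val A X1) ` car A X1"
    using assms k unfolding V.cr_ind dsum_def by (auto simp: cr_mdl vsimps dest!: bspec)
  then obtain a where "Poly_Mapping.lookup p (s, Y, X1, f) = em (val A X1) a" "a \<in> car A X1" by (rule imageE)
  then show "Y = sob s \<and> em (val A X1) (ue (val A X1) (Poly_Mapping.lookup p (s, Y, X1, f))) = Poly_Mapping.lookup p (s, Y, X1, f)"
    using Y vb_ag[OF A_vb X1] by simp
next
  assume "k \<notin> V.terms E sob X"
  then have "k \<notin> Poly_Mapping.keys p" using assms unfolding V.cr_ind dsum_def by blast
  then show "Poly_Mapping.lookup p k = 0" by (simp add: in_keys_iff)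
qed

lemma renc_inj: "inj_on (renc :: _ \<Rightarrow> ('f, 'a, 'n) res) (cr (V.ind E sob (mdl A (self A))) X)"
proof (rule inj_onI)
  fix p q assume p: "p \<in> cr (V.ind E sob (mdl A (self A))) X" and q: "q \<in> cr (V.ind E sob (mdl A (self A))) X"
    and e: "renc p = renc q"
  show "p = q"
  proof (rule poly_mapping_eqI)
    fix k :: "('f, 'a, 'n) syz \<times> 'f vmor"
    obtain s Y X1 f where k: "k = (s, Y, X1, f)" by (cases k) auto
    show "Poly_Mapping.lookup p k = Poly_Mapping.lookup q k"
    proof (cases "k \<in> V.terms E sob X")
      case True
      note P = ind_lookup(1)[OF p True[unfolded k]] and Q = ind_lookup(1)[OF q True[unfolded k]]
      have "ue (val A X1) (Poly_Mapping.lookup p (s, sob s, X1, f)) = ue (val A X1) (Poly_Mapping.lookup q (s, sob s, X1, f))"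
        using fun_cong[OF e, of "(s, X1, f)"] by (simp add: renc_def)
      then show ?thesis unfolding k conjunct1[OF P] using conjunct2[OF P] conjunct2[OF Q] conjunct1[OF P] by simp
    next
      case False
      then show ?thesis using ind_lookup(2)[OF p] ind_lookup(2)[OF q] by simp
    qed
  qed
qed

text \<open>A combination is turned into a list of decoded coefficients; decoding loses nothing
  because the coefficients of an element of the free module come from A.\<close>

lemma canres_syz:
  fixes N :: "('f, 'k, 'a, 'n) vblmod"
  assumes N: "left_module A N"
  shows "canres vb_obj vhom vcmp vid vcok vpush {0} vzm Seq.dim (mdl A (self A)) (uone A) (upos A \<epsilon>)
    (mdl A N) sob (sd0 N) sd1"
proof (rule canres.intro[OF G.gring_axioms], rule canres_axioms.intro)
  show "G.md (mdl A N)" by (rule mdl_left[OF N])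
next
  fix Y y assume "vb_obj Y" "y \<in> cr (mdl A N) Y"
  then obtain x where "y = em (val N Y) x" by (auto simp: cr_mdl)
  then show "\<exists>s :: ('f, 'a, 'n) syz. sob s = Y \<and> sd0 N s = y" by (intro exI[of _ "Elt Y x"]) (simp add: sob_def sd0_def)
next
  fix Y and z :: "(('f, 'a, 'n) syz \<times> 'f vmor) \<Rightarrow>\<^sub>0 'a uni"
  assume Y: "vb_obj Y" and z: "z \<in> cr (V.ind UNIV sob (mdl A (self A))) Y"
  obtain l where l: "z = sum_list (map (\<lambda>(s, t, a). Poly_Mapping.single (s, t) a) l)"
      "\<forall>(s, t, a)\<in>set l. a = Poly_Mapping.lookup z (s, t) \<and> (s, t) \<in> Poly_Mapping.keys z"
    using poly_mapping_eq_sum_list[of z] by (elim exE conjE)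
  let ?l = "map (\<lambda>(s, (Y', X1, f), a). (s, X1, f, ue (val A X1) a)) l"
  have "map (\<lambda>(s, X1, f, a). Poly_Mapping.single (s, (sob s, X1, f)) (em (val A X1) a)) ?l =
      map (\<lambda>(s, t, a). Poly_Mapping.single (s, t) a) l"
    unfolding map_map
  proof (rule map_cong[OF refl])
    fix x assume x: "x \<in> set l"
    obtain s Y' X1 f a where e: "x = (s, (Y', X1, f), a)" by (cases x) auto
    have a: "a = Poly_Mapping.lookup z (s, Y', X1, f)" "(s, Y', X1, f) \<in> Poly_Mapping.keys z" using l(2) x e by auto
    have "(s, Y', X1, f) \<in> V.terms UNIV sob Y" using z a(2) unfolding V.cr_ind dsum_def by blast
    note I = ind_lookup(1)[OF z this]
    show "((\<lambda>(s, X1, f, a). Poly_Mapping.single (s, (sob s, X1, f)) (em (val A X1) a)) \<circ>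
        (\<lambda>(s, (Y', X1, f), a). (s, X1, f, ue (val A X1) a))) x = (\<lambda>(s, t, a). Poly_Mapping.single (s, t) a) x"
      unfolding e a(1) using conjunct2[OF I] unfolding conjunct1[OF I] by simp
  qed
  then have "sum_list (map (\<lambda>(s, X1, f, a). Poly_Mapping.single (s, (sob s, X1, f)) (em (val A X1) a)) ?l) = z"
    unfolding l(1) by (rule arg_cong)
  then have "sd1 (Syz Y ?l) = z" unfolding sd1_def syz.case .
  moreover have "sob (Syz Y ?l) = Y" by (simp add: sob_def)
  ultimately show "\<exists>s. sob s = Y \<and> sd1 s = z" by (intro exI conjI)
qed

text \<open>Without this existence statement the resolution picked by
  \<open>chosen_resolution\<close> would be arbitrary. The canonical resolution with all names as
  generators is encoded term by term.\<close>

theorem ex_free_resolution: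
  fixes N :: "('f, 'k, 'a, 'n) vblmod"
  assumes N: "left_module A N"
  shows "\<exists>(P :: nat \<Rightarrow> ('f, 'k, 'a, ('f, 'a, 'n) res) vblmod) d \<eta>. free_resolution A N P d \<eta>"
proof -
  interpret C: canres vb_obj vhom vcmp vid vcok vpush "{0}" vzm Seq.dim "mdl A (self A)" "uone A" "upos A \<epsilon>"
    "mdl A N" "sob :: ('f, 'a, 'n) syz \<Rightarrow> 'f obj" "sd0 N" sd1 by (rule canres_syz[OF N])
  let ?\<beta> = "\<lambda>(_::nat) (_::'f obj). True"
  let ?M = "C.P ?\<beta>"
  define h0 where "h0 = (\<lambda>X::'f obj. G.ev (mdl A N) (sd0 N))"
  have r: "G.res (mdl A N) ?M C.D h0" unfolding h0_def by (rule C.res_canonical[OF C.bsurj_full]) simp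
  note rn = G.resnD[OF G.resD(1)[OF r]]
  have M: "G.md (?M n)" for n by (rule C.md_P)
  have inj: "inj_on renc (cr (?M n) X)" for n X unfolding C.P_def by (rule renc_inj)
  have E: "vb_obj (sob s)" if "s \<in> C.E ?\<beta> n" for s n using that by (cases n) simp_all
  define P where "P n = record_of (?M n) renc" for n
  define Ki where "Ki n X = inv_into (cr (?M n) X) (kap (?M n) renc X)" for n X
  have fr: "free_left_module A (P n)" for n
    unfolding P_def C.P_def
  proof (rule free_record[where E = "C.E ?\<beta> n" and ob = sob])
    show "vb_obj (sob s)" if "s \<in> C.E ?\<beta> n" for s by (rule E[OF that])
    show "inj_on renc (cr (V.ind (C.E ?\<beta> n) sob (mdl A (self A))) X)" for X by (rule renc_inj)
  qed
  have L: "left_module A (P n)" for n using fr[of n] unfolding free_left_module_def by (rule conjunct1)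
  have K: "G.mhom (?M n) (mdl A (P n)) (kap (?M n) renc)" for n unfolding P_def by (rule kap_hom[OF M inj])
  have kb: "vb_obj X \<Longrightarrow> bij_betw (kap (?M n) renc X) (cr (?M n) X) (cr (mdl A (P n)) X)" for n X
    unfolding P_def by (rule kap_bij[OF M inj])
  have ke: "kap (?M n) renc X p = em (val (P n) X) (renc p)" for n X p unfolding P_def by (rule kap_def[OF M inj])
  have Kih: "G.mhom (mdl A (P n)) (?M n) (Ki n)" for n
    unfolding Ki_def[abs_def] by (rule inv_mhom[OF M K kb])
  have car: "car (P n) X = renc ` cr (?M n) X" for n X unfolding P_def by (rule rec_car[OF M inj])
  have Kie: "Ki n X (em (val (P n) X) (renc p)) = p" if "vb_obj X" "p \<in> cr (?M n) X" for n X p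
    unfolding Ki_def ke[symmetric] using kb[OF that(1), of n] that(2) by (simp add: bij_betw_def inv_into_f_f)
  define d where "d n X x = ue (val (P n) X) (kap (?M n) renc X (C.D (Suc n) X (Ki (Suc n) X (em (val (P (Suc n)) X) x))))" for n X x
  define \<eta> where "\<eta> X x = ue (val N X) (h0 X (Ki 0 X (em (val (P 0) X) x)))" for X x
  have Dh: "G.mhom (?M (Suc n)) (?M n) (C.D (Suc n))" for n
    using G.cpxD(2)[OF G.resD(3)[OF r], of "Suc n"] by simp
  have hd: "left_hom A (P (Suc n)) (P n) (d n)" for n
    using left_hom_of[OF L L G.mhom_comp[OF G.mhom_comp[OF Kih Dh] K]] unfolding d_def[abs_def] .
  have hh: "G.mhom (?M 0) (mdl A N) h0" by (rule G.acpxD(3)[OF G.resD(2)[OF r]])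
  have h\<eta>: "left_hom A (P 0) N \<eta>"
    using left_hom_of[OF L N G.mhom_comp[OF Kih hh]] unfolding \<eta>_def[abs_def] .
  have Din: "C.D (Suc n) X p \<in> cr (?M n) X" if "vb_obj X" "p \<in> cr (?M (Suc n)) X" for n X p
    by (rule G.mhomD(1)[OF Dh that])
  have de: "d n X (renc p) = renc (C.D (Suc n) X p)" if X: "vb_obj X" and p: "p \<in> cr (?M (Suc n)) X" for n X p
    unfolding d_def Kie[OF X p] ke using vb_ag[OF left_moduleD(1)[OF L] X] Din[OF X p] car by simp
  have hin: "h0 X p \<in> em (val N X) ` car N X" if "vb_obj X" "p \<in> cr (?M 0) X" for X p
    using G.mhomD(1)[OF hh that] by (simp add: cr_mdl)
  have \<eta>e: "em (val N X) (\<eta> X (renc p)) = h0 X p \<and> \<eta> X (renc p) \<in> car N X" if X: "vb_obj X" and p: "p \<in> cr (?M 0) X" for X p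
  proof -
    obtain y where "h0 X p = em (val N X) y" "y \<in> car N X" using hin[OF X p] by (rule imageE)
    then show ?thesis unfolding \<eta>_def Kie[OF X p] using vb_ag[OF left_moduleD(1)[OF N] X] by simp
  qed
  have zero: "\<zero>\<^bsub>val (P n) X\<^esub> = renc 0" for n X unfolding P_def by (rule rec_zero[OF M inj])
  have renc0: "renc p = renc 0 \<longleftrightarrow> p = 0" if "vb_obj X" "p \<in> cr (?M n) X" for n X p
    using inj[of n X] that(2) G.md_sgrp(1)[OF M that(1)] unfolding inj_on_def by blast
  have \<eta>0: "\<eta> X (renc p) = \<zero>\<^bsub>val N X\<^esub> \<longleftrightarrow> h0 X p = 0" if X: "vb_obj X" and p: "p \<in> cr (?M 0) X" for X p
    using em_eq_zero[OF vb_ag[OF left_moduleD(1)[OF N] X] conjunct2[OF \<eta>e[OF X p]]]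
    unfolding conjunct1[OF \<eta>e[OF X p]] by blast
  have su: "vb_surj (P 0) N \<eta>"
    unfolding vb_surj_def
  proof (intro allI impI equalityI subsetI)
    fix X :: "'f obj" and y assume X: "vb_obj X"
    show "y \<in> car N X" if y: "y \<in> \<eta> X ` car (P 0) X"
    proof -
      obtain p where "y = \<eta> X (renc p)" "p \<in> cr (?M 0) X" using y unfolding car image_image by (rule imageE)
      then show ?thesis using conjunct2[OF \<eta>e[OF X]] by simp
    qed
    assume y: "y \<in> car N X"
    have "em (val N X) y \<in> cr (mdl A N) X" using y by (simp add: cr_mdl)
    from rn(2)[OF X this] obtain p where p: "h0 X p = em (val N X) y" "p \<in> cr (?M 0) X" by (rule bexE)
    have "\<eta> X (renc p) = y"
      using conjunct1[OF \<eta>e[OF X p(2)]] em_inj[OF vb_ag[OF left_moduleD(1)[OF N] X] conjunct2[OF \<eta>e[OF X p(2)]] y]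
      unfolding p(1) by simp
    then have "y = \<eta> X (renc p)" ..
    then show "y \<in> \<eta> X ` car (P 0) X" unfolding car image_image using p(2) by (rule image_eqI)
  qed
  have e0: "d 0 X ` car (P (Suc 0)) X = {x \<in> car (P 0) X. \<eta> X x = \<zero>\<^bsub>val N X\<^esub>}" if X: "vb_obj X" for X
  proof (intro equalityI subsetI)
    fix x assume "x \<in> d 0 X ` car (P (Suc 0)) X"
    then obtain p where p: "x = d 0 X (renc p)" "p \<in> cr (?M (Suc 0)) X" unfolding car image_image by (rule imageE)
    have "h0 X (C.D (Suc 0) X p) = 0"
      using G.acpxD(4)[OF G.resD(2)[OF r] X, of p] p(2) unfolding One_nat_def by blast
    then show "x \<in> {x \<in> car (P 0) X. \<eta> X x = \<zero>\<^bsub>val N X\<^esub>}"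
      using \<eta>0[OF X Din[OF X p(2)]] imageI[OF Din[OF X p(2)], of renc] unfolding p(1) de[OF X p(2)] car by blast
  next
    fix x assume "x \<in> {x \<in> car (P 0) X. \<eta> X x = \<zero>\<^bsub>val N X\<^esub>}"
    then have x: "x \<in> renc ` cr (?M 0) X" "\<eta> X x = \<zero>\<^bsub>val N X\<^esub>" unfolding car by blast+
    from x(1) obtain p where p: "x = renc p" "p \<in> cr (?M 0) X" by (rule imageE)
    have "h0 X p = 0" using x(2) \<eta>0[OF X p(2)] unfolding p(1) by blast
    from rn(3)[OF X p(2) this] obtain q where q: "C.D (Suc 0) X q = p" "q \<in> cr (?M (Suc 0)) X"
      unfolding One_nat_def by (rule bexE)
    have "x = d 0 X (renc q)" unfolding de[OF X q(2)] q(1) p(1) ..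
    then show "x \<in> d 0 X ` car (P (Suc 0)) X" unfolding car image_image using q(2) by (rule image_eqI)
  qed
  have e1: "d (Suc n) X ` car (P (Suc (Suc n))) X = {x \<in> car (P (Suc n)) X. d n X x = \<zero>\<^bsub>val (P n) X\<^esub>}" if X: "vb_obj X" for n X
  proof (intro equalityI subsetI)
    fix x assume "x \<in> d (Suc n) X ` car (P (Suc (Suc n))) X"
    then obtain p where p: "x = d (Suc n) X (renc p)" "p \<in> cr (?M (Suc (Suc n))) X" unfolding car image_image by (rule imageE)
    have z: "C.D (Suc n) X (C.D (Suc (Suc n)) X p) = 0" by (rule G.cpxD(5)[OF G.resD(3)[OF r] X p(2)])
    have "d n X (renc (C.D (Suc (Suc n)) X p)) = renc 0" unfolding de[OF X Din[OF X p(2)]] z ..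
    then show "x \<in> {x \<in> car (P (Suc n)) X. d n X x = \<zero>\<^bsub>val (P n) X\<^esub>}"
      using imageI[OF Din[OF X p(2)], of renc] unfolding p(1) de[OF X p(2)] car zero by blast
  next
    fix x assume "x \<in> {x \<in> car (P (Suc n)) X. d n X x = \<zero>\<^bsub>val (P n) X\<^esub>}"
    then have x: "x \<in> renc ` cr (?M (Suc n)) X" "d n X x = renc 0" unfolding car zero by blast+
    from x(1) obtain p where p: "x = renc p" "p \<in> cr (?M (Suc n)) X" by (rule imageE)
    have "C.D (Suc n) X p = 0" using x(2) renc0[OF X Din[OF X p(2)]] unfolding p(1) de[OF X p(2)] by blast
    from rn(4)[OF X p(2) this] obtain q where q: "C.D (Suc (Suc n)) X q = p" "q \<in> cr (?M (Suc (Suc n))) X" by (rule bexE)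
    have "x = d (Suc n) X (renc q)" unfolding de[OF X q(2)] q(1) p(1) ..
    then show "x \<in> d (Suc n) X ` car (P (Suc (Suc n))) X" unfolding car image_image using q(2) by (rule image_eqI)
  qed
  have "free_resolution A N P d \<eta>"
    unfolding free_resolution_def One_nat_def by (intro conjI allI impI fr hd h\<eta> su e0 e1)
  then show ?thesis by (intro exI)
qed

end

context aug_monoid
begin

text \<open>The bridge from the concrete Tor to \<open>TorV\<close>: some abstract resolution
  computes its vanishing in all degrees, and \<open>TorV_transfer\<close> then allows any
  other.\<close>

lemma Tor_res:
  fixes N :: "('f, 'k, 'a, 'n) vblmod"
  assumes N: "left_module A N"
  shows "\<exists>(P :: nat \<Rightarrow> ('f obj, 'f vmor, 'a uni, ('f, 'a, 'n) res uni) md) D \<eta>. G.res (mdl A N) P D \<eta> \<and>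
    (\<forall>i X. vb_obj X \<longrightarrow> kzero (val (Tor A kR N i) X) = G.TorV P D i X)"
proof -
  obtain P d where c: "chosen_resolution A N = (P, d)" by (cases "chosen_resolution A N") auto
  have "\<exists>x :: (nat \<Rightarrow> ('f, 'k, 'a, ('f, 'a, 'n) res) vblmod) \<times> _. case x of (P, d) \<Rightarrow> \<exists>\<eta>. free_resolution A N P d \<eta>"
    using ex_free_resolution[OF N] by (auto intro: exI)
  from someI_ex[OF this] obtain \<eta> where r: "free_resolution A N P d \<eta>"
    using c unfolding chosen_resolution_def by auto
  have L: "left_module A (P n)" for n using r unfolding free_resolution_def free_left_module_def by blast
  have d: "left_hom A (P (Suc n)) (P n) (d n)" for n using r unfolding free_resolution_def by blast
  have "kzero (val (Tor A kR N i) X) = G.TorV (\<lambda>n. mdl A (P n)) (udiff P d) i X" if "vb_obj X" for i X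
    unfolding Tor_def c prod.case by (rule kzero_TorV[where P = P and d = d, OF L d that])
  then show ?thesis using free_resolution_res[OF N r] by blast
qed

end

section \<open>The unit monoid, restriction along monoid maps and signs\<close>

lemma unit_simps: "car vb_unit X = (if X = {0} then UNIV else {0})" "add (val vb_unit X) = (+)"
  "smult (val vb_unit X) = (*)" "\<zero>\<^bsub>val vb_unit X\<^esub> = 0" "act vb_unit X Y f c = c" "mmul vb_unit X1 X2 = (*)" "mone vb_unit = 1"
  by (simp_all add: vb_unit_def)

lemma unit_monoid:
  assumes R: "cring (kring :: 'k::{comm_ring,monoid_mult} ring)"
  shows "vb_monoid (vb_unit :: ('f::field, 'k, 'k) vbmonoid)"
proof -
  let ?U = "vb_unit :: ('f, 'k, 'k) vbmonoid"
  have m: "Module.module kring (val ?U X)" for X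
  proof (rule moduleI[OF R])
    show "abelian_group (val ?U X)"
    proof (rule abelian_groupI)
      fix x assume "x \<in> car ?U X"
      then show "\<exists>y\<in>car ?U X. y \<oplus>\<^bsub>val ?U X\<^esub> x = \<zero>\<^bsub>val ?U X\<^esub>"
        by (intro bexI[of _ "- x"]) (auto simp: unit_simps split: if_splits)
    qed (auto simp: unit_simps add_ac split: if_splits)
  qed (auto simp: unit_simps kring_def algebra_simps split: if_splits)
  have a: "klinear (val ?U X) (val ?U Y) (act ?U X Y f)" if "vb_obj X" "f \<in> vb_iso X Y" for X Y f
  proof -
    have "X = {0} \<Longrightarrow> Y = {0}" using isoD(2)[OF that(2,1)] isoD(6)[OF that(2,1)] by auto
    then show ?thesis unfolding klinear_def by (auto simp: unit_simps split: if_splits)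
  qed
  have z: "X = {0}" if "decomp X {0} {0}" for X :: "'f obj"
    using that vsum_zero(1)[of "{0} :: 'f obj"] by (simp add: decomp_def)
  have b: "kbilinear (val ?U X1) (val ?U X2) (val ?U X) (mmul ?U X1 X2)" if "decomp X X1 X2" for X X1 X2
  proof -
    have "X1 = {0} \<Longrightarrow> X2 = {0} \<Longrightarrow> X = {0}" using z that by blast
    then show ?thesis unfolding kbilinear_def klinear_def
      by (auto simp: unit_simps algebra_simps split: if_splits)
  qed
  have vb: "vb_module ?U" unfolding vb_module_def using m a by (auto simp: unit_simps)
  have pr: "vb_pairing ?U ?U ?U (mmul ?U)" unfolding vb_pairing_def using b by (auto simp: unit_simps)
  show ?thesis unfolding vb_monoid_def using vb pr by (auto simp: unit_simps mult.assoc)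
qed

lemma monoid_homD:
  assumes "monoid_hom A B \<phi>"
  shows "vb_obj X \<Longrightarrow> klinear (val A X) (val B X) (\<phi> X)"
    "f \<in> vb_iso X Y \<Longrightarrow> vb_obj X \<Longrightarrow> vb_obj Y \<Longrightarrow> x \<in> car A X \<Longrightarrow> \<phi> Y (act A X Y f x) = act B X Y f (\<phi> X x)"
    "\<phi> {0} (mone A) = mone B"
    "decomp X X1 X2 \<Longrightarrow> a \<in> car A X1 \<Longrightarrow> b \<in> car A X2 \<Longrightarrow> \<phi> X (mmul A X1 X2 a b) = mmul B X1 X2 (\<phi> X1 a) (\<phi> X2 b)"
  using assms unfolding monoid_hom_def vb_hom_def by blast+

lemma left_via_left:
  assumes A: "vb_monoid A" and B: "vb_monoid B" and h: "monoid_hom A B \<phi>"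
  shows "left_module A (left_via \<phi> B)"
proof -
  note S = vb_monoidD(4)[OF B] and vA = vb_monoidD(1)[OF A] and vB = vb_monoidD(1)[OF B] and H = monoid_homD[OF h]
  have \<phi>: "\<phi> X a \<in> car B X" if "vb_obj X" "a \<in> car A X" for X a by (rule klinearD(1)[OF H(1)[OF that(1)] that(2)])
  let ?L = "left_via \<phi> B"
  have 1: "klinear (val ?L X2) (val ?L X) (lact ?L X1 X2 a)" if "decomp X X1 X2" "a \<in> car A X1" for X X1 X2 a
  proof -
    have "lact ?L X1 X2 a = lact (self B) X1 X2 (\<phi> X1 a)" by (rule ext) simp
    then show ?thesis using left_moduleD(2)[OF S that(1) \<phi>[OF decompD(1)[OF that(1)] that(2)]] by simp
  qed
  have 2: "klinear (val A X1) (val ?L X) (\<lambda>a. lact ?L X1 X2 a x)" if d: "decomp X X1 X2" and x: "x \<in> car ?L X2" for X X1 X2 x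
  proof -
    note k = klinearD[OF left_moduleD(3)[OF S d, of x]] and p = klinearD[OF H(1)[OF decompD(1)[OF d]]]
    have x': "x \<in> car (self B) X2" using x by simp
    show ?thesis unfolding klinear_def using k[OF x'] p by simp
  qed
  have 3: "act ?L X Y f (lact ?L X1 X2 a x) = lact ?L (f ` X1) (f ` X2) (act A X1 (f ` X1) (restrict f X1) a)
      (act ?L X2 (f ` X2) (restrict f X2) x)"
    if d: "decomp X X1 X2" and Y: "vb_obj Y" and f: "f \<in> vb_iso X Y" and a: "a \<in> car A X1" and x: "x \<in> car ?L X2" for X X1 X2 Y f a x
  proof -
    note D = decompD[OF d] and D' = decompD[OF iso_decomp[OF f d]]
    have f1: "restrict f X1 \<in> vb_iso X1 (f ` X1)" by (rule iso_restrict[OF f D(5) D(1,6)])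
    show ?thesis using left_moduleD(4)[OF S d Y f \<phi>[OF D(1) a], of x] x H(2)[OF f1 D(1) D'(1) a] by simp
  qed
  have 4: "lact ?L {0} X (mone A) x = x" if "vb_obj X" "x \<in> car ?L X" for X x
    using left_moduleD(5)[OF S that(1), of x] that(2) H(3) by simp
  have 5: "lact ?L (vsum X1 X2) X3 (mmul A X1 X2 a b) x = lact ?L X1 (vsum X2 X3) a (lact ?L X2 X3 b x)"
    if d: "decomp3 X X1 X2 X3" and a: "a \<in> car A X1" and b: "b \<in> car A X2" and x: "x \<in> car ?L X3" for X X1 X2 X3 a b x
  proof -
    have d1: "decomp (vsum X1 X2) X1 X2" using d by (simp add: decomp3_def)
    note D = decompD[OF d1]
    show ?thesis
      using left_moduleD(6)[OF S d \<phi>[OF D(1) a] \<phi>[OF D(2) b], of x] x H(4)[OF d1 a b] by simp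
  qed
  have "vb_pairing A ?L ?L (lact ?L)" unfolding vb_pairing_def kbilinear_def using 1 2 3 by blast
  then show ?thesis unfolding left_module_def using vb_module_left_via[THEN iffD2, OF vB] 4 5 by blast
qed

locale koszul_pair =
  A: aug_monoid A "\<lambda>X. \<epsilon> X \<circ> \<phi> X" + B: aug_monoid B \<epsilon>
  for A :: "('f::field, 'k::{comm_ring,monoid_mult}, 'a) vbmonoid" and B :: "('f, 'k, 'b) vbmonoid"
    and \<phi> :: "'f obj \<Rightarrow> 'a \<Rightarrow> 'b" and \<epsilon> :: "'f obj \<Rightarrow> 'b \<Rightarrow> 'k" +
  assumes hom: "monoid_hom A B \<phi>" and surj: "vb_surj A B \<phi>"
    and comm: "(vb_commutative A \<and> vb_commutative B) \<or> (vb_skew_commutative A \<and> vb_skew_commutative B)"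
begin

text \<open>One sign for both cases. The arguments use that it is multiplicative and squares to
  1.\<close>

definition sgn_pow :: "nat \<Rightarrow> 'k" where
  "sgn_pow n = (if vb_commutative A \<and> vb_commutative B then 1 else (- 1) ^ n)"

lemma sgn_pow: "sgn_pow n * sgn_pow n = 1" "sgn_pow (m + n) = sgn_pow m * sgn_pow n"
proof -
  have "(- 1 :: 'k) ^ n * (- 1) ^ n = 1"
    by (induction n) (simp_all add: mult.assoc mult.left_commute)
  then show "sgn_pow n * sgn_pow n = 1" by (simp add: sgn_pow_def)
  show "sgn_pow (m + n) = sgn_pow m * sgn_pow n" by (simp add: sgn_pow_def power_add)
qed

lemma swap_A: "decomp X X1 X2 \<Longrightarrow> a \<in> car A X1 \<Longrightarrow> b \<in> car A X2 \<Longrightarrow>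
    mmul A X1 X2 a b = sgn_pow (Seq.dim X1 * Seq.dim X2) \<odot>\<^bsub>val A X\<^esub> mmul A X2 X1 b a"
  and swap_B: "decomp X X1 X2 \<Longrightarrow> c \<in> car B X1 \<Longrightarrow> d \<in> car B X2 \<Longrightarrow>
    mmul B X1 X2 c d = sgn_pow (Seq.dim X1 * Seq.dim X2) \<odot>\<^bsub>val B X\<^esub> mmul B X2 X1 d c"
proof -
  assume d: "decomp X X1 X2"
  note X = decompD(5)[OF d]
  show "a \<in> car A X1 \<Longrightarrow> b \<in> car A X2 \<Longrightarrow> mmul A X1 X2 a b = sgn_pow (Seq.dim X1 * Seq.dim X2) \<odot>\<^bsub>val A X\<^esub> mmul A X2 X1 b a"
  proof (cases "vb_commutative A \<and> vb_commutative B")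
    case True
    assume a: "a \<in> car A X1" "b \<in> car A X2"
    have "mmul A X1 X2 a b = mmul A X2 X1 b a" using True d a unfolding vb_commutative_def by blast
    moreover have "mmul A X1 X2 a b \<in> car A X" using lact_in[OF vb_monoidD(4)[OF A.A_mon] d, of a b] a by simp
    ultimately show ?thesis using kmodD(4)[OF vb_moduleD(1)[OF A.A_vb X], of "mmul A X2 X1 b a"] True by (simp add: sgn_pow_def)
  next
    case False
    assume "a \<in> car A X1" "b \<in> car A X2"
    then show ?thesis using comm False d unfolding vb_skew_commutative_def sgn_pow_def by auto
  qed
  show "c \<in> car B X1 \<Longrightarrow> d \<in> car B X2 \<Longrightarrow> mmul B X1 X2 c d = sgn_pow (Seq.dim X1 * Seq.dim X2) \<odot>\<^bsub>val B X\<^esub> mmul B X2 X1 d c" for c d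
  proof (cases "vb_commutative A \<and> vb_commutative B")
    case True
    assume a: "c \<in> car B X1" "d \<in> car B X2"
    have "mmul B X1 X2 c d = mmul B X2 X1 d c" using True \<open>decomp X X1 X2\<close> a unfolding vb_commutative_def by blast
    moreover have "mmul B X1 X2 c d \<in> car B X" using lact_in[OF vb_monoidD(4)[OF B.A_mon] \<open>decomp X X1 X2\<close>, of c d] a by simp
    ultimately show ?thesis using kmodD(4)[OF vb_moduleD(1)[OF B.A_vb X], of "mmul B X2 X1 d c"] True by (simp add: sgn_pow_def)
  next
    case False
    assume "c \<in> car B X1" "d \<in> car B X2"
    then show ?thesis using comm False \<open>decomp X X1 X2\<close> unfolding vb_skew_commutative_def sgn_pow_def by auto
  qed
qed

definition uphi :: "'f obj \<Rightarrow> 'a uni \<Rightarrow> 'b uni" where "uphi X u = em (val B X) (\<phi> X (ue (val A X) u))"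
text \<open>The inclusion of the complement, with the image of Y as its chosen complement.\<close>

definition sw :: "'f vmor \<Rightarrow> 'f vmor" where "sw = (\<lambda>(Y, X1, f). (X1, f ` Y, \<lambda>v\<in>X1. v))"
text \<open>The sign is that of moving an element over Y past one over the complement X1; with it
  \<open>comm\<close> and \<open>comm_B\<close> hold without further signs.\<close>

definition tr :: "'f vmor \<Rightarrow> 'a uni \<Rightarrow> 'a uni" where
  "tr = (\<lambda>(Y, X1, f) u. em (val A (f ` Y)) (sgn_pow (Seq.dim X1 * Seq.dim Y) \<odot>\<^bsub>val A (f ` Y)\<^esub> act A Y (f ` Y) f (ue (val A Y) u)))"

lemma uphi_em: "vb_obj X \<Longrightarrow> a \<in> car A X \<Longrightarrow> uphi X (em (val A X) a) = em (val B X) (\<phi> X a)"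
  by (simp add: uphi_def vb_ag[OF A.A_vb])

lemma phi_in: "vb_obj X \<Longrightarrow> a \<in> car A X \<Longrightarrow> \<phi> X a \<in> car B X"
  by (rule klinearD(1)[OF monoid_homD(1)[OF hom]])

lemma tr_em:
  assumes "vb_obj Y" "f \<in> vb_iso Y (f ` Y)" "vb_obj (f ` Y)" "a \<in> car A Y"
  shows "tr (Y, X1, f) (em (val A Y) a) = em (val A (f ` Y)) (sgn_pow (Seq.dim X1 * Seq.dim Y) \<odot>\<^bsub>val A (f ` Y)\<^esub> act A Y (f ` Y) f a)"
    "sgn_pow n \<odot>\<^bsub>val A (f ` Y)\<^esub> act A Y (f ` Y) f a \<in> car A (f ` Y)" "act A Y (f ` Y) f a \<in> car A (f ` Y)"
  using assms act_in[OF A.A_vb assms(2,1,3,4)] kmodD(1)[OF vb_moduleD(1)[OF A.A_vb assms(3)]]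
  by (simp_all add: tr_def vb_ag[OF A.A_vb])

lemma decomp_swap: "decomp X X1 X2 \<Longrightarrow> decomp X X2 X1"
  by (auto simp: decomp_def vsum_comm)

lemma sw_vhom: "(Y, X1, f) \<in> vhom Y X \<Longrightarrow> (X1, f ` Y, \<lambda>v\<in>X1. v) \<in> vhom X1 X"
proof -
  assume "(Y, X1, f) \<in> vhom Y X"
  then have d: "decomp X X1 (f ` Y)" by (simp add: vhom_iff)
  show ?thesis by (rule A.mult_vhom[OF decomp_swap[OF d]])
qed

lemma ac_self_A:
  assumes "(Y, X1, f) \<in> vhom Y X" "a \<in> car A X1" "x \<in> car A Y"
  shows "ac (mdl A (self A)) (Y, X1, f) (em (val A X1) a) (em (val A Y) x) = em (val A X) (mmul A X1 (f ` Y) a (act A Y (f ` Y) f x))"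
proof -
  have v: "vb_module (self A)" by (simp add: vb_module_left_via A.A_vb)
  show ?thesis using ac_mdl[OF A.A_vb v assms(1,2), of x] assms(3) by simp
qed

lemma ac_self_B:
  assumes "(Y, X1, f) \<in> vhom Y X" "a \<in> car B X1" "x \<in> car B Y"
  shows "ac (mdl B (self B)) (Y, X1, f) (em (val B X1) a) (em (val B Y) x) = em (val B X) (mmul B X1 (f ` Y) a (act B Y (f ` Y) f x))"
proof -
  have v: "vb_module (self B)" by (simp add: vb_module_left_via B.A_vb)
  show ?thesis using ac_mdl[OF B.A_vb v assms(1,2), of x] assms(3) by simp
qed

lemma two: "two_rings vb_obj vhom vcmp vid vcok vpush {0} vzm Seq.dim (mdl A (self A)) (uone A) (upos A (\<lambda>X. \<epsilon> X \<circ> \<phi> X))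
    (mdl B (self B)) (uone B) (upos B \<epsilon>) uphi sw tr"
proof (rule two_rings.intro[OF A.G.gring_axioms B.G.gring_axioms], rule two_rings_axioms.intro, goal_cases)
  note H = monoid_homD[OF hom] and vA = A.A_vb and vB = B.A_vb
  {
    case (1 X a) then show ?case using uphi_em phi_in by (auto simp: cr_mdl)
  next
    case (2 X)
    show ?case unfolding cr_mdl left_via_simps uphi_def[abs_def]
      by (rule em_additive[OF vb_ag[OF vA 2] vb_ag[OF vB 2] klinearD(1,2)[OF H(1)[OF 2]]])
  next
    case (3 X c)
    obtain b where b: "c = em (val B X) b" "b \<in> car B X" using 3(2) by (auto simp: cr_mdl)
    have "\<phi> X ` car A X = car B X" using surj 3(1) unfolding vb_surj_def by blast
    then obtain a where "\<phi> X a = b" "a \<in> car A X" using b(2) by (metis imageE)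
    then show ?case using uphi_em[OF 3(1)] b(1) by (auto simp: cr_mdl)
  next
    case 4 show ?case using uphi_em[OF vb_obj_zero vb_monoidD(2)[OF A.A_mon]] H(3) by simp
  next
    case (5 t Y X a x)
    obtain X1 f b where t: "t = (Y, X1, f)" "vb_obj Y" "f \<in> vb_iso Y (f ` Y)" "decomp X X1 (f ` Y)"
      "a = em (val A X1) b" "b \<in> car A X1" "vb_obj (f ` Y)" "vb_obj X1" "vb_obj X" using 5(1,2) by (rule vhomE')
    obtain y where y: "x = em (val A Y) y" "y \<in> car A Y" using 5(3) by (auto simp: cr_mdl)
    note ay = act_in[OF vA t(3,2,7) y(2)]
    have m: "mmul A X1 (f ` Y) b (act A Y (f ` Y) f y) \<in> car A X"
      using lact_in[OF vb_monoidD(4)[OF A.A_mon] t(4,6)] ay by simp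
    show ?case
      unfolding t(1,5) y(1) vsimps ac_self_A[OF 5(1)[unfolded t(1)] t(6) y(2)] uphi_em[OF t(9) m] uphi_em[OF t(8,6)] uphi_em[OF t(2) y(2)]
        ac_self_B[OF 5(1)[unfolded t(1)] phi_in[OF t(8,6)] phi_in[OF t(2) y(2)]]
      using H(4)[OF t(4,6) ay] H(2)[OF t(3,2,7) y(2)] by simp
  next
    case (6 X a)
    obtain b where b: "a = em (val A X) b" "b \<in> car A X" using 6(2) by (auto simp: cr_mdl)
    have "a \<in> upos A (\<lambda>X. \<epsilon> X \<circ> \<phi> X) X \<longleftrightarrow> \<epsilon> X (\<phi> X b) = 0"
      using b em_inj[OF vb_ag[OF vA 6(1)]] by (auto simp: upos_def)
    moreover have "uphi X a \<in> upos B \<epsilon> X \<longleftrightarrow> \<epsilon> X (\<phi> X b) = 0"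
      using b uphi_em[OF 6(1) b(2)] phi_in[OF 6(1) b(2)] em_inj[OF vb_ag[OF vB 6(1)]] by (auto simp: upos_def)
    ultimately show ?case by blast
  next
    case (7 t Y X)
    then obtain X1 f where t: "t = (Y, X1, f)" by (rule vhomE)
    show ?case using sw_vhom 7 by (simp add: t sw_def vsimps)
  next
    case (8 t Y X a)
    obtain X1 f where t: "t = (Y, X1, f)" "vb_obj Y" "f \<in> vb_iso Y (f ` Y)" "decomp X X1 (f ` Y)" using 8(1) by (rule vhomE)
    obtain b where b: "a = em (val A Y) b" "b \<in> car A Y" using 8(2) by (auto simp: cr_mdl)
    show ?case using tr_em[OF t(2,3) decompD(2)[OF t(4)] b(2)] by (simp add: t(1) b(1) sw_def vsimps cr_mdl)
  next
    case (9 t Y X a)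
    obtain X1 f where t: "t = (Y, X1, f)" "vb_obj Y" "f \<in> vb_iso Y (f ` Y)" "decomp X X1 (f ` Y)" using 9(1) by (rule vhomE)
    obtain b where b: "a = em (val A Y) b" "b \<in> car A Y" "(\<epsilon> Y \<circ> \<phi> Y) b = 0" using 9(2) by (auto simp: upos_def)
    note d = decompD(2)[OF t(4)] and T = tr_em[OF t(2,3) decompD(2)[OF t(4)] b(2)]
    have "(\<epsilon> (f ` Y) \<circ> \<phi> (f ` Y)) (act A Y (f ` Y) f b) = 0"
      using monoid_homD(2)[OF augmentedD(2)[OF A.aug] t(3,2) d b(2)] b(3) by (simp add: unit_simps)
    then have "(\<epsilon> (f ` Y) \<circ> \<phi> (f ` Y)) (sgn_pow n \<odot>\<^bsub>val A (f ` Y)\<^esub> act A Y (f ` Y) f b) = 0" for n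
      using A.eps(1)[OF d T(3), of "sgn_pow n"] by simp
    then show ?case using T by (simp add: t(1) b(1) sw_def vsimps upos_def)
  next
    case (10 t Y X u Z)
    obtain X1 f where t: "t = (Y, X1, f)" "vb_obj Y" "f \<in> vb_iso Y (f ` Y)" "decomp X X1 (f ` Y)" using 10(1) by (rule vhomE)
    obtain Z1 g where u: "u = (X, Z1, g)" "vb_obj X" "g \<in> vb_iso X (g ` X)" "decomp Z Z1 (g ` X)" using 10(2) by (rule vhomE)
    have im: "compose Y g f ` Y = g ` f ` Y" unfolding image_image by (rule image_cong) (simp_all add: compose_def)
    have ob: "vb_obj Z1" "vb_obj (g ` X1)" using decompD(1)[OF u(4)] decompD(1)[OF iso_decomp[OF u(3) t(4)]] by blast+
    have s: "Z1 \<subseteq> vsum Z1 (g ` X1)" "g ` X1 \<subseteq> vsum Z1 (g ` X1)"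
    proof -
      have "decomp (vsum Z1 (g ` X1)) Z1 (g ` X1)"
        using V.push[OF 10(1,2)] by (simp add: t(1) u(1) vsimps vhom_iff image_restrict_eq)
      from decompD(6,7)[OF this] show "Z1 \<subseteq> vsum Z1 (g ` X1)" "g ` X1 \<subseteq> vsum Z1 (g ` X1)" .
    qed
    have i: "(\<lambda>v\<in>vsum Z1 (g ` X1). v) ` Z1 = Z1" using s(1) by auto
    have c: "compose X1 (\<lambda>v\<in>vsum Z1 (g ` X1). v) (restrict g X1) = compose X1 g (\<lambda>v\<in>X1. v)"
      using s(2) by (auto simp: compose_def fun_eq_iff)
    have z: "Z1 \<inter> vsum Z1 (g ` X1) = Z1" "Z1 \<inter> {x. x \<notin> vsum Z1 (g ` X1)} = {}" using s(1) by blast+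
    show ?case unfolding t(1) u(1) by (simp add: sw_def vsimps im i c z vsum_comm)
  next
    case (11 t Y X u Z a b)
    obtain X1 f where t: "t = (Y, X1, f)" "vb_obj Y" "f \<in> vb_iso Y (f ` Y)" "decomp X X1 (f ` Y)" using 11(1) by (rule vhomE)
    obtain Z1 g b' where u: "u = (X, Z1, g)" "vb_obj X" "g \<in> vb_iso X (g ` X)" "decomp Z Z1 (g ` X)"
      "b = em (val A Z1) b'" "b' \<in> car A Z1" "vb_obj (g ` X)" "vb_obj Z1" "vb_obj Z" using 11(2,4) by (rule vhomE')
    obtain a' where a: "a = em (val A Y) a'" "a' \<in> car A Y" using 11(3) by (auto simp: cr_mdl)
    let ?V = "g ` f ` Y" and ?s = sgn_pow and ?d = Seq.dim
    note D = decompD[OF t(4)]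
    have im: "compose Y g f ` Y = ?V" unfolding image_image by (rule image_cong) (simp_all add: compose_def)
    have gd: "decomp (g ` X) (g ` X1) ?V" by (rule iso_decomp[OF u(3) t(4)])
    have V: "vb_obj ?V" "vb_obj (g ` X1)" using decompD[OF gd] by blast+
    have g2: "restrict g (f ` Y) \<in> vb_iso (f ` Y) ?V" by (rule iso_restrict[OF u(3,2) D(2,7)])
    have dV: "?d ?V = ?d Y" using dim_iso[OF g2 D(2)] dim_iso[OF t(3,2)] by simp
    have p1: "(f ` Y, Z1, restrict g (f ` Y)) \<in> vhom (f ` Y) (vsum Z1 ?V)"
      using V.push[OF sw_vhom[OF 11(1)[unfolded t(1)]] 11(2)[unfolded u(1)]] by (simp add: vsimps)
    have dZ: "decomp (vsum Z1 ?V) Z1 ?V" using p1 by (simp add: vhom_iff image_restrict_eq)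
    have p2: "(Z1, ?V, \<lambda>v\<in>Z1. v) \<in> vhom Z1 (vsum Z1 ?V)" by (rule A.mult_vhom[OF decomp_swap[OF dZ]])
    have dZX: "decomp (vsum Z1 (g ` X1)) Z1 (g ` X1)"
      using V.push[OF 11(1,2)] by (simp add: t(1) u(1) vsimps vhom_iff image_restrict_eq)
    have g1: "restrict g X1 \<in> vb_iso X1 (g ` X1)" by (rule iso_restrict[OF u(3,2) D(1,6)])
    have dimZX: "?d (vsum Z1 (g ` X1)) = ?d Z1 + ?d X1" using dim_decomp[OF dZX] dim_iso[OF g1 D(1)] by simp
    have r1: "restrict (\<lambda>v\<in>vsum Z1 (g ` X1). v) Z1 = (\<lambda>v\<in>Z1. v)"
      using decompD(6)[OF dZX] by (auto simp: fun_eq_iff)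
    have r2: "vsum Z1 (g ` X1) \<inter> Z1 = Z1" using decompD(6)[OF dZX] by blast
    have ut: "(Y, vsum Z1 (g ` X1), compose Y g f) \<in> vhom Y Z" using V.cmp[OF 11(1,2)] by (simp add: t(1) u(1) vsimps)
    then have iso: "compose Y g f \<in> vb_iso Y (compose Y g f ` Y)" by (simp add: vhom_iff)
    note T1 = tr_em[OF t(2,3) D(2) a(2)] and T2 = tr_em[OF t(2) iso V(1)[folded im] a(2), unfolded im]
    let ?w = "act A Y ?V (compose Y g f) a'"
    have w: "act A (f ` Y) ?V (restrict g (f ` Y)) (act A Y (f ` Y) f a') = ?w"
    proof -
      have "compose Y (restrict g (f ` Y)) f = compose Y g f" by (rule ext) (simp add: compose_def)
      then show ?thesis using vb_moduleD(5)[OF vA t(3) g2 t(2) D(2) V(1) a(2)] by simp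
    qed
    note k = klinearD(3)[OF vb_moduleD(3)[OF vA g2 D(2) V(1)] T1(3)]
    note S = vb_monoidD(4)[OF A.A_mon]
    have m: "mmul A Z1 ?V b' ?w \<in> car A (vsum Z1 ?V)" using lact_in[OF S dZ u(6), of ?w] T2(3) by simp
    have rim: "restrict g (f ` Y) ` f ` Y = ?V" by auto
    have "ac (mdl A (self A)) (vpush u (sw t)) b (tr t a) =
        em (val A (vsum Z1 ?V)) (mmul A Z1 ?V b' (?s (?d X1 * ?d Y) \<odot>\<^bsub>val A ?V\<^esub> ?w))"
      using ac_self_A[OF p1 u(6) T1(2), of "?d X1 * ?d Y"] k[of "?s (?d X1 * ?d Y)"] w
      unfolding t(1) u(1,5) a(1) T1(1) by (simp add: sw_def vsimps rim)
    also have "mmul A Z1 ?V b' (?s (?d X1 * ?d Y) \<odot>\<^bsub>val A ?V\<^esub> ?w) = ?s (?d X1 * ?d Y) \<odot>\<^bsub>val A (vsum Z1 ?V)\<^esub> mmul A Z1 ?V b' ?w"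
      using klinearD(3)[OF left_moduleD(2)[OF S dZ u(6)], of ?w "?s (?d X1 * ?d Y)"] T2(3) by simp
    finally have l: "ac (mdl A (self A)) (vpush u (sw t)) b (tr t a) =
        em (val A (vsum Z1 ?V)) (?s (?d X1 * ?d Y) \<odot>\<^bsub>val A (vsum Z1 ?V)\<^esub> mmul A Z1 ?V b' ?w)" .
    let ?n = "(?d Z1 + ?d X1) * ?d Y"
    have "ac (mdl A (self A)) (vpush (sw (vcmp u t)) (vpush u t)) (tr (vcmp u t) a) b =
        em (val A (vsum Z1 ?V)) (mmul A ?V Z1 (?s ?n \<odot>\<^bsub>val A ?V\<^esub> ?w) b')"
      using ac_self_A[OF p2 T2(2) u(6), of ?n] T2(1)[of "vsum Z1 (g ` X1)"] vb_moduleD(4)[OF vA u(8,6)]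
      unfolding t(1) u(1,5) a(1) by (simp add: sw_def vsimps im r1 r2 dimZX)
    also have "mmul A ?V Z1 (?s ?n \<odot>\<^bsub>val A ?V\<^esub> ?w) b' = ?s ?n \<odot>\<^bsub>val A (vsum Z1 ?V)\<^esub> mmul A ?V Z1 ?w b'"
      using klinearD(3)[OF left_moduleD(3)[OF S decomp_swap[OF dZ]], of b' ?w "?s ?n"] T2(3) u(6) by simp
    also have "mmul A ?V Z1 ?w b' = ?s (?d Z1 * ?d Y) \<odot>\<^bsub>val A (vsum Z1 ?V)\<^esub> mmul A Z1 ?V b' ?w"
      using swap_A[OF decomp_swap[OF dZ] T2(3) u(6)] dV by (simp add: mult.commute)
    also have "?s ?n \<odot>\<^bsub>val A (vsum Z1 ?V)\<^esub> (?s (?d Z1 * ?d Y) \<odot>\<^bsub>val A (vsum Z1 ?V)\<^esub> mmul A Z1 ?V b' ?w) =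
        (?s ?n * ?s (?d Z1 * ?d Y)) \<odot>\<^bsub>val A (vsum Z1 ?V)\<^esub> mmul A Z1 ?V b' ?w"
      by (rule kmodD(3)[OF vb_moduleD(1)[OF vA decompD(5)[OF dZ]] m, symmetric])
    \<comment> \<open>After u the complement has grown by Z1, and swapping b past the image of a
      costs the sign of Z1 against Y. The two contributions of Z1 cancel, which leaves the sign
      attached to t.\<close>
    also have "?s ?n * ?s (?d Z1 * ?d Y) = ?s (?d X1 * ?d Y)"
    proof -
      have "?s ?n = ?s (?d X1 * ?d Y) * ?s (?d Z1 * ?d Y)" unfolding add_mult_distrib sgn_pow(2) by (rule mult.commute)
      then show ?thesis by (simp add: mult.assoc sgn_pow(1))
    qed
    finally show ?case unfolding l ..
  next
    case (12 t Y X a c)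
    obtain X1 f where t: "t = (Y, X1, f)" "vb_obj Y" "f \<in> vb_iso Y (f ` Y)" "decomp X X1 (f ` Y)" using 12(1) by (rule vhomE)
    obtain a' where a: "a = em (val A Y) a'" "a' \<in> car A Y" using 12(2) by (auto simp: cr_mdl)
    obtain c' where c: "c = em (val B X1) c'" "c' \<in> car B X1" using 12(3) by (auto simp: cr_mdl t(1) vsimps)
    note D = decompD[OF t(4)] and T = tr_em[OF t(2,3) decompD(2)[OF t(4)] a(2)]
    note S = vb_monoidD(4)[OF B.A_mon]
    let ?s = "sgn_pow (Seq.dim X1 * Seq.dim Y)" and ?w = "\<phi> (f ` Y) (act A Y (f ` Y) f a')"
    have w: "?w \<in> car B (f ` Y)" by (rule phi_in[OF D(2) T(3)])
    have "ac (mdl B (self B)) t c (uphi Y a) = em (val B X) (mmul B X1 (f ` Y) c' ?w)"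
      using ac_self_B[OF 12(1)[unfolded t(1)] c(2) phi_in[OF t(2) a(2)]] H(2)[OF t(3,2) D(2) a(2)] uphi_em[OF t(2) a(2)]
      by (simp add: t(1) a(1) c(1))
    also have "mmul B X1 (f ` Y) c' ?w = ?s \<odot>\<^bsub>val B X\<^esub> mmul B (f ` Y) X1 ?w c'"
      using swap_B[OF t(4) c(2) w] dim_iso[OF t(3,2)] by simp
    also have "\<dots> = mmul B (f ` Y) X1 (?s \<odot>\<^bsub>val B (f ` Y)\<^esub> ?w) c'"
      using klinearD(3)[OF left_moduleD(3)[OF S decomp_swap[OF t(4)]], of c' ?w ?s] w c(2) by simp
    also have "?s \<odot>\<^bsub>val B (f ` Y)\<^esub> ?w = \<phi> (f ` Y) (?s \<odot>\<^bsub>val A (f ` Y)\<^esub> act A Y (f ` Y) f a')"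
      by (rule klinearD(3)[OF H(1)[OF D(2)] T(3), symmetric])
    also have "em (val B X) (mmul B (f ` Y) X1 \<dots> c') = ac (mdl B (self B)) (sw t) (uphi (vcok (sw t)) (tr t a)) c"
      using ac_self_B[OF sw_vhom[OF 12(1)[unfolded t(1)]] phi_in[OF D(2) T(2)] c(2), of "Seq.dim X1 * Seq.dim Y"]
        vb_moduleD(4)[OF vB D(1) c(2)] uphi_em[OF D(2) T(2), of "Seq.dim X1 * Seq.dim Y"]
      by (simp add: t(1) a(1) c(1) sw_def vsimps T(1))
    finally show ?case .
  }
qed

text \<open>A module over A through the composite map and the restriction of the module over B have
  the same carriers and agree on them as actions, so \<open>res_cong\<close> applies.\<close>

lemma res_via:
  assumes C: "left_module B (left_via \<psi> C)" and r: "A.G.res (mdl A (left_via (\<lambda>X. \<psi> X \<circ> \<phi> X) C)) P D \<eta>"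
  shows "A.G.res (two_rings.rs vcok uphi (mdl B (left_via \<psi> C))) P D \<eta>"
proof -
  interpret T: two_rings vb_obj vhom vcmp vid vcok vpush "{0}" vzm Seq.dim "mdl A (self A)" "uone A" "upos A (\<lambda>X. \<epsilon> X \<circ> \<phi> X)"
    "mdl B (self B)" "uone B" "upos B \<epsilon>" uphi sw tr by (rule two)
  note vC = left_moduleD(1)[OF C]
  have vC': "vb_module (left_via (\<lambda>X. \<psi> X \<circ> \<phi> X) C)" using vC by (simp add: vb_module_left_via)
  show ?thesis
  proof (rule A.G.res_cong[OF r T.rs_md[OF B.mdl_left[OF C]]])
    show "cr (T.rs (mdl B (left_via \<psi> C))) X = cr (mdl A (left_via (\<lambda>X. \<psi> X \<circ> \<phi> X) C)) X" for X
      by (simp add: T.cr_rs cr_mdl)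
    fix Y X t b x assume t: "t \<in> vhom Y X" and b: "b \<in> cr (mdl A (self A)) (vcok t)" and x: "x \<in> cr (mdl A (left_via (\<lambda>X. \<psi> X \<circ> \<phi> X) C)) Y"
    obtain X1 f b' where u: "t = (Y, X1, f)" "vb_obj Y" "f \<in> vb_iso Y (f ` Y)" "decomp X X1 (f ` Y)"
      "b = em (val A X1) b'" "b' \<in> car A X1" "vb_obj (f ` Y)" "vb_obj X1" "vb_obj X" using t b by (rule vhomE')
    obtain y where y: "x = em (val C Y) y" "y \<in> car C Y" using x by (auto simp: cr_mdl)
    show "ac (T.rs (mdl B (left_via \<psi> C))) t b x = ac (mdl A (left_via (\<lambda>X. \<psi> X \<circ> \<phi> X) C)) t b x"
      using ac_mdl[OF B.A_vb vC t[unfolded u(1)] phi_in[OF u(8,6)], of y] ac_mdl[OF A.A_vb vC' t[unfolded u(1)] u(6), of y]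
        uphi_em[OF u(8,6)] y(2) by (simp add: T.ac_rs u(1,5) y(1) vsimps)
  qed
qed

section \<open>Koszul monoids and the degree bound\<close>

theorem Tor_vanish:
  assumes KA: "koszul A (\<lambda>X. \<epsilon> X \<circ> \<phi> X)" and KB: "koszul B \<epsilon>" and X: "vb_obj X" and q: "2 * i < Seq.dim X"
  shows "kzero (val (Tor A A.kR (left_via \<phi> B) i) X)"
proof -
  interpret T: two_rings vb_obj vhom vcmp vid vcok vpush "{0}" vzm Seq.dim "mdl A (self A)" "uone A" "upos A (\<lambda>X. \<epsilon> X \<circ> \<phi> X)"
    "mdl B (self B)" "uone B" "upos B \<epsilon>" uphi sw tr by (rule two)
  note U = unit_monoid[OF A.kring_cring]
  note hA = augmentedD(2)[OF A.aug] and hB = augmentedD(2)[OF B.aug]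
  note LU = left_via_left[OF B.A_mon U hB] and LA = left_via_left[OF A.A_mon U hA] and LB = left_via_left[OF A.A_mon B.A_mon hom]
  let ?K = "mdl B (left_via \<epsilon> vb_unit)"
  obtain PK :: "nat \<Rightarrow> ('f obj, 'f vmor, 'a uni, ('f, 'a, 'k) res uni) md" and DK \<eta>K where PK0: "A.G.res (mdl A (left_via (\<lambda>X. \<epsilon> X \<circ> \<phi> X) vb_unit)) PK DK \<eta>K \<and>
      (\<forall>i X. vb_obj X \<longrightarrow> kzero (val (Tor A A.kR (left_via (\<lambda>X. \<epsilon> X \<circ> \<phi> X) vb_unit) i) X) = A.G.TorV PK DK i X)"
    using A.Tor_res[OF LA] by (elim exE)
  note PK = conjunct1[OF PK0] conjunct2[OF PK0]
  obtain PB :: "nat \<Rightarrow> ('f obj, 'f vmor, 'b uni, ('f, 'b, 'k) res uni) md" and DB \<eta>B where PB0: "B.G.res ?K PB DB \<eta>B \<and>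
      (\<forall>i X. vb_obj X \<longrightarrow> kzero (val (Tor B B.kR (left_via \<epsilon> vb_unit) i) X) = B.G.TorV PB DB i X)"
    using B.Tor_res[OF LU] by (elim exE)
  note PB = conjunct1[OF PB0] conjunct2[OF PB0]
  obtain P :: "nat \<Rightarrow> ('f obj, 'f vmor, 'a uni, ('f, 'a, 'b) res uni) md" and D \<eta> where P0: "A.G.res (mdl A (left_via \<phi> B)) P D \<eta> \<and>
      (\<forall>i X. vb_obj X \<longrightarrow> kzero (val (Tor A A.kR (left_via \<phi> B) i) X) = A.G.TorV P D i X)"
    using A.Tor_res[OF LB] by (elim exE)
  note P = conjunct1[OF P0] conjunct2[OF P0]
  have TK: "A.G.TorV PK DK i X" if "vb_obj X" "i < Seq.dim X" for i X
  proof -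
    have "vb_supp (Tor A A.kR (left_via (\<lambda>X. \<epsilon> X \<circ> \<phi> X) vb_unit) i) \<subseteq> {i}" using KA unfolding koszul_def by blast
    then have "kzero (val (Tor A A.kR (left_via (\<lambda>X. \<epsilon> X \<circ> \<phi> X) vb_unit) i) X)" using that unfolding vb_supp_def by auto
    then show ?thesis using PK(2) that(1) by blast
  qed
  have TB: "B.G.TorV PB DB i X" if "vb_obj X" "i < Seq.dim X" for i X
  proof -
    have "vb_supp (Tor B B.kR (left_via \<epsilon> vb_unit) i) \<subseteq> {i}" using KB unfolding koszul_def by blast
    then have "kzero (val (Tor B B.kR (left_via \<epsilon> vb_unit) i) X)" using that unfolding vb_supp_def by auto
    then show ?thesis using PB(2) that(1) by blast
  qed
  note H = monoid_homD[OF hB]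
  have lh: "left_hom B (self B) (left_via \<epsilon> vb_unit) \<epsilon>"
    unfolding left_hom_def vb_hom_def using H(1,2,4) by simp
  note e = B.umap_hom[OF vb_monoidD(4)[OF B.A_mon] LU lh]
  have em: "B.umap (self B) (left_via \<epsilon> vb_unit) \<epsilon> X (em (val B X) b) = em (val vb_unit X) (\<epsilon> X b)" if "vb_obj X" "b \<in> car B X" for X b
    using B.umap_em[OF vb_monoidD(4)[OF B.A_mon] that(1), of b "left_via \<epsilon> vb_unit" \<epsilon>] that(2) by simp
  have "A.G.TorV P D i X"
  proof (rule T.main[OF B.mdl_left[OF LU] e _ _ res_via[OF LU PK(1)] TK PB(1) TB _ X q])
    show "A.G.res (T.rs (mdl B (self B))) P D \<eta>"
      by (rule res_via[OF vb_monoidD(4)[OF B.A_mon]]) (use P(1) in \<open>simp add: comp_def\<close>)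
    fix X :: "'f obj" assume X: "vb_obj X"
    show "\<exists>b\<in>cr (mdl B (self B)) X. B.umap (self B) (left_via \<epsilon> vb_unit) \<epsilon> X b = z" if "z \<in> cr ?K X" for z
    proof -
      obtain c where c: "z = em (val vb_unit X) c" "c \<in> car vb_unit X" using \<open>z \<in> cr ?K X\<close> by (auto simp: cr_mdl)
      have "\<epsilon> X ` car B X = car vb_unit X" using augmentedD(3)[OF B.aug] X unfolding vb_surj_def by blast
      then obtain b where "\<epsilon> X b = c" "b \<in> car B X" using c(2) by (metis imageE)
      then show ?thesis using em[OF X] c(1) by (auto simp: cr_mdl)
    qed
    show "b \<in> upos B \<epsilon> X \<longleftrightarrow> B.umap (self B) (left_via \<epsilon> vb_unit) \<epsilon> X b = 0" if "b \<in> cr (mdl B (self B)) X" for b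
    proof -
      obtain c where c: "b = em (val B X) c" "c \<in> car B X" using \<open>b \<in> cr (mdl B (self B)) X\<close> by (auto simp: cr_mdl)
      have "b \<in> upos B \<epsilon> X \<longleftrightarrow> \<epsilon> X c = 0" using c em_inj[OF vb_ag[OF B.A_vb X]] by (auto simp: upos_def)
      also have "\<dots> \<longleftrightarrow> em (val vb_unit X) (\<epsilon> X c) = 0"
        using em_eq_zero[OF vb_ag[OF vb_monoidD(1)[OF U] X] klinearD(1)[OF H(1)[OF X] c(2)]] by (simp add: unit_simps)
      finally show ?thesis using em[OF X c(2)] c(1) by simp
    qed
  qed
  then show ?thesis using P(2) X by blast
qed

end

theorem proposition4p6:
  fixes A :: "('f::field, 'k::{comm_ring,monoid_mult}, 'a) vbmonoid"
    and B :: "('f, 'k, 'b) vbmonoid"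
    and \<phi> :: "'f obj \<Rightarrow> 'a \<Rightarrow> 'b"
    and \<epsilon> :: "'f obj \<Rightarrow> 'b \<Rightarrow> 'k"
  assumes "vb_monoid A" and "vb_monoid B"
    and "(vb_commutative A \<and> vb_commutative B) \<or> (vb_skew_commutative A \<and> vb_skew_commutative B)"
    and "monoid_hom A B \<phi>" and "vb_surj A B \<phi>"
    and "monoid_hom B vb_unit \<epsilon>" and "vb_surj B vb_unit \<epsilon>"
    and "vb_supp (vb_kernel A vb_unit (\<lambda>X. \<epsilon> X \<circ> \<phi> X)) \<subseteq> {0<..}"
    and "vb_supp (vb_kernel B vb_unit \<epsilon>) \<subseteq> {0<..}"
    and "koszul A (\<lambda>X. \<epsilon> X \<circ> \<phi> X)" and "koszul B \<epsilon>"
  shows "\<forall>i. vb_deg (Tor A (right_via (\<lambda>X. \<epsilon> X \<circ> \<phi> X) vb_unit) (left_via \<phi> B) i)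
           \<le> ereal (2 * real i)"
proof
  fix i
  have aug: "augmented A (\<lambda>X. \<epsilon> X \<circ> \<phi> X)" "augmented B \<epsilon>" using assms(10,11) unfolding koszul_def by blast+
  interpret koszul_pair A B \<phi> \<epsilon>
    by (rule koszul_pair.intro[OF aug_monoid.intro[OF aug(1)] aug_monoid.intro[OF aug(2)] koszul_pair_axioms.intro[OF assms(4,5,3)]])
  let ?T = "Tor A (right_via (\<lambda>X. \<epsilon> X \<circ> \<phi> X) vb_unit) (left_via \<phi> B) i"
  have n: "n \<le> 2 * i" if "n \<in> vb_supp ?T" for n
    using that Tor_vanish[OF assms(10,11), of _ i] unfolding vb_supp_def by (auto simp: not_less[symmetric])
  have "ereal (real n) \<le> ereal (2 * real i)" if "n \<in> vb_supp ?T" for n using n[OF that] by simp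
  then have s: "(SUP n\<in>vb_supp ?T. ereal (real n)) \<le> ereal (2 * real i)" by (rule SUP_least)
  \<comment> \<open>An empty support has degree -1, a case that the supremum does not cover.\<close>
  have "(- 1 :: ereal) \<le> ereal (2 * real i)" by (simp add: one_ereal_def)
  then show "vb_deg ?T \<le> ereal (2 * real i)" unfolding vb_deg_def using s by (cases "vb_supp ?T = {}") simp_all
qed

end
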